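(* Let $n\ge1$, $m\in\mathbb{Z}_{>0}$ and $q,q_0,q_1\in(-1,1)$. Then for every $f\in\mathbb{P}^{(2m,n)}_{\texttt{b}}$, \[ \frac{1}{(2\pi)^n}\int_{\mathbb{A}^{(n)}_{\texttt{b}}}f(\boldsymbol{\xi})\,|C_{\texttt{b}}(\boldsymbol{\xi};q,q_0)|^{-2}\,\mathrm{d}\boldsymbol{\xi}=\sum_{\lambda\in\Lambda^{(m,n)}_{\texttt{b}}}f(\boldsymbol{\xi}^{(m,n)}_{\texttt{b};\lambda})\,\hat{\Delta}^{(m,n)}_{\texttt{b};\lambda}, \] with Christoffel weights $\hat{\Delta}^{(m,n)}_{\texttt{b};\lambda}=\Bigl(\sum_{\mu\in\Lambda^{(m,n)}_{\texttt{b}}}|P_{\texttt{b};\mu}(\boldsymbol{\xi}^{(m,n)}_{\texttt{b};\lambda};q,q_0)|^2\,\delta^{(m,n)}_{\texttt{b};\mu}(q)\Bigr)^{-1}$.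
   Context: Let $\mathbb{A}^{(n)}_{\texttt{b}}=\{\boldsymbol{\xi}\in\mathbb{R}^n:\pi>\xi_1>\xi_2>\dots>\xi_n>0\}$ with Lebesgue measure $\mathrm{d}\boldsymbol{\xi}=\mathrm{d}\xi_1\cdots\mathrm{d}\xi_n$. For an integer $D\ge0$ let $\Lambda^{(D,n)}_{\texttt{b}}=\{\mu\in\mathbb{Z}^n: D\ge\mu_1\ge\dots\ge\mu_n\ge0\}$. Define $C_{\texttt{b}}(\boldsymbol{\xi};q,q_0)=\prod_{j=1}^n\frac{1-q_0e^{-i\xi_j}}{1-e^{-2i\xi_j}}\prod_{1\le j<k\le n}\frac{1-qe^{-i(\xi_j-\xi_k)}}{1-e^{-i(\xi_j-\xi_k)}}\cdot\frac{1-qe^{-i(\xi_j+\xi_k)}}{1-e^{-i(\xi_j+\xi_k)}}$ and, for $\mu\in\mathbb{Z}^n$, the hyperoctahedral Hall-Littlewood polynomial $P_{\texttt{b};\mu}(\boldsymbol{\xi};q,q_0)=\sum_{\sigma\in S_n}\sum_{\epsilon\in\{1,-1\}^n}C_{\texttt{b}}(\epsilon_1\xi_{\sigma_1},\dots,\epsilon_n\xi_{\sigma_n};q,q_0)\exp(i\epsilon_1\xi_{\sigma_1}\mu_1+\dots+i\epsilon_n\xi_{\sigma_n}\mu_n)$. Let $\delta^{(m,n)}_{\texttt{b};\mu}(q)=\prod_{1\le j<k\le n,\ \mu_j=\mu_k}\frac{1-q^{k-j}}{1-q^{1+k-j}}$. Let $u_q(\theta)=\frac{1-q^2}{1-2q\cos\theta+q^2}$,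 $v_q(\vartheta)=\int_0^\vartheta u_q(\theta)\,\mathrm{d}\theta$ (same definition for $q_0,q_1$), and $\varrho_{\texttt{b};j}=n+1-j$. For $\lambda\in\Lambda^{(m,n)}_{\texttt{b}}$, the node $\boldsymbol{\xi}^{(m,n)}_{\texttt{b};\lambda}\in\mathbb{R}^n$ is the unique global minimizer of the strictly convex function $V(\boldsymbol{\xi})=\sum_{1\le j<k\le n}\Bigl(\int_0^{\xi_j+\xi_k}v_q+\int_0^{\xi_j-\xi_k}v_q\Bigr)+\sum_{j=1}^n\Bigl((m+1)\xi_j^2-2\pi(\varrho_{\texttt{b};j}+\lambda_j)\xi_j+\int_0^{\xi_j}(v_{q_0}+v_{q_1})\Bigr)$, equivalently the unique solution of $2(m+1)\xi_j+v_{q_0}(\xi_j)+v_{q_1}(\xi_j)+\sum_{k\ne j}(v_q(\xi_j+\xi_k)+v_q(\xi_j-\xi_k))=2\pi(\varrho_{\texttt{b};j}+\lambda_j)$, $j=1,\dots,n$ (it lies in $\mathbb{A}^{(n)}_{\texttt{b}}$). For $D\ge0$, $\mathbb{P}^{(D,n)}_{\texttt{b}}$ is the linear span of the functions $M_{\texttt{b};\mu}(\boldsymbol{\xi})=\sum_{\nu}\exp(i\nu_1\xi_1+\dots+i\nu_n\xi_n)$, $\mu\in\Lambda^{(D,n)}_{\texttt{b}}$, where $\nu$ runs over the distinct vectors $(\epsilon_1\mu_{\sigma_1},\dots,\epsilon_n\mu_{\sigma_n})$ with $\sigma\in S_n$, $\epsilon\in\{1,-1\}^n$ (equivalently, the symmetric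 polynomials of degree at most $D$ in each variable $\cos\xi_j$). *)

theory Defs
  imports "HOL-Analysis.Analysis"
begin

text \<open>Vectors in R^n are represented as functions nat => real, with coordinates
  0..n-1 (0-based: paper index j corresponds to j-1 here).\<close>

definition Ab :: "nat \<Rightarrow> (nat \<Rightarrow> real) set" where
  "Ab n = {\<xi> \<in> PiE {..<n} (\<lambda>_. UNIV).
      (\<forall>j<n. 0 < \<xi> j \<and> \<xi> j < pi) \<and> (\<forall>j. Suc j < n \<longrightarrow> \<xi> (Suc j) < \<xi> j)}"

definition Lambdab :: "nat \<Rightarrow> nat \<Rightarrow> (nat \<Rightarrow> int) set" where
  "Lambdab D n = {\<mu>. (\<forall>j\<ge>n. \<mu> j = 0) \<and> (\<forall>j<n. 0 \<le> \<mu> j \<and> \<mu> j \<le> int D)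
      \<and> (\<forall>j k. j \<le> k \<and> k < n \<longrightarrow> \<mu> k \<le> \<mu> j)}"

definition Cb :: "nat \<Rightarrow> real \<Rightarrow> real \<Rightarrow> (nat \<Rightarrow> real) \<Rightarrow> complex" where
  "Cb n q q0 x =
     (\<Prod>j<n. (1 - complex_of_real q0 * exp (- \<i> * x j)) / (1 - exp (- 2 * \<i> * x j))) *
     (\<Prod>j<n. \<Prod>k\<in>{j<..<n}.
        ((1 - complex_of_real q * exp (- \<i> * (x j - x k))) / (1 - exp (- \<i> * (x j - x k)))) *
        ((1 - complex_of_real q * exp (- \<i> * (x j + x k))) / (1 - exp (- \<i> * (x j + x k)))))"

definition signs :: "nat \<Rightarrow> (nat \<Rightarrow> int) set" where
  "signs n = {..<n} \<rightarrow>\<^sub>E {-1, 1}"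

definition Pb :: "nat \<Rightarrow> (nat \<Rightarrow> int) \<Rightarrow> (nat \<Rightarrow> real) \<Rightarrow> real \<Rightarrow> real \<Rightarrow> complex" where
  "Pb n \<mu> \<xi> q q0 =
     (\<Sum>\<sigma>\<in>{\<sigma>. \<sigma> permutes {..<n}}. \<Sum>\<epsilon>\<in>signs n.
        Cb n q q0 (\<lambda>j. real_of_int (\<epsilon> j) * \<xi> (\<sigma> j)) *
        exp (\<i> * complex_of_real (\<Sum>j<n. real_of_int (\<epsilon> j) * \<xi> (\<sigma> j) * real_of_int (\<mu> j))))"

definition deltab :: "nat \<Rightarrow> (nat \<Rightarrow> int) \<Rightarrow> real \<Rightarrow> real" where
  "deltab n \<mu> q = (\<Prod>(j,k)\<in>{(j,k). j < k \<and> k < n \<and> \<mu> j = \<mu> k}.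
       (1 - q ^ (k - j)) / (1 - q ^ (1 + k - j)))"

definition orbitb :: "nat \<Rightarrow> (nat \<Rightarrow> int) \<Rightarrow> (nat \<Rightarrow> int) set" where
  "orbitb n \<mu> = (\<lambda>(\<sigma>, \<epsilon>). (\<lambda>j. if j < n then \<epsilon> j * \<mu> (\<sigma> j) else 0))
      ` ({\<sigma>. \<sigma> permutes {..<n}} \<times> signs n)"

definition Mb :: "nat \<Rightarrow> (nat \<Rightarrow> int) \<Rightarrow> (nat \<Rightarrow> real) \<Rightarrow> complex" where
  "Mb n \<mu> \<xi> = (\<Sum>\<nu>\<in>orbitb n \<mu>. exp (\<i> * complex_of_real (\<Sum>j<n. real_of_int (\<nu> j) * \<xi> j)))"

definition Pspace :: "nat \<Rightarrow> nat \<Rightarrow> ((nat \<Rightarrow> real) \<Rightarrow> complex) set" where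
  "Pspace D n = {f. \<exists>c. f = (\<lambda>\<xi>. \<Sum>\<mu>\<in>Lambdab D n. c \<mu> * Mb n \<mu> \<xi>)}"

definition uq :: "real \<Rightarrow> real \<Rightarrow> real" where
  "uq q \<theta> = (1 - q\<^sup>2) / (1 - 2 * q * cos \<theta> + q\<^sup>2)"

definition vq :: "real \<Rightarrow> real \<Rightarrow> real" where
  "vq q t = (LBINT \<theta>=ereal 0..ereal t. uq q \<theta>)"

text \<open>Node: unique solution of the critical-point equations (0-based j, rho_j = n - j).\<close>
definition nodeb :: "nat \<Rightarrow> nat \<Rightarrow> real \<Rightarrow> real \<Rightarrow> real \<Rightarrow> (nat \<Rightarrow> int) \<Rightarrow> (nat \<Rightarrow> real)" where
  "nodeb m n q q0 q1 la = (THE \<xi>. \<xi> \<in> PiE {..<n} (\<lambda>_. UNIV) \<and>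
     (\<forall>j<n. 2 * real (m + 1) * \<xi> j + vq q0 (\<xi> j) + vq q1 (\<xi> j)
        + (\<Sum>k\<in>{..<n} - {j}. vq q (\<xi> j + \<xi> k) + vq q (\<xi> j - \<xi> k))
        = 2 * pi * (real (n - j) + real_of_int (la j))))"

definition weightb :: "nat \<Rightarrow> nat \<Rightarrow> real \<Rightarrow> real \<Rightarrow> real \<Rightarrow> (nat \<Rightarrow> int) \<Rightarrow> real" where
  "weightb m n q q0 q1 la = inverse (\<Sum>\<mu>\<in>Lambdab m n.
      (cmod (Pb n \<mu> (nodeb m n q q0 q1 la) q q0))\<^sup>2 * deltab n \<mu> q)"

end

theory Submission
  imports Defs "HOL-Complex_Analysis.Complex_Analysis"
begin

text \<open>
  Put \<open>z j = exp (i \<xi> j)\<close>, and let \<open>b j\<close> be the rational function on the torus whose phase is the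
  left-hand side of the equation for \<open>\<xi> j\<close>. The nodes, up to signed permutations, are the common
  solutions of \<open>b j = 1\<close> off the reflection hyperplanes, where the weight \<open>1 / |C|\<^sup>2\<close> vanishes. For a
  Laurent polynomial \<open>F\<close> of degree at most \<open>2 m\<close> in each variable and a nonzero integer vector \<open>k\<close>, the
  torus integral of \<open>F / |C|\<^sup>2\<close> times the product of the \<open>b j powi k j\<close> is zero: after sorting \<open>k\<close>, scale
  the coordinates with the largest exponent by \<open>t\<close>; the zeros of the \<open>b j\<close> cancel the poles of the weight,
  so the integrand becomes holomorphic in \<open>t\<close> with value 0 at \<open>t = 0\<close>. Testing against the positive
  kernels made from \<open>|1 + b j|\<close>, which concentrate where all \<open>b j = 1\<close>, shows that the integral of
  \<open>F / |C|\<^sup>2\<close> vanishes as soon as \<open>F\<close> vanishes at the nodes.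

  The Hall-Littlewood polynomials are orthogonal for the same weight, again by a scaling argument, with
  \<open>1 / \<delta>\<close> as squared norms; they are as many as the candidate nodes. Hence every candidate is a node, the
  Lagrange interpolants exist, and testing the interpolant at a node against the reproducing kernel
  identifies its integral with the Christoffel weight.
\<close>

section \<open>Permutations, inversions and square linear systems\<close>

text \<open>Existence of the nodes is not derived by minimizing the convex function. Convexity
  enters only through injectivity of the phases, and existence falls out of a count: were some label
  without a node in the alcove, there would be fewer conditions than Hall-Littlewood polynomials of
  degree \<open>m\<close>, so a nonzero combination of these would vanish at all solutions; its
  product with each of them would have mean zero, against orthogonality.

  The degree \<open>2 * m\<close> is the break-even point of the scaling argument: the power
  \<open>2 * (m + 1)\<close> in \<open>b j\<close> has to pay for the monomial, for the simple pole
  at the origin that the weight keeps after the cancellation, and for the zero at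
  \<open>t = 0\<close>. The poles at \<open>q\<close> and \<open>q0\<close> are cancelled and never
  evaluated as residues, so vanishing, negative or coinciding parameters are covered by the same
  formulas.

  The equations \<open>b j = 1\<close> also have solutions on the hyperplanes, since a coordinate
  equal to 1 always solves its own equation. Hence solutions are matched with labels only inside the
  alcove, and the zeros of the weight make the others invisible.\<close>

definition idx_pairs :: "nat \<Rightarrow> (nat \<times> nat) set" where
  "idx_pairs n = {(j, k). j < k \<and> k < n}"

lemma finite_idx_pairs [simp]: "finite (idx_pairs n)"
  by (rule finite_subset[of _ "{..<n} \<times> {..<n}"]) (auto simp: idx_pairs_def)

lemma mem_idx_pairs [simp]: "(j, k) \<in> idx_pairs n \<longleftrightarrow> j < k \<and> k < n"
  by (simp add: idx_pairs_def)

lemma prod_idx_pairs_Suc: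
  fixes g :: "nat \<Rightarrow> nat \<Rightarrow> 'a::comm_monoid_mult"
  shows "(\<Prod>(j,k)\<in>idx_pairs (Suc n). g j k) = (\<Prod>(j,k)\<in>idx_pairs n. g j k) * (\<Prod>j<n. g j n)"
proof -
  have U: "idx_pairs (Suc n) = idx_pairs n \<union> (\<lambda>j. (j,n)) ` {..<n}"
    by (auto simp: less_Suc_eq idx_pairs_def)
  moreover have "(\<Prod>(j,k)\<in>(\<lambda>j. (j,n)) ` {..<n}. g j k) = (\<Prod>j<n. g j n)"
    by (subst prod.reindex) (auto simp: inj_on_def)
  ultimately show ?thesis
    unfolding U by (subst prod.union_disjoint) auto
qed

lemma prod_idx_pairs_nested:
  fixes g :: "nat \<Rightarrow> nat \<Rightarrow> 'a::comm_monoid_mult"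
  shows "(\<Prod>j<n. \<Prod>k\<in>{j<..<n}. g j k) = (\<Prod>(j,k)\<in>idx_pairs n. g j k)"
  by (subst prod.Sigma) (auto intro!: prod.cong)

text \<open>Serves to bring a product of Bethe functions, which is organized by coordinates, into
  the form indexed by pairs in which the weight is written.\<close>

lemma prod_off_diagonal:
  fixes g :: "nat \<Rightarrow> nat \<Rightarrow> 'a::comm_monoid_mult"
  shows "(\<Prod>j<n. \<Prod>k\<in>{..<n} - {j}. g j k) = (\<Prod>(j,k)\<in>idx_pairs n. g j k * g k j)"
proof (induction n)
  case (Suc n)
  have "(\<Prod>k\<in>{..<Suc n} - {j}. g j k) = (\<Prod>k\<in>{..<n} - {j}. g j k) * g j n" if "j < n" for j
  proof -
    have "{..<Suc n} - {j} = insert n ({..<n} - {j})" using that by auto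
    then show ?thesis by (simp add: mult.commute)
  qed
  moreover have "{..<Suc n} - {n} = {..<n}" by auto
  ultimately show ?case
    by (simp add: prod_idx_pairs_Suc Suc.IH prod.distrib ac_simps)
qed (auto simp: idx_pairs_def)

lemma sum_off_diagonal:
  fixes g :: "nat \<Rightarrow> nat \<Rightarrow> 'a::comm_monoid_add"
  shows "(\<Sum>j<n. \<Sum>k\<in>{..<n} - {j}. g j k) = (\<Sum>(j,k)\<in>idx_pairs n. g j k + g k j)"
proof (induction n)
  case (Suc n)
  have U: "idx_pairs (Suc n) = idx_pairs n \<union> (\<lambda>j. (j,n)) ` {..<n}"
    by (auto simp: less_Suc_eq idx_pairs_def)
  moreover have "(\<Sum>(j,k)\<in>(\<lambda>j. (j,n)) ` {..<n}. g j k + g k j) = (\<Sum>j<n. g j n + g n j)"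
    by (subst sum.reindex) (auto simp: inj_on_def)
  ultimately have 1: "(\<Sum>(j,k)\<in>idx_pairs (Suc n). g j k + g k j)
      = (\<Sum>(j,k)\<in>idx_pairs n. g j k + g k j) + (\<Sum>j<n. g j n + g n j)"
    unfolding U by (subst sum.union_disjoint) auto
  have "(\<Sum>k\<in>{..<Suc n} - {j}. g j k) = (\<Sum>k\<in>{..<n} - {j}. g j k) + g j n" if "j < n" for j
  proof -
    have "{..<Suc n} - {j} = insert n ({..<n} - {j})" using that by auto
    then show ?thesis by (simp add: add.commute)
  qed
  moreover have "{..<Suc n} - {n} = {..<n}" by auto
  ultimately show ?case
    by (simp add: 1 Suc.IH sum.distrib ac_simps)
qed (auto simp: idx_pairs_def)

section \<open>Permutations of an initial segment, built by placing the last value\<close>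

lemma permutes_lessThan_less: "\<sigma> permutes {..<n} \<Longrightarrow> j < n \<Longrightarrow> \<sigma> j < n"
  using permutes_in_image[of \<sigma> "{..<n}" j] by simp

lemma permutes_eq_iff: "\<sigma> permutes S \<Longrightarrow> \<sigma> j = \<sigma> k \<longleftrightarrow> j = k"
  by (meson inj_eq permutes_inj)

text \<open>The cycle (i i+1 ... n). Composed from the left it gives the last place the value
  \<open>i\<close>, keeps the relative order of the other values and adds exactly
  \<open>n - i\<close> inversions, which makes it the coset representative suited to inductions on
  inversion counts.\<close>

definition shift_perm :: "nat \<Rightarrow> nat \<Rightarrow> nat \<Rightarrow> nat" where
  "shift_perm n i j = (if j = n then i else if i \<le> j \<and> j < n then Suc j else j)"

lemma shift_perm_permutes:
  assumes "i \<le> n" shows "shift_perm n i permutes {..<Suc n}"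
proof (rule bij_imp_permutes)
  have "inj_on (shift_perm n i) {..<Suc n}"
    using assms by (auto simp: inj_on_def shift_perm_def split: if_splits)
  moreover have "shift_perm n i ` {..<Suc n} \<subseteq> {..<Suc n}"
    using assms by (auto simp: shift_perm_def)
  ultimately show "bij_betw (shift_perm n i) {..<Suc n} {..<Suc n}"
    by (simp add: bij_betw_def endo_inj_surj)
qed (use assms in \<open>auto simp: shift_perm_def\<close>)

lemma permutes_Suc_decomp:
  "bij_betw (\<lambda>(i, p). shift_perm n i \<circ> p) ({..n} \<times> {p. p permutes {..<n}}) {p. p permutes {..<Suc n}}"
proof -
  let ?f = "\<lambda>(i, p). shift_perm n i \<circ> p"
  let ?A = "{..n} \<times> {p. p permutes {..<n}}"
  have inj: "inj_on ?f ?A"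
  proof (rule inj_onI)
    fix u v assume uv: "u \<in> ?A" "v \<in> ?A" "?f u = ?f v"
    obtain i p i' p' where [simp]: "u = (i, p)" "v = (i', p')" by (cases u, cases v)
    have i: "i \<in> {..n}" "i' \<in> {..n}" and p: "p permutes {..<n}" "p' permutes {..<n}"
      and eq: "shift_perm n i \<circ> p = shift_perm n i' \<circ> p'" using uv by auto
    have "p n = n" "p' n = n" using p by (auto simp: permutes_def)
    then have "i = i'" using fun_cong[OF eq, of n] by (simp add: shift_perm_def)
    moreover have "inj (shift_perm n i)" using shift_perm_permutes i permutes_inj by blast
    ultimately have "p x = p' x" for x using fun_cong[OF eq, of x] by (simp add: inj_eq)
    then have "p = p'" by (rule ext)
    with \<open>i = i'\<close> show "u = v" by simp
  qed
  have sub: "?f ` ?A \<subseteq> {p. p permutes {..<Suc n}}"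
  proof (rule image_subsetI)
    fix u assume u: "u \<in> ?A"
    obtain i p where [simp]: "u = (i, p)" by (cases u)
    have "shift_perm n i \<circ> p permutes {..<Suc n}"
      using u by (intro permutes_compose shift_perm_permutes) (auto intro: permutes_subset)
    then show "?f u \<in> {p. p permutes {..<Suc n}}" by simp
  qed
  \<comment> \<open>Surjectivity comes from counting: both sides have (n+1)! elements.\<close>
  have "card (?f ` ?A) = card {p. p permutes {..<Suc n}}"
    using inj by (simp add: card_image card_cartesian_product card_permutations)
  then have "?f ` ?A = {p. p permutes {..<Suc n}}"
    using sub by (intro card_subset_eq) (auto simp: finite_permutations)
  then show ?thesis using inj by (simp add: bij_betw_def)
qed

lemma permutes_Suc_cases:
  assumes "\<sigma> permutes {..<Suc n}"
  obtains i p where "i \<le> n" "p permutes {..<n}" "\<sigma> = shift_perm n i \<circ> p"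
proof -
  have "\<sigma> \<in> (\<lambda>(i, p). shift_perm n i \<circ> p) ` ({..n} \<times> {p. p permutes {..<n}})"
    using assms bij_betw_imp_surj_on[OF permutes_Suc_decomp[of n]] by simp
  then show thesis using that by auto
qed

lemma sort_permutation:
  fixes x :: "nat \<Rightarrow> 'a::linorder"
  obtains \<sigma> where "\<sigma> permutes {..<n}" "\<And>j k. j \<le> k \<Longrightarrow> k < n \<Longrightarrow> x (\<sigma> k) \<le> x (\<sigma> j)"
proof -
  have "\<exists>\<sigma>. \<sigma> permutes {..<n} \<and> (\<forall>j k. j \<le> k \<longrightarrow> k < n \<longrightarrow> x (\<sigma> k) \<le> x (\<sigma> j))"
  proof (induction n arbitrary: x)
    case 0
    show ?case by (auto intro: permutes_id)
  next
    case (Suc n)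
    have "Min (x ` {..n}) \<in> x ` {..n}" by (rule Min_in) auto
    then obtain i where "i \<le> n" "x i = Min (x ` {..n})" by (metis atMost_iff imageE)
    then have i: "i \<le> n" "\<And>j. j \<le> n \<Longrightarrow> x i \<le> x j" by auto
    obtain p where p: "p permutes {..<n}"
      "\<And>j k. j \<le> k \<Longrightarrow> k < n \<Longrightarrow> x (shift_perm n i (p k)) \<le> x (shift_perm n i (p j))"
      using Suc[of "x \<circ> shift_perm n i"] by auto
    let ?s = "shift_perm n i \<circ> p"
    have s: "?s permutes {..<Suc n}"
      using i p by (intro permutes_compose[of p] shift_perm_permutes) (auto intro: permutes_subset)
    have "p n = n" using p by (auto simp: permutes_def)
    then have last: "?s n = i" by (simp add: shift_perm_def)
    have "x (?s k) \<le> x (?s j)" if "j \<le> k" "k < Suc n" for j k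
    proof (cases "k = n")
      case True
      have "?s j \<le> n" using permutes_lessThan_less[OF s, of j] that by simp
      then show ?thesis using True last i by simp
    next
      case False
      then show ?thesis using that p(2)[of j k] by simp
    qed
    then show ?case using s by blast
  qed
  then show thesis using that by blast
qed

text \<open>The rearrangement inequality together with its equality case, which later identifies the
  terms surviving in a leading coefficient with the stabilizer of the weight. In the induction,
  passing from \<open>p\<close> to the shifted permutation adds \<open>\<nu> j\<close> for each of
  the \<open>n - i\<close> places with \<open>i \<le> p j\<close>, and each such value is at least
  \<open>\<nu> n\<close>.\<close>

lemma rearrangement_decreasing:
  fixes \<nu> :: "nat \<Rightarrow> int"
  assumes "\<sigma> permutes {..<n}" "\<And>j k. j \<le> k \<Longrightarrow> k < n \<Longrightarrow> \<nu> k \<le> \<nu> j"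
  shows "(\<Sum>j<n. int j * \<nu> j) \<le> (\<Sum>j<n. int (\<sigma> j) * \<nu> j) \<and>
    ((\<Sum>j<n. int (\<sigma> j) * \<nu> j) = (\<Sum>j<n. int j * \<nu> j) \<longrightarrow> (\<forall>j<n. \<nu> (\<sigma> j) = \<nu> j))"
  using assms
proof (induction n arbitrary: \<sigma>)
  case (Suc n)
  obtain i p where ip: "i \<le> n" "p permutes {..<n}" "\<sigma> = shift_perm n i \<circ> p"
    using permutes_Suc_cases[OF Suc.prems(1)] by metis
  have pn: "p n = n" using ip(2) by (auto simp: permutes_def)
  then have sn: "\<sigma> n = i" by (simp add: ip shift_perm_def)
  have pl: "p j < n" if "j < n" for j using permutes_lessThan_less[OF ip(2) that] .
  have s: "int (\<sigma> j) * \<nu> j = int (p j) * \<nu> j + (if i \<le> p j then \<nu> j else 0)" if "j < n" for j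
    using pl[OF that] by (auto simp: ip shift_perm_def algebra_simps)
  have IH: "(\<Sum>j<n. int j * \<nu> j) \<le> (\<Sum>j<n. int (p j) * \<nu> j)"
    "(\<Sum>j<n. int (p j) * \<nu> j) = (\<Sum>j<n. int j * \<nu> j) \<longrightarrow> (\<forall>j<n. \<nu> (p j) = \<nu> j)"
    using Suc.IH[OF ip(2)] Suc.prems(2) by auto
  have cnt: "(\<Sum>j<n. if i \<le> p j then \<nu> n else 0) = int (n - i) * \<nu> n"
  proof -
    have "(\<Sum>j<n. if i \<le> p j then \<nu> n else 0) = (\<Sum>j<n. if i \<le> j then \<nu> n else 0)"
      using sum.permute[OF ip(2), of "\<lambda>j. if i \<le> j then \<nu> n else 0"] by simp
    also have "\<dots> = (\<Sum>j\<in>{i..<n}. \<nu> n)"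
      by (rule sum.mono_neutral_cong_right) auto
    finally show ?thesis by simp
  qed
  have le: "(if i \<le> p j then \<nu> n else 0) \<le> (if i \<le> p j then \<nu> j else 0)" if "j < n" for j
    using Suc.prems(2)[of j n] that by auto
  have le': "int (n - i) * \<nu> n \<le> (\<Sum>j<n. if i \<le> p j then \<nu> j else 0)"
    unfolding cnt[symmetric] by (rule sum_mono) (use le in auto)
  have tot: "(\<Sum>j<Suc n. int (\<sigma> j) * \<nu> j)
     = (\<Sum>j<n. int (p j) * \<nu> j) + (\<Sum>j<n. if i \<le> p j then \<nu> j else 0) + int i * \<nu> n"
    by (simp add: s sn sum.distrib)
  have ni: "int n * \<nu> n = int (n - i) * \<nu> n + int i * \<nu> n"
    using ip(1) by (simp add: of_nat_diff algebra_simps)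
  show ?case
  proof (intro conjI impI allI)
    show "(\<Sum>j<Suc n. int j * \<nu> j) \<le> (\<Sum>j<Suc n. int (\<sigma> j) * \<nu> j)"
      unfolding tot using IH(1) le' ni by simp
  next
    fix j assume eq: "(\<Sum>j<Suc n. int (\<sigma> j) * \<nu> j) = (\<Sum>j<Suc n. int j * \<nu> j)" and j: "j < Suc n"
    have e1: "(\<Sum>j<n. int (p j) * \<nu> j) = (\<Sum>j<n. int j * \<nu> j)"
      and e2: "(\<Sum>j<n. if i \<le> p j then \<nu> j else 0) = (\<Sum>j<n. if i \<le> p j then \<nu> n else 0)"
      using eq IH(1) le' ni unfolding tot cnt by simp_all
    have inv: "\<nu> (p j) = \<nu> j" if "j < n" for j using IH(2) e1 that by blast
    have "(\<Sum>j<n. (if i \<le> p j then \<nu> j else 0) - (if i \<le> p j then \<nu> n else 0)) = 0"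
      using e2 by (simp add: sum_subtractf)
    then have "\<forall>j\<in>{..<n}. (if i \<le> p j then \<nu> j else 0) - (if i \<le> p j then \<nu> n else 0) = 0"
      by (subst (asm) sum_nonneg_eq_0_iff) (use le in auto)
    then have z: "(if i \<le> p j then \<nu> j else 0) - (if i \<le> p j then \<nu> n else 0) = 0" if "j < n" for j
      using that by blast
    have top: "\<nu> (p j) = \<nu> n" if "j < n" "i \<le> p j" for j
      using z[OF that(1)] that(2) inv[OF that(1)] by simp
    have top': "\<nu> l = \<nu> n" if "i \<le> l" "l \<le> n" for l
    proof (cases "l = n")
      case False
      then have "l \<in> p ` {..<n}" using that by (simp add: permutes_image[OF ip(2)])
      then obtain j where "j < n" "p j = l" by auto
      then show ?thesis using top[of j] that by simp
    qed simp
    show "\<nu> (\<sigma> j) = \<nu> j"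
    proof (cases "j = n")
      case True then show ?thesis using top'[of i] ip(1) sn by simp
    next
      case False
      then have jn: "j < n" using j by simp
      show ?thesis
      proof (cases "i \<le> p j")
        case True
        then have "\<sigma> j = Suc (p j)" using pl[OF jn] by (simp add: ip shift_perm_def)
        then show ?thesis using top'[of "Suc (p j)"] top'[of "p j"] True pl[OF jn] inv[OF jn] by simp
      next
        case False
        then have "\<sigma> j = p j" using pl[OF jn] by (simp add: ip shift_perm_def)
        then show ?thesis using inv[OF jn] by simp
      qed
    qed
  qed
qed auto

text \<open>For \<open>q = -1\<close> this is the sign of the permutation; for real
  \<open>q\<close>, summed over a stabilizer, it gives products of q-factorials. The general base
  type serves both.\<close>

definition inv_weight :: "nat \<Rightarrow> 'a::comm_monoid_mult \<Rightarrow> (nat \<Rightarrow> nat) \<Rightarrow> 'a" where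
  "inv_weight n q \<sigma> = (\<Prod>(j,k)\<in>idx_pairs n. if \<sigma> k < \<sigma> j then q else 1)"

lemma inv_weight_shift:
  fixes q :: "'a::comm_semiring_1"
  assumes "i \<le> n" "p permutes {..<n}"
  shows "inv_weight (Suc n) q (shift_perm n i \<circ> p) = inv_weight n q p * q ^ (n - i)"
proof -
  have pn: "p n = n" using assms(2) by (auto simp: permutes_def)
  have pl: "p j < n" if "j < n" for j using permutes_lessThan_less[OF assms(2) that] .
  have 1: "(\<Prod>(j,k)\<in>idx_pairs n. if (shift_perm n i \<circ> p) k < (shift_perm n i \<circ> p) j then q else 1)
     = inv_weight n q p"
    unfolding inv_weight_def
  proof (rule prod.cong, simp)
    fix x assume x: "x \<in> idx_pairs n"
    obtain j k where [simp]: "x = (j, k)" by (cases x)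
    have "p j < n" "p k < n" using x pl by auto
    then show "(case x of (j,k) \<Rightarrow> if (shift_perm n i \<circ> p) k < (shift_perm n i \<circ> p) j then q else 1)
      = (case x of (j,k) \<Rightarrow> if p k < p j then q else 1)"
      by (auto simp: shift_perm_def)
  qed
  have "(\<Prod>j<n. if (shift_perm n i \<circ> p) n < (shift_perm n i \<circ> p) j then q else 1)
      = (\<Prod>j<n. if i \<le> p j then q else 1)"
  proof (rule prod.cong, simp)
    fix j assume "j \<in> {..<n}"
    then have "p j < n" using pl by simp
    then show "(if (shift_perm n i \<circ> p) n < (shift_perm n i \<circ> p) j then q else 1) = (if i \<le> p j then q else 1)"
      using pn assms(1) by (auto simp: shift_perm_def)
  qed
  also have "\<dots> = (\<Prod>j<n. if i \<le> j then q else 1)"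
    using prod.permute[OF assms(2), of "\<lambda>j. if i \<le> j then q else 1"] by simp
  also have "\<dots> = (\<Prod>j\<in>{i..<n}. q)"
    by (rule prod.mono_neutral_cong_right) auto
  finally show ?thesis unfolding inv_weight_def[of "Suc n"] prod_idx_pairs_Suc 1 by simp
qed

lemma one_minus_power_nonzero:
  fixes q :: real assumes "\<bar>q\<bar> < 1" "0 < k" shows "1 - q ^ k \<noteq> 0"
proof -
  have "\<bar>q ^ k\<bar> < 1" using assms by (simp add: power_abs power_less_one_iff)
  then show ?thesis by auto
qed

text \<open>Both sides are the q-integer of \<open>n - a + 1\<close>, a geometric series on the left
  and a telescoping product on the right; \<open>\<bar>q\<bar> < 1\<close> keeps the denominators of
  the product nonzero.\<close>

lemma geometric_block:
  fixes q :: real assumes q: "\<bar>q\<bar> < 1" and "a \<le> n"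
  shows "(\<Sum>i\<in>{a..n}. q ^ (n - i)) = (\<Prod>j\<in>{a..<n}. (1 - q ^ Suc (n - j)) / (1 - q ^ (n - j)))"
proof -
  have "(\<Sum>i\<in>{a..n}. q ^ (n - i)) = (1 - q ^ Suc (n - a)) / (1 - q) \<and>
    (\<Prod>j\<in>{a..<n}. (1 - q ^ Suc (n - j)) / (1 - q ^ (n - j))) = (1 - q ^ Suc (n - a)) / (1 - q)"
    using assms(2)
  proof (induction rule: inc_induct)
    case base
    then show ?case using q by simp
  next
    case (step a)
    have 1: "{a..n} = insert a {Suc a..n}" "{a..<n} = insert a {Suc a..<n}" using step by auto
    have d: "n - a = Suc (n - Suc a)" using step by simp
    have q1: "1 - q \<noteq> 0" using q by auto
    have q2: "1 - q ^ Suc (n - Suc a) \<noteq> 0" using one_minus_power_nonzero[OF q, of "Suc (n - Suc a)"] by simp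
    have e: "q ^ (n - a) + (1 - q ^ (n - a)) / (1 - q) = (1 - q ^ Suc (n - a)) / (1 - q)"
      using q1 by (simp add: field_simps)
    have "(\<Sum>i\<in>{a..n}. q ^ (n - i)) = q ^ (n - a) + (1 - q ^ (n - a)) / (1 - q)"
      unfolding 1 using step.IH d by simp
    moreover have "(\<Prod>j\<in>{a..<n}. (1 - q ^ Suc (n - j)) / (1 - q ^ (n - j)))
        = (1 - q ^ Suc (n - a)) / (1 - q ^ (n - a)) * ((1 - q ^ (n - a)) / (1 - q))"
      unfolding 1 using step.IH d by simp
    moreover have "1 - q ^ (n - a) \<noteq> 0" using q2 d by simp
    ultimately show ?case using e by simp
  qed
  then show ?thesis by simp
qed

text \<open>The stabilizer of a decreasing \<open>\<nu>\<close> permutes consecutive blocks, so its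
  Poincare polynomial is the product of the q-factorials of the block lengths. On the right, for
  fixed \<open>k\<close>, the quotients telescope over \<open>j\<close> to one q-integer of such a
  factorial. This value will turn out to be the reciprocal of \<open>deltab\<close>.\<close>

lemma stabilizer_inv_weight_sum:
  fixes q :: real and \<nu> :: "nat \<Rightarrow> int"
  assumes q: "\<bar>q\<bar> < 1" and mono: "\<And>j k. j \<le> k \<Longrightarrow> k < n \<Longrightarrow> \<nu> k \<le> \<nu> j"
  shows "(\<Sum>\<sigma>\<in>{\<sigma>. \<sigma> permutes {..<n} \<and> (\<forall>j<n. \<nu> (\<sigma> j) = \<nu> j)}. inv_weight n q \<sigma>)
    = (\<Prod>(j,k)\<in>idx_pairs n. if \<nu> j = \<nu> k then (1 - q ^ Suc (k - j)) / (1 - q ^ (k - j)) else 1)"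
  using mono
proof (induction n)
  case 0
  have "{\<sigma>. \<sigma> permutes ({}::nat set)} = {id}" by (auto simp: permutes_empty)
  then show ?case by (simp add: inv_weight_def idx_pairs_def)
next
  case (Suc n)
  \<comment> \<open>As \<open>\<nu>\<close> decreases, the level set of \<open>\<nu> n\<close> is an
    interval ending at \<open>n\<close>; \<open>a\<close> is its first place, and a stabilizing
    permutation must send \<open>n\<close> into it.\<close>
  define a where "a = (LEAST i. \<nu> i = \<nu> n)"
  have a: "\<nu> a = \<nu> n" "a \<le> n" unfolding a_def by (auto intro: LeastI Least_le)
  have blk: "\<nu> i = \<nu> n \<longleftrightarrow> a \<le> i" if "i \<le> n" for i
  proof
    show "\<nu> i = \<nu> n \<Longrightarrow> a \<le> i" unfolding a_def by (rule Least_le)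
    assume "a \<le> i"
    then have "\<nu> i \<le> \<nu> a" "\<nu> n \<le> \<nu> i" using Suc.prems that by auto
    then show "\<nu> i = \<nu> n" using a by simp
  qed
  let ?S = "{p. p permutes {..<n} \<and> (\<forall>j<n. \<nu> (p j) = \<nu> j)}"
  have cond: "(\<forall>j<Suc n. \<nu> ((shift_perm n i \<circ> p) j) = \<nu> j) \<longleftrightarrow> a \<le> i \<and> (\<forall>j<n. \<nu> (p j) = \<nu> j)"
    if i: "i \<le> n" and p: "p permutes {..<n}" for i p
  proof -
    have pn: "p n = n" using p by (auto simp: permutes_def)
    have pl: "p j < n" if "j < n" for j using permutes_lessThan_less[OF p that] .
    have A: "\<nu> ((shift_perm n i \<circ> p) n) = \<nu> n \<longleftrightarrow> a \<le> i" using blk[OF i] pn by (simp add: shift_perm_def)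
    have B: "\<nu> ((shift_perm n i \<circ> p) j) = \<nu> (p j)" if "a \<le> i" "j < n" for j
    proof (cases "i \<le> p j")
      case True
      then have "\<nu> (Suc (p j)) = \<nu> n" "\<nu> (p j) = \<nu> n" using blk pl[OF that(2)] that(1) by auto
      then show ?thesis using True pl[OF that(2)] by (simp add: shift_perm_def)
    qed (use pl[OF that(2)] in \<open>simp add: shift_perm_def\<close>)
    show ?thesis using A B by (auto simp: less_Suc_eq simp del: comp_apply)
  qed
  have "(\<Sum>\<sigma>\<in>{\<sigma>. \<sigma> permutes {..<Suc n} \<and> (\<forall>j<Suc n. \<nu> (\<sigma> j) = \<nu> j)}. inv_weight (Suc n) q \<sigma>)
    = (\<Sum>\<sigma>\<in>{\<sigma>. \<sigma> permutes {..<Suc n}}. if \<forall>j<Suc n. \<nu> (\<sigma> j) = \<nu> j then inv_weight (Suc n) q \<sigma> else 0)"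
    by (subst sum.inter_filter[symmetric]) (auto simp: finite_permutations)
  also have "\<dots> = (\<Sum>(i,p)\<in>{..n} \<times> {p. p permutes {..<n}}.
       if a \<le> i \<and> (\<forall>j<n. \<nu> (p j) = \<nu> j) then inv_weight n q p * q ^ (n - i) else 0)"
    by (subst sum.reindex_bij_betw[OF permutes_Suc_decomp, symmetric])
       (auto intro!: sum.cong simp: cond inv_weight_shift simp del: comp_apply All_less_Suc)
  also have "\<dots> = (\<Sum>i\<le>n. \<Sum>p\<in>{p. p permutes {..<n}}.
       (if a \<le> i then q ^ (n - i) else 0) * (if \<forall>j<n. \<nu> (p j) = \<nu> j then inv_weight n q p else 0))"
    by (subst sum.cartesian_product) (auto intro!: sum.cong)
  also have "\<dots> = (\<Sum>i\<le>n. if a \<le> i then q ^ (n - i) else 0) *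
      (\<Sum>p\<in>{p. p permutes {..<n}}. if \<forall>j<n. \<nu> (p j) = \<nu> j then inv_weight n q p else 0)"
    by (simp add: sum_product)
  also have "(\<Sum>p\<in>{p. p permutes {..<n}}. if \<forall>j<n. \<nu> (p j) = \<nu> j then inv_weight n q p else 0)
      = (\<Sum>p\<in>?S. inv_weight n q p)"
    by (subst sum.inter_filter[symmetric]) (auto simp: finite_permutations)
  also have "\<dots> = (\<Prod>(j,k)\<in>idx_pairs n. if \<nu> j = \<nu> k then (1 - q ^ Suc (k - j)) / (1 - q ^ (k - j)) else 1)"
    by (rule Suc.IH) (use Suc.prems in auto)
  also have "(\<Sum>i\<le>n. if a \<le> i then q ^ (n - i) else 0) = (\<Sum>i\<in>{a..n}. q ^ (n - i))"
    by (rule sum.mono_neutral_cong_right) auto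
  also have "\<dots> = (\<Prod>j\<in>{a..<n}. (1 - q ^ Suc (n - j)) / (1 - q ^ (n - j)))"
    by (rule geometric_block[OF q a(2)])
  also have "\<dots> = (\<Prod>j<n. if \<nu> j = \<nu> n then (1 - q ^ Suc (n - j)) / (1 - q ^ (n - j)) else 1)"
    by (rule prod.mono_neutral_cong_left) (use blk in auto)
  finally show ?case by (simp only: prod_idx_pairs_Suc mult.commute)
qed

lemma prod_idx_pairs_permute:
  fixes g :: "nat \<Rightarrow> nat \<Rightarrow> 'a::comm_monoid_mult"
  assumes s: "\<sigma> permutes {..<n}" and sym: "\<And>j k. g j k = g k j"
  shows "(\<Prod>(j,k)\<in>idx_pairs n. g (\<sigma> j) (\<sigma> k)) = (\<Prod>(j,k)\<in>idx_pairs n. g j k)"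
proof -
  let ?h = "\<lambda>(j,k). (min (\<sigma> j) (\<sigma> k), max (\<sigma> j) (\<sigma> k))"
  have inj: "inj_on ?h (idx_pairs n)"
  proof (rule inj_onI)
    fix u v assume uv: "u \<in> idx_pairs n" "v \<in> idx_pairs n" "?h u = ?h v"
    obtain j k j' k' where [simp]: "u = (j, k)" "v = (j', k')" by (cases u, cases v)
    have jk: "(j,k) \<in> idx_pairs n" "(j',k') \<in> idx_pairs n"
      and e: "min (\<sigma> j) (\<sigma> k) = min (\<sigma> j') (\<sigma> k')" "max (\<sigma> j) (\<sigma> k) = max (\<sigma> j') (\<sigma> k')" using uv by auto
    then have "(\<sigma> j = \<sigma> j' \<and> \<sigma> k = \<sigma> k') \<or> (\<sigma> j = \<sigma> k' \<and> \<sigma> k = \<sigma> j')"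
      by (auto simp: min_def max_def split: if_splits)
    then show "u = v" using jk permutes_eq_iff[OF s] by auto
  qed
  have sub: "?h ` idx_pairs n \<subseteq> idx_pairs n"
  proof (rule image_subsetI)
    fix u assume u: "u \<in> idx_pairs n"
    obtain j k where [simp]: "u = (j, k)" by (cases u)
    show "?h u \<in> idx_pairs n" using u
      using permutes_lessThan_less[OF s, of j] permutes_lessThan_less[OF s, of k] permutes_eq_iff[OF s, of j k]
      by (auto simp: min_def max_def)
  qed
  have bij: "bij_betw ?h (idx_pairs n) (idx_pairs n)"
    using endo_inj_surj[OF finite_idx_pairs sub inj] inj by (simp add: bij_betw_def)
  have "(\<Prod>(j,k)\<in>idx_pairs n. g j k) = (\<Prod>x\<in>idx_pairs n. case ?h x of (j,k) \<Rightarrow> g j k)"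
    by (rule prod.reindex_bij_betw[OF bij, symmetric])
  also have "\<dots> = (\<Prod>(j,k)\<in>idx_pairs n. g (\<sigma> j) (\<sigma> k))"
    by (rule prod.cong) (auto simp: min_def max_def sym)
  finally show ?thesis by simp
qed

lemma prod_idx_pairs_permute_antisym:
  fixes g :: "nat \<Rightarrow> nat \<Rightarrow> 'a::comm_ring_1"
  assumes s: "\<sigma> permutes {..<n}" and anti: "\<And>j k. g k j = - g j k"
  shows "(\<Prod>(j,k)\<in>idx_pairs n. g (\<sigma> j) (\<sigma> k)) = inv_weight n (-1) \<sigma> * (\<Prod>(j,k)\<in>idx_pairs n. g j k)"
proof -
  define g' where "g' j k = (if j \<le> k then g j k else g k j)" for j k
  have "(\<Prod>(j,k)\<in>idx_pairs n. g j k) = (\<Prod>(j,k)\<in>idx_pairs n. g' j k)"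
    by (rule prod.cong) (auto simp: g'_def)
  also have "\<dots> = (\<Prod>(j,k)\<in>idx_pairs n. g' (\<sigma> j) (\<sigma> k))"
    by (rule prod_idx_pairs_permute[OF s, symmetric]) (auto simp: g'_def)
  also have "inv_weight n (-1) \<sigma> * \<dots> = (\<Prod>(j,k)\<in>idx_pairs n. g (\<sigma> j) (\<sigma> k))"
    unfolding inv_weight_def prod.distrib[symmetric]
  proof (rule prod.cong, simp, clarify)
    fix j k assume "(j,k) \<in> idx_pairs n"
    then have "\<sigma> j \<noteq> \<sigma> k" using permutes_eq_iff[OF s] by auto
    then show "(if \<sigma> k < \<sigma> j then - 1 else 1) * g' (\<sigma> j) (\<sigma> k) = g (\<sigma> j) (\<sigma> k)"
      using anti[of "\<sigma> j" "\<sigma> k"] by (auto simp: g'_def)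
  qed
  finally show ?thesis by simp
qed

lemma inv_weight_transpose:
  assumes "a < b" "b < n"
  shows "inv_weight n (-1 :: 'a::comm_ring_1) (Transposition.transpose a b) = -1"
proof -
  let ?s = "Transposition.transpose a b"
  let ?L = "Pair a ` {a<..<b}" and ?R = "(\<lambda>l. (l,b)) ` {a<..<b}"
  \<comment> \<open>The inversions of a transposition are the transposed pair and two pairs for
    every place strictly between, hence odd in number.\<close>
  have eq: "{x \<in> idx_pairs n. ?s (snd x) < ?s (fst x)} = insert (a,b) (?L \<union> ?R)" (is "?I = _")
  proof (rule set_eqI)
    fix x :: "nat \<times> nat"
    obtain j k where [simp]: "x = (j, k)" by (cases x)
    have "x \<in> ?I \<longleftrightarrow> (j = a \<and> a < k \<and> k \<le> b) \<or> (k = b \<and> a \<le> j \<and> j < b)"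
      using assms unfolding Transposition.transpose_def by auto
    also have "\<dots> \<longleftrightarrow> x \<in> insert (a,b) (?L \<union> ?R)"
      using assms by auto
    finally show "x \<in> ?I \<longleftrightarrow> x \<in> insert (a,b) (?L \<union> ?R)" .
  qed
  have c: "card ?L = b - Suc a" "card ?R = b - Suc a"
    by (simp_all add: card_image inj_on_def)
  have "card (?L \<union> ?R) = 2 * (b - Suc a)"
    by (subst card_Un_disjoint) (auto simp: c)
  then have card: "card ?I = Suc (2 * (b - Suc a))"
    unfolding eq by (subst card_insert_disjoint) auto
  have "inv_weight n (-1 :: 'a) ?s = (\<Prod>x\<in>idx_pairs n. if ?s (snd x) < ?s (fst x) then -1 else 1)"
    unfolding inv_weight_def by (rule prod.cong) auto
  also have "\<dots> = (\<Prod>x\<in>?I. -1)"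
    by (subst prod.inter_filter) auto
  also have "\<dots> = -1" using card by simp
  finally show ?thesis .
qed

text \<open>Multiplicativity is read off from the Vandermonde product of the indices: it is nonzero,
  and permuting the indices by \<open>\<sigma>\<close> multiplies it by
  \<open>inv_weight n (-1) \<sigma>\<close>.\<close>

lemma inv_weight_sign:
  assumes "\<sigma> permutes {..<n}"
  shows "inv_weight n (-1 :: complex) \<sigma> = of_int (sign \<sigma>)"
  using assms finite_lessThan
proof (induction rule: permutes_induct)
  case id
  show ?case by (auto simp: inv_weight_def sign_id intro!: prod.neutral)
next
  case (swap a b p)
  let ?s = "Transposition.transpose a b"
  let ?g = "\<lambda>j k. of_nat j - of_nat k :: complex"
  have s: "?s permutes {..<n}" using swap by (intro permutes_swap_id) auto
  have sp: "?s \<circ> p permutes {..<n}" using s swap by (intro permutes_compose) auto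
  have tr: "inv_weight n (-1 :: complex) ?s = -1"
    using swap inv_weight_transpose[of a b n] inv_weight_transpose[of b a n]
    by (metis (no_types) lessThan_iff nat_neq_iff transpose_commute)
  let ?V = "\<Prod>(j,k)\<in>idx_pairs n. ?g j k"
  have V0: "?V \<noteq> 0" by (auto simp: prod_zero_iff)
  have "inv_weight n (-1) (?s \<circ> p) * ?V = (\<Prod>(j,k)\<in>idx_pairs n. ?g (?s (p j)) (?s (p k)))"
    using prod_idx_pairs_permute_antisym[OF sp, of ?g] by simp
  also have "\<dots> = inv_weight n (-1) p * (\<Prod>(j,k)\<in>idx_pairs n. ?g (?s j) (?s k))"
    using prod_idx_pairs_permute_antisym[OF swap.hyps(4), of "\<lambda>j k. ?g (?s j) (?s k)"] by simp
  also have "\<dots> = inv_weight n (-1) p * (inv_weight n (-1) ?s * ?V)"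
    using prod_idx_pairs_permute_antisym[OF s, of ?g] by simp
  finally have "inv_weight n (-1 :: complex) (?s \<circ> p) = inv_weight n (-1) p * inv_weight n (-1) ?s"
    using V0 by simp
  moreover have "sign (?s \<circ> p) = sign ?s * sign p"
    using swap.hyps(4) by (intro sign_compose permutation_swap_id permutation_permutes[THEN iffD2]) auto
  ultimately show ?case using swap.hyps(3) by (simp only: tr sign_swap_id swap.IH) simp
qed

text \<open>Gaussian elimination, one equation at a time. It will be applied with Hall-Littlewood
  coefficients as unknowns and realized nodes as equations, to exclude that a node is
  missing.\<close>

lemma homogeneous_system_nontrivial:
  fixes E :: "'i \<Rightarrow> 'x \<Rightarrow> 'f::field"
  assumes "finite X" "finite I" "card X < card I"
  shows "\<exists>c. (\<exists>i\<in>I. c i \<noteq> 0) \<and> (\<forall>x\<in>X. (\<Sum>i\<in>I. c i * E i x) = 0)"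
  using assms
proof (induction X arbitrary: I E rule: finite_induct)
  case empty
  then have "I \<noteq> {}" by auto
  then show ?case by (intro exI[of _ "\<lambda>_. 1"]) auto
next
  case (insert x0 X)
  show ?case
  proof (cases "\<forall>i\<in>I. E i x0 = 0")
    case True
    have "card X < card I" using insert by simp
    then obtain c where "\<exists>i\<in>I. c i \<noteq> 0" "\<forall>x\<in>X. (\<Sum>i\<in>I. c i * E i x) = 0"
      using insert.IH[OF insert.prems(1), of E] by blast
    then show ?thesis using True by (intro exI[of _ c]) auto
  next
    case False
    then obtain i0 where i0: "i0 \<in> I" "E i0 x0 \<noteq> 0" by blast
    let ?I = "I - {i0}" and ?E = "\<lambda>i x. E i x - E i x0 / E i0 x0 * E i0 x"
    have "card X < card ?I" using insert i0 by simp
    then obtain c where c: "\<exists>i\<in>?I. c i \<noteq> 0" "\<forall>x\<in>X. (\<Sum>i\<in>?I. c i * ?E i x) = 0"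
      using insert.IH[of ?I ?E] insert.prems by auto
    define d where "d i = (if i = i0 then - (\<Sum>i\<in>?I. c i * (E i x0 / E i0 x0)) else c i)" for i
    have "(\<Sum>i\<in>I. d i * E i x) = (\<Sum>i\<in>?I. c i * ?E i x)" for x
    proof -
      have "(\<Sum>i\<in>I. d i * E i x) = d i0 * E i0 x + (\<Sum>i\<in>?I. d i * E i x)"
        using i0 insert.prems by (subst sum.remove[of _ i0]) auto
      also have "(\<Sum>i\<in>?I. d i * E i x) = (\<Sum>i\<in>?I. c i * E i x)"
        by (rule sum.cong) (auto simp: d_def)
      also have "d i0 * E i0 x = - (\<Sum>i\<in>?I. c i * (E i x0 / E i0 x0 * E i0 x))"
        by (simp add: d_def sum_distrib_right sum_distrib_left mult.assoc)
      finally show ?thesis by (simp add: algebra_simps sum_subtractf)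
    qed
    moreover have "(\<Sum>i\<in>?I. c i * ?E i x0) = 0" using i0 by simp
    moreover have "\<exists>i\<in>I. d i \<noteq> 0" using c(1) by (auto simp: d_def)
    ultimately show ?thesis using c(2) by (intro exI[of _ d]) auto
  qed
qed

lemma injective_square_system_solvable:
  fixes E :: "'i \<Rightarrow> 'x \<Rightarrow> 'f::field"
  assumes fin: "finite X" "finite I" and card: "card X = card I"
    and inj: "\<And>c. (\<forall>x\<in>X. (\<Sum>i\<in>I. c i * E i x) = 0) \<Longrightarrow> \<forall>i\<in>I. c i = 0"
  shows "\<exists>c. \<forall>x\<in>X. (\<Sum>i\<in>I. c i * E i x) = y x"
proof -
  \<comment> \<open>The right-hand side becomes one more unknown, indexed by \<open>None\<close>. A
    nontrivial solution of the enlarged homogeneous system has a nonzero coefficient there, because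
    of injectivity, and can be divided by it.\<close>
  define E' where "E' i x = (case i of None \<Rightarrow> - y x | Some i \<Rightarrow> E i x)" for i x
  let ?I = "insert None (Some ` I)"
  have "card X < card ?I" using fin card by (simp add: card_image)
  then obtain c where c: "\<exists>i\<in>?I. c i \<noteq> 0" "\<forall>x\<in>X. (\<Sum>i\<in>?I. c i * E' i x) = 0"
    using homogeneous_system_nontrivial[of X ?I E'] fin by auto
  have eq: "(\<Sum>i\<in>I. c (Some i) * E i x) = c None * y x" if "x \<in> X" for x
  proof -
    have "(\<Sum>i\<in>?I. c i * E' i x) = - (c None * y x) + (\<Sum>i\<in>I. c (Some i) * E i x)"
      using fin by (simp add: sum.reindex E'_def)
    then show ?thesis using c(2) that by simp
  qed
  have "c None \<noteq> 0"
  proof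
    assume "c None = 0"
    then have "\<forall>i\<in>I. c (Some i) = 0" using inj[of "\<lambda>i. c (Some i)"] eq by simp
    then show False using c(1) \<open>c None = 0\<close> by auto
  qed
  then show ?thesis
    using eq by (intro exI[of _ "\<lambda>i. c (Some i) / c None"])
      (simp add: sum_divide_distrib[symmetric] divide_inverse mult.assoc mult.commute[of "inverse _"]
        flip: sum_distrib_left sum_distrib_right, simp add: field_simps flip: sum_divide_distrib)
qed

section \<open>Laurent polynomials and antisymmetrization\<close>

definition nzvecs :: "nat \<Rightarrow> (nat \<Rightarrow> complex) set" where
  "nzvecs n = {z. \<forall>j<n. z j \<noteq> 0}"

definition lmono :: "nat \<Rightarrow> (nat \<Rightarrow> int) \<Rightarrow> (nat \<Rightarrow> complex) \<Rightarrow> complex" where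
  "lmono n \<nu> z = (\<Prod>j<n. z j powi \<nu> j)"

text \<open>The functions are total, but only their values on vectors with nonzero coordinates matter
  (\<open>0 powi k\<close> is a junk value for negative \<open>k\<close>).\<close>

inductive laurent :: "nat \<Rightarrow> (nat \<Rightarrow> nat) \<Rightarrow> ((nat \<Rightarrow> complex) \<Rightarrow> complex) \<Rightarrow> bool" for n D where
  zero: "(\<And>z. z \<in> nzvecs n \<Longrightarrow> F z = 0) \<Longrightarrow> laurent n D F"
| step: "laurent n D F \<Longrightarrow> (\<And>j. j < n \<Longrightarrow> \<bar>\<nu> j\<bar> \<le> int (D j)) \<Longrightarrow>
    (\<And>z. z \<in> nzvecs n \<Longrightarrow> G z = F z + c * lmono n \<nu> z) \<Longrightarrow> laurent n D G"

lemma laurent_cong: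
  assumes "laurent n D F" "\<And>z. z \<in> nzvecs n \<Longrightarrow> G z = F z"
  shows "laurent n D G"
  using laurent.step[OF assms(1), of "\<lambda>_. 0" G 0] assms(2) by simp

lemma laurent_lmono: "(\<And>j. j < n \<Longrightarrow> \<bar>\<nu> j\<bar> \<le> int (D j)) \<Longrightarrow> laurent n D (\<lambda>z. c * lmono n \<nu> z)"
  by (rule laurent.step[of n D "\<lambda>_. 0" \<nu> _ c]) (auto intro: laurent.zero)

lemma laurent_const: "laurent n D (\<lambda>_. c)"
  by (rule laurent_cong[OF laurent_lmono[of n "\<lambda>_. 0" D c]]) (auto simp: lmono_def)

lemma laurent_add:
  assumes "laurent n D G" "laurent n D F" shows "laurent n D (\<lambda>z. F z + G z)"
  using assms
proof (induction rule: laurent.induct)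
  case (zero G)
  then show ?case by (intro laurent_cong[OF zero(2)]) auto
next
  case (step G \<nu> H c)
  show ?case
    by (rule laurent.step[OF step.IH[OF step.prems] step.hyps(2), of _ c])
       (simp_all add: step.hyps(3) algebra_simps)
qed

lemma laurent_cmult:
  assumes "laurent n D F" shows "laurent n D (\<lambda>z. c * F z)"
  using assms
proof (induction rule: laurent.induct)
  case (zero F)
  then show ?case by (intro laurent.zero) auto
next
  case (step F \<nu> G d)
  show ?case
    by (rule laurent.step[OF step.IH step.hyps(2), of _ "c * d"])
       (simp_all add: step.hyps(3) algebra_simps)
qed

lemma laurent_diff:
  assumes "laurent n D F" "laurent n D G" shows "laurent n D (\<lambda>z. F z - G z)"
  using laurent_add[OF laurent_cmult[OF assms(2), of "-1"] assms(1)] by simp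

lemma laurent_sum:
  assumes "\<And>i. i \<in> I \<Longrightarrow> laurent n D (F i)" shows "laurent n D (\<lambda>z. \<Sum>i\<in>I. F i z)"
  using assms
  by (induction I rule: infinite_finite_induct) (auto intro: laurent_const laurent_add)

lemma lmono_mult: "z \<in> nzvecs n \<Longrightarrow> lmono n \<nu> z * lmono n \<nu>' z = lmono n (\<lambda>j. \<nu> j + \<nu>' j) z"
  by (auto simp: lmono_def nzvecs_def power_int_add prod.distrib)

lemma laurent_mult:
  assumes "laurent n D F" "laurent n D' G"
  shows "laurent n (\<lambda>j. D j + D' j) (\<lambda>z. F z * G z)"
  using assms(1)
proof (induction rule: laurent.induct)
  case (zero F)
  then show ?case by (intro laurent.zero) auto
next
  case (step F \<nu> H c)
  have "laurent n (\<lambda>j. D j + D' j) (\<lambda>z. c * lmono n \<nu> z * G z)"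
    using assms(2)
  proof (induction rule: laurent.induct)
    case (zero G)
    then show ?case by (intro laurent.zero) auto
  next
    case (step G \<nu>' G' d)
    show ?case
    proof (rule laurent.step[OF step.IH, of "\<lambda>j. \<nu> j + \<nu>' j" _ "c * d"])
      show "\<bar>\<nu> j + \<nu>' j\<bar> \<le> int (D j + D' j)" if "j < n" for j
        using step.hyps(2)[OF that] \<open>\<And>j. j < n \<Longrightarrow> \<bar>\<nu> j\<bar> \<le> int (D j)\<close>[OF that] by simp
    qed (simp add: step.hyps(3) lmono_mult[symmetric] algebra_simps)
  qed
  from laurent_add[OF this step.IH] show ?case
    by (rule laurent_cong) (simp add: step.hyps(3) algebra_simps)
qed

lemma laurent_weaken:
  assumes "laurent n D F" "\<And>j. j < n \<Longrightarrow> D j \<le> D' j" shows "laurent n D' F"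
  using assms(1)
proof (induction rule: laurent.induct)
  case (zero F)
  then show ?case by (rule laurent.zero)
next
  case (step F \<nu> G c)
  show ?case
    by (rule laurent.step[OF step.IH _ step.hyps(3)])
       (use step.hyps(2) assms(2) in \<open>force intro: order_trans\<close>)
qed

lemma laurent_prod:
  assumes "finite I" "\<And>i. i \<in> I \<Longrightarrow> laurent n (D i) (F i)"
  shows "laurent n (\<lambda>j. \<Sum>i\<in>I. D i j) (\<lambda>z. \<Prod>i\<in>I. F i z)"
  using assms by (induction I rule: finite_induct) (auto intro: laurent_const laurent_mult)

lemma laurent_powi_coord:
  assumes "j < n" shows "laurent n (\<lambda>i. if i = j then nat \<bar>k\<bar> else 0) (\<lambda>z. z j powi k)"
proof -
  have "(\<Prod>i<n. z i powi (if i = j then k else 0)) = z j powi k" for z :: "nat \<Rightarrow> complex"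
    using assms by (subst prod.remove[of _ j]) (auto intro!: prod.neutral)
  then show ?thesis
    by (intro laurent_cong[OF laurent_lmono[of n "\<lambda>i. if i = j then k else 0" _ 1]])
       (auto simp: lmono_def)
qed

section \<open>The hyperoctahedral action, alternating sums and the Weyl denominator\<close>

definition sact :: "nat \<Rightarrow> (nat \<Rightarrow> nat) \<Rightarrow> (nat \<Rightarrow> int) \<Rightarrow> (nat \<Rightarrow> complex) \<Rightarrow> nat \<Rightarrow> complex" where
  "sact n \<sigma> \<epsilon> z = (\<lambda>j\<in>{..<n}. z (\<sigma> j) powi \<epsilon> j)"

definition wsym :: "nat \<Rightarrow> ((nat \<Rightarrow> complex) \<Rightarrow> complex) \<Rightarrow> bool" where
  "wsym n F \<longleftrightarrow> (\<forall>\<sigma> \<epsilon> z. \<sigma> permutes {..<n} \<longrightarrow> \<epsilon> \<in> signs n \<longrightarrow> z \<in> nzvecs n \<longrightarrow> F (sact n \<sigma> \<epsilon> z) = F z)"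

text \<open>The determinant of the matrix with entries
  \<open>z i powi \<tau> j - z i powi (- \<tau> j)\<close>, that is, the Weyl numerator of type C.
  For the staircase \<open>\<tau> j = n - j\<close> it is the Weyl denominator up to a
  constant.\<close>

definition antisym_sum :: "nat \<Rightarrow> (nat \<Rightarrow> int) \<Rightarrow> (nat \<Rightarrow> complex) \<Rightarrow> complex" where
  "antisym_sum n \<tau> z = (\<Sum>\<sigma>\<in>{\<sigma>. \<sigma> permutes {..<n}}. of_int (sign \<sigma>) *
      (\<Prod>j<n. z (\<sigma> j) powi \<tau> j - z (\<sigma> j) powi (- \<tau> j)))"

text \<open>An unnormalized orbit sum: every monomial of the orbit is counted as often as the
  stabilizer of \<open>\<kappa>\<close> in the hyperoctahedral group has elements.\<close>

definition sym_sum :: "nat \<Rightarrow> (nat \<Rightarrow> int) \<Rightarrow> (nat \<Rightarrow> complex) \<Rightarrow> complex" where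
  "sym_sum n \<kappa> z = (\<Sum>\<sigma>\<in>{\<sigma>. \<sigma> permutes {..<n}}. \<Prod>j<n. z (\<sigma> j) powi \<kappa> j + z (\<sigma> j) powi (- \<kappa> j))"

definition weyl_den :: "nat \<Rightarrow> (nat \<Rightarrow> complex) \<Rightarrow> complex" where
  "weyl_den n z = (\<Prod>j<n. z j - inverse (z j)) *
     (\<Prod>(j,k)\<in>idx_pairs n. (z j + inverse (z j)) - (z k + inverse (z k)))"

lemma signsD: "\<epsilon> \<in> signs n \<Longrightarrow> j < n \<Longrightarrow> \<epsilon> j = 1 \<or> \<epsilon> j = -1"
  by (auto simp: signs_def PiE_def Pi_def)

lemma finite_signs [simp]: "finite (signs n)"
  by (auto simp: signs_def intro!: finite_PiE)

lemma finite_perms [simp]: "finite {\<sigma>. \<sigma> permutes {..<n::nat}}"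
  by (simp add: finite_permutations)

lemma sact_nzvecs: "\<sigma> permutes {..<n} \<Longrightarrow> z \<in> nzvecs n \<Longrightarrow> sact n \<sigma> \<epsilon> z \<in> nzvecs n"
  using permutes_lessThan_less by (auto simp: nzvecs_def sact_def power_int_not_zero)

lemma sact_apply: "j < n \<Longrightarrow> sact n \<sigma> \<epsilon> z j = z (\<sigma> j) powi \<epsilon> j"
  by (simp add: sact_def)

lemma lmono_sact: "lmono n \<nu> (sact n \<sigma> \<epsilon> z) = (\<Prod>j<n. z (\<sigma> j) powi (\<epsilon> j * \<nu> j))"
  by (simp add: lmono_def sact_def power_int_mult)

lemma antisymmetrize_lmono:
  "(\<Sum>\<sigma>\<in>{\<sigma>. \<sigma> permutes {..<n}}. \<Sum>\<epsilon>\<in>signs n.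
      of_int (sign \<sigma>) * of_int (\<Prod>j<n. \<epsilon> j) * lmono n \<tau> (sact n \<sigma> \<epsilon> z)) = antisym_sum n \<tau> z"
  unfolding antisym_sum_def
proof (rule sum.cong[OF refl])
  fix \<sigma> assume "\<sigma> \<in> {\<sigma>. \<sigma> permutes {..<n}}"
  have "(\<Prod>j<n. z (\<sigma> j) powi \<tau> j - z (\<sigma> j) powi (- \<tau> j))
      = (\<Prod>j<n. \<Sum>e\<in>{-1,1::int}. of_int e * z (\<sigma> j) powi (e * \<tau> j))"
    by simp
  also have "\<dots> = (\<Sum>\<epsilon>\<in>signs n. \<Prod>j<n. of_int (\<epsilon> j) * z (\<sigma> j) powi (\<epsilon> j * \<tau> j))"
    unfolding signs_def by (rule prod_sum_PiE) auto
  finally show "(\<Sum>\<epsilon>\<in>signs n. of_int (sign \<sigma>) * of_int (\<Prod>j<n. \<epsilon> j) * lmono n \<tau> (sact n \<sigma> \<epsilon> z))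
    = of_int (sign \<sigma>) * (\<Prod>j<n. z (\<sigma> j) powi \<tau> j - z (\<sigma> j) powi (- \<tau> j))"
    by (simp add: lmono_sact prod.distrib sum_distrib_left mult.assoc)
qed

lemma antisym_sum_cong: "(\<And>j. j < n \<Longrightarrow> \<tau> j = \<tau>' j) \<Longrightarrow> antisym_sum n \<tau> z = antisym_sum n \<tau>' z"
  by (auto simp: antisym_sum_def intro!: sum.cong prod.cong)

lemma antisym_sum_permute:
  assumes p: "\<pi> permutes {..<n}"
  shows "antisym_sum n (\<lambda>j. \<tau> (\<pi> j)) z = of_int (sign \<pi>) * antisym_sum n \<tau> z"
proof -
  have fin: "finite {..<n}" by simp
  have "antisym_sum n (\<lambda>j. \<tau> (\<pi> j)) z = (\<Sum>\<sigma>\<in>{\<sigma>. \<sigma> permutes {..<n}}. of_int (sign (\<sigma> \<circ> \<pi>)) *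
      (\<Prod>j<n. z ((\<sigma> \<circ> \<pi>) j) powi \<tau> (\<pi> j) - z ((\<sigma> \<circ> \<pi>) j) powi (- \<tau> (\<pi> j))))"
    unfolding antisym_sum_def
    by (subst sum_permutations_compose_right[OF p]) simp
  also have "\<dots> = (\<Sum>\<sigma>\<in>{\<sigma>. \<sigma> permutes {..<n}}. of_int (sign \<pi>) * (of_int (sign \<sigma>) *
      (\<Prod>j<n. z (\<sigma> j) powi \<tau> j - z (\<sigma> j) powi (- \<tau> j))))"
  proof (rule sum.cong[OF refl])
    fix \<sigma> assume "\<sigma> \<in> {\<sigma>. \<sigma> permutes {..<n}}"
    then have s: "sign (\<sigma> \<circ> \<pi>) = sign \<sigma> * sign \<pi>"
      using p fin by (intro sign_compose) (auto simp: permutation_permutes)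
    have e: "(\<Prod>j<n. z ((\<sigma> \<circ> \<pi>) j) powi \<tau> (\<pi> j) - z ((\<sigma> \<circ> \<pi>) j) powi (- \<tau> (\<pi> j)))
        = (\<Prod>j<n. z (\<sigma> j) powi \<tau> j - z (\<sigma> j) powi (- \<tau> j))"
      using prod.permute[OF p, of "\<lambda>j. z (\<sigma> j) powi \<tau> j - z (\<sigma> j) powi (- \<tau> j)"]
      by (simp only: o_def)
    show "of_int (sign (\<sigma> \<circ> \<pi>)) * (\<Prod>j<n. z ((\<sigma> \<circ> \<pi>) j) powi \<tau> (\<pi> j) - z ((\<sigma> \<circ> \<pi>) j) powi (- \<tau> (\<pi> j)))
      = of_int (sign \<pi>) * (of_int (sign \<sigma>) * (\<Prod>j<n. z (\<sigma> j) powi \<tau> j - z (\<sigma> j) powi (- \<tau> j)))"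
      unfolding s e by (simp only: of_int_mult ac_simps)
  qed
  finally show ?thesis by (simp add: antisym_sum_def sum_distrib_left)
qed

lemma antisym_sum_equal_zero:
  assumes "i < n" "k < n" "i \<noteq> k" "\<tau> i = \<tau> k"
  shows "antisym_sum n \<tau> z = 0"
proof -
  let ?s = "Transposition.transpose i k"
  have "?s permutes {..<n}" using assms by (intro permutes_swap_id) auto
  moreover have "(\<lambda>j. \<tau> (?s j)) = \<tau>" using assms by (auto simp: Transposition.transpose_def)
  ultimately have "antisym_sum n \<tau> z = - antisym_sum n \<tau> z"
    using antisym_sum_permute[of ?s n \<tau> z] assms by (simp add: sign_swap_id)
  then show ?thesis by simp
qed

lemma antisym_sum_abs:
  "antisym_sum n \<tau> z = of_int (\<Prod>j<n. sgn (\<tau> j)) * antisym_sum n (\<lambda>j. \<bar>\<tau> j\<bar>) z"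
proof -
  have "x powi t - x powi (- t) = of_int (sgn t) * (x powi \<bar>t\<bar> - x powi (- \<bar>t\<bar>))" for x :: complex and t
    by (auto simp: sgn_if abs_if)
  then have "(\<Prod>j<n. x j powi \<tau> j - x j powi (- \<tau> j))
      = (\<Prod>j<n. of_int (sgn (\<tau> j)) * (x j powi \<bar>\<tau> j\<bar> - x j powi (- \<bar>\<tau> j\<bar>)))" for x :: "nat \<Rightarrow> complex"
    by (rule prod.cong[OF refl])
  then show ?thesis
    unfolding antisym_sum_def by (simp add: prod.distrib sum_distrib_left mult.left_commute)
qed

lemma antisym_sum_zero: "j < n \<Longrightarrow> \<tau> j = 0 \<Longrightarrow> antisym_sum n \<tau> z = 0"
  by (subst antisym_sum_abs) (force simp: prod_zero_iff)

text \<open>Coordinatewise this is the product-to-sum formula for a sine and a cosine, stated as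
  \<open>sc\<close>; expanding over both choices in each coordinate produces the sum over sign
  vectors.\<close>

lemma antisym_sum_times_sym_sum:
  assumes z: "z \<in> nzvecs n"
  shows "antisym_sum n \<rho> z * sym_sum n \<kappa> z =
    (\<Sum>\<pi>\<in>{\<pi>. \<pi> permutes {..<n}}. \<Sum>\<epsilon>\<in>signs n. antisym_sum n (\<lambda>j. \<rho> j + \<epsilon> j * \<kappa> (\<pi> j)) z)"
proof -
  let ?P = "{\<pi>. \<pi> permutes {..<n}}"
  let ?s = "\<lambda>x k. x powi k - x powi (- k) :: complex" and ?c = "\<lambda>x k. x powi k + x powi (- k) :: complex"
  have sc: "?s x a * ?c x k = (\<Sum>e\<in>{-1,1::int}. ?s x (a + e * k))" if "x \<noteq> 0" for x a k
    using that by (simp add: power_int_add power_int_minus power_int_diff divide_inverse algebra_simps)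
  \<comment> \<open>For each \<open>\<sigma>\<close> separately the symmetric factor is reindexed so
    that its \<open>j\<close>-th factor sits at the same coordinate \<open>z (\<sigma> j)\<close> as
    the antisymmetric one.\<close>
  have sym: "sym_sum n \<kappa> z = (\<Sum>\<pi>\<in>?P. \<Prod>j<n. ?c (z (\<sigma> j)) (\<kappa> (\<pi> j)))" if s: "\<sigma> permutes {..<n}" for \<sigma>
  proof -
    have "sym_sum n \<kappa> z = (\<Sum>\<pi>\<in>?P. \<Prod>j<n. ?c (z ((\<sigma> \<circ> inv \<pi>) j)) (\<kappa> j))"
      unfolding sym_sum_def
      by (subst setum_permutations_compose_left[OF s], subst sum_permutations_inverse) simp
    also have "\<dots> = (\<Sum>\<pi>\<in>?P. \<Prod>j<n. ?c (z (\<sigma> j)) (\<kappa> (\<pi> j)))"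
    proof (rule sum.cong[OF refl])
      fix \<pi> assume p: "\<pi> \<in> ?P"
      then have p': "\<pi> permutes {..<n}" by simp
      show "(\<Prod>j<n. ?c (z ((\<sigma> \<circ> inv \<pi>) j)) (\<kappa> j)) = (\<Prod>j<n. ?c (z (\<sigma> j)) (\<kappa> (\<pi> j)))"
        using prod.permute[OF p', of "\<lambda>j. ?c (z ((\<sigma> \<circ> inv \<pi>) j)) (\<kappa> j)"]
        by (simp add: o_def permutes_inverses[OF p'])
    qed
    finally show ?thesis .
  qed
  have "antisym_sum n \<rho> z * sym_sum n \<kappa> z
     = (\<Sum>\<sigma>\<in>?P. of_int (sign \<sigma>) * (\<Prod>j<n. ?s (z (\<sigma> j)) (\<rho> j)) * sym_sum n \<kappa> z)"
    by (simp add: antisym_sum_def sum_distrib_right)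
  also have "\<dots> = (\<Sum>\<sigma>\<in>?P. of_int (sign \<sigma>) * (\<Prod>j<n. ?s (z (\<sigma> j)) (\<rho> j)) *
      (\<Sum>\<pi>\<in>?P. \<Prod>j<n. ?c (z (\<sigma> j)) (\<kappa> (\<pi> j))))"
    by (rule sum.cong[OF refl]) (simp only: mem_Collect_eq sym)
  also have "\<dots> = (\<Sum>\<sigma>\<in>?P. \<Sum>\<pi>\<in>?P. of_int (sign \<sigma>) * (\<Prod>j<n. ?s (z (\<sigma> j)) (\<rho> j) * ?c (z (\<sigma> j)) (\<kappa> (\<pi> j))))"
    by (simp only: sum_distrib_left prod.distrib mult.assoc)
  also have "\<dots> = (\<Sum>\<sigma>\<in>?P. \<Sum>\<pi>\<in>?P. \<Sum>\<epsilon>\<in>signs n. of_int (sign \<sigma>) * (\<Prod>j<n. ?s (z (\<sigma> j)) (\<rho> j + \<epsilon> j * \<kappa> (\<pi> j))))"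
  proof (intro sum.cong refl)
    fix \<sigma> \<pi> assume "\<sigma> \<in> ?P" "\<pi> \<in> ?P"
    then have nz: "z (\<sigma> j) \<noteq> 0" if "j < n" for j
      using z that permutes_lessThan_less by (auto simp: nzvecs_def)
    have "(\<Prod>j<n. ?s (z (\<sigma> j)) (\<rho> j) * ?c (z (\<sigma> j)) (\<kappa> (\<pi> j)))
       = (\<Prod>j<n. \<Sum>e\<in>{-1,1::int}. ?s (z (\<sigma> j)) (\<rho> j + e * \<kappa> (\<pi> j)))"
      by (rule prod.cong[OF refl], rule sc) (simp add: nz)
    also have "\<dots> = (\<Sum>\<epsilon>\<in>signs n. \<Prod>j<n. ?s (z (\<sigma> j)) (\<rho> j + \<epsilon> j * \<kappa> (\<pi> j)))"
      unfolding signs_def by (rule prod_sum_PiE) auto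
    finally show "of_int (sign \<sigma>) * (\<Prod>j<n. ?s (z (\<sigma> j)) (\<rho> j) * ?c (z (\<sigma> j)) (\<kappa> (\<pi> j)))
       = (\<Sum>\<epsilon>\<in>signs n. of_int (sign \<sigma>) * (\<Prod>j<n. ?s (z (\<sigma> j)) (\<rho> j + \<epsilon> j * \<kappa> (\<pi> j))))"
      by (simp only: sum_distrib_left)
  qed
  also have "\<dots> = (\<Sum>\<pi>\<in>?P. \<Sum>\<epsilon>\<in>signs n. \<Sum>\<sigma>\<in>?P. of_int (sign \<sigma>) * (\<Prod>j<n. ?s (z (\<sigma> j)) (\<rho> j + \<epsilon> j * \<kappa> (\<pi> j))))"
    by (subst sum.swap) (rule sum.cong[OF refl], rule sum.swap)
  finally show ?thesis by (simp only: antisym_sum_def)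
qed

lemma sym_sum_wsym: "wsym n (sym_sum n \<kappa>)"
  unfolding wsym_def
proof (intro allI impI)
  fix \<sigma> \<epsilon> z assume s: "\<sigma> permutes {..<n}" and e: "\<epsilon> \<in> signs n"
  have "(x powi \<epsilon> j) powi k + (x powi \<epsilon> j) powi (- k) = x powi k + x powi (- k)" if "j < n" for x :: complex and j k
    using signsD[OF e that] by (auto simp: add.commute simp flip: power_int_mult)
  then have "sym_sum n \<kappa> (sact n \<sigma> \<epsilon> z)
      = (\<Sum>\<pi>\<in>{\<sigma>. \<sigma> permutes {..<n}}. \<Prod>j<n. z ((\<sigma> \<circ> \<pi>) j) powi \<kappa> j + z ((\<sigma> \<circ> \<pi>) j) powi (- \<kappa> j))"
    unfolding sym_sum_def by (intro sum.cong prod.cong refl) (auto simp: sact_apply permutes_lessThan_less)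
  also have "\<dots> = sym_sum n \<kappa> z"
    unfolding sym_sum_def by (rule setum_permutations_compose_left[OF s, symmetric])
  finally show "sym_sum n \<kappa> (sact n \<sigma> \<epsilon> z) = sym_sum n \<kappa> z" .
qed

lemma laurent_sym_sum:
  assumes "\<And>j. j < n \<Longrightarrow> \<bar>\<kappa> j\<bar> \<le> int d"
  shows "laurent n (\<lambda>_. d) (sym_sum n \<kappa>)"
proof -
  have *: "sym_sum n \<kappa> z = (\<Sum>\<pi>\<in>{\<pi>. \<pi> permutes {..<n}}. \<Prod>j<n. z j powi \<kappa> (\<pi> j) + z j powi (- \<kappa> (\<pi> j)))" for z
  proof -
    have "sym_sum n \<kappa> z = (\<Sum>\<pi>\<in>{\<pi>. \<pi> permutes {..<n}}. \<Prod>j<n. z (inv \<pi> j) powi \<kappa> j + z (inv \<pi> j) powi (- \<kappa> j))"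
      unfolding sym_sum_def by (rule sum_permutations_inverse)
    also have "\<dots> = (\<Sum>\<pi>\<in>{\<pi>. \<pi> permutes {..<n}}. \<Prod>j<n. z j powi \<kappa> (\<pi> j) + z j powi (- \<kappa> (\<pi> j)))"
    proof (rule sum.cong[OF refl])
      fix \<pi> assume "\<pi> \<in> {\<pi>. \<pi> permutes {..<n}}"
      then have p: "\<pi> permutes {..<n}" by simp
      show "(\<Prod>j<n. z (inv \<pi> j) powi \<kappa> j + z (inv \<pi> j) powi (- \<kappa> j))
          = (\<Prod>j<n. z j powi \<kappa> (\<pi> j) + z j powi (- \<kappa> (\<pi> j)))"
        using prod.permute[OF p, of "\<lambda>j. z (inv \<pi> j) powi \<kappa> j + z (inv \<pi> j) powi (- \<kappa> j)"]
        by (simp add: o_def permutes_inverses[OF p])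
    qed
    finally show ?thesis .
  qed
  have "laurent n (\<lambda>_. d) (\<lambda>z. \<Prod>j<n. z j powi \<kappa> (\<pi> j) + z j powi (- \<kappa> (\<pi> j)))" if p: "\<pi> permutes {..<n}" for \<pi>
  proof -
    have "laurent n (\<lambda>i. \<Sum>j<n. if i = j then nat \<bar>\<kappa> (\<pi> j)\<bar> else 0)
        (\<lambda>z. \<Prod>j<n. z j powi \<kappa> (\<pi> j) + z j powi (- \<kappa> (\<pi> j)))"
    proof (rule laurent_prod)
      fix j assume "j \<in> {..<n}"
      then have "j < n" by simp
      from laurent_powi_coord[OF this, of "\<kappa> (\<pi> j)"] laurent_powi_coord[OF this, of "- \<kappa> (\<pi> j)"]
      show "laurent n (\<lambda>i. if i = j then nat \<bar>\<kappa> (\<pi> j)\<bar> else 0) (\<lambda>z. z j powi \<kappa> (\<pi> j) + z j powi (- \<kappa> (\<pi> j)))"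
        unfolding abs_minus_cancel by (rule laurent_add[rotated])
    qed simp
    then show ?thesis
      by (rule laurent_weaken) (use assms permutes_lessThan_less[OF p] in \<open>simp add: nat_le_iff\<close>)
  qed
  then have "laurent n (\<lambda>_. d) (\<lambda>z. \<Sum>\<pi>\<in>{\<pi>. \<pi> permutes {..<n}}. \<Prod>j<n. z j powi \<kappa> (\<pi> j) + z j powi (- \<kappa> (\<pi> j)))"
    by (intro laurent_sum) auto
  then show ?thesis by (rule laurent_cong) (simp add: *)
qed

lemma weyl_den_sact:
  assumes s: "\<sigma> permutes {..<n}" and e: "\<epsilon> \<in> signs n"
  shows "weyl_den n (sact n \<sigma> \<epsilon> z) = of_int (sign \<sigma>) * of_int (\<Prod>j<n. \<epsilon> j) * weyl_den n z"
proof -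
  let ?y = "sact n \<sigma> \<epsilon> z"
  have 1: "?y j - inverse (?y j) = of_int (\<epsilon> j) * (z (\<sigma> j) - inverse (z (\<sigma> j)))"
    and 2: "?y j + inverse (?y j) = z (\<sigma> j) + inverse (z (\<sigma> j))" if "j < n" for j
    using signsD[OF e that] that by (auto simp: sact_apply power_int_minus)
  have "(\<Prod>j<n. ?y j - inverse (?y j)) = (\<Prod>j<n. of_int (\<epsilon> j) * (z (\<sigma> j) - inverse (z (\<sigma> j))))"
    by (rule prod.cong) (auto simp: 1)
  also have "\<dots> = of_int (\<Prod>j<n. \<epsilon> j) * (\<Prod>j<n. z j - inverse (z j))"
    using prod.permute[OF s, of "\<lambda>j. z j - inverse (z j)"] by (simp add: prod.distrib o_def)
  finally have A: "(\<Prod>j<n. ?y j - inverse (?y j)) = of_int (\<Prod>j<n. \<epsilon> j) * (\<Prod>j<n. z j - inverse (z j))" .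
  have "(\<Prod>(j,k)\<in>idx_pairs n. (?y j + inverse (?y j)) - (?y k + inverse (?y k)))
     = (\<Prod>(j,k)\<in>idx_pairs n. (z (\<sigma> j) + inverse (z (\<sigma> j))) - (z (\<sigma> k) + inverse (z (\<sigma> k))))"
    by (rule prod.cong) (auto simp: 2)
  also have "\<dots> = of_int (sign \<sigma>) * (\<Prod>(j,k)\<in>idx_pairs n. (z j + inverse (z j)) - (z k + inverse (z k)))"
    using prod_idx_pairs_permute_antisym[OF s, of "\<lambda>j k. (z j + inverse (z j)) - (z k + inverse (z k))"]
    by (simp add: inv_weight_sign[OF s])
  finally show ?thesis unfolding weyl_den_def A by (simp only: ac_simps)
qed

text \<open>Each coordinate occurs in one single factor and in \<open>n - 1\<close> pair factors,
  which gives degree \<open>n\<close>. It serves both the Weyl denominator and the Hall-Littlewood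
  numerator, so that the degree cancels in their quotient.\<close>

lemma laurent_root_product:
  fixes n :: nat
  defines "\<delta> \<equiv> \<lambda>j i. if i = j then 1 else 0 :: nat"
  assumes A: "\<And>j. j < n \<Longrightarrow> laurent n (\<delta> j) (A j)"
    and B: "\<And>j k. j < k \<Longrightarrow> k < n \<Longrightarrow> laurent n (\<lambda>i. \<delta> j i + \<delta> k i) (B j k)"
  shows "laurent n (\<lambda>_. n) (\<lambda>z. (\<Prod>j<n. A j z) * (\<Prod>(j,k)\<in>idx_pairs n. B j k z))"
proof -
  have A': "laurent n (\<lambda>i. \<Sum>j<n. \<delta> j i) (\<lambda>z. \<Prod>j<n. A j z)"
    by (rule laurent_prod) (auto intro: A)
  have B': "laurent n (\<lambda>i. \<Sum>x\<in>idx_pairs n. \<delta> (fst x) i + \<delta> (snd x) i)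
     (\<lambda>z. \<Prod>x\<in>idx_pairs n. case x of (j,k) \<Rightarrow> B j k z)"
  proof (rule laurent_prod)
    fix x assume "x \<in> idx_pairs n"
    then obtain j k where x: "x = (j,k)" "j < k" "k < n" by (cases x) auto
    then show "laurent n (\<lambda>i. \<delta> (fst x) i + \<delta> (snd x) i) (\<lambda>z. case x of (j,k) \<Rightarrow> B j k z)"
      using B[of j k] by simp
  qed simp
  have deg: "(\<Sum>x\<in>idx_pairs n. \<delta> (fst x) i + \<delta> (snd x) i) = n - 1" if "i < n" for i
  proof -
    have "(\<Sum>x\<in>idx_pairs n. \<delta> (fst x) i + \<delta> (snd x) i) = (\<Sum>j<n. \<Sum>k\<in>{..<n} - {j}. \<delta> j i)"
      using sum_off_diagonal[of "\<lambda>j k. \<delta> j i" n] by (simp add: case_prod_unfold)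
    also have "\<dots> = (\<Sum>j<n. if i = j then n - 1 else 0)"
      by (rule sum.cong) (auto simp: \<delta>_def)
    also have "\<dots> = n - 1" using that by simp
    finally show ?thesis .
  qed
  have deg': "(\<Sum>j<n. \<delta> j i) = 1" if "i < n" for i using that by (simp add: \<delta>_def)
  show ?thesis
  proof (rule laurent_weaken[OF laurent_mult[OF A' B']])
    fix i assume "i < n"
    then show "(\<Sum>j<n. \<delta> j i) + (\<Sum>x\<in>idx_pairs n. \<delta> (fst x) i + \<delta> (snd x) i) \<le> n"
      by (simp only: deg deg')
  qed
qed

lemma laurent_coord:
  assumes "j < n"
  shows "laurent n (\<lambda>i. if i = j then 1 else 0) (\<lambda>z. z j)"
    and "laurent n (\<lambda>i. if i = j then 1 else 0) (\<lambda>z. inverse (z j))"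
  using laurent_powi_coord[OF assms, of 1] laurent_powi_coord[OF assms, of "-1"] by (simp_all cong: if_cong)

lemma laurent_coord_pair:
  assumes "j < n" "k < n"
  shows "laurent n (\<lambda>i. (if i = j then 1 else 0) + (if i = k then 1 else 0))
    (\<lambda>z. a * z j + b * inverse (z j) + (c * z k + d * inverse (z k)))"
  by (intro laurent_add laurent_cmult; rule laurent_weaken, rule laurent_coord) (use assms in auto)

lemma laurent_weyl_den: "laurent n (\<lambda>_. n) (weyl_den n)"
proof -
  have "laurent n (\<lambda>_. n) (\<lambda>z. (\<Prod>j<n. z j - inverse (z j)) *
      (\<Prod>(j,k)\<in>idx_pairs n. 1 * z j + 1 * inverse (z j) + ((-1) * z k + (-1) * inverse (z k))))"
  proof (rule laurent_root_product)
    show "laurent n (\<lambda>i. if i = j then 1 else 0) (\<lambda>z. z j - inverse (z j))" if "j < n" for j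
      using that by (intro laurent_diff laurent_coord)
    show "laurent n (\<lambda>i. (if i = j then 1 else 0) + (if i = k then 1 else 0))
      (\<lambda>z. 1 * z j + 1 * inverse (z j) + ((-1) * z k + (-1) * inverse (z k)))" if "j < k" "k < n" for j k
      using that by (intro laurent_coord_pair) auto
  qed
  then show ?thesis by (rule laurent_cong) (simp add: weyl_den_def algebra_simps)
qed

lemma rearrangement_rho:
  fixes \<kappa> :: "nat \<Rightarrow> int"
  assumes p: "\<pi> permutes {..<n}" and mono: "\<And>j k. j \<le> k \<Longrightarrow> k < n \<Longrightarrow> \<kappa> k \<le> \<kappa> j"
  shows "(\<Sum>j<n. int (n - j) * \<kappa> (\<pi> j)) \<le> (\<Sum>j<n. int (n - j) * \<kappa> j)"
    and "(\<Sum>j<n. int (n - j) * \<kappa> (\<pi> j)) = (\<Sum>j<n. int (n - j) * \<kappa> j) \<Longrightarrow> j < n \<Longrightarrow> \<kappa> (\<pi> j) = \<kappa> j"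
proof -
  have i: "inv \<pi> permutes {..<n}" using p by (rule permutes_inv)
  have e1: "(\<Sum>j<n. int (inv \<pi> j) * \<kappa> j) = (\<Sum>j<n. int j * \<kappa> (\<pi> j))"
    using sum.permute[OF p, of "\<lambda>j. int (inv \<pi> j) * \<kappa> j"] by (simp add: o_def permutes_inverses[OF p])
  have e2: "(\<Sum>j<n. \<kappa> (\<pi> j)) = (\<Sum>j<n. \<kappa> j)"
    using sum.permute[OF p, of \<kappa>] by (simp add: o_def)
  have e3: "(\<Sum>j<n. int (n - j) * \<mu> j) = int n * (\<Sum>j<n. \<mu> j) - (\<Sum>j<n. int j * \<mu> j)" for \<mu> :: "nat \<Rightarrow> int"
    unfolding sum_distrib_left sum_subtractf[symmetric]
    by (rule sum.cong) (auto simp: of_nat_diff algebra_simps)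
  note R = rearrangement_decreasing[OF i, of \<kappa>, OF mono, unfolded e1]
  show "(\<Sum>j<n. int (n - j) * \<kappa> (\<pi> j)) \<le> (\<Sum>j<n. int (n - j) * \<kappa> j)"
    unfolding e3 e2 using R by simp
  assume "(\<Sum>j<n. int (n - j) * \<kappa> (\<pi> j)) = (\<Sum>j<n. int (n - j) * \<kappa> j)" and j: "j < n"
  then have "\<forall>j<n. \<kappa> (inv \<pi> j) = \<kappa> j" unfolding e3 e2 using R by simp
  then have "\<kappa> (inv \<pi> (\<pi> j)) = \<kappa> (\<pi> j)" using permutes_lessThan_less[OF p j] by blast
  then show "\<kappa> (\<pi> j) = \<kappa> j" by (simp add: permutes_inverses[OF p])
qed

text \<open>Signs and order of the exponents can be normalized at the price of a scalar, and a zero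
  or a repeated absolute value kills the sum. Distinct positive values in decreasing order dominate
  the staircase \<open>n - j\<close> termwise and differ from it by a decreasing vector. The sum of
  squares is recorded because it is the measure of the later induction.\<close>

lemma antisym_sum_normal_form:
  obtains (vanish) "\<And>z. antisym_sum n \<tau> z = 0"
  | (dominant) \<kappa> s where "\<And>z. antisym_sum n \<tau> z = s * antisym_sum n (\<lambda>j. int (n - j) + \<kappa> j) z"
      "\<And>j k. j \<le> k \<Longrightarrow> k < n \<Longrightarrow> \<kappa> k \<le> \<kappa> j" "\<And>j. j < n \<Longrightarrow> 0 \<le> \<kappa> j"
      "(\<Sum>j<n. (int (n - j) + \<kappa> j)\<^sup>2) = (\<Sum>j<n. (\<tau> j)\<^sup>2)"
      "\<And>d j. (\<And>j. j < n \<Longrightarrow> \<bar>\<tau> j\<bar> \<le> int (d + n)) \<Longrightarrow> j < n \<Longrightarrow> \<kappa> j \<le> int d"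
proof (cases "\<exists>i k. i < n \<and> k < n \<and> i \<noteq> k \<and> \<bar>\<tau> i\<bar> = \<bar>\<tau> k\<bar> \<or> (\<exists>j<n. \<tau> j = 0)")
  case True
  have "antisym_sum n \<tau> z = 0" for z
    using True antisym_sum_zero[of _ n \<tau> z] antisym_sum_equal_zero[of _ n _ "\<lambda>j. \<bar>\<tau> j\<bar>" z]
    by (subst antisym_sum_abs) (metis mult_zero_right antisym_sum_abs mult_eq_0_iff)
  then show ?thesis by (rule vanish)
next
  case False
  obtain \<pi> where p: "\<pi> permutes {..<n}" and sorted: "\<And>j k. j \<le> k \<Longrightarrow> k < n \<Longrightarrow> \<bar>\<tau> (\<pi> k)\<bar> \<le> \<bar>\<tau> (\<pi> j)\<bar>"
    using sort_permutation[of n "\<lambda>j. \<bar>\<tau> j\<bar>"] by blast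
  have strict: "\<bar>\<tau> (\<pi> k)\<bar> < \<bar>\<tau> (\<pi> j)\<bar>" if "j < k" "k < n" for j k
  proof -
    have "\<pi> j \<noteq> \<pi> k" using that permutes_eq_iff[OF p] by auto
    then have "\<bar>\<tau> (\<pi> j)\<bar> \<noteq> \<bar>\<tau> (\<pi> k)\<bar>"
      using False that permutes_lessThan_less[OF p, of j] permutes_lessThan_less[OF p, of k] by auto
    then show ?thesis using sorted[of j k] that by simp
  qed
  define \<kappa> where "\<kappa> j = \<bar>\<tau> (\<pi> j)\<bar> - int (n - j)" for j
  have step: "\<kappa> (Suc j) \<le> \<kappa> j" if "Suc j < n" for j
    using strict[of j "Suc j"] that by (simp add: \<kappa>_def of_nat_diff)
  have mono: "\<kappa> k \<le> \<kappa> j" if "j \<le> k" "k < n" for j k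
    using that by (induction rule: dec_induct) (use step in \<open>force intro: order_trans\<close>)+
  have nonneg: "0 \<le> \<kappa> j" if "j < n" for j
  proof -
    have "n - 1 < n" using that by simp
    then have "\<tau> (\<pi> (n - 1)) \<noteq> 0" using False permutes_lessThan_less[OF p] by blast
    then have "0 \<le> \<kappa> (n - 1)" using that by (simp add: \<kappa>_def)
    moreover have "\<kappa> (n - 1) \<le> \<kappa> j" using mono[of j "n - 1"] that by linarith
    ultimately show ?thesis by linarith
  qed
  show ?thesis
  proof (rule dominant)
    fix z
    have "antisym_sum n (\<lambda>j. int (n - j) + \<kappa> j) z = of_int (sign \<pi>) * antisym_sum n (\<lambda>j. \<bar>\<tau> j\<bar>) z"
      using antisym_sum_permute[OF p, of "\<lambda>j. \<bar>\<tau> j\<bar>" z] by (simp add: \<kappa>_def)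
    then have "antisym_sum n (\<lambda>j. \<bar>\<tau> j\<bar>) z = of_int (sign \<pi>) * antisym_sum n (\<lambda>j. int (n - j) + \<kappa> j) z"
      by (simp flip: mult.assoc of_int_mult)
    then show "antisym_sum n \<tau> z = (of_int (\<Prod>j<n. sgn (\<tau> j)) * of_int (sign \<pi>)) *
        antisym_sum n (\<lambda>j. int (n - j) + \<kappa> j) z"
      by (subst antisym_sum_abs) simp
    show "(\<Sum>j<n. (int (n - j) + \<kappa> j)\<^sup>2) = (\<Sum>j<n. (\<tau> j)\<^sup>2)"
      using sum.permute[OF p, of "\<lambda>j. (\<tau> j)\<^sup>2"] by (simp add: \<kappa>_def o_def)
    show "\<kappa> j \<le> int d" if "\<And>j. j < n \<Longrightarrow> \<bar>\<tau> j\<bar> \<le> int (d + n)" "j < n" for d j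
    proof -
      have "\<kappa> 0 \<le> int d" using that(1)[OF permutes_lessThan_less[OF p, of 0]] that(2) by (simp add: \<kappa>_def)
      then show ?thesis using mono[of 0 j] that(2) by simp
    qed
  qed (use mono nonneg in auto)
qed

definition wsum :: "nat \<Rightarrow> ((nat \<Rightarrow> nat) \<Rightarrow> (nat \<Rightarrow> int) \<Rightarrow> 'a) \<Rightarrow> 'a::comm_monoid_add" where
  "wsum n f = (\<Sum>\<sigma>\<in>{\<sigma>. \<sigma> permutes {..<n}}. \<Sum>\<epsilon>\<in>signs n. f \<sigma> \<epsilon>)"

lemma wsum_cong: "(\<And>\<sigma> \<epsilon>. \<sigma> permutes {..<n} \<Longrightarrow> \<epsilon> \<in> signs n \<Longrightarrow> f \<sigma> \<epsilon> = g \<sigma> \<epsilon>) \<Longrightarrow> wsum n f = wsum n g"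
  by (auto simp: wsum_def intro!: sum.cong)

lemma wsum_add: "wsum n (\<lambda>\<sigma> \<epsilon>. f \<sigma> \<epsilon> + g \<sigma> \<epsilon>) = wsum n f + wsum n g"
  by (simp add: wsum_def sum.distrib)

lemma wsum_cmult: "wsum n (\<lambda>\<sigma> \<epsilon>. c * f \<sigma> \<epsilon>) = c * wsum n (f :: _ \<Rightarrow> _ \<Rightarrow> 'a::semiring_0)"
  by (simp add: wsum_def sum_distrib_left)

definition antisymmetrize :: "nat \<Rightarrow> ((nat \<Rightarrow> complex) \<Rightarrow> complex) \<Rightarrow> (nat \<Rightarrow> complex) \<Rightarrow> complex" where
  "antisymmetrize n F z = wsum n (\<lambda>\<sigma> \<epsilon>. of_int (sign \<sigma>) * of_int (\<Prod>j<n. \<epsilon> j) * F (sact n \<sigma> \<epsilon> z))"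

lemma antisymmetrize_step:
  assumes "\<And>z. z \<in> nzvecs n \<Longrightarrow> G z = F z + c * lmono n \<nu> z" "z \<in> nzvecs n"
  shows "antisymmetrize n G z = antisymmetrize n F z + c * antisym_sum n \<nu> z"
proof -
  have "antisymmetrize n G z = wsum n (\<lambda>\<sigma> \<epsilon>. of_int (sign \<sigma>) * of_int (\<Prod>j<n. \<epsilon> j) * F (sact n \<sigma> \<epsilon> z)
     + c * (of_int (sign \<sigma>) * of_int (\<Prod>j<n. \<epsilon> j) * lmono n \<nu> (sact n \<sigma> \<epsilon> z)))"
    unfolding antisymmetrize_def
    by (rule wsum_cong) (simp add: assms sact_nzvecs algebra_simps)
  also have "\<dots> = antisymmetrize n F z + c * antisym_sum n \<nu> z"
    unfolding wsum_add wsum_cmult antisymmetrize_def antisymmetrize_lmono[symmetric] wsum_def ..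
  finally show ?thesis .
qed

lemma signs_prod_square: "\<epsilon> \<in> signs n \<Longrightarrow> of_int (\<Prod>j<n. \<epsilon> j) * of_int (\<Prod>j<n. \<epsilon> j) = (1::complex)"
proof -
  assume e: "\<epsilon> \<in> signs n"
  have "(\<Prod>j<n. \<epsilon> j) * (\<Prod>j<n. \<epsilon> j) = (\<Prod>j<n. \<epsilon> j * \<epsilon> j)" by (simp add: prod.distrib)
  also have "\<dots> = 1" by (rule prod.neutral) (use signsD[OF e] in force)
  finally show ?thesis by (metis of_int_1 of_int_mult)
qed

lemma of_int_sign_square: "of_int (sign \<sigma>) * of_int (sign \<sigma>) = (1::complex)"
  by (metis of_int_1 of_int_mult sign_idempotent)

text \<open>The Weyl denominator formula up to a constant. Antisymmetrizing a Laurent polynomial of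
  degree at most \<open>n\<close> can only yield multiples of the staircase sum, since that degree
  leaves no room for a nonzero \<open>\<kappa>\<close>; the Weyl denominator is such a
  polynomial.\<close>

lemma weyl_den_eq_antisym_sum:
  obtains K where "\<And>z. z \<in> nzvecs n \<Longrightarrow> antisym_sum n (\<lambda>j. int (n - j)) z = K * weyl_den n z"
proof -
  let ?\<rho> = "\<lambda>j. int (n - j)"
  have "\<exists>c. \<forall>z\<in>nzvecs n. antisymmetrize n F z = c * antisym_sum n ?\<rho> z" if "laurent n (\<lambda>_. n) F" for F
    using that
  proof (induction rule: laurent.induct)
    case (zero F)
    then show ?case
      by (intro exI[of _ 0]) (auto simp: antisymmetrize_def wsum_def sact_nzvecs)
  next
    case (step F \<nu> G c)
    then obtain a where a: "\<forall>z\<in>nzvecs n. antisymmetrize n F z = a * antisym_sum n ?\<rho> z" by blast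
    have "\<exists>b. \<forall>z. antisym_sum n \<nu> z = b * antisym_sum n ?\<rho> z"
    proof (cases rule: antisym_sum_normal_form[of n \<nu>])
      case vanish
      then show ?thesis by (intro exI[of _ 0]) simp
    next
      case (dominant \<kappa> s)
      have "\<kappa> j = 0" if "j < n" for j
        using dominant(3)[OF that] dominant(5)[of 0 j] that step.hyps(2) by simp
      then have "antisym_sum n (\<lambda>j. ?\<rho> j + \<kappa> j) z = antisym_sum n ?\<rho> z" for z
        by (intro antisym_sum_cong) simp
      then show ?thesis using dominant(1) by auto
    qed
    then obtain b where b: "\<And>z. antisym_sum n \<nu> z = b * antisym_sum n ?\<rho> z" by blast
    show ?case
      using antisymmetrize_step[of n G F c \<nu>, OF step.hyps(3)] a b
      by (intro exI[of _ "a + c * b"]) (simp add: algebra_simps)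
  qed
  then obtain c where c: "\<And>z. z \<in> nzvecs n \<Longrightarrow> antisymmetrize n (weyl_den n) z = c * antisym_sum n ?\<rho> z"
    using laurent_weyl_den by blast
  define N :: complex where "N = wsum n (\<lambda>_ _. 1)"
  \<comment> \<open>The Weyl denominator is already alternating, so antisymmetrizing multiplies it
    by the order \<open>N\<close> of the group.\<close>
  have "antisymmetrize n (weyl_den n) z = weyl_den n z * N" for z
    unfolding antisymmetrize_def N_def wsum_cmult[symmetric]
  proof (rule wsum_cong)
    fix \<sigma> \<epsilon> assume s: "\<sigma> permutes {..<n}" and e: "\<epsilon> \<in> signs n"
    let ?s = "of_int (sign \<sigma>) :: complex" and ?e = "of_int (\<Prod>j<n. \<epsilon> j) :: complex"
    have "?s * ?e * (?s * ?e * weyl_den n z) = (?s * ?s) * (?e * ?e) * weyl_den n z" by (simp only: ac_simps)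
    then show "?s * ?e * weyl_den n (sact n \<sigma> \<epsilon> z) = weyl_den n z * 1"
      unfolding weyl_den_sact[OF s e] by (simp only: signs_prod_square[OF e] of_int_sign_square) simp
  qed
  then have eq: "c * antisym_sum n ?\<rho> z = weyl_den n z * N" if "z \<in> nzvecs n" for z
    using c[OF that] by simp
  have "N = of_nat (card {\<sigma>. \<sigma> permutes {..<n}} * card (signs n))"
    by (simp add: N_def wsum_def)
  moreover have "card (signs n) = 2 ^ n" by (simp add: signs_def card_PiE numeral_2_eq_2)
  ultimately have N0: "N \<noteq> 0" by (simp add: card_permutations)
  \<comment> \<open>A test point off the reflection hyperplanes, used to see
    \<open>c \<noteq> 0\<close>: the integers from 2 on are distinct, and no product of two of them
    is 1.\<close>
  define y :: "nat \<Rightarrow> complex" where "y j = of_nat (j + 2)" for j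
  have y0: "y j \<noteq> 0" for j unfolding y_def by (simp only: of_nat_eq_0_iff)
  then have y: "y \<in> nzvecs n" by (simp add: nzvecs_def)
  have "weyl_den n y \<noteq> 0"
  proof -
    have A: "y j - inverse (y j) \<noteq> 0" for j
    proof
      assume "y j - inverse (y j) = 0"
      then have "y j * y j = 1" using y0[of j] by (simp add: field_simps)
      then have "(of_nat ((j + 2) * (j + 2)) :: complex) = of_nat 1" unfolding y_def by (simp only: of_nat_mult of_nat_1)
      then show False by (simp only: of_nat_eq_iff) simp
    qed
    have B: "(y j + inverse (y j)) - (y k + inverse (y k)) \<noteq> 0" if "j < k" for j k
    proof
      assume "(y j + inverse (y j)) - (y k + inverse (y k)) = 0"
      with y0[of j] y0[of k] have "(y j - y k) * (y j * y k - 1) = 0" by (simp add: field_simps)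
      then have "y j = y k \<or> y j * y k = 1" by simp
      moreover have "y j \<noteq> y k" using that by (simp add: y_def)
      moreover have "y j * y k \<noteq> 1"
      proof
        assume "y j * y k = 1"
        then have "(of_nat ((j + 2) * (k + 2)) :: complex) = of_nat 1" unfolding y_def by (simp only: of_nat_mult of_nat_1)
        then show False by (simp only: of_nat_eq_iff) simp
      qed
      ultimately show False by blast
    qed
    show ?thesis unfolding weyl_den_def using A B by (auto simp: prod_zero_iff)
  qed
  then have "c \<noteq> 0" using eq[OF y] N0 by auto
  then have "antisym_sum n ?\<rho> z = N / c * weyl_den n z" if "z \<in> nzvecs n" for z
    using eq[OF that] by (simp add: field_simps)
  then show thesis by (rule that)
qed

text \<open>Divisibility is obtained without dividing polynomials. The staircase sum times
  \<open>sym_sum n \<kappa>\<close> contains the wanted alternating sum with positive multiplicity,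
  and all its other terms have exponent vectors of strictly smaller Euclidean length, so that
  induction on the squared length covers them. The quotient inherits the degree of
  \<open>sym_sum\<close>.\<close>

lemma antisym_sum_divisible:
  assumes "\<And>j. j < n \<Longrightarrow> \<bar>\<tau> j\<bar> \<le> int (d + n)"
  shows "\<exists>g. laurent n (\<lambda>_. d) g \<and> wsym n g \<and> (\<forall>z\<in>nzvecs n. antisym_sum n \<tau> z = weyl_den n z * g z)"
  using assms
proof (induction "nat (\<Sum>j<n. (\<tau> j)\<^sup>2)" arbitrary: \<tau> rule: less_induct)
  case less
  show ?case
  proof (cases rule: antisym_sum_normal_form[of n \<tau>])
    case vanish
    then show ?thesis by (intro exI[of _ "\<lambda>_. 0"]) (auto simp: laurent_const wsym_def)
  next
    case (dominant \<kappa> s)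
    obtain K where K: "\<And>z. z \<in> nzvecs n \<Longrightarrow> antisym_sum n (\<lambda>j. int (n - j)) z = K * weyl_den n z"
      using weyl_den_eq_antisym_sum by blast
    let ?\<rho> = "\<lambda>j. int (n - j)"
    let ?W = "{\<pi>. \<pi> permutes {..<n}} \<times> signs n"
    let ?t = "\<lambda>w j. ?\<rho> j + snd w j * \<kappa> (fst w j)"
    let ?fix = "\<lambda>w. \<forall>j<n. snd w j * \<kappa> (fst w j) = \<kappa> j"
    have bound: "\<kappa> j \<le> int d" if "j < n" for j using dominant(5) less.prems that by blast
    let ?Q = "\<lambda>w g. laurent n (\<lambda>_. d) g \<and> wsym n g \<and> (\<forall>z\<in>nzvecs n. antisym_sum n (?t w) z = weyl_den n z * g z)"
    have ex: "\<exists>g. ?Q w g" if w: "w \<in> ?W" "\<not> ?fix w" for w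
    proof (rule less.hyps)
      obtain \<pi> \<epsilon> where w': "w = (\<pi>, \<epsilon>)" "\<pi> permutes {..<n}" "\<epsilon> \<in> signs n" using w by auto
      have e: "\<epsilon> j * \<kappa> (\<pi> j) \<le> \<kappa> (\<pi> j)" "(\<epsilon> j * \<kappa> (\<pi> j))\<^sup>2 = (\<kappa> (\<pi> j))\<^sup>2"
        "\<bar>\<epsilon> j * \<kappa> (\<pi> j)\<bar> \<le> int d" if "j < n" for j
        using signsD[OF w'(3) that] dominant(3)[OF permutes_lessThan_less[OF w'(2) that]]
          bound[OF permutes_lessThan_less[OF w'(2) that]] by (auto simp: abs_mult)
      show "\<bar>?t w j\<bar> \<le> int (d + n)" if "j < n" for j
        using e(3)[OF that] that by (simp add: w') 
      have le1: "(\<Sum>j<n. ?\<rho> j * (\<epsilon> j * \<kappa> (\<pi> j))) \<le> (\<Sum>j<n. ?\<rho> j * \<kappa> (\<pi> j))"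
      proof (rule sum_mono)
        fix j assume "j \<in> {..<n}"
        then show "?\<rho> j * (\<epsilon> j * \<kappa> (\<pi> j)) \<le> ?\<rho> j * \<kappa> (\<pi> j)" using e(1)[of j] by (intro mult_left_mono) simp_all
      qed
      have le2: "(\<Sum>j<n. ?\<rho> j * \<kappa> (\<pi> j)) \<le> (\<Sum>j<n. ?\<rho> j * \<kappa> j)"
        by (rule rearrangement_rho(1)[OF w'(2) dominant(2)])
      have "(\<Sum>j<n. ?\<rho> j * (\<epsilon> j * \<kappa> (\<pi> j))) \<noteq> (\<Sum>j<n. ?\<rho> j * \<kappa> j)"
      proof
        assume eq: "(\<Sum>j<n. ?\<rho> j * (\<epsilon> j * \<kappa> (\<pi> j))) = (\<Sum>j<n. ?\<rho> j * \<kappa> j)"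
        have "(\<Sum>j<n. ?\<rho> j * (\<kappa> (\<pi> j) - \<epsilon> j * \<kappa> (\<pi> j))) = 0"
          using eq le1 le2 by (simp add: right_diff_distrib sum_subtractf)
        then have z: "\<forall>j\<in>{..<n}. ?\<rho> j * (\<kappa> (\<pi> j) - \<epsilon> j * \<kappa> (\<pi> j)) = 0"
          by (subst (asm) sum_nonneg_eq_0_iff) (use e(1) in \<open>auto intro!: mult_nonneg_nonneg\<close>)
        have "\<epsilon> j * \<kappa> (\<pi> j) = \<kappa> j" if "j < n" for j
        proof -
          have "?\<rho> j * (\<kappa> (\<pi> j) - \<epsilon> j * \<kappa> (\<pi> j)) = 0" using z that by blast
          then have "\<epsilon> j * \<kappa> (\<pi> j) = \<kappa> (\<pi> j)" using that by simp
          moreover have "\<kappa> (\<pi> j) = \<kappa> j"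
            by (rule rearrangement_rho(2)[OF w'(2) dominant(2) _ that]) (use eq le1 le2 in auto)
          ultimately show ?thesis by simp
        qed
        then show False using w(2) by (simp add: w')
      qed
      then have lt: "(\<Sum>j<n. ?\<rho> j * (\<epsilon> j * \<kappa> (\<pi> j))) < (\<Sum>j<n. ?\<rho> j * \<kappa> j)" using le1 le2 by simp
      have "(\<Sum>j<n. (\<epsilon> j * \<kappa> (\<pi> j))\<^sup>2) = (\<Sum>j<n. (\<kappa> (\<pi> j))\<^sup>2)" by (rule sum.cong) (use e(2) in auto)
      also have "\<dots> = (\<Sum>j<n. (\<kappa> j)\<^sup>2)" using sum.permute[OF w'(2), of "\<lambda>j. (\<kappa> j)\<^sup>2"] by (simp add: o_def)
      finally have sq: "(\<Sum>j<n. (\<epsilon> j * \<kappa> (\<pi> j))\<^sup>2) = (\<Sum>j<n. (\<kappa> j)\<^sup>2)" .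
      \<comment> \<open>Signed permutations preserve the sum of the squares of \<open>x\<close>, so
        lengths differ only through the inner product with the staircase, which was just
        bounded.\<close>
      have ex: "(\<Sum>j<n. (?\<rho> j + x j)\<^sup>2) = (\<Sum>j<n. (?\<rho> j)\<^sup>2) + (\<Sum>j<n. (x j)\<^sup>2) + 2 * (\<Sum>j<n. ?\<rho> j * x j)" for x :: "nat \<Rightarrow> int"
        by (simp only: power2_sum sum.distrib sum_distrib_left mult.assoc)
      have "(\<Sum>j<n. (?t w j)\<^sup>2) < (\<Sum>j<n. (?\<rho> j + \<kappa> j)\<^sup>2)"
        using lt sq by (simp only: w' fst_conv snd_conv ex)
      also have "\<dots> = (\<Sum>j<n. (\<tau> j)\<^sup>2)" by (rule dominant(4))
      finally have "(\<Sum>j<n. (?t w j)\<^sup>2) < (\<Sum>j<n. (\<tau> j)\<^sup>2)" .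
      moreover have "0 \<le> (\<Sum>j<n. (?t w j)\<^sup>2)" by (rule sum_nonneg) simp
      ultimately show "nat (\<Sum>j<n. (?t w j)\<^sup>2) < nat (\<Sum>j<n. (\<tau> j)\<^sup>2)" by simp
    qed
    define g where "g w = (SOME g. ?Q w g)" for w
    have g: "?Q w (g w)" if "w \<in> ?W" "\<not> ?fix w" for w
      unfolding g_def by (rule someI_ex[OF ex[OF that]])
    let ?F = "{w\<in>?W. ?fix w}" and ?O = "{w\<in>?W. \<not> ?fix w}"
    have fin: "finite ?W" by simp
    \<comment> \<open>The identity contributes to the leading term, whose multiplicity can therefore
      be divided out.\<close>
    have "(id, \<lambda>j\<in>{..<n}. 1) \<in> ?F" by (auto simp: permutes_id signs_def)
    then have "?F \<noteq> {}" by blast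
    moreover have "finite ?F" using fin by simp
    ultimately have cF: "card ?F \<noteq> 0" by (simp only: card_eq_0_iff) blast
    define G where "G z = s / of_nat (card ?F) * (K * sym_sum n \<kappa> z - (\<Sum>w\<in>?O. g w z))" for z
    have eq: "antisym_sum n \<tau> z = weyl_den n z * G z" if z: "z \<in> nzvecs n" for z
    proof -
      have "K * weyl_den n z * sym_sum n \<kappa> z = (\<Sum>w\<in>?W. antisym_sum n (?t w) z)"
        using antisym_sum_times_sym_sum[OF z, of ?\<rho> \<kappa>] K[OF z]
        by (simp add: sum.cartesian_product case_prod_unfold)
      also have "\<dots> = (\<Sum>w\<in>?F. antisym_sum n (?t w) z) + (\<Sum>w\<in>?O. antisym_sum n (?t w) z)"
        using fin by (subst sum.union_disjoint[symmetric]) (auto intro!: sum.cong)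
      also have "(\<Sum>w\<in>?F. antisym_sum n (?t w) z) = (\<Sum>w\<in>?F. antisym_sum n (\<lambda>j. ?\<rho> j + \<kappa> j) z)"
        by (intro sum.cong refl antisym_sum_cong) auto
      also have "\<dots> = of_nat (card ?F) * antisym_sum n (\<lambda>j. ?\<rho> j + \<kappa> j) z" by simp
      also have "(\<Sum>w\<in>?O. antisym_sum n (?t w) z) = weyl_den n z * (\<Sum>w\<in>?O. g w z)"
        unfolding sum_distrib_left by (rule sum.cong[OF refl]) (use g z in auto)
      finally have "of_nat (card ?F) * antisym_sum n (\<lambda>j. ?\<rho> j + \<kappa> j) z
          = weyl_den n z * (K * sym_sum n \<kappa> z - (\<Sum>w\<in>?O. g w z))" by (simp add: algebra_simps)
      then have "antisym_sum n (\<lambda>j. ?\<rho> j + \<kappa> j) z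
          = weyl_den n z * (K * sym_sum n \<kappa> z - (\<Sum>w\<in>?O. g w z)) / of_nat (card ?F)"
        using cF by (simp add: field_simps)
      then show ?thesis unfolding dominant(1) G_def by simp
    qed
    have "laurent n (\<lambda>_. d) G" unfolding G_def
      by (intro laurent_cmult laurent_diff laurent_sum laurent_sym_sum)
         (use g bound dominant(3) in auto)
    moreover have "wsym n G"
      using sym_sum_wsym[of n \<kappa>] g unfolding wsym_def G_def
      by (auto intro!: sum.cong)
    ultimately show ?thesis using eq by blast
  qed
qed

lemma antisymmetrize_divisible:
  assumes "laurent n (\<lambda>_. d + n) F"
  shows "\<exists>g. laurent n (\<lambda>_. d) g \<and> wsym n g \<and> (\<forall>z\<in>nzvecs n. antisymmetrize n F z = weyl_den n z * g z)"
  using assms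
proof (induction rule: laurent.induct)
  case (zero F)
  then show ?case
    by (intro exI[of _ "\<lambda>_. 0"]) (auto simp: laurent_const wsym_def antisymmetrize_def wsum_def sact_nzvecs)
next
  case (step F \<nu> G c)
  then obtain g where g: "laurent n (\<lambda>_. d) g" "wsym n g" "\<forall>z\<in>nzvecs n. antisymmetrize n F z = weyl_den n z * g z"
    by blast
  obtain h where h: "laurent n (\<lambda>_. d) h" "wsym n h" "\<forall>z\<in>nzvecs n. antisym_sum n \<nu> z = weyl_den n z * h z"
    using antisym_sum_divisible[of n \<nu> d] step.hyps(2) by blast
  have "laurent n (\<lambda>_. d) (\<lambda>z. g z + c * h z)" using g h by (intro laurent_add laurent_cmult)
  moreover have "wsym n (\<lambda>z. g z + c * h z)" using g h by (auto simp: wsym_def)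
  moreover have "\<forall>z\<in>nzvecs n. antisymmetrize n G z = weyl_den n z * (g z + c * h z)"
    using antisymmetrize_step[of n G F c \<nu>, OF step.hyps(3)] g h by (simp add: algebra_simps)
  ultimately show ?case by blast
qed

section \<open>Hall-Littlewood sums and the orthogonality weight\<close>

text \<open>\<open>Cb\<close> in the variables \<open>z j = cis (x j)\<close>. As a rational
  function with complex parameters it can be followed off the torus when the coordinates are
  scaled.\<close>

definition hl_c :: "nat \<Rightarrow> complex \<Rightarrow> complex \<Rightarrow> (nat \<Rightarrow> complex) \<Rightarrow> complex" where
  "hl_c n q q0 z = (\<Prod>j<n. (1 - q0 / z j) / (1 - 1 / (z j)\<^sup>2)) *
     (\<Prod>(j,k)\<in>idx_pairs n. ((1 - q * (z k / z j)) / (1 - z k / z j)) *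
        ((1 - q * (1 / (z j * z k))) / (1 - 1 / (z j * z k))))"

definition hl_sum :: "nat \<Rightarrow> complex \<Rightarrow> complex \<Rightarrow> (nat \<Rightarrow> int) \<Rightarrow> (nat \<Rightarrow> complex) \<Rightarrow> complex" where
  "hl_sum n q q0 \<nu> z = wsum n (\<lambda>\<sigma> \<epsilon>. hl_c n q q0 (sact n \<sigma> \<epsilon> z) * lmono n \<nu> (sact n \<sigma> \<epsilon> z))"

text \<open>The complement of the reflection hyperplanes: there the Weyl denominator is nonzero and
  no summand of \<open>hl_sum\<close> divides by zero.\<close>

definition regular :: "nat \<Rightarrow> (nat \<Rightarrow> complex) \<Rightarrow> bool" where
  "regular n z \<longleftrightarrow> (\<forall>j<n. z j \<noteq> 0 \<and> (z j)\<^sup>2 \<noteq> 1) \<and>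
     (\<forall>j<n. \<forall>k<n. j \<noteq> k \<longrightarrow> z j \<noteq> z k \<and> z j * z k \<noteq> 1)"

lemma regular_nzvecs: "regular n z \<Longrightarrow> z \<in> nzvecs n"
  by (auto simp: regular_def nzvecs_def)

lemma regular_sact:
  assumes s: "\<sigma> permutes {..<n}" and e: "\<epsilon> \<in> signs n" and z: "z \<in> nzvecs n"
  shows "regular n (sact n \<sigma> \<epsilon> z) \<longleftrightarrow> regular n z"
proof -
  have nz: "z (\<sigma> j) \<noteq> 0" if "j < n" for j
    using z permutes_lessThan_less[OF s that] by (simp add: nzvecs_def)
  have 1: "(sact n \<sigma> \<epsilon> z j)\<^sup>2 = 1 \<longleftrightarrow> (z (\<sigma> j))\<^sup>2 = 1" if "j < n" for j
    using signsD[OF e that] that by (auto simp: sact_apply power_inverse)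
  have 2: "sact n \<sigma> \<epsilon> z j \<noteq> sact n \<sigma> \<epsilon> z k \<and> sact n \<sigma> \<epsilon> z j * sact n \<sigma> \<epsilon> z k \<noteq> 1
     \<longleftrightarrow> z (\<sigma> j) \<noteq> z (\<sigma> k) \<and> z (\<sigma> j) * z (\<sigma> k) \<noteq> 1" if "j < n" "k < n" for j k
    using signsD[OF e that(1)] signsD[OF e that(2)] that nz[OF that(1)] nz[OF that(2)]
    by (auto simp: sact_apply field_simps)
  have all: "(\<forall>j<n. P (\<sigma> j)) \<longleftrightarrow> (\<forall>j<n. P j)" for P
    by (metis lessThan_iff permutes_in_image[OF s] permutes_inverses(1)[OF s])
  have "regular n (sact n \<sigma> \<epsilon> z) \<longleftrightarrow> (\<forall>j<n. (z (\<sigma> j))\<^sup>2 \<noteq> 1) \<and>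
     (\<forall>j<n. \<forall>k<n. \<sigma> j \<noteq> \<sigma> k \<longrightarrow> z (\<sigma> j) \<noteq> z (\<sigma> k) \<and> z (\<sigma> j) * z (\<sigma> k) \<noteq> 1)"
    unfolding regular_def using sact_nzvecs[OF s z, of \<epsilon>]
    by (simp add: 1 2 nzvecs_def permutes_eq_iff[OF s])
  also have "\<dots> \<longleftrightarrow> (\<forall>j<n. (z j)\<^sup>2 \<noteq> 1) \<and> (\<forall>j<n. \<forall>k<n. j \<noteq> k \<longrightarrow> z j \<noteq> z k \<and> z j * z k \<noteq> 1)"
  proof -
    have inner: "(\<forall>k<n. a \<noteq> \<sigma> k \<longrightarrow> z a \<noteq> z (\<sigma> k) \<and> z a * z (\<sigma> k) \<noteq> 1)
        \<longleftrightarrow> (\<forall>k<n. a \<noteq> k \<longrightarrow> z a \<noteq> z k \<and> z a * z k \<noteq> 1)" for a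
      by (rule all)
    show ?thesis
      by (simp only: all[of "\<lambda>a. (z a)\<^sup>2 \<noteq> 1"] all[of "\<lambda>a. \<forall>k<n. a \<noteq> k \<longrightarrow> z a \<noteq> z k \<and> z a * z k \<noteq> 1"] inner)
  qed
  finally show ?thesis using z by (auto simp: regular_def nzvecs_def)
qed

lemma weyl_den_nonzero:
  assumes "regular n z" shows "weyl_den n z \<noteq> 0"
proof -
  have A: "z j - inverse (z j) \<noteq> 0" if "j < n" for j
  proof
    assume "z j - inverse (z j) = 0"
    then have "z j * z j = 1" using assms that by (auto simp: regular_def field_simps)
    then show False using assms that by (auto simp: regular_def power2_eq_square)
  qed
  have B: "(z j + inverse (z j)) - (z k + inverse (z k)) \<noteq> 0" if "j < k" "k < n" for j k
  proof
    assume e: "(z j + inverse (z j)) - (z k + inverse (z k)) = 0"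
    have nz: "z j \<noteq> 0" "z k \<noteq> 0" using assms that by (auto simp: regular_def)
    from e have "(z j - z k) * (z j * z k - 1) = 0" using nz by (simp add: field_simps)
    then show False using assms that by (auto simp: regular_def)
  qed
  show ?thesis unfolding weyl_den_def using A B by (auto simp: prod_zero_iff)
qed

text \<open>\<open>hl_c\<close> times the Weyl denominator. A pair factor is
  \<open>z j * (1 - q * (z k / z j)) * (1 - q / (z j * z k))\<close> multiplied out; written with
  explicit coefficients it is an instance of \<open>laurent_coord_pair\<close>, and has degree one
  in both variables.\<close>

definition hl_numerator :: "nat \<Rightarrow> complex \<Rightarrow> complex \<Rightarrow> (nat \<Rightarrow> complex) \<Rightarrow> complex" where
  "hl_numerator n q q0 z = (\<Prod>j<n. z j - q0) *
     (\<Prod>(j,k)\<in>idx_pairs n. 1 * z j + q\<^sup>2 * inverse (z j) + ((- q) * z k + (- q) * inverse (z k)))"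

lemma laurent_hl_numerator: "laurent n (\<lambda>_. n) (hl_numerator n q q0)"
proof -
  have "laurent n (\<lambda>_. n) (\<lambda>z. (\<Prod>j<n. z j - q0) *
     (\<Prod>(j,k)\<in>idx_pairs n. 1 * z j + q\<^sup>2 * inverse (z j) + ((- q) * z k + (- q) * inverse (z k))))"
  proof (rule laurent_root_product)
    show "laurent n (\<lambda>i. if i = j then 1 else 0) (\<lambda>z. z j - q0)" if "j < n" for j
      using that by (intro laurent_diff laurent_coord laurent_const)
    show "laurent n (\<lambda>i. (if i = j then 1 else 0) + (if i = k then 1 else 0))
      (\<lambda>z. 1 * z j + q\<^sup>2 * inverse (z j) + ((- q) * z k + (- q) * inverse (z k)))" if "j < k" "k < n" for j k
      using that by (intro laurent_coord_pair) auto
  qed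
  then show ?thesis by (rule laurent_cong) (simp add: hl_numerator_def)
qed

lemma hl_c_weyl_den:
  assumes "regular n z" shows "hl_c n q q0 z * weyl_den n z = hl_numerator n q q0 z"
proof -
  have A: "(1 - q0 / x) / (1 - 1 / x\<^sup>2) * (x - inverse x) = x - q0" if "x \<noteq> 0" "x\<^sup>2 \<noteq> 1" for x :: complex
  proof -
    have "1 - 1 / x\<^sup>2 \<noteq> 0" using that by (simp add: field_simps)
    moreover have "x - inverse x = x * (1 - 1 / x\<^sup>2)" using that by (simp add: field_simps power2_eq_square)
    moreover have "a / u * (x * u) = a * x" if "u \<noteq> 0" for a u using that by simp
    ultimately have "(1 - q0 / x) / (1 - 1 / x\<^sup>2) * (x - inverse x) = (1 - q0 / x) * x" by metis
    then show ?thesis using that by (simp add: left_diff_distrib)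
  qed
  have B: "((1 - q * (y / x)) / (1 - y / x)) * ((1 - q * (1 / (x * y))) / (1 - 1 / (x * y))) *
      ((x + inverse x) - (y + inverse y)) = 1 * x + q\<^sup>2 * inverse x + ((- q) * y + (- q) * inverse y)"
    if "x \<noteq> 0" "y \<noteq> 0" "x \<noteq> y" "x * y \<noteq> 1" for x y :: complex
  proof -
    have nz: "1 - y / x \<noteq> 0" "1 - 1 / (x * y) \<noteq> 0" using that by (auto simp: field_simps)
    have "(x + inverse x) - (y + inverse y) = x * ((1 - y / x) * (1 - 1 / (x * y)))"
      using that by (simp add: field_simps)
    moreover have "a / u * (b / v) * (w * (u * v)) = w * (a * b)" if "u \<noteq> 0" "v \<noteq> 0" for a b u v w :: complex
      using that by simp
    ultimately have "((1 - q * (y / x)) / (1 - y / x)) * ((1 - q * (1 / (x * y))) / (1 - 1 / (x * y))) *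
      ((x + inverse x) - (y + inverse y)) = x * ((1 - q * (y / x)) * (1 - q * (1 / (x * y))))"
      using nz by presburger
    also have "\<dots> = 1 * x + q\<^sup>2 * inverse x + ((- q) * y + (- q) * inverse y)"
      using that by (simp add: field_simps power2_eq_square)
    finally show ?thesis .
  qed
  have P: "(\<Prod>j<n. (1 - q0 / z j) / (1 - 1 / (z j)\<^sup>2)) * (\<Prod>j<n. z j - inverse (z j)) = (\<Prod>j<n. z j - q0)"
    unfolding prod.distrib[symmetric] by (rule prod.cong[OF refl], rule A) (use assms in \<open>auto simp: regular_def\<close>)
  have R: "(\<Prod>(j,k)\<in>idx_pairs n. ((1 - q * (z k / z j)) / (1 - z k / z j)) * ((1 - q * (1 / (z j * z k))) / (1 - 1 / (z j * z k)))) *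
     (\<Prod>(j,k)\<in>idx_pairs n. (z j + inverse (z j)) - (z k + inverse (z k)))
    = (\<Prod>(j,k)\<in>idx_pairs n. 1 * z j + q\<^sup>2 * inverse (z j) + ((- q) * z k + (- q) * inverse (z k)))"
    unfolding prod.distrib[symmetric]
  proof (rule prod.cong[OF refl], clarify)
    fix j k assume "(j, k) \<in> idx_pairs n"
    then show "((1 - q * (z k / z j)) / (1 - z k / z j)) * ((1 - q * (1 / (z j * z k))) / (1 - 1 / (z j * z k))) *
       ((z j + inverse (z j)) - (z k + inverse (z k)))
      = 1 * z j + q\<^sup>2 * inverse (z j) + ((- q) * z k + (- q) * inverse (z k))"
      by (intro B) (use assms in \<open>auto simp: regular_def\<close>)
  qed
  show ?thesis unfolding hl_c_def weyl_den_def hl_numerator_def P[symmetric] R[symmetric] by (simp only: ac_simps)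
qed

text \<open>The summands have poles on the hyperplanes, but their sum times the Weyl denominator is
  an antisymmetrization and hence divisible by it. The numerator raises the degree by
  \<open>n\<close> and the division lowers it by \<open>n\<close>, so the bound on
  \<open>\<nu>\<close> survives. Agreement with \<open>hl_sum\<close> is claimed at regular points
  only, since elsewhere the summands contain division by zero.\<close>

lemma hl_polynomial:
  assumes "\<And>j. j < n \<Longrightarrow> \<bar>\<nu> j\<bar> \<le> int d"
  obtains p where "laurent n (\<lambda>_. d) p" "wsym n p" "\<And>z. regular n z \<Longrightarrow> p z = hl_sum n q q0 \<nu> z"
proof -
  let ?F = "\<lambda>z. hl_numerator n q q0 z * lmono n \<nu> z"
  have "laurent n (\<lambda>_. n + d) ?F"
    using laurent_mult[OF laurent_hl_numerator laurent_lmono[of n \<nu> "\<lambda>_. d" 1]] assms by simp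
  then obtain p where p: "laurent n (\<lambda>_. d) p" "wsym n p"
      "\<forall>z\<in>nzvecs n. antisymmetrize n ?F z = weyl_den n z * p z"
    using antisymmetrize_divisible[of n d ?F] by (auto simp: add.commute)
  have "p z = hl_sum n q q0 \<nu> z" if z: "regular n z" for z
  proof -
    have "antisymmetrize n ?F z = weyl_den n z * hl_sum n q q0 \<nu> z"
      unfolding antisymmetrize_def hl_sum_def wsum_cmult[symmetric]
    proof (rule wsum_cong)
      fix \<sigma> \<epsilon> assume s: "\<sigma> permutes {..<n}" and e: "\<epsilon> \<in> signs n"
      let ?y = "sact n \<sigma> \<epsilon> z" and ?s = "of_int (sign \<sigma>) :: complex" and ?e = "of_int (\<Prod>j<n. \<epsilon> j) :: complex"
      have "regular n ?y" using regular_sact[OF s e regular_nzvecs[OF z]] z by simp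
      then have "hl_numerator n q q0 ?y = hl_c n q q0 ?y * (?s * ?e * weyl_den n z)"
        by (simp only: hl_c_weyl_den[symmetric] weyl_den_sact[OF s e])
      then have "?s * ?e * (hl_numerator n q q0 ?y * lmono n \<nu> ?y)
        = (?s * ?s) * (?e * ?e) * (weyl_den n z * (hl_c n q q0 ?y * lmono n \<nu> ?y))"
        by (simp only: ac_simps)
      then show "?s * ?e * (hl_numerator n q q0 ?y * lmono n \<nu> ?y)
        = weyl_den n z * (hl_c n q q0 ?y * lmono n \<nu> ?y)"
        by (simp only: signs_prod_square[OF e] of_int_sign_square) simp
    qed
    then show ?thesis using p(3) regular_nzvecs[OF z] weyl_den_nonzero[OF z] by auto
  qed
  then show thesis using that p by blast
qed

text \<open>The reciprocal of \<open>hl_c\<close> at the inverted point: the half of the weight that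
  has no poles as long as the moduli of the coordinates increase with the index and do not exceed
  1.\<close>

definition hl_r :: "nat \<Rightarrow> complex \<Rightarrow> complex \<Rightarrow> (nat \<Rightarrow> complex) \<Rightarrow> complex" where
  "hl_r n q q0 z = (\<Prod>j<n. (1 - (z j)\<^sup>2) / (1 - q0 * z j)) *
     (\<Prod>(j,k)\<in>idx_pairs n. ((1 - z j / z k) / (1 - q * (z j / z k))) * ((1 - z j * z k) / (1 - q * (z j * z k))))"

definition delta_short :: "complex \<Rightarrow> complex \<Rightarrow> complex" where
  "delta_short q0 x = (1 - x\<^sup>2) * (1 - (inverse x)\<^sup>2) / ((1 - q0 * x) * (1 - q0 * inverse x))"

definition delta_root :: "complex \<Rightarrow> complex \<Rightarrow> complex" where
  "delta_root q x = (1 - x) * (1 - inverse x) / ((1 - q * x) * (1 - q * inverse x))"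

text \<open>With the two factors as parameters, the trivial weight and the Hall-Littlewood weight
  pass through one and the same vanishing argument.\<close>

definition root_product :: "nat \<Rightarrow> (complex \<Rightarrow> complex) \<Rightarrow> (complex \<Rightarrow> complex) \<Rightarrow> (nat \<Rightarrow> complex) \<Rightarrow> complex" where
  "root_product n \<alpha> \<beta> z = (\<Prod>j<n. \<alpha> (z j)) * (\<Prod>(j,k)\<in>idx_pairs n. \<beta> (z j * z k) * \<beta> (z j / z k))"

definition hl_delta :: "nat \<Rightarrow> complex \<Rightarrow> complex \<Rightarrow> (nat \<Rightarrow> complex) \<Rightarrow> complex" where
  "hl_delta n q q0 = root_product n (delta_short q0) (delta_root q)"

lemma delta_short_inverse: "delta_short q0 (inverse x) = delta_short q0 x"
  by (simp add: delta_short_def mult.commute)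

lemma delta_root_inverse: "delta_root q (inverse x) = delta_root q x"
  by (simp add: delta_root_def mult.commute)

lemma root_product_wsym:
  assumes \<alpha>: "\<And>x. \<alpha> (inverse x) = \<alpha> x" and \<beta>: "\<And>x. \<beta> (inverse x) = \<beta> x"
  shows "wsym n (root_product n \<alpha> \<beta>)"
  unfolding wsym_def
proof (intro allI impI)
  fix \<sigma> \<epsilon> z assume s: "\<sigma> permutes {..<n}" and e: "\<epsilon> \<in> signs n"
  let ?y = "sact n \<sigma> \<epsilon> z"
  have b: "\<beta> (x / y) = \<beta> (y / x)" for x y using \<beta>[of "x / y"] by (simp add: field_simps)
  have b2: "\<beta> (1 / x) = \<beta> x" for x using \<beta>[of x] by (simp add: field_simps)
  have 1: "\<alpha> (?y j) = \<alpha> (z (\<sigma> j))" if "j < n" for j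
    using signsD[OF e that] that \<alpha> by (auto simp: sact_apply)
  have 2: "\<beta> (?y j * ?y k) * \<beta> (?y j / ?y k) = \<beta> (z (\<sigma> j) * z (\<sigma> k)) * \<beta> (z (\<sigma> j) / z (\<sigma> k))"
    if "j < n" "k < n" for j k
    using signsD[OF e that(1)] signsD[OF e that(2)] that \<beta>[of "z (\<sigma> j) * z (\<sigma> k)"] b[of "z (\<sigma> j)" "z (\<sigma> k)"]
      \<beta>[of "z (\<sigma> j) / z (\<sigma> k)"]
    by (auto simp: sact_apply divide_inverse mult.commute)
  have "(\<Prod>(j,k)\<in>idx_pairs n. \<beta> (?y j * ?y k) * \<beta> (?y j / ?y k))
     = (\<Prod>(j,k)\<in>idx_pairs n. \<beta> (z (\<sigma> j) * z (\<sigma> k)) * \<beta> (z (\<sigma> j) / z (\<sigma> k)))"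
    by (rule prod.cong) (auto simp: 2)
  also have "\<dots> = (\<Prod>(j,k)\<in>idx_pairs n. \<beta> (z j * z k) * \<beta> (z j / z k))"
    by (rule prod_idx_pairs_permute[OF s, of "\<lambda>j k. \<beta> (z j * z k) * \<beta> (z j / z k)"])
       (metis b mult.commute)
  finally show "root_product n \<alpha> \<beta> ?y = root_product n \<alpha> \<beta> z"
    using prod.permute[OF s, of "\<lambda>j. \<alpha> (z j)"] by (simp add: root_product_def 1 o_def)
qed

lemma hl_delta_wsym: "wsym n (hl_delta n q q0)"
  unfolding hl_delta_def by (intro root_product_wsym delta_short_inverse delta_root_inverse)

lemma one_minus_mult_nonzero:
  fixes q x :: complex assumes "norm q < 1" "norm x \<le> 1" shows "1 - q * x \<noteq> 0"
proof
  assume "1 - q * x = 0"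
  then have "norm (q * x) = 1" by (metis eq_iff_diff_eq_0 norm_one)
  moreover have "norm (q * x) \<le> norm q * 1" unfolding norm_mult using assms by (intro mult_left_mono) auto
  ultimately show False using assms by simp
qed

lemma hl_delta_nonregular:
  assumes "z \<in> nzvecs n" "\<not> regular n z" shows "hl_delta n q q0 z = 0"
proof -
  have "(\<exists>j<n. (z j)\<^sup>2 = 1) \<or> (\<exists>j<n. \<exists>k<n. j \<noteq> k \<and> (z j = z k \<or> z j * z k = 1))"
    using assms by (auto simp: regular_def nzvecs_def)
  then consider j where "j < n" "(z j)\<^sup>2 = 1" | j k where "j < k" "k < n" "z j = z k \<or> z j * z k = 1"
    by (metis nat_neq_iff mult.commute)
  then show ?thesis
  proof cases
    case 1
    then have "delta_short q0 (z j) = 0" by (simp add: delta_short_def)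
    then show ?thesis using 1 by (auto simp: hl_delta_def root_product_def prod_zero_iff)
  next
    case 2
    then have "delta_root q (z j * z k) * delta_root q (z j / z k) = 0"
      using assms by (auto simp: delta_root_def nzvecs_def)
    then have "\<exists>x\<in>idx_pairs n. (case x of (j,k) \<Rightarrow> delta_root q (z j * z k) * delta_root q (z j / z k)) = 0"
      using 2 by (intro bexI[of _ "(j,k)"]) auto
    then have "(\<Prod>(j,k)\<in>idx_pairs n. delta_root q (z j * z k) * delta_root q (z j / z k)) = 0"
      by (simp add: prod_zero_iff)
    then show ?thesis by (simp add: hl_delta_def root_product_def)
  qed
qed

lemma hl_r_nonregular:
  assumes "z \<in> nzvecs n" "\<not> regular n z" shows "hl_r n q q0 z = 0"
proof -
  have "(\<exists>j<n. (z j)\<^sup>2 = 1) \<or> (\<exists>j<n. \<exists>k<n. j \<noteq> k \<and> (z j = z k \<or> z j * z k = 1))"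
    using assms by (auto simp: regular_def nzvecs_def)
  then consider j where "j < n" "(z j)\<^sup>2 = 1" | j k where "j < k" "k < n" "z j = z k \<or> z j * z k = 1"
    by (metis nat_neq_iff mult.commute)
  then show ?thesis
  proof cases
    case 1
    then show ?thesis by (auto simp: hl_r_def prod_zero_iff)
  next
    case 2
    let ?f = "\<lambda>j k. ((1 - z j / z k) / (1 - q * (z j / z k))) * ((1 - z j * z k) / (1 - q * (z j * z k)))"
    have "?f j k = 0" using 2 assms by (auto simp: nzvecs_def)
    then have "\<exists>x\<in>idx_pairs n. (case x of (j,k) \<Rightarrow> ?f j k) = 0"
      using 2 by (intro bexI[of _ "(j,k)"]) auto
    then have "(\<Prod>(j,k)\<in>idx_pairs n. ?f j k) = 0"
      by (simp add: prod_zero_iff)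
    then show ?thesis by (simp add: hl_r_def)
  qed
qed

definition torus :: "nat \<Rightarrow> (nat \<Rightarrow> complex) set" where
  "torus n = ({..<n} \<rightarrow>\<^sub>E sphere 0 1)"

lemma torusD: "z \<in> torus n \<Longrightarrow> j < n \<Longrightarrow> norm (z j) = 1"
  unfolding torus_def by (drule PiE_mem[where x = j]) simp_all

lemma torus_nzvecs: "z \<in> torus n \<Longrightarrow> z \<in> nzvecs n"
  using torusD by (force simp: nzvecs_def)

lemma sact_torus: "\<sigma> permutes {..<n} \<Longrightarrow> z \<in> torus n \<Longrightarrow> sact n \<sigma> \<epsilon> z \<in> torus n"
proof -
  assume s: "\<sigma> permutes {..<n}" and z: "z \<in> torus n"
  have "norm (z (\<sigma> j)) = 1" if "j < n" for j
    using torusD[OF z permutes_lessThan_less[OF s that]] .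
  then show ?thesis by (auto simp: torus_def sact_def norm_power_int)
qed

lemma hl_c_delta:
  assumes z: "z \<in> torus n" and reg: "regular n z" and q: "norm q < 1" "norm q0 < 1"
  shows "hl_c n q q0 z * hl_delta n q q0 z = hl_r n q q0 z"
proof -
  have A: "(1 - q0 / x) / (1 - 1 / x\<^sup>2) * delta_short q0 x = (1 - x\<^sup>2) / (1 - q0 * x)"
    if "norm x = 1" "x\<^sup>2 \<noteq> 1" for x
  proof -
    have x0: "x \<noteq> 0" using that by auto
    have "1 - q0 * inverse x \<noteq> 0" "1 - q0 * x \<noteq> 0"
      by (rule one_minus_mult_nonzero[OF q(2)], simp add: that norm_inverse)+
    moreover have "1 - (inverse x)\<^sup>2 \<noteq> 0" using that x0 by (simp add: field_simps)
    moreover have "1 - q0 / x = 1 - q0 * inverse x" "1 - 1 / x\<^sup>2 = 1 - (inverse x)\<^sup>2"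
      by (simp_all add: divide_inverse power_inverse)
    moreover have "u / v * (w * v / (r * u)) = w / r" if "u \<noteq> 0" "v \<noteq> 0" for u v w r :: complex using that by simp
    ultimately show ?thesis unfolding delta_short_def by presburger
  qed
  have B: "(1 - q * (1 / x)) / (1 - 1 / x) * delta_root q x = (1 - x) / (1 - q * x)"
    if "norm x = 1" "x \<noteq> 1" for x
  proof -
    have x0: "x \<noteq> 0" using that by auto
    have "1 - q * inverse x \<noteq> 0" "1 - q * x \<noteq> 0"
      by (rule one_minus_mult_nonzero[OF q(1)], simp add: that norm_inverse)+
    moreover have "1 - inverse x \<noteq> 0" using that x0 by (simp add: field_simps)
    moreover have "1 - q * (1 / x) = 1 - q * inverse x" "1 - 1 / x = 1 - inverse x"
      by (simp_all add: divide_inverse)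
    moreover have "u / v * (w * v / (r * u)) = w / r" if "u \<noteq> 0" "v \<noteq> 0" for u v w r :: complex using that by simp
    ultimately show ?thesis unfolding delta_root_def by presburger
  qed
  have P: "(\<Prod>j<n. (1 - q0 / z j) / (1 - 1 / (z j)\<^sup>2)) * (\<Prod>j<n. delta_short q0 (z j)) = (\<Prod>j<n. (1 - (z j)\<^sup>2) / (1 - q0 * z j))"
    unfolding prod.distrib[symmetric]
    by (rule prod.cong[OF refl], rule A) (use reg torusD[OF z] in \<open>auto simp: regular_def\<close>)
  have R: "(\<Prod>(j,k)\<in>idx_pairs n. ((1 - q * (z k / z j)) / (1 - z k / z j)) * ((1 - q * (1 / (z j * z k))) / (1 - 1 / (z j * z k)))) *
     (\<Prod>(j,k)\<in>idx_pairs n. delta_root q (z j * z k) * delta_root q (z j / z k))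
    = (\<Prod>(j,k)\<in>idx_pairs n. ((1 - z j / z k) / (1 - q * (z j / z k))) * ((1 - z j * z k) / (1 - q * (z j * z k))))"
    unfolding prod.distrib[symmetric]
  proof (rule prod.cong[OF refl], clarify)
    fix j k assume jk: "(j, k) \<in> idx_pairs n"
    have n1: "norm (z j * z k) = 1" "norm (z j / z k) = 1"
      using jk torusD[OF z, of j] torusD[OF z, of k] by (auto simp: norm_mult norm_divide)
    have n2: "z j * z k \<noteq> 1" "z j / z k \<noteq> 1"
      using jk reg by (auto simp: regular_def)
    have "z k / z j = 1 / (z j / z k)" by simp
    show "((1 - q * (z k / z j)) / (1 - z k / z j)) * ((1 - q * (1 / (z j * z k))) / (1 - 1 / (z j * z k))) *
       (delta_root q (z j * z k) * delta_root q (z j / z k))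
      = ((1 - z j / z k) / (1 - q * (z j / z k))) * ((1 - z j * z k) / (1 - q * (z j * z k)))"
      unfolding \<open>z k / z j = 1 / (z j / z k)\<close> B[OF n1(1) n2(1), symmetric] B[OF n1(2) n2(2), symmetric]
      by (simp only: ac_simps)
  qed
  show ?thesis unfolding hl_c_def hl_delta_def root_product_def hl_r_def P[symmetric] R[symmetric] by (simp only: ac_simps)
qed

text \<open>On the torus conjugation inverts the coordinates, and the parameters are real, so
  \<open>cnj (hl_c n q q0 z)\<close> is the reciprocal of \<open>hl_r n q q0 z\<close>; the latter
  is \<open>hl_c\<close> times the weight.\<close>

lemma hl_delta_norm:
  fixes q q0 :: real
  assumes z: "z \<in> torus n" and reg: "regular n z" and q: "\<bar>q\<bar> < 1" "\<bar>q0\<bar> < 1"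
  shows "hl_delta n q q0 z = complex_of_real (1 / (cmod (hl_c n q q0 z))\<^sup>2)"
proof -
  have cnj1: "cnj x = inverse x" if "norm x = 1" for x
  proof -
    have "x * cnj x = 1" using complex_norm_square[of x] that by simp
    from inverse_unique[OF this] show ?thesis by simp
  qed
  have A: "cnj ((1 - q0 / x) / (1 - 1 / x\<^sup>2)) * ((1 - x\<^sup>2) / (1 - q0 * x)) = 1"
    if "norm x = 1" "x\<^sup>2 \<noteq> 1" for x :: complex
  proof -
    have "1 - of_real q0 * x \<noteq> 0" using that q by (intro one_minus_mult_nonzero) auto
    moreover have "cnj ((1 - q0 / x) / (1 - 1 / x\<^sup>2)) = (1 - of_real q0 * x) / (1 - x\<^sup>2)"
      using that by (simp add: cnj1 divide_inverse power_inverse)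
    moreover have "1 - x\<^sup>2 \<noteq> 0" using that by simp
    ultimately show ?thesis by simp
  qed
  have B: "cnj ((1 - q * (1 / x)) / (1 - 1 / x)) * ((1 - x) / (1 - q * x)) = 1"
    if "norm x = 1" "x \<noteq> 1" for x :: complex
  proof -
    have "1 - of_real q * x \<noteq> 0" using that q by (intro one_minus_mult_nonzero) auto
    moreover have "cnj ((1 - q * (1 / x)) / (1 - 1 / x)) = (1 - of_real q * x) / (1 - x)"
      using that by (simp add: cnj1 divide_inverse)
    moreover have "1 - x \<noteq> 0" using that by simp
    ultimately show ?thesis by simp
  qed
  have P: "cnj (\<Prod>j<n. (1 - q0 / z j) / (1 - 1 / (z j)\<^sup>2)) * (\<Prod>j<n. (1 - (z j)\<^sup>2) / (1 - q0 * z j)) = 1"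
    unfolding cnj_prod prod.distrib[symmetric]
    by (rule prod.neutral, rule ballI, rule A) (use reg torusD[OF z] in \<open>auto simp: regular_def\<close>)
  have R: "cnj (\<Prod>(j,k)\<in>idx_pairs n. ((1 - q * (z k / z j)) / (1 - z k / z j)) * ((1 - q * (1 / (z j * z k))) / (1 - 1 / (z j * z k)))) *
     (\<Prod>(j,k)\<in>idx_pairs n. ((1 - z j / z k) / (1 - q * (z j / z k))) * ((1 - z j * z k) / (1 - q * (z j * z k)))) = 1"
    unfolding cnj_prod prod.distrib[symmetric]
  proof (rule prod.neutral, clarify)
    fix j k assume jk: "(j, k) \<in> idx_pairs n"
    have n1: "norm (z j * z k) = 1" "norm (z j / z k) = 1"
      using jk torusD[OF z, of j] torusD[OF z, of k] by (auto simp: norm_mult norm_divide)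
    have n2: "z j * z k \<noteq> 1" "z j / z k \<noteq> 1"
      using jk reg by (auto simp: regular_def)
    have i: "z k / z j = 1 / (z j / z k)" by simp
    show "cnj (((1 - q * (z k / z j)) / (1 - z k / z j)) * ((1 - q * (1 / (z j * z k))) / (1 - 1 / (z j * z k)))) *
      (((1 - z j / z k) / (1 - q * (z j / z k))) * ((1 - z j * z k) / (1 - q * (z j * z k)))) = 1"
      using arg_cong2[where f = "(*)", OF B[OF n1(1) n2(1)] B[OF n1(2) n2(2)]] unfolding i complex_cnj_mult
      by (simp only: ac_simps mult_1_left)
  qed
  have "cnj (hl_c n q q0 z) * hl_r n q q0 z
    = (cnj (\<Prod>j<n. (1 - q0 / z j) / (1 - 1 / (z j)\<^sup>2)) * (\<Prod>j<n. (1 - (z j)\<^sup>2) / (1 - q0 * z j))) *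
     (cnj (\<Prod>(j,k)\<in>idx_pairs n. ((1 - q * (z k / z j)) / (1 - z k / z j)) * ((1 - q * (1 / (z j * z k))) / (1 - 1 / (z j * z k)))) *
     (\<Prod>(j,k)\<in>idx_pairs n. ((1 - z j / z k) / (1 - q * (z j / z k))) * ((1 - z j * z k) / (1 - q * (z j * z k)))))"
    unfolding hl_c_def hl_r_def complex_cnj_mult by (simp only: ac_simps)
  then have "cnj (hl_c n q q0 z) * hl_r n q q0 z = 1" unfolding P R by simp
  moreover have "hl_c n q q0 z * hl_delta n q q0 z = hl_r n q q0 z"
    using q by (intro hl_c_delta[OF z reg]) auto
  ultimately have "hl_c n q q0 z * cnj (hl_c n q q0 z) * hl_delta n q q0 z = 1"
    by (metis mult.assoc mult.commute)
  then have "complex_of_real ((cmod (hl_c n q q0 z))\<^sup>2) * hl_delta n q q0 z = 1"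
    by (simp only: complex_norm_square)
  from inverse_unique[OF this] show ?thesis by (simp add: divide_inverse)
qed

text \<open>The invariant weight can be moved into each summand, where it turns \<open>hl_c\<close>
  into \<open>hl_r\<close>, which is free of poles on the torus. At nonregular points both sides
  vanish, so the identity holds everywhere although \<open>p\<close> is controlled only at regular
  points.\<close>

lemma hl_sum_delta:
  assumes z: "z \<in> torus n" and q: "norm q < 1" "norm q0 < 1"
    and p: "\<And>z. regular n z \<Longrightarrow> p z = hl_sum n q q0 \<nu> z"
  shows "p z * hl_delta n q q0 z = wsum n (\<lambda>\<sigma> \<epsilon>. lmono n \<nu> (sact n \<sigma> \<epsilon> z) * hl_r n q q0 (sact n \<sigma> \<epsilon> z))"
proof (cases "regular n z")
  case True
  have "p z * hl_delta n q q0 z = wsum n (\<lambda>\<sigma> \<epsilon>. hl_delta n q q0 z *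
      (hl_c n q q0 (sact n \<sigma> \<epsilon> z) * lmono n \<nu> (sact n \<sigma> \<epsilon> z)))"
    using p[OF True] by (simp add: hl_sum_def wsum_cmult mult.commute)
  also have "\<dots> = wsum n (\<lambda>\<sigma> \<epsilon>. lmono n \<nu> (sact n \<sigma> \<epsilon> z) * hl_r n q q0 (sact n \<sigma> \<epsilon> z))"
  proof (rule wsum_cong)
    fix \<sigma> \<epsilon> assume s: "\<sigma> permutes {..<n}" and e: "\<epsilon> \<in> signs n"
    have d: "hl_delta n q q0 z = hl_delta n q q0 (sact n \<sigma> \<epsilon> z)"
      using hl_delta_wsym[of n q q0] s e torus_nzvecs[OF z] by (simp add: wsym_def)
    have "regular n (sact n \<sigma> \<epsilon> z)" using regular_sact[OF s e torus_nzvecs[OF z]] True by simp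
    from hl_c_delta[OF sact_torus[OF s z] this q]
    show "hl_delta n q q0 z * (hl_c n q q0 (sact n \<sigma> \<epsilon> z) * lmono n \<nu> (sact n \<sigma> \<epsilon> z))
      = lmono n \<nu> (sact n \<sigma> \<epsilon> z) * hl_r n q q0 (sact n \<sigma> \<epsilon> z)"
      unfolding d by (metis mult.assoc mult.commute)
  qed
  finally show ?thesis .
next
  case False
  have "wsum n (\<lambda>\<sigma> \<epsilon>. lmono n \<nu> (sact n \<sigma> \<epsilon> z) * hl_r n q q0 (sact n \<sigma> \<epsilon> z)) = wsum n (\<lambda>\<sigma> \<epsilon>. 0)"
  proof (rule wsum_cong)
    fix \<sigma> \<epsilon> assume s: "\<sigma> permutes {..<n}" and e: "\<epsilon> \<in> signs n"
    have "\<not> regular n (sact n \<sigma> \<epsilon> z)" using regular_sact[OF s e torus_nzvecs[OF z]] False by simp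
    then show "lmono n \<nu> (sact n \<sigma> \<epsilon> z) * hl_r n q q0 (sact n \<sigma> \<epsilon> z) = 0"
      using hl_r_nonregular sact_nzvecs[OF s torus_nzvecs[OF z]] by simp
  qed
  then show ?thesis using hl_delta_nonregular[OF torus_nzvecs[OF z] False] by (simp add: wsum_def)
qed

section \<open>Leading coefficients by scaling\<close>

text \<open>A one-parameter subgroup of the complex torus. For unimodular \<open>t\<close> it
  preserves the torus measure, and letting \<open>t\<close> tend to 0 extracts leading
  terms.\<close>

definition tscale :: "nat \<Rightarrow> (nat \<Rightarrow> int) \<Rightarrow> complex \<Rightarrow> (nat \<Rightarrow> complex) \<Rightarrow> nat \<Rightarrow> complex" where
  "tscale n \<theta> t z = (\<lambda>j\<in>{..<n}. t powi \<theta> j * z j)"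

lemma prod_power_int_sum:
  fixes t :: complex assumes "t \<noteq> 0"
  shows "(\<Prod>i\<in>A. t powi f i) = t powi (\<Sum>i\<in>A. f i)"
  by (induction A rule: infinite_finite_induct) (auto simp: power_int_add assms)

lemma tendsto_powi_zero:
  assumes "e > 0" shows "((\<lambda>t::complex. t powi e) \<longlongrightarrow> 0) (at 0)"
proof -
  have "((\<lambda>t::complex. t ^ nat e) \<longlongrightarrow> 0 ^ nat e) (at 0)" by (intro tendsto_intros)
  then show ?thesis using assms by (simp add: power_int_def power_0_left)
qed

lemma tendsto_root_factor:
  fixes u q :: complex assumes u: "u \<noteq> 0" and e: "e \<noteq> 0"
  shows "((\<lambda>t. (1 - q * (u * t powi e)) / (1 - u * t powi e)) \<longlongrightarrow> (if e > 0 then 1 else q)) (at 0)"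
proof (cases "e > 0")
  case True
  have "((\<lambda>t. (1 - q * (u * t powi e)) / (1 - u * t powi e)) \<longlongrightarrow> (1 - q * (u * 0)) / (1 - u * 0)) (at 0)"
    by (intro tendsto_intros tendsto_powi_zero True) simp
  then show ?thesis using True by simp
next
  case False
  then have e': "- e > 0" using e by simp
  \<comment> \<open>For a negative exponent \<open>u * t powi e\<close> diverges; numerator and
    denominator are divided by it.\<close>
  have "((\<lambda>t. (t powi (- e) / u - q) / (t powi (- e) / u - 1)) \<longlongrightarrow> (0 / u - q) / (0 / u - 1)) (at 0)"
    by (intro tendsto_intros tendsto_powi_zero e') (use u in simp_all)
  then have "((\<lambda>t. (t powi (- e) / u - q) / (t powi (- e) / u - 1)) \<longlongrightarrow> q) (at 0)" by simp
  moreover have "(1 - q * (u * t powi e)) / (1 - u * t powi e) = (t powi (- e) / u - q) / (t powi (- e) / u - 1)"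
    if "t \<noteq> 0" for t
  proof -
    define w where "w = u * t powi e"
    have w: "w \<noteq> 0" using u that by (simp add: w_def)
    have "t powi (- e) / u = 1 / w" by (simp add: w_def power_int_minus field_simps)
    moreover have "(1 - q * w) / (1 - w) = (1 / w - q) / (1 / w - 1)"
    proof -
      have "1 / w - q = (1 - q * w) / w" "1 / w - 1 = (1 - w) / w" using w by (simp_all add: field_simps)
      then show ?thesis using w by simp
    qed
    ultimately show ?thesis by (simp add: w_def)
  qed
  then have "eventually (\<lambda>t. (t powi (- e) / u - q) / (t powi (- e) / u - 1)
      = (1 - q * (u * t powi e)) / (1 - u * t powi e)) (at 0)"
    unfolding eventually_at_filter by (intro always_eventually) auto
  ultimately show ?thesis using False by (auto elim: Lim_transform_eventually)
qed

lemma tendsto_short_factor: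
  fixes u q0 :: complex assumes u: "u \<noteq> 0" and r: "r > 0" and e: "e = 1 \<or> e = -1"
  shows "((\<lambda>t. (1 - q0 / (t powi r * u) powi e) / (1 - 1 / ((t powi r * u) powi e)\<^sup>2))
    \<longlongrightarrow> (if e = -1 then 1 else 0)) (at 0)"
proof -
  have x: "((\<lambda>t. t powi r * u) \<longlongrightarrow> 0) (at 0)"
    using tendsto_mult[OF tendsto_powi_zero[OF r] tendsto_const[of u]] by simp
  show ?thesis
  proof (cases "e = -1")
    case True
    have "((\<lambda>t. (1 - q0 * (t powi r * u)) / (1 - (t powi r * u)\<^sup>2)) \<longlongrightarrow> (1 - q0 * 0) / (1 - 0\<^sup>2)) (at 0)"
      by (intro tendsto_intros x) simp
    then show ?thesis using True by (simp add: field_simps)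
  next
    case False
    then have e1: "e = 1" using e by simp
    have "((\<lambda>t. (t powi r * u) * (t powi r * u - q0) / ((t powi r * u)\<^sup>2 - 1)) \<longlongrightarrow> 0 * (0 - q0) / (0\<^sup>2 - 1)) (at 0)"
      by (intro tendsto_intros x) simp
    moreover have "(1 - q0 / x) / (1 - 1 / x\<^sup>2) = x * (x - q0) / (x\<^sup>2 - 1)" if "x \<noteq> 0" for x
    proof -
      have "1 - q0 / x = x * (x - q0) / x\<^sup>2" "1 - 1 / x\<^sup>2 = (x\<^sup>2 - 1) / x\<^sup>2"
        using that by (simp_all add: field_simps power2_eq_square)
      then show ?thesis using that by simp
    qed
    then have "eventually (\<lambda>t. (t powi r * u) * (t powi r * u - q0) / ((t powi r * u)\<^sup>2 - 1)
      = (1 - q0 / (t powi r * u)) / (1 - 1 / (t powi r * u)\<^sup>2)) (at 0)"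
      unfolding eventually_at_filter using u by (intro always_eventually) auto
    ultimately show ?thesis using e1 by (auto elim: Lim_transform_eventually)
  qed
qed

lemma tendsto_powi_nonneg:
  fixes u :: complex assumes "E \<ge> 0"
  shows "((\<lambda>t. t powi E * u) \<longlongrightarrow> (if E = 0 then u else 0)) (at 0)"
proof (cases "E = 0")
  case False
  then show ?thesis using tendsto_mult[OF tendsto_powi_zero[of E] tendsto_const[of u]] assms by simp
qed simp

text \<open>Scaling by the staircase sends coordinate \<open>j\<close> to 0 at the rate
  \<open>n - j\<close>. The short factors kill every summand having a sign +1. For the remaining
  sign vector each pair contributes \<open>q\<close> if it is an inversion and 1 otherwise, and by
  the rearrangement inequality a positive power of \<open>t\<close> remains unless the permutation
  stabilizes \<open>\<nu>\<close>.\<close>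

lemma hl_sum_limit:
  fixes \<nu> :: "nat \<Rightarrow> int"
  assumes z: "z \<in> nzvecs n" and mono: "\<And>j k. j \<le> k \<Longrightarrow> k < n \<Longrightarrow> \<nu> k \<le> \<nu> j" and nonneg: "\<And>j. j < n \<Longrightarrow> 0 \<le> \<nu> j"
  shows "((\<lambda>t. t powi (\<Sum>j<n. int (n - j) * \<nu> j) * hl_sum n q q0 \<nu> (tscale n (\<lambda>j. int (n - j)) t z))
     \<longlongrightarrow> (\<Sum>\<sigma>\<in>{\<sigma>. \<sigma> permutes {..<n} \<and> (\<forall>j<n. \<nu> (\<sigma> j) = \<nu> j)}. inv_weight n q \<sigma>) * lmono n (\<lambda>j. - \<nu> j) z) (at 0)"
proof -
  let ?\<rho> = "\<lambda>j. int (n - j)"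
  let ?P = "{\<sigma>. \<sigma> permutes {..<n}}"
  define \<Phi> where "\<Phi> = (\<Sum>j<n. ?\<rho> j * \<nu> j)"
  \<comment> \<open>The exponent of \<open>t\<close> in the monomial of a summand, after the shift
    by \<open>\<Phi>\<close>; \<open>e1\<close> and \<open>e2\<close> below are the exponents of
    \<open>t\<close> in the quotient and in the inverse product attached to a pair.\<close>
  define E where "E \<sigma> \<epsilon> = \<Phi> + (\<Sum>j<n. \<epsilon> j * \<nu> j * ?\<rho> (\<sigma> j))" for \<sigma> :: "nat \<Rightarrow> nat" and \<epsilon> :: "nat \<Rightarrow> int"
  define e1 where "e1 \<sigma> \<epsilon> j k = \<epsilon> k * ?\<rho> (\<sigma> k) - \<epsilon> j * ?\<rho> (\<sigma> j)" for \<sigma> :: "nat \<Rightarrow> nat" and \<epsilon> :: "nat \<Rightarrow> int" and j k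
  define e2 where "e2 \<sigma> \<epsilon> j k = - (\<epsilon> j * ?\<rho> (\<sigma> j) + \<epsilon> k * ?\<rho> (\<sigma> k))" for \<sigma> :: "nat \<Rightarrow> nat" and \<epsilon> :: "nat \<Rightarrow> int" and j k
  define U where "U \<sigma> \<epsilon> = (\<Prod>j<n. z (\<sigma> j) powi (\<epsilon> j * \<nu> j))" for \<sigma> :: "nat \<Rightarrow> nat" and \<epsilon> :: "nat \<Rightarrow> int"
  define L where "L \<sigma> \<epsilon> = (\<Prod>j<n. if \<epsilon> j = -1 then 1 else 0) *
     (\<Prod>(j,k)\<in>idx_pairs n. (if e1 \<sigma> \<epsilon> j k > 0 then 1 else q) * (if e2 \<sigma> \<epsilon> j k > 0 then 1 else q)) *
     (if E \<sigma> \<epsilon> = 0 then U \<sigma> \<epsilon> else 0)" for \<sigma> :: "nat \<Rightarrow> nat" and \<epsilon> :: "nat \<Rightarrow> int"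
  have sum_le: "(\<Sum>j<n. \<nu> j * ?\<rho> (\<sigma> j)) \<le> \<Phi>"
    and sum_eq: "(\<Sum>j<n. \<nu> j * ?\<rho> (\<sigma> j)) = \<Phi> \<longleftrightarrow> (\<forall>j<n. \<nu> (\<sigma> j) = \<nu> j)" if s: "\<sigma> permutes {..<n}" for \<sigma>
  proof -
    have i: "inv \<sigma> permutes {..<n}" using s by (rule permutes_inv)
    have e: "(\<Sum>j<n. \<nu> j * ?\<rho> (\<sigma> j)) = (\<Sum>j<n. ?\<rho> j * \<nu> (inv \<sigma> j))"
      using sum.permute[OF s, of "\<lambda>j. ?\<rho> j * \<nu> (inv \<sigma> j)"] by (simp add: o_def permutes_inverses[OF s] mult.commute)
    show "(\<Sum>j<n. \<nu> j * ?\<rho> (\<sigma> j)) \<le> \<Phi>"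
      unfolding e \<Phi>_def by (rule rearrangement_rho(1)[OF i mono])
    show "(\<Sum>j<n. \<nu> j * ?\<rho> (\<sigma> j)) = \<Phi> \<longleftrightarrow> (\<forall>j<n. \<nu> (\<sigma> j) = \<nu> j)"
    proof
      assume "(\<Sum>j<n. \<nu> j * ?\<rho> (\<sigma> j)) = \<Phi>"
      then have "(\<Sum>j<n. ?\<rho> j * \<nu> (inv \<sigma> j)) = (\<Sum>j<n. ?\<rho> j * \<nu> j)" unfolding e \<Phi>_def .
      then have *: "\<nu> (inv \<sigma> j) = \<nu> j" if "j < n" for j using rearrangement_rho(2)[where \<kappa> = \<nu>, OF i mono] that by blast
      show "\<forall>j<n. \<nu> (\<sigma> j) = \<nu> j"
        using *[OF permutes_lessThan_less[OF s]] by (simp add: permutes_inverses[OF s])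
    next
      assume "\<forall>j<n. \<nu> (\<sigma> j) = \<nu> j"
      then have "(\<Sum>j<n. \<nu> j * ?\<rho> (\<sigma> j)) = (\<Sum>j<n. ?\<rho> (\<sigma> j) * \<nu> (\<sigma> j))"
        by (intro sum.cong) (auto simp: mult.commute)
      also have "\<dots> = \<Phi>" using sum.permute[OF s, of "\<lambda>j. ?\<rho> j * \<nu> j"] by (simp add: o_def \<Phi>_def)
      finally show "(\<Sum>j<n. \<nu> j * ?\<rho> (\<sigma> j)) = \<Phi>" .
    qed
  qed
  have term_lim: "((\<lambda>t. t powi \<Phi> * (hl_c n q q0 (sact n \<sigma> \<epsilon> (tscale n ?\<rho> t z)) * lmono n \<nu> (sact n \<sigma> \<epsilon> (tscale n ?\<rho> t z))))
      \<longlongrightarrow> L \<sigma> \<epsilon>) (at 0)" if s: "\<sigma> permutes {..<n}" and e: "\<epsilon> \<in> signs n" for \<sigma> \<epsilon>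
  proof -
    let ?y = "\<lambda>t. sact n \<sigma> \<epsilon> (tscale n ?\<rho> t z)"
    have sl: "\<sigma> j < n" if "j < n" for j using permutes_lessThan_less[OF s that] .
    have nz: "z (\<sigma> j) \<noteq> 0" if "j < n" for j using z sl[OF that] by (simp add: nzvecs_def)
    have y: "?y t j = (t powi ?\<rho> (\<sigma> j) * z (\<sigma> j)) powi \<epsilon> j" if "j < n" for t j
      using that sl by (simp add: sact_apply tscale_def)
    have y': "?y t j = t powi (\<epsilon> j * ?\<rho> (\<sigma> j)) * z (\<sigma> j) powi \<epsilon> j" if "j < n" for t j
      unfolding y[OF that] power_int_mult_distrib power_int_mult[symmetric] by (simp only: mult.commute)
    have A: "((\<lambda>t. \<Prod>j<n. (1 - q0 / ?y t j) / (1 - 1 / (?y t j)\<^sup>2)) \<longlongrightarrow> (\<Prod>j<n. if \<epsilon> j = -1 then 1 else 0)) (at 0)"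
    proof (rule tendsto_prod)
      fix j assume "j \<in> {..<n}"
      then have j: "j < n" by simp
      show "((\<lambda>t. (1 - q0 / ?y t j) / (1 - 1 / (?y t j)\<^sup>2)) \<longlongrightarrow> (if \<epsilon> j = -1 then 1 else 0)) (at 0)"
        unfolding y[OF j] by (rule tendsto_short_factor) (use nz[OF j] sl[OF j] signsD[OF e j] in auto)
    qed
    define u1 where "u1 j k = z (\<sigma> k) powi \<epsilon> k / z (\<sigma> j) powi \<epsilon> j" for j k
    define u2 where "u2 j k = 1 / (z (\<sigma> j) powi \<epsilon> j * z (\<sigma> k) powi \<epsilon> k)" for j k
    have B: "((\<lambda>t. \<Prod>(j,k)\<in>idx_pairs n. ((1 - q * (u1 j k * t powi e1 \<sigma> \<epsilon> j k)) / (1 - u1 j k * t powi e1 \<sigma> \<epsilon> j k)) *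
        ((1 - q * (u2 j k * t powi e2 \<sigma> \<epsilon> j k)) / (1 - u2 j k * t powi e2 \<sigma> \<epsilon> j k))) \<longlongrightarrow>
       (\<Prod>(j,k)\<in>idx_pairs n. (if e1 \<sigma> \<epsilon> j k > 0 then 1 else q) * (if e2 \<sigma> \<epsilon> j k > 0 then 1 else q))) (at 0)"
      unfolding case_prod_unfold
    proof (rule tendsto_prod)
      fix x assume "x \<in> idx_pairs n"
      then obtain j k where x: "x = (j,k)" "j < k" "k < n" by (cases x) auto
      have jn: "j < n" using x by simp
      have ne: "\<sigma> j \<noteq> \<sigma> k" using x permutes_eq_iff[OF s] by auto
      have "e1 \<sigma> \<epsilon> j k \<noteq> 0" "e2 \<sigma> \<epsilon> j k \<noteq> 0"
        using signsD[OF e jn] signsD[OF e x(3)] sl[OF jn] sl[OF x(3)] ne by (auto simp: e1_def e2_def)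
      moreover have "u1 j k \<noteq> 0" "u2 j k \<noteq> 0" using nz[OF jn] nz[OF x(3)] by (auto simp: u1_def u2_def)
      ultimately show "((\<lambda>t. ((1 - q * (u1 (fst x) (snd x) * t powi e1 \<sigma> \<epsilon> (fst x) (snd x))) / (1 - u1 (fst x) (snd x) * t powi e1 \<sigma> \<epsilon> (fst x) (snd x))) *
        ((1 - q * (u2 (fst x) (snd x) * t powi e2 \<sigma> \<epsilon> (fst x) (snd x))) / (1 - u2 (fst x) (snd x) * t powi e2 \<sigma> \<epsilon> (fst x) (snd x))))
        \<longlongrightarrow> (if e1 \<sigma> \<epsilon> (fst x) (snd x) > 0 then 1 else q) * (if e2 \<sigma> \<epsilon> (fst x) (snd x) > 0 then 1 else q)) (at 0)"
        unfolding x fst_conv snd_conv by (intro tendsto_mult tendsto_root_factor)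
    qed
    have "E \<sigma> \<epsilon> \<ge> 0"
    proof -
      have "- (\<Sum>j<n. \<nu> j * ?\<rho> (\<sigma> j)) \<le> (\<Sum>j<n. \<epsilon> j * \<nu> j * ?\<rho> (\<sigma> j))"
        unfolding sum_negf[symmetric]
      proof (rule sum_mono)
        fix j assume "j \<in> {..<n}"
        then show "- (\<nu> j * ?\<rho> (\<sigma> j)) \<le> \<epsilon> j * \<nu> j * ?\<rho> (\<sigma> j)"
          using signsD[OF e, of j] nonneg[of j] by auto
      qed
      then show ?thesis using sum_le[OF s] by (simp add: E_def)
    qed
    from tendsto_powi_nonneg[OF this, of "U \<sigma> \<epsilon>"]
    have lim: "((\<lambda>t. (\<Prod>j<n. (1 - q0 / ?y t j) / (1 - 1 / (?y t j)\<^sup>2)) *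
        (\<Prod>(j,k)\<in>idx_pairs n. ((1 - q * (u1 j k * t powi e1 \<sigma> \<epsilon> j k)) / (1 - u1 j k * t powi e1 \<sigma> \<epsilon> j k)) *
        ((1 - q * (u2 j k * t powi e2 \<sigma> \<epsilon> j k)) / (1 - u2 j k * t powi e2 \<sigma> \<epsilon> j k))) *
        (t powi E \<sigma> \<epsilon> * U \<sigma> \<epsilon>)) \<longlongrightarrow> L \<sigma> \<epsilon>) (at 0)"
      unfolding L_def by (intro tendsto_mult A B)
    have eq: "t powi \<Phi> * (hl_c n q q0 (?y t) * lmono n \<nu> (?y t)) =
      (\<Prod>j<n. (1 - q0 / ?y t j) / (1 - 1 / (?y t j)\<^sup>2)) *
        (\<Prod>(j,k)\<in>idx_pairs n. ((1 - q * (u1 j k * t powi e1 \<sigma> \<epsilon> j k)) / (1 - u1 j k * t powi e1 \<sigma> \<epsilon> j k)) *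
        ((1 - q * (u2 j k * t powi e2 \<sigma> \<epsilon> j k)) / (1 - u2 j k * t powi e2 \<sigma> \<epsilon> j k))) *
        (t powi E \<sigma> \<epsilon> * U \<sigma> \<epsilon>)" if t: "t \<noteq> 0" for t
    proof -
      have pairs: "?y t k / ?y t j = u1 j k * t powi e1 \<sigma> \<epsilon> j k" "1 / (?y t j * ?y t k) = u2 j k * t powi e2 \<sigma> \<epsilon> j k"
        if "j < n" "k < n" for j k
        using t by (simp_all add: y'[OF that(1)] y'[OF that(2)] u1_def u2_def e1_def e2_def power_int_diff power_int_minus power_int_add field_simps)
      have c: "hl_c n q q0 (?y t) = (\<Prod>j<n. (1 - q0 / ?y t j) / (1 - 1 / (?y t j)\<^sup>2)) *
        (\<Prod>(j,k)\<in>idx_pairs n. ((1 - q * (u1 j k * t powi e1 \<sigma> \<epsilon> j k)) / (1 - u1 j k * t powi e1 \<sigma> \<epsilon> j k)) *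
        ((1 - q * (u2 j k * t powi e2 \<sigma> \<epsilon> j k)) / (1 - u2 j k * t powi e2 \<sigma> \<epsilon> j k)))"
        unfolding hl_c_def
        by (intro arg_cong2[where f = "(*)"] prod.cong refl) (clarsimp simp only: mem_idx_pairs, simp only: pairs less_trans)
      have "lmono n \<nu> (?y t) = (\<Prod>j<n. t powi (\<epsilon> j * \<nu> j * ?\<rho> (\<sigma> j)) * z (\<sigma> j) powi (\<epsilon> j * \<nu> j))"
        unfolding lmono_def
      proof (rule prod.cong[OF refl])
        fix j assume "j \<in> {..<n}"
        then show "?y t j powi \<nu> j = t powi (\<epsilon> j * \<nu> j * ?\<rho> (\<sigma> j)) * z (\<sigma> j) powi (\<epsilon> j * \<nu> j)"
          by (simp add: y' power_int_mult_distrib ac_simps flip: power_int_mult)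
      qed
      also have "\<dots> = t powi (\<Sum>j<n. \<epsilon> j * \<nu> j * ?\<rho> (\<sigma> j)) * U \<sigma> \<epsilon>"
        by (simp add: prod.distrib prod_power_int_sum[OF t] U_def)
      finally have "t powi \<Phi> * lmono n \<nu> (?y t) = t powi E \<sigma> \<epsilon> * U \<sigma> \<epsilon>"
        using t by (simp add: E_def power_int_add)
      then show ?thesis unfolding c[symmetric] by (metis mult.left_commute)
    qed
    show ?thesis
      by (rule Lim_transform_eventually[OF lim])
         (unfold eventually_at_filter, intro always_eventually allI impI, rule eq[symmetric])
  qed
  have "((\<lambda>t. \<Sum>\<sigma>\<in>?P. \<Sum>\<epsilon>\<in>signs n. t powi \<Phi> * (hl_c n q q0 (sact n \<sigma> \<epsilon> (tscale n ?\<rho> t z)) * lmono n \<nu> (sact n \<sigma> \<epsilon> (tscale n ?\<rho> t z))))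
    \<longlongrightarrow> (\<Sum>\<sigma>\<in>?P. \<Sum>\<epsilon>\<in>signs n. L \<sigma> \<epsilon>)) (at 0)"
    by (intro tendsto_sum term_lim) auto
  moreover have "(\<Sum>\<sigma>\<in>?P. \<Sum>\<epsilon>\<in>signs n. L \<sigma> \<epsilon>)
     = (\<Sum>\<sigma>\<in>{\<sigma>. \<sigma> permutes {..<n} \<and> (\<forall>j<n. \<nu> (\<sigma> j) = \<nu> j)}. inv_weight n q \<sigma>) * lmono n (\<lambda>j. - \<nu> j) z"
  proof -
    \<comment> \<open>The only sign vector for which no short factor tends to 0.\<close>
    define \<epsilon>0 where "\<epsilon>0 = (\<lambda>j\<in>{..<n}. - 1 :: int)"
    have \<epsilon>0: "\<epsilon>0 \<in> signs n" by (auto simp: signs_def \<epsilon>0_def)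
    have "(\<Sum>\<epsilon>\<in>signs n. L \<sigma> \<epsilon>) = (if \<forall>j<n. \<nu> (\<sigma> j) = \<nu> j then inv_weight n q \<sigma> * lmono n (\<lambda>j. - \<nu> j) z else 0)"
      if s: "\<sigma> permutes {..<n}" for \<sigma>
    proof -
      have "L \<sigma> \<epsilon> = 0" if "\<epsilon> \<in> signs n" "\<epsilon> \<noteq> \<epsilon>0" for \<epsilon>
      proof -
        have "\<exists>j<n. \<epsilon> j \<noteq> -1"
        proof (rule ccontr)
          assume "\<not> (\<exists>j<n. \<epsilon> j \<noteq> -1)"
          then have "\<epsilon> = \<epsilon>0" using that(1) unfolding signs_def \<epsilon>0_def
            by (intro extensionalityI[of _ "{..<n}"]) (auto simp: PiE_def)
          then show False using that by simp
        qed
        then show ?thesis by (auto simp: L_def prod_zero_iff)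
      qed
      then have "(\<Sum>\<epsilon>\<in>signs n. L \<sigma> \<epsilon>) = (\<Sum>\<epsilon>\<in>{\<epsilon>0}. L \<sigma> \<epsilon>)"
        using \<epsilon>0 by (intro sum.mono_neutral_right) auto
      also have "\<dots> = L \<sigma> \<epsilon>0" by simp
      also have "\<dots> = (if \<forall>j<n. \<nu> (\<sigma> j) = \<nu> j then inv_weight n q \<sigma> * lmono n (\<lambda>j. - \<nu> j) z else 0)"
      proof -
        have "(\<Prod>j<n. if \<epsilon>0 j = -1 then 1 else 0 :: complex) = 1" by (rule prod.neutral) (simp add: \<epsilon>0_def)
        moreover have "(\<Prod>(j,k)\<in>idx_pairs n. (if e1 \<sigma> \<epsilon>0 j k > 0 then 1 else q) * (if e2 \<sigma> \<epsilon>0 j k > 0 then 1 else q))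
            = inv_weight n q \<sigma>"
          unfolding inv_weight_def
        proof (rule prod.cong[OF refl], clarify)
          fix j k assume "(j,k) \<in> idx_pairs n"
          then have jk: "j < k" "k < n" by auto
          then have "\<sigma> j < n" "\<sigma> k < n" "\<sigma> j \<noteq> \<sigma> k"
            using permutes_lessThan_less[OF s] permutes_eq_iff[OF s] by auto
          then show "(if e1 \<sigma> \<epsilon>0 j k > 0 then 1 else q) * (if e2 \<sigma> \<epsilon>0 j k > 0 then 1 else q) = (if \<sigma> k < \<sigma> j then q else 1)"
            using jk by (auto simp: e1_def e2_def \<epsilon>0_def)
        qed
        moreover have "E \<sigma> \<epsilon>0 = 0 \<longleftrightarrow> (\<forall>j<n. \<nu> (\<sigma> j) = \<nu> j)"
        proof -
          have "(\<Sum>j<n. \<epsilon>0 j * \<nu> j * ?\<rho> (\<sigma> j)) = - (\<Sum>j<n. \<nu> j * ?\<rho> (\<sigma> j))"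
            unfolding sum_negf[symmetric] by (rule sum.cong) (auto simp: \<epsilon>0_def)
          then show ?thesis using sum_eq[OF s] by (auto simp: E_def)
        qed
        moreover have "U \<sigma> \<epsilon>0 = lmono n (\<lambda>j. - \<nu> j) z" if st: "\<forall>j<n. \<nu> (\<sigma> j) = \<nu> j"
        proof -
          have "U \<sigma> \<epsilon>0 = (\<Prod>j<n. z (\<sigma> j) powi (- \<nu> (\<sigma> j)))"
            unfolding U_def by (rule prod.cong) (use st in \<open>auto simp: \<epsilon>0_def\<close>)
          also have "\<dots> = lmono n (\<lambda>j. - \<nu> j) z"
            using prod.permute[OF s, of "\<lambda>j. z j powi (- \<nu> j)"] by (simp add: o_def lmono_def)
          finally show ?thesis .
        qed
        ultimately show ?thesis unfolding L_def by auto
      qed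
      finally show ?thesis .
    qed
    then have "(\<Sum>\<sigma>\<in>?P. \<Sum>\<epsilon>\<in>signs n. L \<sigma> \<epsilon>)
      = (\<Sum>\<sigma>\<in>?P. if \<forall>j<n. \<nu> (\<sigma> j) = \<nu> j then inv_weight n q \<sigma> * lmono n (\<lambda>j. - \<nu> j) z else 0)"
      by (intro sum.cong) auto
    also have "\<dots> = (\<Sum>\<sigma>\<in>{\<sigma>\<in>?P. \<forall>j<n. \<nu> (\<sigma> j) = \<nu> j}. inv_weight n q \<sigma> * lmono n (\<lambda>j. - \<nu> j) z)"
      by (rule sum.inter_filter[symmetric]) simp
    finally show ?thesis by (simp add: sum_distrib_right)
  qed
  ultimately show ?thesis
    unfolding hl_sum_def wsum_def \<Phi>_def[symmetric] by (simp add: sum_distrib_left)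
qed

section \<open>Integration over the torus\<close>

text \<open>Normalized arc length, defined as an image of Lebesgue measure so that the return to
  angles is immediate. Its space is the circle itself, which makes the space of the product measure
  exactly the torus.\<close>

definition circle_measure :: "complex measure" where
  "circle_measure = distr (density lborel (\<lambda>x. ennreal (indicator {0..2*pi} x / (2*pi))))
     (restrict_space borel (sphere 0 1)) cis"

lemma space_circle [simp]: "space circle_measure = sphere 0 1"
  by (simp add: circle_measure_def space_restrict_space)

lemma sets_circle [measurable_cong]: "sets circle_measure = sets (restrict_space borel (sphere 0 1))"
  by (simp add: circle_measure_def)

lemma cis_measurable [measurable]: "cis \<in> borel \<rightarrow>\<^sub>M restrict_space borel (sphere 0 1)"
  by (rule measurable_restrict_space2) (auto intro!: borel_measurable_continuous_onI continuous_intros)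

lemma circle_to_borel [measurable]: "(\<lambda>z. z) \<in> circle_measure \<rightarrow>\<^sub>M borel"
  unfolding measurable_cong_sets[OF sets_circle refl] by (rule measurable_restrict_space1) simp

lemma emeasure_circle:
  assumes "A \<in> sets circle_measure"
  shows "emeasure circle_measure A =
    (\<integral>\<^sup>+ x. ennreal (indicator {0..2*pi} x / (2*pi)) * indicator A (cis x) \<partial>lborel)"
proof -
  have A: "A \<in> sets (restrict_space borel (sphere 0 1))" using assms sets_circle by simp
  have m: "cis \<in> density lborel (\<lambda>x. ennreal (indicator {0..2*pi} x / (2*pi))) \<rightarrow>\<^sub>M restrict_space borel (sphere 0 1)"
    by simp
  have "cis -` A \<in> sets lborel" using measurable_sets[OF m A] by simp
  then show ?thesis
    unfolding circle_measure_def using A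
    by (subst emeasure_distr[OF m A], subst emeasure_density) (auto simp: indicator_def intro!: nn_integral_cong)
qed

lemma nn_integral_interval_shift:
  fixes g :: "real \<Rightarrow> ennreal"
  assumes [measurable]: "g \<in> borel_measurable borel" and per: "\<And>x. g (x + 2*pi) = g x" and a: "0 \<le> a" "a < 2*pi"
  shows "(\<integral>\<^sup>+ x. indicator {0..2*pi} x * g (x + a) \<partial>lborel) = (\<integral>\<^sup>+ x. indicator {0..2*pi} x * g x \<partial>lborel)"
proof -
  have "(\<integral>\<^sup>+ x. indicator {0..2*pi} x * g (x + a) \<partial>lborel) = (\<integral>\<^sup>+ y. indicator {0..2*pi} (y - a) * g y \<partial>lborel)"
    by (subst (2) nn_integral_real_affine[where c = 1 and t = a]) (auto simp: add.commute)
  also have "\<dots> = (\<integral>\<^sup>+ y. indicator {a..2*pi} y * g y + indicator {2*pi<..2*pi+a} y * g y \<partial>lborel)"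
    by (rule nn_integral_cong) (use a in \<open>auto simp: indicator_def\<close>)
  also have "\<dots> = (\<integral>\<^sup>+ y. indicator {a..2*pi} y * g y \<partial>lborel) + (\<integral>\<^sup>+ y. indicator {2*pi<..2*pi+a} y * g y \<partial>lborel)"
    by (rule nn_integral_add) auto
  also have "(\<integral>\<^sup>+ y. indicator {2*pi<..2*pi+a} y * g y \<partial>lborel) = (\<integral>\<^sup>+ y. indicator {0<..a} y * g y \<partial>lborel)"
  proof -
    have "(\<integral>\<^sup>+ y. indicator {2*pi<..2*pi+a} y * g y \<partial>lborel)
      = (\<integral>\<^sup>+ y. indicator {2*pi<..2*pi+a} (2*pi + y) * g (2*pi + y) \<partial>lborel)"
      by (subst nn_integral_real_affine[where c = 1 and t = "2*pi"]) auto
    also have "\<dots> = (\<integral>\<^sup>+ y. indicator {0<..a} y * g y \<partial>lborel)"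
      by (rule nn_integral_cong) (use per in \<open>auto simp: indicator_def add.commute\<close>)
    finally show ?thesis .
  qed
  also have "(\<integral>\<^sup>+ y. indicator {a..2*pi} y * g y \<partial>lborel) + (\<integral>\<^sup>+ y. indicator {0<..a} y * g y \<partial>lborel)
      = (\<integral>\<^sup>+ y. indicator {a..2*pi} y * g y + indicator {0<..a} y * g y \<partial>lborel)"
    by (rule nn_integral_add[symmetric]) auto
  also have "\<dots> = (\<integral>\<^sup>+ x. indicator {0..2*pi} x * g x \<partial>lborel)"
  proof (rule nn_integral_cong_AE)
    have "AE y in lborel. y \<noteq> a" "AE y in lborel. y \<noteq> (0::real)" by (rule AE_lborel_singleton)+
    then show "AE y in lborel. indicator {a..2*pi} y * g y + indicator {0<..a} y * g y = indicator {0..2*pi} y * g y"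
      by eventually_elim (use a in \<open>auto simp: indicator_def\<close>)
  qed
  finally show ?thesis .
qed

lemma emeasure_circle':
  assumes "A \<in> sets circle_measure"
  shows "emeasure circle_measure A =
    ennreal (1 / (2*pi)) * (\<integral>\<^sup>+ x. indicator {0..2*pi} x * indicator A (cis x) \<partial>lborel)"
proof -
  have m: "(\<lambda>x. indicator A (cis x) :: ennreal) \<in> borel_measurable borel"
    using assms sets_circle by (intro measurable_compose[OF cis_measurable]) (auto intro!: borel_measurable_indicator)
  have "ennreal (indicator {0..2*pi} x / (2*pi)) = ennreal (1 / (2*pi)) * indicator {0..2*pi} x" for x :: real
    by (auto simp: indicator_def)
  then have "emeasure circle_measure A =
    (\<integral>\<^sup>+ x. ennreal (1 / (2*pi)) * (indicator {0..2*pi} x * indicator A (cis x)) \<partial>lborel)"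
    unfolding emeasure_circle[OF assms] by (simp add: mult.assoc)
  also have "\<dots> = ennreal (1 / (2*pi)) * (\<integral>\<^sup>+ x. indicator {0..2*pi} x * indicator A (cis x) \<partial>lborel)"
  proof (rule nn_integral_cmult)
    have "(\<lambda>x. indicator {0..2*pi} x * indicator A (cis x) :: ennreal) \<in> borel_measurable borel"
      by (intro borel_measurable_times_ennreal m borel_measurable_indicator) simp
    then show "(\<lambda>x. indicator {0..2*pi} x * indicator A (cis x) :: ennreal) \<in> borel_measurable lborel" by simp
  qed
  finally show ?thesis .
qed

lemma emeasure_circle_space: "emeasure circle_measure (sphere 0 1) = 1"
proof -
  have "sphere 0 1 \<in> sets circle_measure" using sets.top[of circle_measure] by simp
  then have "emeasure circle_measure (sphere 0 1) = ennreal (1 / (2*pi)) * (\<integral>\<^sup>+ x. indicator {0..2*pi} x \<partial>lborel)"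
    by (simp add: emeasure_circle')
  also have "(\<integral>\<^sup>+ x. indicator {0..2*pi} x \<partial>lborel) = ennreal (2 * pi)"
    by simp
  finally show ?thesis by (simp flip: ennreal_mult)
qed

interpretation circle: finite_measure circle_measure
  by standard (simp add: emeasure_circle_space)

interpretation circle_prod: product_sigma_finite "\<lambda>_::nat. circle_measure"
  by (simp add: product_sigma_finite_def circle.sigma_finite_measure_axioms)

lemma circle_map_measurable:
  assumes "f \<in> borel_measurable borel" "\<And>z. norm z = 1 \<Longrightarrow> norm (f z) = 1"
  shows "f \<in> circle_measure \<rightarrow>\<^sub>M circle_measure"
proof -
  have "f \<in> borel_measurable circle_measure"
    using measurable_compose[OF circle_to_borel assms(1)] .
  then have "f \<in> circle_measure \<rightarrow>\<^sub>M restrict_space borel (sphere 0 1)"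
    using assms(2) by (intro measurable_restrict_space2) auto
  then show ?thesis by (simp add: measurable_cong_sets[OF refl sets_circle])
qed

lemma circle_rotation:
  assumes c: "norm c = 1"
  shows "distr circle_measure circle_measure ((*) c) = circle_measure"
proof (rule measure_eqI)
  have m: "(*) c \<in> circle_measure \<rightarrow>\<^sub>M circle_measure"
    by (rule circle_map_measurable) (use c in \<open>auto simp: norm_mult\<close>)
  fix A assume "A \<in> sets (distr circle_measure circle_measure ((*) c))"
  then have A: "A \<in> sets circle_measure" by simp
  define a where "a = Arg2pi c"
  have ca: "c = cis a" "0 \<le> a" "a < 2*pi"
    using Arg2pi[of c] c unfolding a_def cis_conv_exp is_Arg_def by (simp_all add: mult.commute)
  have B: "(*) c -` A \<inter> space circle_measure \<in> sets circle_measure" using measurable_sets[OF m A] .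
  have g: "(\<lambda>x. indicator A (cis x) :: ennreal) \<in> borel_measurable borel"
    using A sets_circle by (intro measurable_compose[OF cis_measurable]) (auto intro!: borel_measurable_indicator)
  have "emeasure (distr circle_measure circle_measure ((*) c)) A
     = emeasure circle_measure ((*) c -` A \<inter> space circle_measure)"
    by (rule emeasure_distr[OF m A])
  also have "\<dots> = ennreal (1 / (2*pi)) * (\<integral>\<^sup>+ x. indicator {0..2*pi} x * indicator A (cis (x + a)) \<partial>lborel)"
    unfolding emeasure_circle'[OF B]
    by (intro arg_cong2[where f = "(*)"] nn_integral_cong refl) (auto simp: indicator_def ca cis_mult add.commute)
  also have "\<dots> = emeasure circle_measure A"
    unfolding emeasure_circle'[OF A]
    by (subst nn_integral_interval_shift[OF g _ ca(2,3)]) (auto simp: cis_mult[symmetric])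
  finally show "emeasure (distr circle_measure circle_measure ((*) c)) A = emeasure circle_measure A" .
qed simp

lemma circle_inverse:
  "distr circle_measure circle_measure inverse = circle_measure"
proof (rule measure_eqI)
  have m: "inverse \<in> circle_measure \<rightarrow>\<^sub>M circle_measure"
    by (rule circle_map_measurable) (auto simp: norm_inverse)
  fix A assume "A \<in> sets (distr circle_measure circle_measure inverse)"
  then have A: "A \<in> sets circle_measure" by simp
  have B: "inverse -` A \<inter> space circle_measure \<in> sets circle_measure" using measurable_sets[OF m A] .
  have g [measurable]: "(\<lambda>x. indicator A (cis x) :: ennreal) \<in> borel_measurable borel"
    using A sets_circle by (intro measurable_compose[OF cis_measurable]) (auto intro!: borel_measurable_indicator)
  have "emeasure (distr circle_measure circle_measure inverse) A
     = emeasure circle_measure (inverse -` A \<inter> space circle_measure)"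
    by (rule emeasure_distr[OF m A])
  also have "\<dots> = ennreal (1 / (2*pi)) * (\<integral>\<^sup>+ x. indicator {0..2*pi} x * indicator A (cis (- x)) \<partial>lborel)"
    unfolding emeasure_circle'[OF B]
    by (intro arg_cong2[where f = "(*)"] nn_integral_cong refl) (auto simp: indicator_def cis_inverse)
  also have "(\<integral>\<^sup>+ x. indicator {0..2*pi} x * indicator A (cis (- x)) \<partial>lborel)
      = (\<integral>\<^sup>+ x. indicator {0..2*pi} x * indicator A (cis x) \<partial>lborel :: ennreal)"
  proof -
    have "(\<integral>\<^sup>+ x. indicator {0..2*pi} x * indicator A (cis x) \<partial>lborel :: ennreal)
      = (\<integral>\<^sup>+ x. indicator {0..2*pi} (2*pi + - 1 * x) * indicator A (cis (2*pi + - 1 * x)) \<partial>lborel)"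
      by (subst nn_integral_real_affine[where c = "-1" and t = "2*pi"]) simp_all
    also have "\<dots> = (\<integral>\<^sup>+ x. indicator {0..2*pi} x * indicator A (cis (- x)) \<partial>lborel)"
    proof (rule nn_integral_cong)
      fix x :: real
      have "cis (2*pi + - 1 * x) = cis (- x)" unfolding cis_mult[symmetric] by simp
      then show "indicator {0..2*pi} (2*pi + - 1 * x) * indicator A (cis (2*pi + - 1 * x))
        = (indicator {0..2*pi} x * indicator A (cis (- x)) :: ennreal)"
        by (auto simp: indicator_def)
    qed
    finally show ?thesis by simp
  qed
  finally show "emeasure (distr circle_measure circle_measure inverse) A = emeasure circle_measure A"
    unfolding emeasure_circle'[OF A] .
qed simp

section \<open>The product measure and its symmetries\<close>

definition torus_measure :: "nat \<Rightarrow> (nat \<Rightarrow> complex) measure" where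
  "torus_measure n = PiM {..<n} (\<lambda>_. circle_measure)"

lemma space_torus [simp]: "space (torus_measure n) = torus n"
  by (simp add: torus_measure_def space_PiM torus_def)

lemma emeasure_torus: "emeasure (torus_measure n) (torus n) = 1"
  unfolding torus_measure_def torus_def
  by (subst circle_prod.emeasure_PiM) (use sets.top[of circle_measure] in \<open>auto simp: emeasure_circle_space\<close>)

lemma finite_torus: "finite_measure (torus_measure n)"
  by standard (simp add: emeasure_torus)

lemma measure_torus: "measure (torus_measure n) (torus n) = 1"
  by (simp add: measure_def emeasure_torus)

text \<open>Both invariances used later are instances: signed permutations, with each
  \<open>T j\<close> the identity or the inversion, and scaling by a unimodular number, with each
  \<open>T j\<close> a rotation.\<close>

lemma torus_distr:
  assumes s: "\<sigma> permutes {..<n}"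
    and m: "\<And>j. j < n \<Longrightarrow> T j \<in> circle_measure \<rightarrow>\<^sub>M circle_measure"
    and d: "\<And>j. j < n \<Longrightarrow> distr circle_measure circle_measure (T j) = circle_measure"
  shows "(\<lambda>z. \<lambda>j\<in>{..<n}. T j (z (\<sigma> j))) \<in> torus_measure n \<rightarrow>\<^sub>M torus_measure n"
    and "distr (torus_measure n) (torus_measure n) (\<lambda>z. \<lambda>j\<in>{..<n}. T j (z (\<sigma> j))) = torus_measure n"
proof -
  let ?f = "\<lambda>z. \<lambda>j\<in>{..<n}. T j (z (\<sigma> j))"
  have sl: "\<sigma> j < n" "inv \<sigma> j < n" if "j < n" for j
    using permutes_lessThan_less[OF s that] permutes_lessThan_less[OF permutes_inv[OF s] that] .
  show f: "?f \<in> torus_measure n \<rightarrow>\<^sub>M torus_measure n"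
    unfolding torus_measure_def
  proof (rule measurable_restrict)
    fix j assume j: "j \<in> {..<n}"
    have "(\<lambda>z. z (\<sigma> j)) \<in> PiM {..<n} (\<lambda>_. circle_measure) \<rightarrow>\<^sub>M circle_measure"
      using sl j by (intro measurable_component_singleton) auto
    then show "(\<lambda>z. T j (z (\<sigma> j))) \<in> PiM {..<n} (\<lambda>_. circle_measure) \<rightarrow>\<^sub>M circle_measure"
      by (rule measurable_compose[OF _ m]) (use j in simp)
  qed
  show "distr (torus_measure n) (torus_measure n) ?f = torus_measure n"
    unfolding torus_measure_def
  proof (rule circle_prod.PiM_eqI)
    fix A assume A: "\<And>i. i \<in> {..<n} \<Longrightarrow> A i \<in> sets circle_measure"
    have PA: "Pi\<^sub>E {..<n} A \<in> sets (PiM {..<n} (\<lambda>_. circle_measure))"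
      by (rule sets_PiM_I_finite) (use A in auto)
    let ?B = "\<lambda>k. T (inv \<sigma> k) -` A (inv \<sigma> k) \<inter> space circle_measure"
    have B: "?B k \<in> sets circle_measure" if "k < n" for k
      using measurable_sets[OF m A] sl[OF that] by auto
    have "?f -` Pi\<^sub>E {..<n} A \<inter> space (PiM {..<n} (\<lambda>_. circle_measure)) = Pi\<^sub>E {..<n} ?B"
    proof (rule set_eqI)
      fix z
      have "(\<forall>j<n. T j (z (\<sigma> j)) \<in> A j) \<longleftrightarrow> (\<forall>k<n. T (inv \<sigma> k) (z k) \<in> A (inv \<sigma> k))"
        using sl permutes_inverses[OF s] by metis
      then show "z \<in> ?f -` Pi\<^sub>E {..<n} A \<inter> space (PiM {..<n} (\<lambda>_. circle_measure)) \<longleftrightarrow> z \<in> Pi\<^sub>E {..<n} ?B"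
        by (auto simp: space_PiM PiE_def Pi_def)
    qed
    then have "emeasure (distr (PiM {..<n} (\<lambda>_. circle_measure)) (PiM {..<n} (\<lambda>_. circle_measure)) ?f) (Pi\<^sub>E {..<n} A)
       = emeasure (PiM {..<n} (\<lambda>_. circle_measure)) (Pi\<^sub>E {..<n} ?B)"
      using emeasure_distr[OF f[unfolded torus_measure_def] PA] by simp
    also have "\<dots> = (\<Prod>k<n. emeasure circle_measure (?B k))"
      by (rule circle_prod.emeasure_PiM) (use B in auto)
    also have "\<dots> = (\<Prod>k<n. emeasure circle_measure (A (inv \<sigma> k)))"
    proof (rule prod.cong[OF refl])
      fix k assume "k \<in> {..<n}"
      then have "inv \<sigma> k < n" using sl by simp
      then show "emeasure circle_measure (?B k) = emeasure circle_measure (A (inv \<sigma> k))"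
        using emeasure_distr[OF m A, of "inv \<sigma> k"] d by simp
    qed
    also have "\<dots> = (\<Prod>k<n. emeasure circle_measure (A k))"
      using prod.permute[OF permutes_inv[OF s], of "\<lambda>k. emeasure circle_measure (A k)"] by (simp add: o_def)
    finally show "emeasure (distr (PiM {..<n} (\<lambda>_. circle_measure)) (PiM {..<n} (\<lambda>_. circle_measure)) ?f) (Pi\<^sub>E {..<n} A)
       = (\<Prod>k<n. emeasure circle_measure (A k))" .
  qed auto
qed

lemma circle_powi_sign:
  assumes "e = 1 \<or> e = (-1::int)"
  shows "(\<lambda>z. z powi e) \<in> circle_measure \<rightarrow>\<^sub>M circle_measure"
    and "distr circle_measure circle_measure (\<lambda>z. z powi e) = circle_measure"
proof -
  have "inverse \<in> circle_measure \<rightarrow>\<^sub>M circle_measure"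
    by (rule circle_map_measurable) (auto simp: norm_inverse)
  moreover have "(\<lambda>z::complex. z powi (-1)) = inverse" by (simp add: fun_eq_iff)
  ultimately show "(\<lambda>z. z powi e) \<in> circle_measure \<rightarrow>\<^sub>M circle_measure"
      "distr circle_measure circle_measure (\<lambda>z. z powi e) = circle_measure"
    using assms circle_inverse distr_id[of circle_measure] by (auto simp: id_def)
qed

lemma integral_sact:
  fixes F :: "(nat \<Rightarrow> complex) \<Rightarrow> complex"
  assumes s: "\<sigma> permutes {..<n}" and e: "\<epsilon> \<in> signs n" and F: "F \<in> borel_measurable (torus_measure n)"
  shows "(\<lambda>z. F (sact n \<sigma> \<epsilon> z)) \<in> borel_measurable (torus_measure n)"
    and "(\<integral>z. F (sact n \<sigma> \<epsilon> z) \<partial>torus_measure n) = (\<integral>z. F z \<partial>torus_measure n)"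
proof -
  note T = torus_distr[OF s, of "\<lambda>j z. z powi \<epsilon> j", OF circle_powi_sign, OF signsD[OF e] signsD[OF e]]
  have m: "sact n \<sigma> \<epsilon> \<in> torus_measure n \<rightarrow>\<^sub>M torus_measure n"
    and d: "distr (torus_measure n) (torus_measure n) (sact n \<sigma> \<epsilon>) = torus_measure n"
    using T unfolding sact_def[abs_def] by auto
  show "(\<lambda>z. F (sact n \<sigma> \<epsilon> z)) \<in> borel_measurable (torus_measure n)"
    by (rule measurable_compose[OF m F])
  show "(\<integral>z. F (sact n \<sigma> \<epsilon> z) \<partial>torus_measure n) = (\<integral>z. F z \<partial>torus_measure n)"
    using integral_distr[OF m F] d by simp
qed

lemma integral_tscale:
  fixes F :: "(nat \<Rightarrow> complex) \<Rightarrow> complex"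
  assumes t: "norm t = 1" and F: "F \<in> borel_measurable (torus_measure n)"
  shows "(\<integral>z. F (tscale n \<theta> t z) \<partial>torus_measure n) = (\<integral>z. F z \<partial>torus_measure n)"
proof -
  have m1: "(*) c \<in> circle_measure \<rightarrow>\<^sub>M circle_measure" if "norm c = 1" for c
    by (rule circle_map_measurable) (use that in \<open>auto simp: norm_mult\<close>)
  have n1: "norm (t powi \<theta> j) = 1" for j by (simp add: norm_power_int t)
  note T = torus_distr[OF permutes_id, where T = "\<lambda>j. (*) (t powi \<theta> j)", OF m1 circle_rotation, OF n1 n1]
  have m: "tscale n \<theta> t \<in> torus_measure n \<rightarrow>\<^sub>M torus_measure n"
    and d: "distr (torus_measure n) (torus_measure n) (tscale n \<theta> t) = torus_measure n"
    using T unfolding tscale_def[abs_def] by auto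
  show ?thesis
    using integral_distr[OF m F] d by simp
qed

lemma compact_torus: "compact (torus n)"
proof -
  have "torus n = PiE UNIV (\<lambda>i. if i < n then sphere 0 1 else {undefined})"
    by (auto simp: torus_def PiE_def Pi_def extensional_def split: if_splits)
  moreover have "compactin (product_topology (\<lambda>_. euclidean) UNIV)
      (PiE UNIV (\<lambda>i::nat. if i < n then sphere (0::complex) 1 else {undefined}))"
    unfolding compactin_PiE by (auto simp: compactin_euclidean_iff)
  ultimately show ?thesis
    by (simp add: euclidean_product_topology compactin_euclidean_iff)
qed

text \<open>Measurability for the product sigma-algebra and continuity for the product topology are
  carried side by side: compactness turns the second into a bound, and with this bound the first
  gives integrability.\<close>

definition tfun :: "nat \<Rightarrow> ((nat \<Rightarrow> complex) \<Rightarrow> complex) \<Rightarrow> bool" where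
  "tfun n F \<longleftrightarrow> F \<in> borel_measurable (torus_measure n) \<and> continuous_on (torus n) F"

lemma tfun_const: "tfun n (\<lambda>_. c)"
  by (simp add: tfun_def)

lemma tfun_coord: "j < n \<Longrightarrow> tfun n (\<lambda>z. z j)"
proof -
  assume "j < n"
  then have "(\<lambda>z. z j) \<in> torus_measure n \<rightarrow>\<^sub>M circle_measure"
    unfolding torus_measure_def by (intro measurable_component_singleton) simp
  from measurable_compose[OF this circle_to_borel]
  show ?thesis by (auto simp: tfun_def intro: continuous_on_subset[OF continuous_on_product_coordinates])
qed

lemma tfun_add: "tfun n F \<Longrightarrow> tfun n G \<Longrightarrow> tfun n (\<lambda>z. F z + G z)"
  by (auto simp: tfun_def intro: continuous_on_add)

lemma tfun_diff: "tfun n F \<Longrightarrow> tfun n G \<Longrightarrow> tfun n (\<lambda>z. F z - G z)"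
  by (auto simp: tfun_def intro: continuous_on_diff)

lemma tfun_mult: "tfun n F \<Longrightarrow> tfun n G \<Longrightarrow> tfun n (\<lambda>z. F z * G z)"
  by (auto simp: tfun_def intro: continuous_on_mult)

lemma tfun_divide:
  "tfun n F \<Longrightarrow> tfun n G \<Longrightarrow> (\<And>z. z \<in> torus n \<Longrightarrow> G z \<noteq> 0) \<Longrightarrow> tfun n (\<lambda>z. F z / G z)"
  by (auto simp: tfun_def intro: continuous_on_divide)

lemma tfun_cong: "tfun n F \<Longrightarrow> (\<And>z. z \<in> torus n \<Longrightarrow> G z = F z) \<Longrightarrow> tfun n G"
  unfolding tfun_def
  by (metis (no_types, lifting) continuous_on_cong measurable_cong space_torus)

lemma tfun_sum: "(\<And>i. i \<in> I \<Longrightarrow> tfun n (F i)) \<Longrightarrow> tfun n (\<lambda>z. \<Sum>i\<in>I. F i z)"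
  by (induction I rule: infinite_finite_induct) (auto intro: tfun_const tfun_add)

lemma tfun_prod: "(\<And>i. i \<in> I \<Longrightarrow> tfun n (F i)) \<Longrightarrow> tfun n (\<lambda>z. \<Prod>i\<in>I. F i z)"
  by (induction I rule: infinite_finite_induct) (auto intro: tfun_const tfun_mult)

lemma tfun_power: "tfun n F \<Longrightarrow> tfun n (\<lambda>z. F z ^ k)"
  by (induction k) (auto intro: tfun_const tfun_mult)

lemma tfun_powi:
  assumes "tfun n F" "\<And>z. z \<in> torus n \<Longrightarrow> F z \<noteq> 0" shows "tfun n (\<lambda>z. F z powi k)"
proof (cases "k \<ge> 0")
  case True
  then show ?thesis using tfun_power[OF assms(1), of "nat k"] by (simp add: power_int_def)
next
  case False
  have "tfun n (\<lambda>z. 1 / F z ^ nat (- k))"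
    by (intro tfun_divide tfun_const tfun_power assms) (use assms in auto)
  then show ?thesis using False by (simp add: power_int_def power_one_over inverse_eq_divide)
qed

lemma tfun_laurent:
  assumes "laurent n D F" shows "tfun n F"
  using assms
proof (induction rule: laurent.induct)
  case (zero F)
  show ?case by (rule tfun_cong[OF tfun_const[of n 0]]) (use zero torus_nzvecs in auto)
next
  case (step F \<nu> G c)
  have "tfun n (\<lambda>z. F z + c * lmono n \<nu> z)"
    unfolding lmono_def
    by (intro tfun_add step.IH tfun_mult tfun_const tfun_prod tfun_powi tfun_coord)
       (use torus_nzvecs in \<open>auto simp: nzvecs_def\<close>)
  then show ?case by (rule tfun_cong) (use step.hyps(3) torus_nzvecs in auto)
qed

lemma tfun_bounded:
  assumes "tfun n F" obtains B where "B > 0" "\<And>z. z \<in> torus n \<Longrightarrow> norm (F z) \<le> B"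
proof -
  have "bounded (F ` torus n)"
    using assms compact_continuous_image compact_torus compact_imp_bounded unfolding tfun_def by blast
  then show thesis using that unfolding bounded_pos by auto
qed

lemma tfun_integrable: assumes "tfun n F" shows "integrable (torus_measure n) F"
proof -
  interpret finite_measure "torus_measure n" by (rule finite_torus)
  obtain B where "\<And>z. z \<in> torus n \<Longrightarrow> norm (F z) \<le> B" using tfun_bounded[OF assms] by blast
  then show ?thesis
    using assms by (intro integrable_const_bound[of _ B]) (auto simp: tfun_def)
qed

lemma tfun_sact:
  assumes s: "\<sigma> permutes {..<n}" and e: "\<epsilon> \<in> signs n" and F: "tfun n F"
  shows "tfun n (\<lambda>z. F (sact n \<sigma> \<epsilon> z))"
proof -
  have "continuous_on (torus n) (sact n \<sigma> \<epsilon>)"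
  proof (rule continuous_on_coordinatewise_then_product)
    fix j
    show "continuous_on (torus n) (\<lambda>z. sact n \<sigma> \<epsilon> z j)"
    proof (cases "j < n")
      case True
      have "tfun n (\<lambda>z. z (\<sigma> j) powi \<epsilon> j)"
        using permutes_lessThan_less[OF s True] torus_nzvecs
        by (intro tfun_powi tfun_coord) (auto simp: nzvecs_def)
      then show ?thesis using True by (simp add: tfun_def sact_def)
    qed (simp add: sact_def)
  qed
  then have "continuous_on (torus n) (\<lambda>z. F (sact n \<sigma> \<epsilon> z))"
    by (rule continuous_on_compose2[of "torus n" F, rotated]) (use F sact_torus[OF s] in \<open>auto simp: tfun_def\<close>)
  then show ?thesis using integral_sact(1)[OF s e] F by (simp add: tfun_def)
qed

text \<open>The mean value property. The puncture at 0 is filled by the limit, which is a removable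
  singularity, and holomorphy up to the closed disc gives the continuity on the boundary that
  Cauchy's formula asks for.\<close>

lemma circle_mean:
  fixes G :: "complex \<Rightarrow> complex"
  assumes hol: "G holomorphic_on (cball 0 1 - {0})" and lim: "(G \<longlongrightarrow> c) (at 0)"
  shows "(\<integral>s. G s \<partial>circle_measure) = c"
proof -
  define H where "H s = (if s = 0 then c else G s)" for s
  have holG: "H holomorphic_on (cball 0 1 - {0})"
    using hol by (rule holomorphic_transform) (simp add: H_def)
  have c0: "isCont H 0"
    unfolding isCont_def using lim by (auto simp: H_def cong: Lim_cong_within)
  have cont: "continuous_on (cball 0 1) H"
  proof -
    have "continuous (at s within cball 0 1) H" if s: "s \<in> cball 0 1" for s
    proof (cases "s = 0")
      case True
      then show ?thesis using c0 by (simp add: continuous_at_imp_continuous_within)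
    next
      case False
      have "continuous (at s within cball 0 1 - {0}) H"
        using holomorphic_on_imp_continuous_on[OF holG] s False by (auto simp: continuous_on_eq_continuous_within)
      moreover have "at s within cball 0 1 - {0} = at s within cball 0 1"
        using False by (intro at_within_nhd[of _ "- {0}"]) auto
      ultimately show ?thesis by simp
    qed
    then show ?thesis by (simp add: continuous_on_eq_continuous_within)
  qed
  have hol1: "H holomorphic_on ball 0 1"
  proof (rule no_isolated_singularity[where K = "{0}"])
    show "continuous_on (ball 0 1) H" using cont by (rule continuous_on_subset) auto
    show "H holomorphic_on ball 0 1 - {0}" using holG by (rule holomorphic_on_subset) auto
  qed auto
  have "((\<lambda>u. H u / (u - 0)) has_contour_integral 2 * of_real pi * \<i> * H 0) (circlepath 0 1)"
    by (rule Cauchy_integral_circlepath[OF cont hol1]) simp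
  then have "((\<lambda>t. H (0 + of_real 1 * cis t) / (0 + of_real 1 * cis t - 0) * of_real 1 * \<i> * cis t)
      has_integral 2 * of_real pi * \<i> * H 0) {0..2*pi}"
    unfolding circlepath_def by (subst (asm) has_contour_integral_part_circlepath_iff) auto
  then have "((\<lambda>t. H (cis t) * \<i>) has_integral 2 * of_real pi * \<i> * c) {0..2*pi}"
    by (simp add: H_def)
  from has_integral_mult_left[OF this, of "- \<i>"]
  have "((\<lambda>t. H (cis t) * (\<i> * (- \<i>))) has_integral 2 * of_real pi * c * (\<i> * (- \<i>))) {0..2*pi}"
    by (simp only: ac_simps)
  then have I: "((\<lambda>t. H (cis t)) has_integral 2 * of_real pi * c) {0..2*pi}" by simp
  have contc: "continuous_on UNIV (\<lambda>t. H (cis t))"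
    by (rule continuous_on_compose2[OF cont]) (auto intro!: continuous_intros)
  have "set_integrable lborel {0..2*pi} (\<lambda>t. H (cis t))"
    by (rule borel_integrable_atLeastAtMost') (rule continuous_on_subset[OF contc], simp)
  from set_borel_integral_eq_integral(2)[OF this] I
  have L: "(LINT t:{0..2*pi}|lborel. H (cis t)) = 2 * of_real pi * c"
    by (simp add: integral_unique)
  have mH: "H \<in> borel_measurable (restrict_space borel (sphere 0 1))"
    by (rule borel_measurable_continuous_on_restrict) (rule continuous_on_subset[OF cont], auto)
  have "(\<integral>s. G s \<partial>circle_measure) = (\<integral>s. H s \<partial>circle_measure)"
    by (rule Bochner_Integration.integral_cong) (auto simp: H_def)
  also have "\<dots> = (\<integral>x. H (cis x) \<partial>density lborel (\<lambda>x. ennreal (indicator {0..2*pi} x / (2*pi))))"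
    unfolding circle_measure_def by (rule integral_distr) (use mH in auto)
  also have "\<dots> = (\<integral>x. (indicator {0..2*pi} x / (2*pi)) *\<^sub>R H (cis x) \<partial>lborel)"
  proof (rule integral_density)
    have "(\<lambda>x. H (cis x)) \<in> borel_measurable borel"
      using contc by (rule borel_measurable_continuous_onI)
    then show "(\<lambda>x. H (cis x)) \<in> borel_measurable lborel" by simp
  qed (auto simp: indicator_def)
  also have "\<dots> = (\<integral>x. (1 / (2*pi)) *\<^sub>R (indicator {0..2*pi} x *\<^sub>R H (cis x)) \<partial>lborel)"
    by (rule Bochner_Integration.integral_cong) auto
  also have "\<dots> = (1 / (2*pi)) *\<^sub>R (LINT t:{0..2*pi}|lborel. H (cis t))"
    unfolding set_lebesgue_integral_def by (rule integral_scaleR_right)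
  also have "\<dots> = c" unfolding L by (simp add: scaleR_conv_of_real)
  finally show ?thesis .
qed

text \<open>The device behind all integral evaluations. Averaging over the rotations
  \<open>tscale n \<theta> s\<close> does not change the integral, and for fixed \<open>z\<close>
  the inner average is the limit at 0 of a function holomorphic in the scaling parameter. That
  function \<open>G z\<close> has to agree with \<open>H\<close> on the unit circle only, which
  leaves room for cancelling poles before continuing inward.\<close>

lemma torus_mean:
  fixes H g :: "(nat \<Rightarrow> complex) \<Rightarrow> complex" and G :: "(nat \<Rightarrow> complex) \<Rightarrow> complex \<Rightarrow> complex"
  assumes H: "tfun n H"
    and hol: "\<And>z. z \<in> torus n \<Longrightarrow> G z holomorphic_on (cball 0 1 - {0})"
    and lim: "\<And>z. z \<in> torus n \<Longrightarrow> (G z \<longlongrightarrow> g z) (at 0)"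
    and bd: "\<And>z s. z \<in> torus n \<Longrightarrow> norm s = 1 \<Longrightarrow> H (tscale n \<theta> s z) = G z s"
  shows "(\<integral>z. H z \<partial>torus_measure n) = (\<integral>z. g z \<partial>torus_measure n)"
proof -
  interpret T: finite_measure "torus_measure n" by (rule finite_torus)
  interpret P: pair_sigma_finite "torus_measure n" circle_measure ..
  interpret Q: finite_measure "torus_measure n \<Otimes>\<^sub>M circle_measure"
    by (rule finite_measure_pair_measure[OF circle.finite_measure_axioms finite_torus])
  have mH: "H \<in> borel_measurable (torus_measure n)" using H by (simp add: tfun_def)
  have m: "(\<lambda>x. tscale n \<theta> (snd x) (fst x)) \<in> torus_measure n \<Otimes>\<^sub>M circle_measure \<rightarrow>\<^sub>M torus_measure n"
    unfolding tscale_def torus_measure_def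
  proof (rule measurable_restrict)
    fix j assume j: "j \<in> {..<n}"
    let ?M = "PiM {..<n} (\<lambda>_. circle_measure) \<Otimes>\<^sub>M circle_measure"
    have a: "(\<lambda>x. snd x) \<in> ?M \<rightarrow>\<^sub>M borel" by (rule measurable_compose[OF measurable_snd circle_to_borel])
    have b: "(\<lambda>x. fst x j) \<in> ?M \<rightarrow>\<^sub>M borel"
      by (rule measurable_compose[OF measurable_compose[OF measurable_fst measurable_component_singleton[OF j]] circle_to_borel])
    have p: "(\<lambda>s::complex. s powi \<theta> j) \<in> borel_measurable borel"
      unfolding power_int_def by (cases "\<theta> j \<ge> 0") auto
    have "(\<lambda>x. snd x powi \<theta> j * fst x j) \<in> ?M \<rightarrow>\<^sub>M borel"
      by (intro borel_measurable_times b measurable_compose[OF a p])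
    then have "(\<lambda>x. snd x powi \<theta> j * fst x j) \<in> ?M \<rightarrow>\<^sub>M restrict_space borel (sphere 0 1)"
      by (rule measurable_restrict_space2[rotated])
         (use j in \<open>auto simp: space_pair_measure space_PiM norm_mult norm_power_int PiE_def Pi_def\<close>)
    then show "(\<lambda>x. snd x powi \<theta> j * fst x j) \<in> ?M \<rightarrow>\<^sub>M circle_measure"
      by (simp add: measurable_cong_sets[OF refl sets_circle])
  qed
  obtain B where B: "\<And>z. z \<in> torus n \<Longrightarrow> norm (H z) \<le> B" using tfun_bounded[OF H] by blast
  have int: "integrable (torus_measure n \<Otimes>\<^sub>M circle_measure) (\<lambda>(z, s). H (tscale n \<theta> s z))"
    unfolding case_prod_unfold
  proof (rule Q.integrable_const_bound[of _ B])
    show "(\<lambda>x. H (tscale n \<theta> (snd x) (fst x))) \<in> borel_measurable (torus_measure n \<Otimes>\<^sub>M circle_measure)"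
      by (rule measurable_compose[OF m mH])
    show "AE x in torus_measure n \<Otimes>\<^sub>M circle_measure. norm (H (tscale n \<theta> (snd x) (fst x))) \<le> B"
    proof (rule AE_I2)
      fix x assume "x \<in> space (torus_measure n \<Otimes>\<^sub>M circle_measure)"
      then have "tscale n \<theta> (snd x) (fst x) \<in> torus n"
        using measurable_space[OF m] by auto
      then show "norm (H (tscale n \<theta> (snd x) (fst x))) \<le> B" by (rule B)
    qed
  qed
  have "(\<integral>z. H z \<partial>torus_measure n) = (\<integral>s. (\<integral>z. H z \<partial>torus_measure n) \<partial>circle_measure)"
    by (simp add: measure_def emeasure_circle_space)
  also have "\<dots> = (\<integral>s. (\<integral>z. H (tscale n \<theta> s z) \<partial>torus_measure n) \<partial>circle_measure)"
    by (rule Bochner_Integration.integral_cong) (auto simp: integral_tscale[OF _ mH])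
  also have "\<dots> = (\<integral>z. (\<integral>s. H (tscale n \<theta> s z) \<partial>circle_measure) \<partial>torus_measure n)"
    by (rule P.Fubini_integral[OF int])
  also have "\<dots> = (\<integral>z. g z \<partial>torus_measure n)"
  proof (rule Bochner_Integration.integral_cong[OF refl])
    fix z assume "z \<in> space (torus_measure n)"
    then have z: "z \<in> torus n" by simp
    have "(\<integral>s. H (tscale n \<theta> s z) \<partial>circle_measure) = (\<integral>s. G z s \<partial>circle_measure)"
      by (rule Bochner_Integration.integral_cong) (auto simp: bd[OF z])
    then show "(\<integral>s. H (tscale n \<theta> s z) \<partial>circle_measure) = g z"
      using circle_mean[OF hol[OF z] lim[OF z]] by simp
  qed
  finally show ?thesis .
qed

lemma integral_lmono:
  "(\<integral>z. lmono n \<kappa> z \<partial>torus_measure n) = (if \<forall>j<n. \<kappa> j = 0 then 1 else 0)"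
proof (cases "\<forall>j<n. \<kappa> j = 0")
  case True
  then show ?thesis by (simp add: lmono_def measure_torus)
next
  case False
  then obtain i where i: "i < n" "\<kappa> i \<noteq> 0" by blast
  \<comment> \<open>A rotation of the \<open>i\<close>-th coordinate by \<open>s\<close> negates the
    monomial, so its integral is its own negative.\<close>
  define s where "s = cis (pi / of_int (\<kappa> i))"
  have s: "norm s = 1" "s powi \<kappa> i = -1"
    using i by (simp_all add: s_def cis_power_int)
  let ?\<theta> = "\<lambda>j. if j = i then 1 else 0 :: int"
  have sc: "lmono n \<kappa> (tscale n ?\<theta> s z) = - lmono n \<kappa> z" for z
  proof -
    have "lmono n \<kappa> (tscale n ?\<theta> s z) = (\<Prod>j<n. (s powi ?\<theta> j) powi \<kappa> j) * lmono n \<kappa> z"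
      by (simp add: lmono_def tscale_def power_int_mult_distrib prod.distrib)
    also have "(\<Prod>j<n. (s powi ?\<theta> j) powi \<kappa> j) = s powi \<kappa> i"
      using i by (subst prod.remove[of _ i]) (auto intro!: prod.neutral)
    finally show ?thesis by (simp add: s)
  qed
  have "tfun n (lmono n \<kappa>)"
    using tfun_laurent[OF laurent_lmono[of n \<kappa> "\<lambda>j. nat \<bar>\<kappa> j\<bar>" 1]] by simp
  then have "(\<integral>z. lmono n \<kappa> (tscale n ?\<theta> s z) \<partial>torus_measure n) = (\<integral>z. lmono n \<kappa> z \<partial>torus_measure n)"
    using s by (intro integral_tscale) (auto simp: tfun_def)
  then show ?thesis using False unfolding sc by auto
qed

section \<open>Orthogonality\<close>

lemma wsum_const: "wsum n (\<lambda>_ _. c :: complex) = wsum n (\<lambda>_ _. 1) * c"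
  by (simp add: wsum_def)

lemma wsum_one_nonzero: "wsum n (\<lambda>_ _. 1 :: complex) \<noteq> 0"
  by (simp add: wsum_def card_permutations signs_def card_PiE)

lemma wsum_mult_right: "wsum n (\<lambda>\<sigma> \<epsilon>. f \<sigma> \<epsilon> * c) = wsum n f * (c :: complex)"
  by (simp add: wsum_def sum_distrib_right)

lemma integral_wsum_sact:
  assumes Q: "tfun n Q"
  shows "(\<integral>z. wsum n (\<lambda>\<sigma> \<epsilon>. Q (sact n \<sigma> \<epsilon> z)) \<partial>torus_measure n) = wsum n (\<lambda>_ _. 1) * (\<integral>z. Q z \<partial>torus_measure n)"
proof -
  have mQ: "Q \<in> borel_measurable (torus_measure n)" using Q by (simp add: tfun_def)
  have "(\<integral>z. wsum n (\<lambda>\<sigma> \<epsilon>. Q (sact n \<sigma> \<epsilon> z)) \<partial>torus_measure n)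
     = wsum n (\<lambda>\<sigma> \<epsilon>. \<integral>z. Q (sact n \<sigma> \<epsilon> z) \<partial>torus_measure n)"
    unfolding wsum_def
    by (subst Bochner_Integration.integral_sum, simp add: tfun_integrable tfun_sum tfun_sact Q,
        rule sum.cong[OF refl], rule Bochner_Integration.integral_sum, simp add: tfun_integrable tfun_sact Q)
  also have "\<dots> = wsum n (\<lambda>_ _. \<integral>z. Q z \<partial>torus_measure n)"
    by (rule wsum_cong) (rule integral_sact(2)[OF _ _ mQ])
  also have "\<dots> = wsum n (\<lambda>_ _. 1) * (\<integral>z. Q z \<partial>torus_measure n)" by (rule wsum_const)
  finally show ?thesis .
qed

lemma torus_one_minus:
  assumes "norm q < 1" "z \<in> torus n" "j < n" "k < n"
  shows "1 - q * z j \<noteq> 0" "1 - q * inverse (z j) \<noteq> 0" "1 - q * (z j * z k) \<noteq> 0" "1 - q * (z j / z k) \<noteq> 0"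
    "1 - q * inverse (z j * z k) \<noteq> 0" "1 - q * inverse (z j / z k) \<noteq> 0"
  by (rule one_minus_mult_nonzero[OF assms(1)];
      simp add: torusD[OF assms(2,3)] torusD[OF assms(2,4)] norm_mult norm_divide norm_inverse)+

lemma tfun_inverse: "tfun n F \<Longrightarrow> (\<And>z. z \<in> torus n \<Longrightarrow> F z \<noteq> 0) \<Longrightarrow> tfun n (\<lambda>z. inverse (F z))"
  using tfun_divide[OF tfun_const[of n 1]] by (simp add: inverse_eq_divide)

lemma tfun_root_product:
  assumes \<alpha>: "\<And>j. j < n \<Longrightarrow> tfun n (\<lambda>z. \<alpha> (z j))"
    and \<beta>: "\<And>j k. j < n \<Longrightarrow> k < n \<Longrightarrow> tfun n (\<lambda>z. \<beta> (z j * z k))"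
           "\<And>j k. j < n \<Longrightarrow> k < n \<Longrightarrow> tfun n (\<lambda>z. \<beta> (z j / z k))"
  shows "tfun n (root_product n \<alpha> \<beta>)"
proof -
  have "tfun n (\<lambda>z. (\<Prod>j<n. \<alpha> (z j)) * (\<Prod>x\<in>idx_pairs n. \<beta> (z (fst x) * z (snd x)) * \<beta> (z (fst x) / z (snd x))))"
    by (intro tfun_mult tfun_prod \<alpha> \<beta>) auto
  then show ?thesis by (simp add: root_product_def[abs_def] case_prod_unfold)
qed

lemma torus_nz: "z \<in> torus n \<Longrightarrow> j < n \<Longrightarrow> z j \<noteq> 0"
  using torusD by force

lemma tfun_hl_delta:
  assumes "norm q < 1" "norm q0 < 1" shows "tfun n (hl_delta n q q0)"
  unfolding hl_delta_def
proof (rule tfun_root_product)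
  show "tfun n (\<lambda>z. delta_short q0 (z j))" if "j < n" for j
    unfolding delta_short_def
    by (intro tfun_divide tfun_mult tfun_diff tfun_const tfun_power tfun_inverse tfun_coord that)
       (use torus_one_minus[OF assms(2) _ that that] torus_nz that in auto)
  show "tfun n (\<lambda>z. delta_root q (z j * z k))" if "j < n" "k < n" for j k
    unfolding delta_root_def
    by (intro tfun_divide tfun_mult tfun_diff tfun_const tfun_inverse tfun_coord that)
       (use torus_one_minus[OF assms(1) _ that] torus_nz that in auto)
  show "tfun n (\<lambda>z. delta_root q (z j / z k))" if "j < n" "k < n" for j k
    unfolding delta_root_def
    by (intro tfun_divide tfun_mult tfun_diff tfun_const tfun_inverse tfun_coord that)
       (use torus_one_minus[OF assms(1) _ that] torus_nz that in auto)
qed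

lemma tfun_hl_r:
  assumes "norm q < 1" "norm q0 < 1" shows "tfun n (hl_r n q q0)"
proof -
  have "tfun n (\<lambda>z. (\<Prod>j<n. (1 - (z j)\<^sup>2) / (1 - q0 * z j)) *
     (\<Prod>x\<in>idx_pairs n. ((1 - z (fst x) / z (snd x)) / (1 - q * (z (fst x) / z (snd x)))) *
       ((1 - z (fst x) * z (snd x)) / (1 - q * (z (fst x) * z (snd x))))))"
    by (intro tfun_prod tfun_divide tfun_mult tfun_diff tfun_const tfun_power tfun_coord)
       (use torus_one_minus[OF assms(1)] torus_one_minus[OF assms(2)] torus_nz in auto)
  then show ?thesis by (simp add: hl_r_def[abs_def] case_prod_unfold)
qed

text \<open>Unfolding: against an invariant \<open>g\<close> all summands of
  \<open>hl_sum_delta\<close> have the same integral, so a single monomial times \<open>hl_r\<close>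
  is left, multiplied by the group order.\<close>

lemma integral_hl_unfold:
  assumes q: "norm q < 1" "norm q0 < 1"
    and p: "\<And>z. regular n z \<Longrightarrow> p z = hl_sum n q q0 \<nu> z"
    and g: "tfun n g" "wsym n g"
  shows "(\<integral>z. p z * g z * hl_delta n q q0 z \<partial>torus_measure n)
    = wsum n (\<lambda>_ _. 1) * (\<integral>z. lmono n \<nu> z * hl_r n q q0 z * g z \<partial>torus_measure n)"
proof -
  let ?Q = "\<lambda>z. lmono n \<nu> z * hl_r n q q0 z * g z"
  have "tfun n (\<lambda>z. 1 * lmono n \<nu> z)"
    by (rule tfun_laurent[of n "\<lambda>j. nat \<bar>\<nu> j\<bar>"], rule laurent_lmono) simp
  then have Q: "tfun n ?Q" by (intro tfun_mult tfun_hl_r q g) simp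
  have "(\<integral>z. p z * g z * hl_delta n q q0 z \<partial>torus_measure n)
     = (\<integral>z. wsum n (\<lambda>\<sigma> \<epsilon>. ?Q (sact n \<sigma> \<epsilon> z)) \<partial>torus_measure n)"
  proof (rule Bochner_Integration.integral_cong[OF refl])
    fix z assume "z \<in> space (torus_measure n)"
    then have z: "z \<in> torus n" by simp
    have "p z * g z * hl_delta n q q0 z = (p z * hl_delta n q q0 z) * g z" by (simp only: ac_simps)
    also have "\<dots> = wsum n (\<lambda>\<sigma> \<epsilon>. lmono n \<nu> (sact n \<sigma> \<epsilon> z) * hl_r n q q0 (sact n \<sigma> \<epsilon> z) * g z)"
      by (simp only: hl_sum_delta[OF z q p] wsum_mult_right)
    also have "\<dots> = wsum n (\<lambda>\<sigma> \<epsilon>. ?Q (sact n \<sigma> \<epsilon> z))"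
      by (rule wsum_cong) (use g(2) torus_nzvecs[OF z] in \<open>simp add: wsym_def\<close>)
    finally show "p z * g z * hl_delta n q q0 z = wsum n (\<lambda>\<sigma> \<epsilon>. ?Q (sact n \<sigma> \<epsilon> z))" .
  qed
  then show ?thesis using integral_wsum_sact[OF Q] by simp
qed

lemma laurent_tscale_holomorphic:
  assumes "laurent n D F" "z \<in> nzvecs n" "0 \<notin> S"
  shows "(\<lambda>t. F (tscale n \<theta> t z)) holomorphic_on S"
  using assms(1)
proof (induction rule: laurent.induct)
  have nz: "tscale n \<theta> t z \<in> nzvecs n" if "t \<in> S" for t
    using that assms(2,3) by (auto simp: nzvecs_def tscale_def)
  {
    case (zero F)
    show ?case by (rule holomorphic_transform[of "\<lambda>_. 0"]) (use zero nz in auto)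
  next
    case (step F \<nu> G c)
    have "(\<lambda>t. \<Prod>j<n. (t powi \<theta> j * z j) powi \<nu> j) holomorphic_on S"
      by (intro holomorphic_on_prod holomorphic_on_power_int holomorphic_intros) (use assms in \<open>auto simp: nzvecs_def\<close>)
    then have "(\<lambda>t. F (tscale n \<theta> t z) + c * lmono n \<nu> (tscale n \<theta> t z)) holomorphic_on S"
      by (intro holomorphic_intros step.IH) (simp add: lmono_def tscale_def)
    then show ?case by (rule holomorphic_transform) (use step.hyps(3) nz in auto)
  }
qed

lemma lmono_tscale:
  assumes "t \<noteq> 0" shows "lmono n \<nu> (tscale n \<theta> t z) = t powi (\<Sum>j<n. \<theta> j * \<nu> j) * lmono n \<nu> z"
proof -
  have "lmono n \<nu> (tscale n \<theta> t z) = (\<Prod>j<n. t powi (\<theta> j * \<nu> j) * z j powi \<nu> j)"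
    unfolding lmono_def by (rule prod.cong) (simp_all add: tscale_def power_int_mult_distrib power_int_mult)
  then show ?thesis by (simp add: prod.distrib prod_power_int_sum[OF assms] lmono_def)
qed

section \<open>Scaling a torus point along the staircase\<close>

context
  fixes n :: nat and z :: "nat \<Rightarrow> complex"
  assumes z: "z \<in> torus n"
begin

abbreviation (input) "rho_scale t \<equiv> tscale n (\<lambda>j. int (n - j)) t z"

lemma norm_rho_scale: "j < n \<Longrightarrow> norm (rho_scale t j) = norm t ^ (n - j)"
  by (simp add: tscale_def norm_mult torusD[OF z] norm_power)

lemma rho_scale_nz: "t \<noteq> 0 \<Longrightarrow> j < n \<Longrightarrow> rho_scale t j \<noteq> 0"
  using norm_rho_scale[of j t] by auto

lemma rho_scale_ratio:
  "t \<noteq> 0 \<Longrightarrow> j < n \<Longrightarrow> k < n \<Longrightarrow> rho_scale t j / rho_scale t k = z j / z k * t powi (int k - int j)"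
proof -
  assume t: "t \<noteq> 0" and jk: "j < n" "k < n"
  have "t powi (int k - int j) = t powi (int (n - j) - int (n - k))" using jk by (simp add: of_nat_diff)
  also have "\<dots> = t powi int (n - j) / t powi int (n - k)" using t by (simp add: power_int_diff)
  finally show ?thesis using jk by (simp add: tscale_def mult.commute del: of_nat_diff)
qed

lemma rho_scale_mult:
  "j < n \<Longrightarrow> k < n \<Longrightarrow> rho_scale t j * rho_scale t k = z j * z k * t powi int ((n - j) + (n - k))"
  by (simp only: tscale_def restrict_apply lessThan_iff if_True power_int_of_nat power_add ac_simps)

lemma regular_rho_scale:
  assumes t: "t \<noteq> 0" "norm t < 1" shows "regular n (rho_scale t)"
proof -
  have lt: "norm (rho_scale t j) < 1" if "j < n" for j
    using t that by (simp add: norm_rho_scale power_less_one_iff)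
  have lt': "norm (rho_scale t j) < norm (rho_scale t k)" if "j < k" "k < n" for j k
    using t that by (simp add: norm_rho_scale power_strict_decreasing)
  have sq: "(rho_scale t j)\<^sup>2 \<noteq> 1" if "j < n" for j
  proof
    assume "(rho_scale t j)\<^sup>2 = 1"
    then have "norm (rho_scale t j) = 1" by (metis norm_one norm_power power2_eq_1_iff norm_ge_zero not_one_le_zero power2_eq_iff_nonneg one_power2 zero_le_one)
    then show False using lt[OF that] by simp
  qed
  have pr: "rho_scale t j * rho_scale t k \<noteq> 1" if "j < n" "k < n" for j k
  proof
    assume "rho_scale t j * rho_scale t k = 1"
    then have "norm (rho_scale t j) * norm (rho_scale t k) = 1" by (metis norm_mult norm_one)
    moreover have "norm (rho_scale t j) * norm (rho_scale t k) < 1 * 1"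
      by (rule mult_strict_mono) (use lt that in auto)
    ultimately show False by simp
  qed
  have ne: "rho_scale t j \<noteq> rho_scale t k" if "j < n" "k < n" "j \<noteq> k" for j k
    using lt'[of j k] lt'[of k j] that by (metis less_irrefl nat_neq_iff)
  show ?thesis unfolding regular_def using sq pr ne rho_scale_nz[OF t(1)] by blast
qed

lemma hl_r_rho_scale_limit:
  "((\<lambda>t. hl_r n q q0 (rho_scale t)) \<longlongrightarrow> 1) (at 0)"
proof -
  have f: "((\<lambda>t. (1 - u * t powi e) / (1 - q * (u * t powi e))) \<longlongrightarrow> 1) (at 0)" if "e > 0" for u e
  proof -
    have "((\<lambda>t. (1 - u * t powi e) / (1 - q * (u * t powi e))) \<longlongrightarrow> (1 - u * 0) / (1 - q * (u * 0))) (at 0)"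
      by (intro tendsto_intros tendsto_powi_zero that) simp
    then show ?thesis by simp
  qed
  have A: "((\<lambda>t. \<Prod>j<n. (1 - (rho_scale t j)\<^sup>2) / (1 - q0 * rho_scale t j)) \<longlongrightarrow> (\<Prod>j<n. 1)) (at 0)"
  proof (rule tendsto_prod)
    fix j assume "j \<in> {..<n}"
    then have j: "j < n" by simp
    have "((\<lambda>t. t powi int (n - j) * z j) \<longlongrightarrow> 0 * z j) (at 0)"
      by (intro tendsto_intros tendsto_powi_zero) (use j in simp)
    then have x: "((\<lambda>t. rho_scale t j) \<longlongrightarrow> 0) (at 0)" using j by (simp add: tscale_def del: of_nat_diff)
    have "((\<lambda>t. (1 - (rho_scale t j)\<^sup>2) / (1 - q0 * rho_scale t j)) \<longlongrightarrow> (1 - 0\<^sup>2) / (1 - q0 * 0)) (at 0)"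
      by (intro tendsto_intros x) simp
    then show "((\<lambda>t. (1 - (rho_scale t j)\<^sup>2) / (1 - q0 * rho_scale t j)) \<longlongrightarrow> 1) (at 0)" by simp
  qed
  let ?f = "\<lambda>e u t. (1 - u * t powi e) / (1 - q * (u * t powi e))"
  have B: "((\<lambda>t. \<Prod>(j,k)\<in>idx_pairs n. ?f (int k - int j) (z j / z k) t * ?f (int ((n - j) + (n - k))) (z j * z k) t)
     \<longlongrightarrow> (\<Prod>(j,k)\<in>idx_pairs n. 1 * 1)) (at 0)"
    unfolding case_prod_unfold
  proof (rule tendsto_prod)
    fix x assume "x \<in> idx_pairs n"
    then have x: "fst x < snd x" "snd x < n" by (cases x, simp)+
    show "((\<lambda>t. ?f (int (snd x) - int (fst x)) (z (fst x) / z (snd x)) t *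
       ?f (int ((n - fst x) + (n - snd x))) (z (fst x) * z (snd x)) t) \<longlongrightarrow> 1 * 1) (at 0)"
      by (intro tendsto_mult f) (use x in auto)
  qed
  have "((\<lambda>t. (\<Prod>j<n. (1 - (rho_scale t j)\<^sup>2) / (1 - q0 * rho_scale t j)) *
     (\<Prod>(j,k)\<in>idx_pairs n. ?f (int k - int j) (z j / z k) t * ?f (int ((n - j) + (n - k))) (z j * z k) t)) \<longlongrightarrow> 1) (at 0)"
    using tendsto_mult[OF A B] by (simp add: case_prod_unfold)
  moreover have "(\<Prod>j<n. (1 - (rho_scale t j)\<^sup>2) / (1 - q0 * rho_scale t j)) *
     (\<Prod>(j,k)\<in>idx_pairs n. ?f (int k - int j) (z j / z k) t * ?f (int ((n - j) + (n - k))) (z j * z k) t)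
     = hl_r n q q0 (rho_scale t)" if t: "t \<noteq> 0" for t
    unfolding hl_r_def
  proof (intro arg_cong2[where f = "(*)"] refl prod.cong, clarify)
    fix j k assume "(j, k) \<in> idx_pairs n"
    then have jk: "j < n" "k < n" by auto
    show "?f (int k - int j) (z j / z k) t * ?f (int ((n - j) + (n - k))) (z j * z k) t
      = ((1 - rho_scale t j / rho_scale t k) / (1 - q * (rho_scale t j / rho_scale t k))) *
        ((1 - rho_scale t j * rho_scale t k) / (1 - q * (rho_scale t j * rho_scale t k)))"
      unfolding rho_scale_ratio[OF t jk] rho_scale_mult[OF jk] ..
  qed
  then have "eventually (\<lambda>t. (\<Prod>j<n. (1 - (rho_scale t j)\<^sup>2) / (1 - q0 * rho_scale t j)) *
     (\<Prod>(j,k)\<in>idx_pairs n. ?f (int k - int j) (z j / z k) t * ?f (int ((n - j) + (n - k))) (z j * z k) t)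
     = hl_r n q q0 (rho_scale t)) (at 0)"
    unfolding eventually_at_filter by (intro always_eventually allI impI)
  ultimately show ?thesis by (rule Lim_transform_eventually)
qed

text \<open>The scaled moduli \<open>norm t ^ (n - j)\<close> are at most 1 and do not decrease with
  \<open>j\<close>. Hence every argument multiplied by \<open>q\<close> or \<open>q0\<close> in a
  denominator of \<open>hl_r\<close> stays in the closed unit disc.\<close>

lemma hl_r_rho_scale_holomorphic:
  assumes q: "norm q < 1" "norm q0 < 1"
  shows "(\<lambda>t. hl_r n q q0 (rho_scale t)) holomorphic_on (cball 0 1 - {0})"
proof -
  have c: "(\<lambda>t. rho_scale t j) holomorphic_on (cball 0 1 - {0})" if "j < n" for j
    using that by (simp add: tscale_def) (intro holomorphic_intros)
  have le: "norm (rho_scale t j) \<le> 1" if "t \<in> cball 0 1" "j < n" for t j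
    using that by (simp add: norm_rho_scale power_le_one)
  have d0: "1 - q0 * rho_scale t j \<noteq> 0" if "t \<in> cball 0 1 - {0}" "j < n" for t j
    by (rule one_minus_mult_nonzero[OF q(2)]) (use that le in auto)
  have d1: "1 - q * (rho_scale t j / rho_scale t k) \<noteq> 0" if "t \<in> cball 0 1 - {0}" "j < k" "k < n" for t j k
  proof (rule one_minus_mult_nonzero[OF q(1)])
    have "norm t ^ (n - j) \<le> norm t ^ (n - k)" using that by (intro power_decreasing) auto
    moreover have "0 < norm t ^ (n - k)" using that by simp
    ultimately show "norm (rho_scale t j / rho_scale t k) \<le> 1"
      using that by (simp add: norm_divide norm_rho_scale)
  qed
  have d2: "1 - q * (rho_scale t j * rho_scale t k) \<noteq> 0" if "t \<in> cball 0 1 - {0}" "j < k" "k < n" for t j k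
  proof (rule one_minus_mult_nonzero[OF q(1)])
    have "norm (rho_scale t j) * norm (rho_scale t k) \<le> 1 * 1"
      by (rule mult_mono) (use that le in auto)
    then show "norm (rho_scale t j * rho_scale t k) \<le> 1" by (simp add: norm_mult)
  qed
  have "(\<lambda>t. (\<Prod>j<n. (1 - (rho_scale t j)\<^sup>2) / (1 - q0 * rho_scale t j)) *
     (\<Prod>x\<in>idx_pairs n. ((1 - rho_scale t (fst x) / rho_scale t (snd x)) / (1 - q * (rho_scale t (fst x) / rho_scale t (snd x)))) *
       ((1 - rho_scale t (fst x) * rho_scale t (snd x)) / (1 - q * (rho_scale t (fst x) * rho_scale t (snd x))))))
     holomorphic_on (cball 0 1 - {0})"
    by (intro holomorphic_on_prod holomorphic_intros c)
       (use d0 d1 d2 rho_scale_nz in auto)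
  then show ?thesis by (simp add: hl_r_def case_prod_unfold)
qed

end

text \<open>Scaling weighs the power \<open>b\<close> of \<open>t\<close> from the monomial against
  the power \<open>-a\<close> with which \<open>p\<close> can grow. If \<open>b > a\<close> the
  limit is 0. If \<open>b = a\<close> it is a multiple of the monomial with exponents
  \<open>\<mu> j - \<nu> j\<close>, whose integral vanishes unless all of them are 0.\<close>

lemma hl_orthogonality_triangular:
  fixes \<mu> \<nu> :: "nat \<Rightarrow> int"
  assumes q: "norm q < 1" "norm q0 < 1"
    and p: "laurent n D p" "\<And>z. regular n z \<Longrightarrow> p z = hl_sum n q q0 \<nu> z"
    and mono: "\<And>j k. j \<le> k \<Longrightarrow> k < n \<Longrightarrow> \<nu> k \<le> \<nu> j" and nonneg: "\<And>j. j < n \<Longrightarrow> 0 \<le> \<nu> j"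
    and le: "(\<Sum>j<n. int (n - j) * \<nu> j) \<le> (\<Sum>j<n. int (n - j) * \<mu> j)"
  shows "(\<integral>z. lmono n \<mu> z * hl_r n q q0 z * p z \<partial>torus_measure n) =
    (if \<forall>j<n. \<mu> j = \<nu> j then \<Sum>\<sigma>\<in>{\<sigma>. \<sigma> permutes {..<n} \<and> (\<forall>j<n. \<nu> (\<sigma> j) = \<nu> j)}. inv_weight n q \<sigma> else 0)"
proof -
  let ?\<rho> = "\<lambda>j. int (n - j)"
  define c where "c = (\<Sum>\<sigma>\<in>{\<sigma>. \<sigma> permutes {..<n} \<and> (\<forall>j<n. \<nu> (\<sigma> j) = \<nu> j)}. inv_weight n q \<sigma>)"
  define a where "a = (\<Sum>j<n. ?\<rho> j * \<nu> j)"
  define b where "b = (\<Sum>j<n. ?\<rho> j * \<mu> j)"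
  have ab: "a \<le> b" using le by (simp add: a_def b_def)
  let ?H = "\<lambda>z. lmono n \<mu> z * hl_r n q q0 z * p z"
  let ?g = "\<lambda>z. (if b - a = 0 then lmono n \<mu> z else 0) * 1 * (c * lmono n (\<lambda>j. - \<nu> j) z)"
  have lmu: "laurent n (\<lambda>j. nat \<bar>\<mu> j\<bar>) (lmono n \<mu>)" using laurent_lmono[of n \<mu> "\<lambda>j. nat \<bar>\<mu> j\<bar>" 1] by simp
  have "(\<integral>z. ?H z \<partial>torus_measure n) = (\<integral>z. ?g z \<partial>torus_measure n)"
  proof (rule torus_mean[where \<theta> = ?\<rho> and G = "\<lambda>z t. ?H (tscale n ?\<rho> t z)"])
    show "tfun n ?H" by (intro tfun_mult tfun_hl_r q tfun_laurent[OF p(1)] tfun_laurent[OF lmu])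
  next
    fix z assume z: "z \<in> torus n"
    show "(\<lambda>t. ?H (tscale n ?\<rho> t z)) holomorphic_on (cball 0 1 - {0})"
      by (intro holomorphic_intros laurent_tscale_holomorphic[OF lmu] laurent_tscale_holomorphic[OF p(1)]
          hl_r_rho_scale_holomorphic z q torus_nzvecs) auto
    have "((\<lambda>t. (t powi (b - a) * lmono n \<mu> z) * hl_r n q q0 (tscale n ?\<rho> t z) *
        (t powi a * hl_sum n q q0 \<nu> (tscale n ?\<rho> t z))) \<longlongrightarrow> ?g z) (at 0)"
      unfolding a_def c_def
      by (intro tendsto_mult hl_sum_limit torus_nzvecs z hl_r_rho_scale_limit tendsto_powi_nonneg mono nonneg)
         (use ab a_def in auto)
    \<comment> \<open>The condition \<open>norm t < 1\<close> makes the scaled point regular, which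
      is where \<open>p\<close> is known to be \<open>hl_sum\<close>.\<close>
    moreover have "(t powi (b - a) * lmono n \<mu> z) * hl_r n q q0 (tscale n ?\<rho> t z) *
        (t powi a * hl_sum n q q0 \<nu> (tscale n ?\<rho> t z)) = ?H (tscale n ?\<rho> t z)" if t: "t \<noteq> 0" "norm t < 1" for t
    proof -
      have "t powi (b - a) * t powi a = t powi b" using t by (simp flip: power_int_add)
      moreover have "p (tscale n ?\<rho> t z) = hl_sum n q q0 \<nu> (tscale n ?\<rho> t z)"
        by (rule p(2)[OF regular_rho_scale[OF z t]])
      moreover have "lmono n \<mu> (tscale n ?\<rho> t z) = t powi b * lmono n \<mu> z"
        unfolding b_def by (rule lmono_tscale[OF t(1)])
      moreover have "(t powi (b - a) * lmono n \<mu> z) * r * (t powi a * s) = (t powi (b - a) * t powi a) * lmono n \<mu> z * r * s" for r s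
        by (simp only: ac_simps)
      ultimately show ?thesis by presburger
    qed
    then have "eventually (\<lambda>t. (t powi (b - a) * lmono n \<mu> z) * hl_r n q q0 (tscale n ?\<rho> t z) *
        (t powi a * hl_sum n q q0 \<nu> (tscale n ?\<rho> t z)) = ?H (tscale n ?\<rho> t z)) (at 0)"
      unfolding eventually_at by (intro exI[of _ 1]) (auto simp: dist_norm)
    ultimately show "((\<lambda>t. ?H (tscale n ?\<rho> t z)) \<longlongrightarrow> ?g z) (at 0)"
      by (rule Lim_transform_eventually)
  qed simp
  also have "\<dots> = (\<integral>z. (if b - a = 0 then c else 0) * lmono n (\<lambda>j. \<mu> j - \<nu> j) z \<partial>torus_measure n)"
    by (rule Bochner_Integration.integral_cong[OF refl])
       (use lmono_mult[OF torus_nzvecs, of _ n \<mu> "\<lambda>j. - \<nu> j"] in auto)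
  also have "\<dots> = (if b - a = 0 then c else 0) * (if \<forall>j<n. \<mu> j - \<nu> j = 0 then 1 else 0)"
    by (simp only: Bochner_Integration.integral_mult_right_zero integral_lmono)
  also have "\<dots> = (if \<forall>j<n. \<mu> j = \<nu> j then c else 0)"
  proof -
    have "b = a" if "\<forall>j<n. \<mu> j = \<nu> j" using that by (simp add: a_def b_def)
    then show ?thesis by auto
  qed
  finally show ?thesis by (simp only: c_def)
qed

text \<open>Any two weights are comparable by their inner product with the staircase, and the
  integrand is symmetric in the two polynomials, so one of the two orders is triangular. The pairing
  carries no conjugate because these polynomials are real on the torus.\<close>

lemma hl_orthogonality:
  fixes \<mu> \<nu> :: "nat \<Rightarrow> int"
  assumes q: "norm q < 1" "norm q0 < 1"
    and p\<mu>: "laurent n D p" "wsym n p" "\<And>z. regular n z \<Longrightarrow> p z = hl_sum n q q0 \<mu> z"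
    and p\<nu>: "laurent n D p'" "wsym n p'" "\<And>z. regular n z \<Longrightarrow> p' z = hl_sum n q q0 \<nu> z"
    and \<mu>: "\<And>j k. j \<le> k \<Longrightarrow> k < n \<Longrightarrow> \<mu> k \<le> \<mu> j" "\<And>j. j < n \<Longrightarrow> 0 \<le> \<mu> j"
    and \<nu>: "\<And>j k. j \<le> k \<Longrightarrow> k < n \<Longrightarrow> \<nu> k \<le> \<nu> j" "\<And>j. j < n \<Longrightarrow> 0 \<le> \<nu> j"
  shows "(\<integral>z. p z * p' z * hl_delta n q q0 z \<partial>torus_measure n) = wsum n (\<lambda>_ _. 1) *
    (if \<forall>j<n. \<mu> j = \<nu> j then \<Sum>\<sigma>\<in>{\<sigma>. \<sigma> permutes {..<n} \<and> (\<forall>j<n. \<nu> (\<sigma> j) = \<nu> j)}. inv_weight n q \<sigma> else 0)"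
proof (cases "(\<Sum>j<n. int (n - j) * \<nu> j) \<le> (\<Sum>j<n. int (n - j) * \<mu> j)")
  case True
  then show ?thesis
    using integral_hl_unfold[OF q p\<mu>(3) tfun_laurent[OF p\<nu>(1)] p\<nu>(2)]
      hl_orthogonality_triangular[OF q p\<nu>(1,3) \<nu> True] by simp
next
  case False
  then have le: "(\<Sum>j<n. int (n - j) * \<mu> j) \<le> (\<Sum>j<n. int (n - j) * \<nu> j)" by simp
  have ne: "\<not> (\<forall>j<n. \<mu> j = \<nu> j)"
  proof
    assume "\<forall>j<n. \<mu> j = \<nu> j"
    then have "(\<Sum>j<n. int (n - j) * \<nu> j) = (\<Sum>j<n. int (n - j) * \<mu> j)" by (intro sum.cong) auto
    then show False using False by simp
  qed
  then have ne': "\<not> (\<forall>j<n. \<nu> j = \<mu> j)" by auto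
  have "(\<integral>z. p' z * p z * hl_delta n q q0 z \<partial>torus_measure n) = 0"
    using integral_hl_unfold[OF q p\<nu>(3) tfun_laurent[OF p\<mu>(1)] p\<mu>(2)]
      hl_orthogonality_triangular[OF q p\<mu>(1,3) \<mu> le] ne' by simp
  then show ?thesis unfolding if_not_P[OF ne] by (simp add: mult.commute[of "p _" "p' _"])
qed

section \<open>Bethe functions and their concentration kernels\<close>

text \<open>A Blaschke factor: unimodular on the circle, holomorphic on the closed disc, and with
  its zero at \<open>q\<close>, exactly where \<open>delta_root q\<close> has its pole inside the
  disc.\<close>

definition psi :: "real \<Rightarrow> complex \<Rightarrow> complex" where
  "psi q x = (x - of_real q) / (1 - of_real q * x)"

lemma circle_one_minus:
  fixes q :: real and x :: complex assumes "\<bar>q\<bar> < 1" "norm x = 1"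
  shows "1 - of_real q * x \<noteq> 0" "1 - of_real q * inverse x \<noteq> 0" "x - of_real q \<noteq> 0" "x \<noteq> 0"
proof -
  show "1 - of_real q * x \<noteq> 0" "1 - of_real q * inverse x \<noteq> 0"
    by (rule one_minus_mult_nonzero; use assms in \<open>simp add: norm_inverse\<close>)+
  show "x - of_real q \<noteq> 0" "x \<noteq> 0"
    using assms by auto
qed

lemma norm_psi: assumes "\<bar>q\<bar> < 1" "norm x = 1" shows "norm (psi q x) = 1"
proof -
  have "1 - of_real q * x = x * cnj (x - of_real q)"
    using complex_norm_square[of x] assms(2) by (simp add: algebra_simps)
  then have "norm (1 - of_real q * x) = norm (x - of_real q)"
    using assms(2) by (simp only: norm_mult complex_mod_cnj)
  then show ?thesis using circle_one_minus[OF assms] by (simp add: psi_def norm_divide)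
qed

lemma psi_nonzero: "\<bar>q\<bar> < 1 \<Longrightarrow> norm x = 1 \<Longrightarrow> psi q x \<noteq> 0"
  using norm_psi by force

lemma psi_inverse: assumes "\<bar>q\<bar> < 1" "norm x = 1" shows "psi q (inverse x) = inverse (psi q x)"
proof -
  have "inverse x - of_real q = (1 - of_real q * x) * inverse x"
    and "1 - of_real q * inverse x = (x - of_real q) * inverse x"
    using circle_one_minus(4)[OF assms] by (simp_all add: field_simps)
  then show ?thesis using circle_one_minus[OF assms] by (simp add: psi_def)
qed

lemma psi_divide_swap: "\<bar>q\<bar> < 1 \<Longrightarrow> norm x = 1 \<Longrightarrow> norm y = 1 \<Longrightarrow> psi q (y / x) = inverse (psi q (x / y))"
  using psi_inverse[of q "x / y"] by (simp add: norm_divide inverse_divide)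

lemma psi_holomorphic: assumes "\<bar>q\<bar> < 1" shows "psi q holomorphic_on (cball 0 1)"
  unfolding psi_def[abs_def]
  by (intro holomorphic_intros) (use one_minus_mult_nonzero[of "of_real q"] assms in auto)

locale bethe_system =
  fixes n m :: nat and q q0 q1 :: real
  assumes q: "\<bar>q\<bar> < 1" "\<bar>q0\<bar> < 1" "\<bar>q1\<bar> < 1"
begin

definition single_factor :: "complex \<Rightarrow> complex" where
  "single_factor x = x ^ (2 * (m + 1)) * psi q0 x * psi q1 x"

definition bethe :: "nat \<Rightarrow> (nat \<Rightarrow> complex) \<Rightarrow> complex" where
  "bethe j z = single_factor (z j) * (\<Prod>l\<in>{..<n} - {j}. psi q (z j * z l) * psi q (z j / z l))"

definition bmono :: "(nat \<Rightarrow> int) \<Rightarrow> (nat \<Rightarrow> complex) \<Rightarrow> complex" where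
  "bmono k z = (\<Prod>j<n. bethe j z powi k j)"

lemma norm_single_factor: "norm x = 1 \<Longrightarrow> norm (single_factor x) = 1"
  using norm_psi q by (simp add: single_factor_def norm_mult norm_power)

lemma single_factor_inverse: "norm x = 1 \<Longrightarrow> single_factor (inverse x) = inverse (single_factor x)"
  using psi_inverse q by (simp add: single_factor_def power_inverse)

lemma norm_bethe:
  assumes "z \<in> torus n" "j < n" shows "norm (bethe j z) = 1"
  unfolding bethe_def norm_mult prod_norm[symmetric]
  using assms torusD[OF assms(1)] norm_single_factor q
  by (auto simp: norm_psi norm_mult norm_divide intro!: prod.neutral)

lemma bethe_nonzero: "z \<in> torus n \<Longrightarrow> j < n \<Longrightarrow> bethe j z \<noteq> 0"
  using norm_bethe by force

text \<open>Makes the common solutions of \<open>bethe j z = 1\<close> stable under signed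
  permutations, and allows an exponent vector of \<open>bmono\<close> to be moved into dominant
  position.\<close>

lemma bethe_sact:
  assumes z: "z \<in> torus n" and s: "\<sigma> permutes {..<n}" and e: "\<epsilon> \<in> signs n" and j: "j < n"
  shows "bethe j (sact n \<sigma> \<epsilon> z) = bethe (\<sigma> j) z powi \<epsilon> j"
proof -
  let ?y = "sact n \<sigma> \<epsilon> z"
  have n1: "norm (z (\<sigma> l)) = 1" if "l < n" for l using torusD[OF z permutes_lessThan_less[OF s that]] .
  have A: "single_factor (?y j) = single_factor (z (\<sigma> j)) powi \<epsilon> j"
    using signsD[OF e j] j single_factor_inverse[OF n1[OF j]] by (auto simp: sact_apply)
  have B: "psi q (?y j * ?y l) * psi q (?y j / ?y l) = (psi q (z (\<sigma> j) * z (\<sigma> l)) * psi q (z (\<sigma> j) / z (\<sigma> l))) powi \<epsilon> j"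
    if l: "l < n" for l
  proof -
    have i1: "psi q (inverse (z (\<sigma> j) * z (\<sigma> l))) = inverse (psi q (z (\<sigma> j) * z (\<sigma> l)))"
      by (rule psi_inverse[OF q(1)]) (simp add: n1 j l norm_mult)
    have i2: "psi q (inverse (z (\<sigma> j) / z (\<sigma> l))) = inverse (psi q (z (\<sigma> j) / z (\<sigma> l)))"
      by (rule psi_inverse[OF q(1)]) (simp add: n1 j l norm_divide)
    show ?thesis
      using signsD[OF e j] signsD[OF e l] j l i1 i2
      by (auto simp: sact_apply divide_inverse mult.commute)
  qed
  have img: "\<sigma> ` ({..<n} - {j}) = {..<n} - {\<sigma> j}"
    using permutes_image[OF s] permutes_inj[OF s] by (simp add: image_set_diff)
  have "(\<Prod>l\<in>{..<n} - {j}. psi q (?y j * ?y l) * psi q (?y j / ?y l))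
      = (\<Prod>l\<in>{..<n} - {j}. (psi q (z (\<sigma> j) * z (\<sigma> l)) * psi q (z (\<sigma> j) / z (\<sigma> l))) powi \<epsilon> j)"
    by (rule prod.cong[OF refl], rule B) simp
  also have "\<dots> = (\<Prod>l\<in>\<sigma> ` ({..<n} - {j}). (psi q (z (\<sigma> j) * z l) * psi q (z (\<sigma> j) / z l)) powi \<epsilon> j)"
    by (subst prod.reindex) (use permutes_inj[OF s] in \<open>auto intro: inj_on_subset\<close>)
  also have "\<dots> = (\<Prod>l\<in>{..<n} - {\<sigma> j}. psi q (z (\<sigma> j) * z l) * psi q (z (\<sigma> j) / z l)) powi \<epsilon> j"
    unfolding img using signsD[OF e j] by (auto simp: prod_inversef[symmetric] comp_def)
  finally show ?thesis unfolding bethe_def A by (simp add: power_int_mult_distrib)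
qed

lemma prod_powi: "(\<Prod>i\<in>A. f i) powi k = (\<Prod>i\<in>A. f i powi k :: complex)"
  by (induction A rule: infinite_finite_induct) (auto simp: power_int_mult_distrib)

text \<open>Because \<open>psi q\<close> turns inversion into inversion, the two occurrences of a
  pair combine to the exponents \<open>k j + k l\<close> and \<open>k j - k l\<close>. For a
  nonnegative decreasing \<open>k\<close> both are nonnegative, the sign required for zeros of
  \<open>psi q\<close> to cancel poles of the weight.\<close>

lemma bmono_expand:
  assumes z: "z \<in> torus n"
  shows "bmono k z = (\<Prod>j<n. single_factor (z j) powi k j) *
     (\<Prod>(j,l)\<in>idx_pairs n. psi q (z j * z l) powi (k j + k l) * psi q (z j / z l) powi (k j - k l))"
proof -
  let ?X = "\<lambda>j l. (psi q (z j * z l) * psi q (z j / z l)) powi k j"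
  have "(\<Prod>j<n. (\<Prod>l\<in>{..<n} - {j}. psi q (z j * z l) * psi q (z j / z l)) powi k j)
     = (\<Prod>(j,l)\<in>idx_pairs n. ?X j l * ?X l j)"
    unfolding prod_powi by (rule prod_off_diagonal)
  also have "\<dots> = (\<Prod>(j,l)\<in>idx_pairs n. psi q (z j * z l) powi (k j + k l) * psi q (z j / z l) powi (k j - k l))"
  proof (rule prod.cong[OF refl], clarify)
    fix j l assume "(j,l) \<in> idx_pairs n"
    then have n1: "norm (z j) = 1" "norm (z l) = 1" using torusD[OF z] by auto
    have nz: "psi q (z j * z l) \<noteq> 0" "psi q (z j / z l) \<noteq> 0"
      by (rule psi_nonzero[OF q(1)]; simp add: n1 norm_mult norm_divide)+
    have gen: "(P * Q) powi a * (P * inverse Q) powi b = P powi (a + b) * Q powi (a - b)"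
      if "P \<noteq> 0" "Q \<noteq> 0" for P Q :: complex and a b
      using that by (simp add: power_int_mult_distrib power_int_add power_int_diff power_int_inverse divide_inverse)
    show "?X j l * ?X l j = psi q (z j * z l) powi (k j + k l) * psi q (z j / z l) powi (k j - k l)"
      unfolding psi_divide_swap[OF q(1) n1] mult.commute[of "z l" "z j"] by (rule gen[OF nz])
  qed
  finally show ?thesis by (simp add: bmono_def bethe_def power_int_mult_distrib prod.distrib)
qed

lemma tfun_psi:
  assumes "\<bar>c\<bar> < 1" "tfun n F" "\<And>z. z \<in> torus n \<Longrightarrow> norm (F z) = 1" shows "tfun n (\<lambda>z. psi c (F z))"
  unfolding psi_def
  by (intro tfun_divide tfun_diff tfun_mult tfun_const assms(2)) (use circle_one_minus[OF assms(1,3)] in auto)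

lemma tfun_bethe: assumes "j < n" shows "tfun n (bethe j)"
  unfolding bethe_def[abs_def] single_factor_def
  by (intro tfun_mult tfun_prod tfun_psi tfun_power tfun_coord tfun_divide q)
     (use assms torusD torus_nz in \<open>auto simp: norm_mult norm_divide\<close>)

lemma tfun_bmono: "tfun n (bmono k)"
  unfolding bmono_def[abs_def]
  by (intro tfun_prod tfun_powi tfun_bethe) (use bethe_nonzero in auto)

text \<open>When the largest entries of \<open>k\<close> sit in the first places, scaling exactly those coordinates
  by \<open>t\<close> turns the integrand into a holomorphic function of \<open>t\<close> on the closed unit disc that
  vanishes at \<open>t = 0\<close>: the poles of the weight are cancelled by zeros of the Bethe factors.\<close>

lemma integral_bmono_dominant:
  assumes \<alpha>: "\<And>j e. j < n \<Longrightarrow> 1 \<le> e \<Longrightarrow> \<exists>S. S holomorphic_on cball 0 1 \<and>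
      (\<forall>x\<in>sphere 0 1. x powi \<eta> j * \<alpha> x * single_factor x powi e = x * S x)"
    and \<beta>: "\<And>e. 1 \<le> e \<Longrightarrow> \<exists>R. R holomorphic_on cball 0 1 \<and> (\<forall>x\<in>sphere 0 1. \<beta> x * psi q x powi e = R x)"
    and tf: "tfun n (root_product n \<alpha> \<beta>)"
    and k: "\<And>j l. j \<le> l \<Longrightarrow> l < n \<Longrightarrow> k l \<le> k j" "\<And>j. j < n \<Longrightarrow> 0 \<le> k j" and k0: "0 < n" "0 < k 0"
  shows "(\<integral>z. lmono n \<eta> z * root_product n \<alpha> \<beta> z * bmono k z \<partial>torus_measure n) = 0"
proof -
  define S where "S j = (SOME S. S holomorphic_on cball 0 1 \<and>
      (\<forall>x\<in>sphere 0 1. x powi \<eta> j * \<alpha> x * single_factor x powi k 0 = x * S x))" for j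
  have S: "S j holomorphic_on cball 0 1" "\<And>x. norm x = 1 \<Longrightarrow> x powi \<eta> j * \<alpha> x * single_factor x powi k 0 = x * S j x"
    if "j < n" for j
    using someI_ex[OF \<alpha>[OF that, of "k 0"]] k0 unfolding S_def[symmetric] by auto
  define R where "R e = (SOME R. R holomorphic_on cball 0 1 \<and> (\<forall>x\<in>sphere 0 1. \<beta> x * psi q x powi e = R x))" for e
  have R: "R e holomorphic_on cball 0 1" "\<And>x. norm x = 1 \<Longrightarrow> \<beta> x * psi q x powi e = R e x" if "1 \<le> e" for e
    using someI_ex[OF \<beta>[OF that]] unfolding R_def[symmetric] by auto
  define top where "top j \<longleftrightarrow> k j = k 0" for j
  define \<theta> where "\<theta> j = (if top j then 1 else 0 :: int)" for j
  \<comment> \<open>The extra factor \<open>x\<close> in the assumption on \<open>\<alpha>\<close>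
    becomes \<open>t * z j\<close> here; since place 0 always belongs to \<open>top\<close>, it
    supplies the zero at \<open>t = 0\<close>.\<close>
  define G1 where "G1 z j t = (if top j then (t * z j) * S j (t * z j)
      else z j powi \<eta> j * \<alpha> (z j) * single_factor (z j) powi k j)" for z j t
  \<comment> \<open>If both coordinates are scaled, their quotient does not move, so its factor
    stays constant although its exponent is 0, and their product moves with the square of
    \<open>t\<close>. If only the first is scaled, both exponents are at least 1 and
    \<open>R\<close> applies.\<close>
  define G2 where "G2 z j l t = (if top j then
      R (k j + k l) ((if top l then t\<^sup>2 else t) * (z j * z l)) *
      (if top l then \<beta> (z j / z l) * psi q (z j / z l) powi (k j - k l) else R (k j - k l) (t * (z j / z l)))
    else (\<beta> (z j * z l) * psi q (z j * z l) powi (k j + k l)) * (\<beta> (z j / z l) * psi q (z j / z l) powi (k j - k l)))" for z j l t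
  define G where "G z t = (\<Prod>j<n. G1 z j t) * (\<Prod>x\<in>idx_pairs n. G2 z (fst x) (snd x) t)" for z t
  let ?H = "\<lambda>z. lmono n \<eta> z * root_product n \<alpha> \<beta> z * bmono k z"
  have topD: "top j" if "top l" "j < l" "l < n" for j l
    using that k(1)[of j l] k(1)[of 0 j] by (simp add: top_def)
  have comp: "(\<lambda>t. F (c t * w)) holomorphic_on cball 0 1"
    if "F holomorphic_on cball 0 1" "c holomorphic_on cball 0 1" "\<And>t. norm t \<le> 1 \<Longrightarrow> norm (c t) \<le> 1" "norm w = 1" for F c w
  proof -
    have "F \<circ> (\<lambda>t. c t * w) holomorphic_on cball 0 1"
    proof (rule holomorphic_on_compose_gen[OF _ that(1)])
      show "(\<lambda>t. c t * w) holomorphic_on cball 0 1" by (intro holomorphic_intros that(2))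
      show "(\<lambda>t. c t * w) ` cball 0 1 \<subseteq> cball 0 1" using that(3,4) by (auto simp: norm_mult)
    qed
    then show ?thesis by (simp add: comp_def)
  qed
  have holG: "G z holomorphic_on cball 0 1" if z: "z \<in> torus n" for z
    unfolding G_def
  proof (intro holomorphic_on_mult holomorphic_on_prod)
    fix j assume "j \<in> {..<n}"
    then have j: "j < n" by simp
    have "(\<lambda>t. S j (t * z j)) holomorphic_on cball 0 1"
      by (rule comp[OF S(1)[OF j], of "\<lambda>t. t"]) (use torusD[OF z j] in \<open>auto intro: holomorphic_intros\<close>)
    then show "(\<lambda>t. G1 z j t) holomorphic_on cball 0 1"
      unfolding G1_def by (cases "top j") (auto intro!: holomorphic_intros)
  next
    fix x assume "x \<in> idx_pairs n"
    then obtain j l where x: "x = (j,l)" "j < l" "l < n" by (cases x) auto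
    have n1: "norm (z j * z l) = 1" "norm (z j / z l) = 1"
      using torusD[OF z, of j] torusD[OF z, of l] x by (auto simp: norm_mult norm_divide)
    have "(\<lambda>t. G2 z j l t) holomorphic_on cball 0 1"
    proof (cases "top j")
      case True
      then have e1: "1 \<le> k j + k l" using k0 k(2)[OF x(3)] by (simp add: top_def)
      have "(\<lambda>t. R (k j + k l) ((if top l then t\<^sup>2 else t) * (z j * z l))) holomorphic_on cball 0 1"
        by (rule comp[OF R(1)[OF e1], of "\<lambda>t. if top l then t\<^sup>2 else t"], cases "top l")
           (use n1 in \<open>auto intro!: holomorphic_intros simp: norm_power power_le_one\<close>)
      moreover have "(\<lambda>t. if top l then \<beta> (z j / z l) * psi q (z j / z l) powi (k j - k l) else R (k j - k l) (t * (z j / z l))) holomorphic_on cball 0 1"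
      proof (cases "top l")
        case False
        then have "1 \<le> k j - k l" using True k(1)[of j l] x by (simp add: top_def)
        from R(1)[OF this] have "(\<lambda>t. R (k j - k l) (t * (z j / z l))) holomorphic_on cball 0 1"
          by (rule comp[of _ "\<lambda>t. t"]) (use n1 in \<open>auto intro: holomorphic_intros\<close>)
        then show ?thesis using False by simp
      qed simp
      ultimately show ?thesis unfolding G2_def using True by (simp add: holomorphic_on_mult)
    qed (simp add: G2_def)
    then show "(\<lambda>t. G2 z (fst x) (snd x) t) holomorphic_on cball 0 1" by (simp add: x)
  qed
  have G0: "G z 0 = 0" for z
  proof -
    have "G1 z 0 0 = 0" by (simp add: G1_def top_def)
    then have "(\<Prod>j<n. G1 z j 0) = 0" using k0(1) by (auto simp: prod_zero_iff)
    then show ?thesis by (simp add: G_def)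
  qed
  have bd: "?H (tscale n \<theta> s z) = G z s" if z: "z \<in> torus n" and s: "norm s = 1" for z s
  proof -
    let ?y = "tscale n \<theta> s z"
    have y: "?y j = (if top j then s * z j else z j)" if "j < n" for j
      using that by (simp add: tscale_def \<theta>_def)
    have yt: "?y \<in> torus n"
      using torusD[OF z] s by (auto simp: torus_def tscale_def norm_mult norm_power_int)
    have nz: "s \<noteq> 0" using s by auto
    have A: "?y j powi \<eta> j * \<alpha> (?y j) * single_factor (?y j) powi k j = G1 z j s" if j: "j < n" for j
    proof (cases "top j")
      case True
      then have "norm (s * z j) = 1" using torusD[OF z j] s by (simp add: norm_mult)
      from S(2)[OF j this] True show ?thesis by (simp add: G1_def y[OF j] top_def)
    qed (simp add: G1_def y[OF j])
    have B: "(\<beta> (?y j * ?y l) * \<beta> (?y j / ?y l)) * (psi q (?y j * ?y l) powi (k j + k l) * psi q (?y j / ?y l) powi (k j - k l))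
        = G2 z j l s" if jl: "j < l" "l < n" for j l
    proof -
      have jn: "j < n" using jl by simp
      have n1: "norm (?y j * ?y l) = 1" "norm (?y j / ?y l) = 1"
        using torusD[OF yt jn] torusD[OF yt jl(2)] by (auto simp: norm_mult norm_divide)
      have re: "(\<beta> u * \<beta> v) * (a * b) = (\<beta> u * a) * (\<beta> v * b)" for u v a b by (simp only: ac_simps)
      show ?thesis
      proof (cases "top j")
        case True
        then have e1: "1 \<le> k j + k l" using k0 k(2)[OF jl(2)] by (simp add: top_def)
        show ?thesis
        proof (cases "top l")
          case tl: True
          have "?y j * ?y l = s\<^sup>2 * (z j * z l)" "?y j / ?y l = z j / z l"
            using True tl nz by (simp_all add: y jn jl power2_eq_square)
          then show ?thesis unfolding re R(2)[OF e1 n1(1)] using True tl by (simp add: G2_def)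
        next
          case False
          then have e2: "1 \<le> k j - k l" using True k(1)[of j l] jl by (simp add: top_def)
          have "?y j * ?y l = s * (z j * z l)" "?y j / ?y l = s * (z j / z l)"
            using True False nz by (simp_all add: y jn jl)
          then show ?thesis unfolding re R(2)[OF e1 n1(1)] R(2)[OF e2 n1(2)] using True False by (simp add: G2_def)
        qed
      next
        case False
        then have "\<not> top l" using topD jl by blast
        then show ?thesis unfolding re using False by (simp add: G2_def y jn jl)
      qed
    qed
    have "?H ?y = (\<Prod>j<n. ?y j powi \<eta> j * \<alpha> (?y j) * single_factor (?y j) powi k j) *
        (\<Prod>(j,l)\<in>idx_pairs n. (\<beta> (?y j * ?y l) * \<beta> (?y j / ?y l)) *
           (psi q (?y j * ?y l) powi (k j + k l) * psi q (?y j / ?y l) powi (k j - k l)))"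
      unfolding bmono_expand[OF yt] root_product_def lmono_def case_prod_unfold prod.distrib by (simp only: ac_simps)
    also have "\<dots> = G z s"
      unfolding G_def case_prod_unfold
      by (intro arg_cong2[where f = "(*)"] prod.cong refl A B) auto
    finally show ?thesis .
  qed
  have lmono: "tfun n (lmono n \<eta>)"
    using tfun_laurent[OF laurent_lmono[of n \<eta> "\<lambda>j. nat \<bar>\<eta> j\<bar>" 1]] by simp
  have "(\<integral>z. ?H z \<partial>torus_measure n) = (\<integral>z. 0 \<partial>torus_measure n)"
  proof (rule torus_mean[where G = G and \<theta> = \<theta>])
    show "tfun n ?H" by (intro tfun_mult tf tfun_bmono lmono)
    show "G z holomorphic_on cball 0 1 - {0}" if "z \<in> torus n" for z
      by (rule holomorphic_on_subset[OF holG[OF that]]) auto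
    show "(G z \<longlongrightarrow> 0) (at 0)" if "z \<in> torus n" for z
    proof -
      have "continuous_on (ball 0 1) (G z)"
        using holomorphic_on_imp_continuous_on[OF holG[OF that]] by (rule continuous_on_subset) auto
      then have "isCont (G z) 0" by (simp add: continuous_on_eq_continuous_at)
      then show ?thesis by (simp add: isCont_def G0)
    qed
    show "?H (tscale n \<theta> s z) = G z s" if "z \<in> torus n" "norm s = 1" for z s by (rule bd[OF that])
  qed
  then show ?thesis by simp
qed

text \<open>A signed permutation makes \<open>k\<close> nonnegative and decreasing, and leaves the
  invariant weight alone. It also permutes and flips the exponents of the monomial, which is why the
  assumption on \<open>\<alpha>\<close> covers every \<open>d\<close> with
  \<open>\<bar>d\<bar> \<le> int M\<close>.\<close>

lemma integral_bmono_zero: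
  assumes \<alpha>: "\<And>d e. \<bar>d\<bar> \<le> int M \<Longrightarrow> 1 \<le> e \<Longrightarrow> \<exists>S. S holomorphic_on cball 0 1 \<and>
      (\<forall>x\<in>sphere 0 1. x powi d * \<alpha> x * single_factor x powi e = x * S x)"
    and \<beta>: "\<And>e. 1 \<le> e \<Longrightarrow> \<exists>R. R holomorphic_on cball 0 1 \<and> (\<forall>x\<in>sphere 0 1. \<beta> x * psi q x powi e = R x)"
    and tf: "tfun n (root_product n \<alpha> \<beta>)" and ws: "wsym n (root_product n \<alpha> \<beta>)"
    and k: "\<exists>j<n. k j \<noteq> 0" and F: "laurent n (\<lambda>_. M) F"
  shows "(\<integral>z. F z * root_product n \<alpha> \<beta> z * bmono k z \<partial>torus_measure n) = 0"
proof -
  let ?h = "root_product n \<alpha> \<beta>"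
  have mono: "(\<integral>z. lmono n \<eta> z * ?h z * bmono k z \<partial>torus_measure n) = 0" if \<eta>: "\<And>j. j < n \<Longrightarrow> \<bar>\<eta> j\<bar> \<le> int M" for \<eta>
  proof -
    obtain \<pi> where p: "\<pi> permutes {..<n}" and sorted: "\<And>j l. j \<le> l \<Longrightarrow> l < n \<Longrightarrow> \<bar>k (\<pi> l)\<bar> \<le> \<bar>k (\<pi> j)\<bar>"
      using sort_permutation[of n "\<lambda>j. \<bar>k j\<bar>"] by blast
    have i: "inv \<pi> permutes {..<n}" by (rule permutes_inv[OF p])
    \<comment> \<open>\<open>bethe_sact\<close> raises the permuted Bethe function to the power
      \<open>\<epsilon> j\<close>, so the sign of \<open>k j\<close> turns the exponent into its
      absolute value.\<close>
    define \<epsilon> where "\<epsilon> = (\<lambda>j\<in>{..<n}. if k j < 0 then -1 else 1 :: int)"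
    have e: "\<epsilon> \<in> signs n" by (auto simp: signs_def \<epsilon>_def)
    define k' where "k' j = \<bar>k (\<pi> j)\<bar>" for j
    define \<eta>' where "\<eta>' j = \<epsilon> (\<pi> j) * \<eta> (\<pi> j)" for j
    have \<eta>'b: "\<bar>\<eta>' j\<bar> \<le> int M" if "j < n" for j
      using signsD[OF e permutes_lessThan_less[OF p that]] \<eta>[OF permutes_lessThan_less[OF p that]]
      by (auto simp: \<eta>'_def abs_mult)
    have lm: "lmono n \<eta> (sact n (inv \<pi>) \<epsilon> z) = lmono n \<eta>' z" for z
      using prod.permute[OF p, of "\<lambda>j. z (inv \<pi> j) powi (\<epsilon> j * \<eta> j)"]
      unfolding lmono_sact by (simp add: lmono_def \<eta>'_def o_def permutes_inverses[OF p])
    have bm: "bmono k (sact n (inv \<pi>) \<epsilon> z) = bmono k' z" if z: "z \<in> torus n" for z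
    proof -
      have "bmono k (sact n (inv \<pi>) \<epsilon> z) = (\<Prod>j<n. bethe (inv \<pi> j) z powi \<bar>k j\<bar>)"
        unfolding bmono_def
      proof (rule prod.cong[OF refl])
        fix j assume "j \<in> {..<n}"
        then have j: "j < n" by simp
        have "\<epsilon> j * k j = \<bar>k j\<bar>" using j by (simp add: \<epsilon>_def)
        then show "bethe j (sact n (inv \<pi>) \<epsilon> z) powi k j = bethe (inv \<pi> j) z powi \<bar>k j\<bar>"
          unfolding bethe_sact[OF z i e j] power_int_mult[symmetric] by simp
      qed
      also have "\<dots> = bmono k' z"
        using prod.permute[OF p, of "\<lambda>j. bethe (inv \<pi> j) z powi \<bar>k j\<bar>"]
        by (simp add: bmono_def k'_def o_def permutes_inverses[OF p])
      finally show ?thesis .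
    qed
    obtain j where j: "j < n" "k j \<noteq> 0" using k by blast
    have n0: "0 < n" using j by simp
    have "inv \<pi> j < n" using permutes_lessThan_less[OF i j(1)] .
    then have "\<bar>k j\<bar> \<le> k' 0" using sorted[of 0 "inv \<pi> j"] by (simp add: k'_def permutes_inverses[OF p])
    then have k0: "0 < k' 0" using j by simp
    let ?H = "\<lambda>z. lmono n \<eta> z * ?h z * bmono k z"
    have "tfun n (lmono n \<eta>)"
      using tfun_laurent[OF laurent_lmono[of n \<eta> "\<lambda>j. nat \<bar>\<eta> j\<bar>" 1]] by simp
    then have "tfun n ?H" by (intro tfun_mult tf tfun_bmono)
    then have "(\<integral>z. ?H z \<partial>torus_measure n) = (\<integral>z. ?H (sact n (inv \<pi>) \<epsilon> z) \<partial>torus_measure n)"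
      by (intro integral_sact(2)[OF i e, symmetric]) (simp add: tfun_def)
    also have "\<dots> = (\<integral>z. lmono n \<eta>' z * ?h z * bmono k' z \<partial>torus_measure n)"
      by (rule Bochner_Integration.integral_cong[OF refl])
         (use ws i e torus_nzvecs in \<open>auto simp: lm bm wsym_def\<close>)
    also have "\<dots> = 0"
      by (rule integral_bmono_dominant[OF \<alpha> \<beta> tf]) (use \<eta>'b sorted n0 k0 in \<open>auto simp: k'_def\<close>)
    finally show ?thesis .
  qed
  have "tfun n F \<and> (\<integral>z. F z * ?h z * bmono k z \<partial>torus_measure n) = 0"
    using F
  proof (induction rule: laurent.induct)
    case (zero F)
    have "(\<integral>z. F z * ?h z * bmono k z \<partial>torus_measure n) = (\<integral>z. 0 \<partial>torus_measure n)"
      by (rule Bochner_Integration.integral_cong[OF refl]) (use zero torus_nzvecs in auto)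
    then show ?case using tfun_laurent[OF laurent.zero[OF zero]] by simp
  next
    case (step F \<nu> G c)
    have lm: "tfun n (lmono n \<nu>)"
      using tfun_laurent[OF laurent_lmono[of n \<nu> "\<lambda>j. nat \<bar>\<nu> j\<bar>" 1]] by simp
    have tF: "tfun n F" using step.IH by simp
    have "(\<integral>z. G z * ?h z * bmono k z \<partial>torus_measure n)
      = (\<integral>z. F z * ?h z * bmono k z + c * (lmono n \<nu> z * ?h z * bmono k z) \<partial>torus_measure n)"
      by (rule Bochner_Integration.integral_cong[OF refl])
         (use step.hyps(3) torus_nzvecs in \<open>auto simp: algebra_simps\<close>)
    also have "\<dots> = (\<integral>z. F z * ?h z * bmono k z \<partial>torus_measure n)
        + (\<integral>z. c * (lmono n \<nu> z * ?h z * bmono k z) \<partial>torus_measure n)"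
      by (rule Bochner_Integration.integral_add; intro tfun_integrable tfun_mult tfun_const lm tF tf tfun_bmono)
    also have "\<dots> = 0" using step.IH mono[OF step.hyps(2)] by simp
    finally show ?case using tfun_laurent[OF laurent.step[OF step.hyps]] by blast
  qed
  then show ?thesis by blast
qed

text \<open>On the torus this is the product of |1 + b j|^(2N), since b^(-1) (1 + b)^2 = |1 + b|^2
  for unimodular b. Written this way it is visibly a Laurent polynomial in the Bethe functions, with
  a power of the central binomial coefficient as constant term.\<close>

definition bethe_kernel :: "nat \<Rightarrow> (nat \<Rightarrow> complex) \<Rightarrow> complex" where
  "bethe_kernel N z = (\<Prod>j<n. bethe j z powi (- int N) * (1 + bethe j z) ^ (2 * N))"

lemma tfun_bethe_kernel: "tfun n (bethe_kernel N)"
  unfolding bethe_kernel_def[abs_def]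
  by (intro tfun_prod tfun_mult tfun_power tfun_add tfun_const tfun_powi tfun_bethe) (use bethe_nonzero in auto)

lemma integral_bethe_kernel:
  assumes z: "\<And>k. \<exists>j<n. k j \<noteq> 0 \<Longrightarrow> (\<integral>z. h z * bmono k z \<partial>torus_measure n) = 0" and h: "tfun n h"
  shows "(\<integral>z. h z * bethe_kernel N z \<partial>torus_measure n) = of_nat ((2 * N) choose N) ^ n * (\<integral>z. h z \<partial>torus_measure n)"
proof -
  let ?I = "PiE {..<n} (\<lambda>_. {..2 * N})"
  let ?c = "\<lambda>f. \<Prod>j<n. of_nat ((2 * N) choose (f j)) :: complex"
  let ?k = "\<lambda>f j. int (f j) - int N"
  have exp: "bethe_kernel N z = (\<Sum>f\<in>?I. ?c f * bmono (?k f) z)" if z: "z \<in> torus n" for z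
  proof -
    have "bethe_kernel N z = (\<Prod>j<n. \<Sum>i\<le>2 * N. of_nat ((2 * N) choose i) * bethe j z powi (int i - int N))"
      unfolding bethe_kernel_def
    proof (rule prod.cong[OF refl])
      fix j assume "j \<in> {..<n}"
      then have nz: "bethe j z \<noteq> 0" using bethe_nonzero[OF z] by simp
      have "(1 + bethe j z) ^ (2 * N) = (\<Sum>i\<le>2 * N. of_nat ((2 * N) choose i) * bethe j z ^ i)"
        using binomial_ring[of "bethe j z" 1 "2 * N"] by (simp add: add.commute)
      then show "bethe j z powi (- int N) * (1 + bethe j z) ^ (2 * N)
        = (\<Sum>i\<le>2 * N. of_nat ((2 * N) choose i) * bethe j z powi (int i - int N))"
        using nz by (simp add: sum_distrib_left power_int_diff power_int_minus divide_inverse ac_simps)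
    qed
    also have "\<dots> = (\<Sum>f\<in>?I. \<Prod>j<n. of_nat ((2 * N) choose (f j)) * bethe j z powi (int (f j) - int N))"
      by (rule prod_sum_PiE) auto
    finally show ?thesis by (simp add: prod.distrib bmono_def)
  qed
  define f0 where "f0 = (\<lambda>j\<in>{..<n}. N)"
  have f0: "f0 \<in> ?I" by (auto simp: f0_def)
  have b0: "bmono (?k f0) z = 1" for z by (simp add: bmono_def f0_def)
  have fin: "finite ?I" by (rule finite_PiE) auto
  have "(\<integral>z. h z * bethe_kernel N z \<partial>torus_measure n) = (\<integral>z. (\<Sum>f\<in>?I. ?c f * (h z * bmono (?k f) z)) \<partial>torus_measure n)"
    by (rule Bochner_Integration.integral_cong[OF refl])
       (auto simp: exp sum_distrib_left ac_simps)
  also have "\<dots> = (\<Sum>f\<in>?I. \<integral>z. ?c f * (h z * bmono (?k f) z) \<partial>torus_measure n)"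
    by (rule Bochner_Integration.integral_sum) (intro tfun_integrable tfun_mult tfun_const h tfun_bmono)
  also have "\<dots> = (\<Sum>f\<in>?I. if f = f0 then of_nat ((2 * N) choose N) ^ n * (\<integral>z. h z \<partial>torus_measure n) else 0)"
  proof (rule sum.cong[OF refl])
    fix f assume f: "f \<in> ?I"
    show "(\<integral>z. ?c f * (h z * bmono (?k f) z) \<partial>torus_measure n)
      = (if f = f0 then of_nat ((2 * N) choose N) ^ n * (\<integral>z. h z \<partial>torus_measure n) else 0)"
    proof (cases "f = f0")
      case True
      have "?c f0 = of_nat ((2 * N) choose N) ^ n" by (simp add: f0_def)
      then show ?thesis using True b0 by simp
    next
      case False
      have "\<exists>j<n. ?k f j \<noteq> 0"
      proof (rule ccontr)
        assume "\<not> (\<exists>j<n. ?k f j \<noteq> 0)"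
        then have "f = f0" unfolding f0_def using f by (intro extensionalityI[of _ "{..<n}"]) (auto simp: PiE_def)
        then show False using False by simp
      qed
      from z[OF this] show ?thesis using False by simp
    qed
  qed
  also have "\<dots> = of_nat ((2 * N) choose N) ^ n * (\<integral>z. h z \<partial>torus_measure n)"
    using fin f0 by simp
  finally show ?thesis .
qed

lemma bethe_kernel_nonneg:
  assumes "z \<in> torus n"
  shows "bethe_kernel N z = of_real ((\<Prod>j<n. (cmod (1 + bethe j z))\<^sup>2) ^ N)"
proof -
  have "bethe j z powi (- int N) * (1 + bethe j z) ^ (2 * N) = of_real (((cmod (1 + bethe j z))\<^sup>2) ^ N)" if "j < n" for j
  proof -
    let ?b = "bethe j z"
    have b: "?b * cnj ?b = 1" using complex_norm_square[of ?b] norm_bethe[OF assms that] by simp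
    have i: "inverse ?b = cnj ?b" using inverse_unique[OF b] .
    have "of_real ((cmod (1 + ?b))\<^sup>2) = (1 + ?b) * cnj (1 + ?b)" by (rule complex_norm_square)
    also have "\<dots> = inverse ?b * (1 + ?b)\<^sup>2"
      unfolding i using b by (simp add: algebra_simps power2_eq_square)
    finally have "of_real (((cmod (1 + ?b))\<^sup>2) ^ N) = (inverse ?b * (1 + ?b)\<^sup>2) ^ N" by simp
    then show ?thesis by (simp add: power_mult_distrib power_mult power_int_minus power_inverse)
  qed
  then have "bethe_kernel N z = (\<Prod>j<n. of_real (((cmod (1 + bethe j z))\<^sup>2) ^ N))"
    unfolding bethe_kernel_def by (intro prod.cong) auto
  then show ?thesis by (simp add: prod_power_distrib)
qed

text \<open>The kernels concentrate on the common solutions of \<open>bethe j z = 1\<close>, so a function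
  annihilated there has vanishing mean.\<close>

lemma integral_zero_of_bethe_zeros:
  assumes h: "tfun n h"
    and z: "\<And>k. \<exists>j<n. k j \<noteq> 0 \<Longrightarrow> (\<integral>z. h z * bmono k z \<partial>torus_measure n) = 0"
    and z1: "\<And>k. \<exists>j<n. k j \<noteq> 0 \<Longrightarrow> (\<integral>z. 1 * bmono k z \<partial>torus_measure n) = 0"
    and vanish: "\<And>z. z \<in> torus n \<Longrightarrow> (\<And>j. j < n \<Longrightarrow> bethe j z = 1) \<Longrightarrow> h z = 0"
  shows "(\<integral>z. h z \<partial>torus_measure n) = 0"
proof (rule ccontr)
  let ?L = "\<integral>z. h z \<partial>torus_measure n"
  assume "?L \<noteq> 0"
  then have L: "norm ?L > 0" by simp
  define \<epsilon> where "\<epsilon> = norm ?L / 2"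
  have \<epsilon>: "\<epsilon> > 0" using L by (simp add: \<epsilon>_def)
  define A where "A z = (\<Prod>j<n. (cmod (1 + bethe j z))\<^sup>2)" for z
  have A0: "0 \<le> A z" for z by (auto simp: A_def intro: prod_nonneg)
  have fac: "(cmod (1 + bethe j z))\<^sup>2 \<le> 4" if "z \<in> torus n" "j < n" for z j
  proof -
    have "cmod (1 + bethe j z) \<le> 1 + 1" using norm_bethe[OF that] norm_triangle_ineq[of 1 "bethe j z"] by simp
    then have "(cmod (1 + bethe j z))\<^sup>2 \<le> 2\<^sup>2" by (intro power_mono) auto
    then show ?thesis by simp
  qed
  have Alt: "A z < 4 ^ n" if zt: "z \<in> torus n" and hz: "h z \<noteq> 0" for z
  proof -
    obtain j where j: "j < n" "bethe j z \<noteq> 1" using vanish[OF zt] hz by blast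
    have strict: "(cmod (1 + bethe j z))\<^sup>2 < 4"
    proof (rule ccontr)
      let ?b = "bethe j z"
      assume "\<not> ?thesis"
      then have "(cmod (1 + ?b))\<^sup>2 = 4" using fac[OF zt j(1)] by simp
      then have "(1 + Re ?b)\<^sup>2 + (Im ?b)\<^sup>2 = 4" by (simp add: cmod_power2)
      moreover have "(Re ?b)\<^sup>2 + (Im ?b)\<^sup>2 = 1" using norm_bethe[OF zt j(1)] cmod_power2[of ?b] by simp
      ultimately have "Re ?b = 1" "Im ?b = 0" by (auto simp: power2_eq_square algebra_simps)
      then show False using j(2) by (simp add: complex_eq_iff)
    qed
    have "A z = (cmod (1 + bethe j z))\<^sup>2 * (\<Prod>i\<in>{..<n} - {j}. (cmod (1 + bethe i z))\<^sup>2)"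
      unfolding A_def using j by (subst prod.remove[of _ j]) auto
    also have "\<dots> \<le> (cmod (1 + bethe j z))\<^sup>2 * (\<Prod>i\<in>{..<n} - {j}. 4)"
      by (intro mult_left_mono prod_mono) (use fac[OF zt] in auto)
    also have "\<dots> < 4 * (\<Prod>i\<in>{..<n} - {j}. 4)" using strict by (intro mult_strict_right_mono) auto
    also have "\<dots> = 4 ^ n" using j by (simp flip: power_Suc)
    finally show ?thesis .
  qed
  define K where "K = {z \<in> torus n. norm (h z) \<ge> \<epsilon>}"
  have contA: "continuous_on (torus n) A"
    unfolding A_def using tfun_bethe by (intro continuous_intros) (auto simp: tfun_def)
  have "closedin (top_of_set (torus n)) K"
  proof -
    have "continuous_on (torus n) (\<lambda>z. norm (h z))" using h by (intro continuous_intros) (simp add: tfun_def)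
    then have "closedin (top_of_set (torus n)) (torus n \<inter> (\<lambda>z. norm (h z)) -` {\<epsilon>..})"
      by (rule continuous_closedin_preimage) simp
    moreover have "torus n \<inter> (\<lambda>z. norm (h z)) -` {\<epsilon>..} = K" by (auto simp: K_def)
    ultimately show ?thesis by simp
  qed
  then have compK: "compact K" by (rule closedin_compact[OF compact_torus])
  \<comment> \<open>On the compact set \<open>K\<close> the function \<open>h\<close> does not
    vanish, so no point of it solves all equations, and \<open>A\<close> stays below its bound
    \<open>4 ^ n\<close> by a fixed ratio.\<close>
  obtain r where r: "0 \<le> r" "r < 1" "\<And>z. z \<in> K \<Longrightarrow> A z \<le> 4 ^ n * r"
  proof (cases "K = {}")
    case True
    then show ?thesis using that[of 0] by simp
  next
    case False
    have "continuous_on K A" using contA by (rule continuous_on_subset) (auto simp: K_def)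
    from continuous_attains_sup[OF compK False this]
    obtain w where w: "w \<in> K" "\<And>z. z \<in> K \<Longrightarrow> A z \<le> A w" by blast
    have "w \<in> torus n" "h w \<noteq> 0" using w(1) \<epsilon> by (auto simp: K_def)
    then have "A w < 4 ^ n" by (rule Alt)
    then show ?thesis using that[of "A w / 4 ^ n"] w(2) A0[of w] by simp
  qed
  obtain B where B: "B > 0" "\<And>z. z \<in> torus n \<Longrightarrow> norm (h z) \<le> B" using tfun_bounded[OF h] by blast
  interpret T: finite_measure "torus_measure n" by (rule finite_torus)
  \<comment> \<open>By \<open>z1\<close> the kernel has total mass \<open>?b ^ n\<close>. Off
    \<open>K\<close> the integrand is at most \<open>\<epsilon>\<close> times the kernel; on
    \<open>K\<close> the kernel is at most \<open>(4 ^ n * r) ^ N\<close>. The lower bound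
    \<open>4 ^ N / (2 * N)\<close> for the central binomial coefficient makes the loss after
    normalization polynomial in \<open>N\<close>, against the geometric gain
    \<open>r ^ N\<close>.\<close>
  have main: "norm ?L \<le> \<epsilon> + B * ((2 * real N) ^ n * r ^ N)" if N: "N > 0" for N
  proof -
    let ?b = "real ((2 * N) choose N)"
    have bpos: "?b > 0" by simp
    have kr: "bethe_kernel N z = of_real (A z ^ N)" if "z \<in> torus n" for z
      using bethe_kernel_nonneg[OF that] by (simp add: A_def)
    have int1: "integrable (torus_measure n) (\<lambda>z. A z ^ N)"
    proof -
      have "integrable (torus_measure n) (\<lambda>z. Re (bethe_kernel N z))"
        using tfun_integrable[OF tfun_bethe_kernel] by (rule integrable_Re)
      then show ?thesis by (rule Bochner_Integration.integrable_cong[OF refl, THEN iffD1, rotated]) (simp add: kr)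
    qed
    have "(\<integral>z. 1 * bethe_kernel N z \<partial>torus_measure n) = of_nat ((2 * N) choose N) ^ n * (\<integral>z. 1 \<partial>torus_measure n)"
      by (rule integral_bethe_kernel[OF _ tfun_const]) (rule z1)
    then have "(\<integral>z. of_real (A z ^ N) \<partial>torus_measure n) = (of_real (?b ^ n) :: complex)"
      using Bochner_Integration.integral_cong[OF refl, of "torus_measure n" "bethe_kernel N" "\<lambda>z. of_real (A z ^ N)"]
      by (simp add: kr measure_torus)
    then have ib: "(\<integral>z. A z ^ N \<partial>torus_measure n) = ?b ^ n"
      by (simp only: integral_complex_of_real of_real_eq_iff)
    have "?b ^ n * norm ?L = norm (\<integral>z. h z * bethe_kernel N z \<partial>torus_measure n)"
    proof -
      have "(\<integral>z. h z * bethe_kernel N z \<partial>torus_measure n) = of_nat ((2 * N) choose N) ^ n * ?L"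
        by (rule integral_bethe_kernel[OF _ h]) (rule z)
      then show ?thesis by (simp add: norm_mult norm_power)
    qed
    also have "\<dots> \<le> (\<integral>z. norm (h z * bethe_kernel N z) \<partial>torus_measure n)"
      by (rule integral_norm_bound)
    also have "\<dots> \<le> (\<integral>z. \<epsilon> * A z ^ N + B * (4 ^ n * r) ^ N \<partial>torus_measure n)"
    proof (rule integral_mono)
      show "integrable (torus_measure n) (\<lambda>z. norm (h z * bethe_kernel N z))"
        by (intro integrable_norm tfun_integrable tfun_mult h tfun_bethe_kernel)
      show "integrable (torus_measure n) (\<lambda>z. \<epsilon> * A z ^ N + B * (4 ^ n * r) ^ N)"
        using int1 by simp
      fix z assume "z \<in> space (torus_measure n)"
      then have zt: "z \<in> torus n" by simp
      have n: "norm (h z * bethe_kernel N z) = norm (h z) * A z ^ N"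
        using A0[of z] by (simp add: kr[OF zt] norm_mult norm_power)
      show "norm (h z * bethe_kernel N z) \<le> \<epsilon> * A z ^ N + B * (4 ^ n * r) ^ N"
      proof (cases "z \<in> K")
        case True
        have "norm (h z) * A z ^ N \<le> B * (4 ^ n * r) ^ N"
          by (intro mult_mono power_mono B(2)[OF zt] r(3)[OF True] A0) (use B A0 in auto)
        moreover have "0 \<le> \<epsilon> * A z ^ N" using \<epsilon> A0[of z] by simp
        ultimately show ?thesis unfolding n by linarith
      next
        case False
        then have "norm (h z) \<le> \<epsilon>" using zt by (simp add: K_def)
        then have "norm (h z) * A z ^ N \<le> \<epsilon> * A z ^ N" using A0[of z] by (intro mult_right_mono) auto
        moreover have "0 \<le> B * (4 ^ n * r) ^ N" using B r by simp
        ultimately show ?thesis unfolding n by linarith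
      qed
    qed
    also have "\<dots> = \<epsilon> * ?b ^ n + B * (4 ^ n * r) ^ N"
      using int1 by (simp add: ib measure_torus)
    finally have *: "?b ^ n * norm ?L \<le> \<epsilon> * ?b ^ n + B * (4 ^ n * r) ^ N" .
    have "4 ^ N / (2 * real N) \<le> ?b" using central_binomial_lower_bound[OF N] by simp
    then have "4 ^ N \<le> (2 * real N) * ?b" using N by (simp add: field_simps)
    then have "(4 ^ N) ^ n \<le> ((2 * real N) * ?b) ^ n" by (intro power_mono) auto
    then have "(4 ^ n) ^ N \<le> (2 * real N) ^ n * ?b ^ n"
      by (simp add: power_mult_distrib flip: power_mult) (simp add: mult.commute)
    then have "B * (4 ^ n * r) ^ N \<le> B * ((2 * real N) ^ n * ?b ^ n * r ^ N)"
      unfolding power_mult_distrib using B r by (intro mult_left_mono mult_right_mono) auto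
    with * have "?b ^ n * norm ?L \<le> ?b ^ n * (\<epsilon> + B * ((2 * real N) ^ n * r ^ N))"
      by (simp add: algebra_simps)
    then show ?thesis using bpos by simp
  qed
  have lim: "(\<lambda>N. \<epsilon> + B * ((2 * real N) ^ n * r ^ N)) \<longlonglongrightarrow> \<epsilon> + B * 0"
  proof (intro tendsto_intros)
    have "(\<lambda>N. real N ^ n * r ^ N) \<longlonglongrightarrow> 0"
    proof (cases "n = 0")
      case True
      then show ?thesis using LIMSEQ_power_zero[of r] r by simp
    next
      case False
      \<comment> \<open>Taking the \<open>n\<close>-th root writes the sequence as the
        \<open>n\<close>-th power of \<open>real N * s ^ N\<close>, which tends to 0.\<close>
      define s where "s = root n r"
      have s: "s ^ n = r" "norm s < 1" using False r by (simp_all add: s_def)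
      have "(\<lambda>N. real N * s ^ N) \<longlonglongrightarrow> 0" using powser_times_n_limit_0[OF s(2)] by simp
      from tendsto_power[OF this, of n] have "(\<lambda>N. (real N * s ^ N) ^ n) \<longlonglongrightarrow> 0" using False by (simp add: power_0_left)
      then show ?thesis unfolding s(1)[symmetric] by (simp add: power_mult_distrib power_mult[symmetric] mult.commute)
    qed
    from tendsto_mult_left[OF this, of "2 ^ n"]
    show "(\<lambda>N. (2 * real N) ^ n * r ^ N) \<longlonglongrightarrow> 0" by (simp add: power_mult_distrib mult.assoc)
  qed
  have "norm ?L \<le> \<epsilon> + B * 0"
    by (rule LIMSEQ_le_const[OF lim]) (use main in \<open>auto intro!: exI[of _ 1]\<close>)
  then show False using L by (simp add: \<epsilon>_def)
qed

end

section \<open>Phases and nodes\<close>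

context bethe_system
begin

text \<open>The instance of the vanishing argument for the constant weight. It is what gives the
  kernels their known total mass.\<close>

lemma integral_bmono_one:
  assumes k: "\<exists>j<n. k j \<noteq> 0" shows "(\<integral>z. 1 * bmono k z \<partial>torus_measure n) = 0"
proof -
  have r1: "root_product n (\<lambda>_. 1) (\<lambda>_. 1) = (\<lambda>_. 1)"
    by (simp add: root_product_def fun_eq_iff case_prod_unfold)
  have "(\<integral>z. 1 * root_product n (\<lambda>_. 1) (\<lambda>_. 1) z * bmono k z \<partial>torus_measure n) = 0"
  proof (rule integral_bmono_zero[where M = 0])
    fix d e :: int assume d: "\<bar>d\<bar> \<le> int 0" and e: "1 \<le> e"
    define E where "E = nat e"
    have eE: "e = int E" "E \<ge> 1" using e by (auto simp: E_def)
    let ?S = "\<lambda>x. x ^ (2 * (m + 1) * E - 1) * (psi q0 x * psi q1 x) ^ E"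
    have "?S holomorphic_on cball 0 1"
      by (intro holomorphic_intros psi_holomorphic q)
    moreover have "x powi d * 1 * single_factor x powi e = x * ?S x" for x
    proof -
      have "2 * (m + 1) * E = Suc (2 * (m + 1) * E - 1)" using eE(2) by simp
      then have e': "x ^ (2 * (m + 1) * E) = x * x ^ (2 * (m + 1) * E - 1)" by (metis power_Suc)
      have s: "single_factor x powi e = x ^ (2 * (m + 1) * E) * (psi q0 x * psi q1 x) ^ E"
        unfolding single_factor_def eE(1) power_int_of_nat power_mult_distrib power_mult by (simp only: mult.assoc)
      have "x powi d = 1" using d by simp
      then show ?thesis unfolding s e' by (simp only: mult_1_left mult_1_right mult.assoc)
    qed
    ultimately show "\<exists>S. S holomorphic_on cball 0 1 \<and> (\<forall>x\<in>sphere 0 1. x powi d * 1 * single_factor x powi e = x * S x)"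
      by blast
  next
    fix e :: int assume e: "1 \<le> e"
    have "(\<lambda>x. psi q x ^ nat e) holomorphic_on cball 0 1" by (intro holomorphic_intros psi_holomorphic q)
    then show "\<exists>R. R holomorphic_on cball 0 1 \<and> (\<forall>x\<in>sphere 0 1. 1 * psi q x powi e = R x)"
      using e by (intro exI[of _ "\<lambda>x. psi q x ^ nat e"]) (simp add: power_int_def)
  next
    show "laurent n (\<lambda>_. 0) (\<lambda>_. 1)" by (rule laurent_const)
  qed (use k in \<open>simp_all add: r1 tfun_const wsym_def\<close>)
  then show ?thesis by (simp add: r1)
qed

text \<open>Here the degree \<open>2 * m\<close> is decided. The monomial costs at most x^(-2m), the
  short weight, once the zero of \<open>psi q0\<close> has cancelled its pole at \<open>q0\<close>,
  costs x^(-1), and \<open>single_factor\<close> provides x^(2m+2). One power of x remains, just the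
  zero at the origin which the vanishing argument demands.\<close>

lemma integral_bmono_delta:
  assumes k: "\<exists>j<n. k j \<noteq> 0" and F: "laurent n (\<lambda>_. 2 * m) F"
  shows "(\<integral>z. F z * hl_delta n q q0 z * bmono k z \<partial>torus_measure n) = 0"
  unfolding hl_delta_def
proof (rule integral_bmono_zero[OF _ _ _ _ k F])
  have qc: "norm (complex_of_real q) < 1" "norm (complex_of_real q0) < 1" using q by auto
  show "tfun n (root_product n (delta_short q0) (delta_root q))"
    using tfun_hl_delta[OF qc] by (simp add: hl_delta_def)
  show "wsym n (root_product n (delta_short q0) (delta_root q))"
    using hl_delta_wsym[of n "of_real q" "of_real q0"] by (simp add: hl_delta_def)
next
  fix d e :: int assume d: "\<bar>d\<bar> \<le> int (2 * m)" and e: "1 \<le> e"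
  \<comment> \<open>The power of x left after splitting off that one factor. In the extreme case
    \<open>d = - 2 * m\<close>, \<open>e = 1\<close> it is 0.\<close>
  define N where "N = nat (d + 2 * int (m + 1) * e - 2)"
  have N: "int N = d + 2 * int (m + 1) * e - 2"
  proof -
    have "int (m + 1) * 1 \<le> int (m + 1) * e" using e by (intro mult_left_mono) auto
    then show ?thesis using d unfolding N_def by (simp add: algebra_simps)
  qed
  let ?S = "\<lambda>x. - ((1 - x\<^sup>2)\<^sup>2 / (1 - of_real q0 * x)\<^sup>2 * psi q0 x ^ nat (e - 1) * psi q1 x ^ nat e * x ^ N)"
  have "?S holomorphic_on cball 0 1"
    by (intro holomorphic_intros psi_holomorphic q) (use one_minus_mult_nonzero[of "of_real q0"] q in auto)
  moreover have "x powi d * delta_short q0 x * single_factor x powi e = x * ?S x" if x: "norm x = 1" for x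
  proof -
    note nz = circle_one_minus[OF q(2) x]
    have p0: "psi q0 x powi e = psi q0 x * psi q0 x ^ nat (e - 1)"
    proof -
      have "psi q0 x powi e = psi q0 x powi (1 + (e - 1))" by simp
      also have "\<dots> = psi q0 x * psi q0 x powi (e - 1)"
        using psi_nonzero[OF q(2) x] by (subst power_int_add) auto
      finally show ?thesis using e by (simp add: power_int_def)
    qed
    have p1: "psi q1 x powi e = psi q1 x ^ nat e" using e by (simp add: power_int_def)
    \<comment> \<open>One factor \<open>psi q0\<close> out of \<open>single_factor x powi e\<close>
      is spent on the pole of the short weight at \<open>q0\<close>; this is where
      \<open>1 \<le> e\<close> is used.\<close>
    have dl: "delta_short q0 x * psi q0 x = - ((1 - x\<^sup>2)\<^sup>2 / (1 - of_real q0 * x)\<^sup>2) * inverse x"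
    proof -
      let ?w = "1 - of_real q0 * x"
      have a: "1 - of_real q0 * inverse x = (x - of_real q0) * inverse x" "1 - (inverse x)\<^sup>2 = - (1 - x\<^sup>2) * (inverse x)\<^sup>2"
        using nz(4) by (simp_all add: field_simps)
      have "delta_short q0 x * psi q0 x
        = (1 - x\<^sup>2) * (- (1 - x\<^sup>2) * (inverse x)\<^sup>2) / (?w * ((x - of_real q0) * inverse x)) * ((x - of_real q0) / ?w)"
        unfolding delta_short_def psi_def a ..
      also have "\<dots> = - ((1 - x\<^sup>2)\<^sup>2 / ?w\<^sup>2) * inverse x"
      proof -
        have gen: "a * (- a * i\<^sup>2) / (w * (r * i)) * (r / w) = - (a\<^sup>2 / w\<^sup>2) * i"
          if "r \<noteq> 0" "i \<noteq> 0" "w \<noteq> 0" for a i w r :: complex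
          using that by (simp add: power2_eq_square field_simps)
        show ?thesis by (rule gen) (use nz in auto)
      qed
      finally show ?thesis .
    qed
    have xp: "x powi d * (x ^ (2 * (m + 1))) powi e * inverse x = x * x ^ N"
    proof -
      have "x powi d * (x ^ (2 * (m + 1))) powi e * inverse x = x powi d * x powi (int (2 * (m + 1)) * e) * x powi (-1)"
        by (simp only: power_int_mult power_int_of_nat power_int_minus power_int_1_right)
      also have "\<dots> = x powi (d + int (2 * (m + 1)) * e + (-1))" using nz(4) by (simp only: power_int_add simp_thms)
      also have "d + int (2 * (m + 1)) * e + (-1) = 1 + int N" using N by simp
      also have "x powi (1 + int N) = x * x ^ N" using nz(4) by (subst power_int_add) auto
      finally show ?thesis .
    qed
    have "x powi d * delta_short q0 x * single_factor x powi e
      = x powi d * (x ^ (2 * (m + 1))) powi e * (delta_short q0 x * psi q0 x) * psi q0 x ^ nat (e - 1) * psi q1 x ^ nat e"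
      unfolding single_factor_def power_int_mult_distrib p0 p1 by (simp only: ac_simps)
    also have "\<dots> = (x powi d * (x ^ (2 * (m + 1))) powi e * inverse x) *
        (- ((1 - x\<^sup>2)\<^sup>2 / (1 - of_real q0 * x)\<^sup>2)) * psi q0 x ^ nat (e - 1) * psi q1 x ^ nat e"
      unfolding dl by (simp only: ac_simps)
    also have "\<dots> = x * ?S x" unfolding xp by (simp add: mult_ac)
    finally show ?thesis .
  qed
  ultimately show "\<exists>S. S holomorphic_on cball 0 1 \<and>
      (\<forall>x\<in>sphere 0 1. x powi d * delta_short q0 x * single_factor x powi e = x * S x)"
    by (intro exI[of _ ?S]) auto
next
  fix e :: int assume e: "1 \<le> e"
  let ?R = "\<lambda>x. - ((1 - x)\<^sup>2 / (1 - of_real q * x)\<^sup>2 * psi q x ^ nat (e - 1))"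
  have "?R holomorphic_on cball 0 1"
    by (intro holomorphic_intros psi_holomorphic q) (use one_minus_mult_nonzero[of "of_real q"] q in auto)
  moreover have "delta_root q x * psi q x powi e = ?R x" if x: "norm x = 1" for x
  proof -
    note nz = circle_one_minus[OF q(1) x]
    have p: "psi q x powi e = psi q x * psi q x ^ nat (e - 1)"
    proof -
      have "psi q x powi e = psi q x powi (1 + (e - 1))" by simp
      also have "\<dots> = psi q x * psi q x powi (e - 1)"
        using psi_nonzero[OF q(1) x] by (subst power_int_add) auto
      finally show ?thesis using e by (simp add: power_int_def)
    qed
    have "delta_root q x * psi q x = - ((1 - x)\<^sup>2 / (1 - of_real q * x)\<^sup>2)"
    proof -
      let ?w = "1 - of_real q * x"
      have a: "1 - of_real q * inverse x = (x - of_real q) * inverse x" "1 - inverse x = - (1 - x) * inverse x"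
        using nz(4) by (simp_all add: field_simps)
      have "delta_root q x * psi q x
        = (1 - x) * (- (1 - x) * inverse x) / (?w * ((x - of_real q) * inverse x)) * ((x - of_real q) / ?w)"
        unfolding delta_root_def psi_def a ..
      also have "\<dots> = - ((1 - x)\<^sup>2 / ?w\<^sup>2)"
      proof -
        have gen: "a * (- a * i) / (w * (r * i)) * (r / w) = - (a\<^sup>2 / w\<^sup>2)"
          if "r \<noteq> 0" "i \<noteq> 0" "w \<noteq> 0" for a i w r :: complex
          using that by (simp add: power2_eq_square field_simps)
        show ?thesis by (rule gen) (use nz in auto)
      qed
      finally show ?thesis .
    qed
    then show ?thesis unfolding p by (simp flip: mult.assoc)
  qed
  ultimately show "\<exists>R. R holomorphic_on cball 0 1 \<and> (\<forall>x\<in>sphere 0 1. delta_root q x * psi q x powi e = R x)"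
    by (intro exI[of _ ?R]) auto
qed

text \<open>The equations may also be solved on the reflection hyperplanes. There the weight
  vanishes, so the weighted function is zero at all solutions as soon as \<open>F\<close> is zero at
  the regular ones.\<close>

lemma integral_delta_zero_of_bethe_zeros:
  assumes F: "laurent n (\<lambda>_. 2 * m) F"
    and v: "\<And>z. z \<in> torus n \<Longrightarrow> regular n z \<Longrightarrow> (\<And>j. j < n \<Longrightarrow> bethe j z = 1) \<Longrightarrow> F z = 0"
  shows "(\<integral>z. F z * hl_delta n q q0 z \<partial>torus_measure n) = 0"
proof (rule integral_zero_of_bethe_zeros)
  show "tfun n (\<lambda>z. F z * hl_delta n q q0 z)"
    by (intro tfun_mult tfun_laurent[OF F] tfun_hl_delta) (use q in auto)
  show "(\<integral>z. F z * hl_delta n q q0 z * bmono k z \<partial>torus_measure n) = 0" if "\<exists>j<n. k j \<noteq> 0" for k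
    using integral_bmono_delta[OF that F] .
  show "(\<integral>z. 1 * bmono k z \<partial>torus_measure n) = 0" if "\<exists>j<n. k j \<noteq> 0" for k
    using integral_bmono_one[OF that] .
  show "F z * hl_delta n q q0 z = 0" if "z \<in> torus n" "\<And>j. j < n \<Longrightarrow> bethe j z = 1" for z
    using v[OF that(1) _ that(2)] hl_delta_nonregular[OF torus_nzvecs[OF that(1)]] by (cases "regular n z") auto
qed

end

section \<open>Closed form and monotonicity of the phase functions\<close>

lemma one_minus_cos_pos: fixes q :: real assumes "\<bar>q\<bar> < 1" shows "1 - q * cos t > 0"
proof -
  have "\<bar>q * cos t\<bar> \<le> \<bar>q\<bar> * 1" unfolding abs_mult by (intro mult_left_mono) auto
  then show ?thesis using assms by linarith
qed

lemma uq_denominator_pos: fixes q :: real assumes "\<bar>q\<bar> < 1" shows "1 - 2 * q * cos t + q\<^sup>2 > 0"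
proof -
  have "1 - 2 * q * cos t + q\<^sup>2 = (1 - q * cos t)\<^sup>2 + (q * sin t)\<^sup>2"
    unfolding power_mult_distrib sin_squared_eq by (simp add: power2_eq_square algebra_simps)
  moreover have "(1 - q * cos t)\<^sup>2 > 0" using one_minus_cos_pos[OF assms, of t] by simp
  ultimately show ?thesis by (simp add: add_pos_nonneg)
qed

text \<open>The function being differentiated is the continuous argument of
  \<open>psi q (cis t)\<close>: \<open>t\<close> minus twice the argument of
  \<open>1 - q * cis t\<close>. For \<open>\<bar>q\<bar> < 1\<close> the latter number stays in the
  right half plane, so \<open>arctan\<close> gives its argument without branch corrections.\<close>

lemma DERIV_vq_closed_form:
  assumes "\<bar>q\<bar> < 1"
  shows "((\<lambda>t. t + 2 * arctan (q * sin t / (1 - q * cos t))) has_real_derivative uq q t) (at t)"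
    (is "(?F has_real_derivative _) _")
proof -
    have p: "1 - q * cos t > 0" by (rule one_minus_cos_pos[OF assms])
    have D: "1 - 2 * q * cos t + q\<^sup>2 > 0" by (rule uq_denominator_pos[OF assms])
    let ?y = "q * sin t / (1 - q * cos t)"
    have d1: "((\<lambda>t. q * sin t / (1 - q * cos t)) has_real_derivative (q * cos t - q\<^sup>2) / (1 - q * cos t)\<^sup>2) (at t)"
    proof -
      have "((\<lambda>t. q * sin t / (1 - q * cos t)) has_real_derivative
        ((q * cos t) * (1 - q * cos t) - (q * sin t) * (q * sin t)) / ((1 - q * cos t) * (1 - q * cos t))) (at t)"
        using p by (auto intro!: derivative_eq_intros)
      moreover have "(q * cos t) * (1 - q * cos t) - (q * sin t) * (q * sin t) = q * cos t - q\<^sup>2"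
      proof -
        have "(q * sin t) * (q * sin t) = q\<^sup>2 * (1 - (cos t)\<^sup>2)"
          unfolding sin_squared_eq[symmetric] by (simp add: power2_eq_square)
        then show ?thesis by (simp add: power2_eq_square algebra_simps)
      qed
      ultimately show ?thesis by (simp add: power2_eq_square)
    qed
    have y2: "1 + ?y\<^sup>2 = (1 - 2 * q * cos t + q\<^sup>2) / (1 - q * cos t)\<^sup>2"
    proof -
      have "1 + ?y\<^sup>2 = ((1 - q * cos t)\<^sup>2 + (q * sin t)\<^sup>2) / (1 - q * cos t)\<^sup>2"
        using p by (simp add: power_divide add_divide_distrib)
      also have "(1 - q * cos t)\<^sup>2 + (q * sin t)\<^sup>2 = 1 - 2 * q * cos t + q\<^sup>2"
        unfolding power_mult_distrib sin_squared_eq by (simp add: power2_eq_square algebra_simps)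
      finally show ?thesis by simp
    qed
    have "(?F has_real_derivative 1 + 2 * (inverse (1 + ?y\<^sup>2) * ((q * cos t - q\<^sup>2) / (1 - q * cos t)\<^sup>2))) (at t)"
      by (intro DERIV_add DERIV_ident DERIV_cmult DERIV_chain2[OF DERIV_arctan d1])
    moreover have "1 + 2 * (inverse (1 + ?y\<^sup>2) * ((q * cos t - q\<^sup>2) / (1 - q * cos t)\<^sup>2)) = uq q t"
    proof -
      have e: "inverse (1 + ?y\<^sup>2) * ((q * cos t - q\<^sup>2) / (1 - q * cos t)\<^sup>2) = (q * cos t - q\<^sup>2) / (1 - 2 * q * cos t + q\<^sup>2)"
        unfolding y2 using p by simp
      show ?thesis unfolding e using D by (simp add: uq_def field_simps)
    qed
    ultimately show ?thesis by simp
qed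

lemma vq_closed_form:
  assumes "\<bar>q\<bar> < 1"
  shows "vq q t = t + 2 * arctan (q * sin t / (1 - q * cos t))"
proof -
  let ?F = "\<lambda>t. t + 2 * arctan (q * sin t / (1 - q * cos t))"
  note der = DERIV_vq_closed_form[OF assms]
  have "continuous_on {min 0 t..max 0 t} (uq q)"
    unfolding uq_def[abs_def] by (intro continuous_intros) (use uq_denominator_pos[OF assms] in \<open>auto simp: less_le\<close>)
  then have "(LBINT x=ereal 0..ereal t. uq q x) = ?F t - ?F 0"
    by (rule interval_integral_FTC_finite)
       (use der in \<open>simp add: has_real_derivative_iff_has_vector_derivative[symmetric] has_field_derivative_at_within\<close>)
  then show ?thesis by (simp add: vq_def)
qed

lemma vq_strict_mono:
  assumes "\<bar>q\<bar> < 1" "a < b" shows "vq q a < vq q b"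
proof -
  have "uq q t > 0" for t
  proof -
    have "q\<^sup>2 < 1" using assms(1) by (simp add: abs_square_less_1)
    then show ?thesis using uq_denominator_pos[OF assms(1), of t] by (simp add: uq_def)
  qed
  then have "a + 2 * arctan (q * sin a / (1 - q * cos a)) < b + 2 * arctan (q * sin b / (1 - q * cos b))"
    using DERIV_vq_closed_form[OF assms(1)] by (intro DERIV_pos_imp_increasing[OF assms(2)]) blast
  then show ?thesis by (simp add: vq_closed_form[OF assms(1)])
qed

lemma vq_odd: "\<bar>q\<bar> < 1 \<Longrightarrow> vq q (- t) = - vq q t"
  by (simp add: vq_closed_form arctan_minus)

lemma vq_periodic: "\<bar>q\<bar> < 1 \<Longrightarrow> vq q (t + 2 * pi) = vq q t + 2 * pi"
  by (simp add: vq_closed_form)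

lemma vq_reflect: "\<bar>q\<bar> < 1 \<Longrightarrow> vq q (2 * pi - t) = 2 * pi - vq q t"
  using vq_periodic[of q "- t"] vq_odd[of q t] by simp

lemma cis_vq:
  assumes "\<bar>q\<bar> < 1" shows "cis (vq q t) = psi q (cis t)"
proof -
  let ?d = "1 - q * cos t" and ?y = "q * sin t / (1 - q * cos t)"
  have p: "?d > 0" by (rule one_minus_cos_pos[OF assms])
  have s: "sqrt (1 + ?y\<^sup>2) > 0" by (simp add: add_pos_nonneg)
  have ca: "cis (arctan ?y) * of_real (sqrt (1 + ?y\<^sup>2)) = 1 + \<i> * of_real ?y"
    using s by (simp add: complex_eq_iff cos_arctan sin_arctan)
  have n: "cnj (cis (arctan ?y)) * of_real (sqrt (1 + ?y\<^sup>2)) = 1 - \<i> * of_real ?y"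
    using s by (simp add: complex_eq_iff cos_arctan sin_arctan)
  have "cis (2 * arctan ?y) * (1 - \<i> * of_real ?y) = 1 + \<i> * of_real ?y"
  proof -
    have "cis (2 * arctan ?y) * cnj (cis (arctan ?y)) = cis (arctan ?y)" by (simp add: cis_cnj cis_mult)
    then show ?thesis unfolding n[symmetric] ca[symmetric] by (simp flip: mult.assoc)
  qed
  then have e: "cis (2 * arctan ?y) * ((1 - \<i> * of_real ?y) * of_real ?d) = (1 + \<i> * of_real ?y) * of_real ?d"
    by (simp flip: mult.assoc)
  have yd: "of_real ?y * of_real ?d = (of_real (q * sin t) :: complex)"
    using p by (simp flip: of_real_mult)
  have l: "(1 - \<i> * of_real ?y) * of_real ?d = 1 - of_real q * cis t"
  proof -
    have "(1 - \<i> * of_real ?y) * of_real ?d = of_real ?d - \<i> * (of_real ?y * of_real ?d)" by (simp add: algebra_simps)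
    then show ?thesis unfolding yd by (simp add: complex_eq_iff)
  qed
  have r: "(1 + \<i> * of_real ?y) * of_real ?d = 1 - of_real q * inverse (cis t)"
  proof -
    have "(1 + \<i> * of_real ?y) * of_real ?d = of_real ?d + \<i> * (of_real ?y * of_real ?d)" by (simp add: algebra_simps)
    then show ?thesis unfolding yd by (simp add: complex_eq_iff cis_inverse)
  qed
  have nz: "1 - of_real q * cis t \<noteq> 0" by (rule circle_one_minus(1)[OF assms]) simp
  have "cis (2 * arctan ?y) = (1 - of_real q * inverse (cis t)) / (1 - of_real q * cis t)"
    using e nz unfolding l r by (simp add: field_simps)
  moreover have "cis (vq q t) = cis t * cis (2 * arctan ?y)"
    by (simp add: vq_closed_form[OF assms] cis_mult)
  moreover have "cis t * (1 - of_real q * inverse (cis t)) = cis t - of_real q"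
    by (simp add: algebra_simps cis_mult)
  ultimately show ?thesis by (simp add: psi_def)
qed

lemma cis_sum: "cis (\<Sum>i\<in>A. f i) = (\<Prod>i\<in>A. cis (f i))"
  by (induction A rule: infinite_finite_induct) (auto simp: cis_mult[symmetric])

definition cis_vec :: "nat \<Rightarrow> (nat \<Rightarrow> real) \<Rightarrow> nat \<Rightarrow> complex" where
  "cis_vec n \<xi> = (\<lambda>j\<in>{..<n}. cis (\<xi> j))"

lemma cis_vec_torus: "cis_vec n \<xi> \<in> torus n"
  by (auto simp: cis_vec_def torus_def)

context bethe_system
begin

definition bethe_phase :: "nat \<Rightarrow> (nat \<Rightarrow> real) \<Rightarrow> real" where
  "bethe_phase j \<xi> = 2 * real (m + 1) * \<xi> j + vq q0 (\<xi> j) + vq q1 (\<xi> j)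
        + (\<Sum>k\<in>{..<n} - {j}. vq q (\<xi> j + \<xi> k) + vq q (\<xi> j - \<xi> k))"

lemma cis_bethe_phase:
  assumes "j < n" shows "cis (bethe_phase j \<xi>) = bethe j (cis_vec n \<xi>)"
proof -
  have c: "cis (2 * real (m + 1) * x) = cis x ^ (2 * (m + 1))" for x
    by (simp only: Complex.DeMoivre) simp
  have "(\<Prod>k\<in>{..<n} - {j}. cis (vq q (\<xi> j + \<xi> k)) * cis (vq q (\<xi> j - \<xi> k)))
    = (\<Prod>k\<in>{..<n} - {j}. psi q (cis_vec n \<xi> j * cis_vec n \<xi> k) * psi q (cis_vec n \<xi> j / cis_vec n \<xi> k))"
    by (rule prod.cong[OF refl]) (use assms in \<open>simp add: cis_vq[OF q(1)] cis_vec_def cis_mult cis_divide\<close>)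
  then show ?thesis
    using assms unfolding bethe_phase_def bethe_def single_factor_def cis_mult[symmetric] c cis_sum cis_vq[OF q(2)] cis_vq[OF q(3)]
    by (simp add: cis_vec_def)
qed

text \<open>The phases form the gradient of a strictly convex function, and injectivity is the
  monotonicity of that gradient: pairing the difference of phases with the difference of vectors
  gives a positive definite quadratic part plus terms that are nonnegative because each
  \<open>vq\<close> increases.\<close>

lemma bethe_phase_inj:
  assumes ext: "\<xi> \<in> extensional {..<n}" "\<eta> \<in> extensional {..<n}"
    and eq: "\<And>j. j < n \<Longrightarrow> bethe_phase j \<xi> = bethe_phase j \<eta>"
  shows "\<xi> = \<eta>"
proof -
  have vm: "0 \<le> (vq c a - vq c b) * (a - b)" if "\<bar>c\<bar> < 1" for c a b
    using vq_strict_mono[OF that, of a b] vq_strict_mono[OF that, of b a]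
    by (cases a b rule: linorder_cases) (auto simp: mult_nonneg_nonneg mult_nonpos_nonpos)
  let ?d = "\<lambda>j. \<xi> j - \<eta> j"
  let ?g = "\<lambda>j k. (vq q (\<xi> j + \<xi> k) + vq q (\<xi> j - \<xi> k) - (vq q (\<eta> j + \<eta> k) + vq q (\<eta> j - \<eta> k))) * ?d j"
  have "0 = (\<Sum>j<n. (bethe_phase j \<xi> - bethe_phase j \<eta>) * ?d j)"
    using eq by simp
  also have "\<dots> = (\<Sum>j<n. 2 * real (m + 1) * (?d j)\<^sup>2 + ((vq q0 (\<xi> j) - vq q0 (\<eta> j)) * ?d j + (vq q1 (\<xi> j) - vq q1 (\<eta> j)) * ?d j)
       + (\<Sum>k\<in>{..<n} - {j}. ?g j k))"
  proof (rule sum.cong[OF refl])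
    fix j
    have "(\<Sum>k\<in>{..<n} - {j}. ?g j k) = ((\<Sum>k\<in>{..<n} - {j}. vq q (\<xi> j + \<xi> k) + vq q (\<xi> j - \<xi> k))
       - (\<Sum>k\<in>{..<n} - {j}. vq q (\<eta> j + \<eta> k) + vq q (\<eta> j - \<eta> k))) * ?d j"
      by (simp only: sum_distrib_right[symmetric] sum_subtractf)
    then show "(bethe_phase j \<xi> - bethe_phase j \<eta>) * ?d j
      = 2 * real (m + 1) * (?d j)\<^sup>2 + ((vq q0 (\<xi> j) - vq q0 (\<eta> j)) * ?d j + (vq q1 (\<xi> j) - vq q1 (\<eta> j)) * ?d j)
       + (\<Sum>k\<in>{..<n} - {j}. ?g j k)"
      unfolding bethe_phase_def by (simp add: power2_eq_square algebra_simps)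
  qed
  also have "\<dots> = (\<Sum>j<n. 2 * real (m + 1) * (?d j)\<^sup>2)
      + (\<Sum>j<n. (vq q0 (\<xi> j) - vq q0 (\<eta> j)) * ?d j + (vq q1 (\<xi> j) - vq q1 (\<eta> j)) * ?d j)
      + (\<Sum>(j,k)\<in>idx_pairs n. ?g j k + ?g k j)"
    by (simp only: sum.distrib sum_off_diagonal)
  finally have tot: "0 = (\<Sum>j<n. 2 * real (m + 1) * (?d j)\<^sup>2)
      + (\<Sum>j<n. (vq q0 (\<xi> j) - vq q0 (\<eta> j)) * ?d j + (vq q1 (\<xi> j) - vq q1 (\<eta> j)) * ?d j)
      + (\<Sum>(j,k)\<in>idx_pairs n. ?g j k + ?g k j)" .
  have "0 \<le> (\<Sum>(j,k)\<in>idx_pairs n. ?g j k + ?g k j)"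
  proof (rule sum_nonneg, clarify)
    fix j k
    have o: "vq q (\<xi> k - \<xi> j) = - vq q (\<xi> j - \<xi> k)" "vq q (\<eta> k - \<eta> j) = - vq q (\<eta> j - \<eta> k)"
      using vq_odd[OF q(1), of "\<xi> j - \<xi> k"] vq_odd[OF q(1), of "\<eta> j - \<eta> k"] by simp_all
    \<comment> \<open>Oddness of \<open>vq\<close> regroups the two contributions of a pair as
      monotone differences in the sum and in the difference of the two angles.\<close>
    have "?g j k + ?g k j = (vq q (\<xi> j + \<xi> k) - vq q (\<eta> j + \<eta> k)) * ((\<xi> j + \<xi> k) - (\<eta> j + \<eta> k))
      + (vq q (\<xi> j - \<xi> k) - vq q (\<eta> j - \<eta> k)) * ((\<xi> j - \<xi> k) - (\<eta> j - \<eta> k))"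
      unfolding o add.commute[of "\<xi> k" "\<xi> j"] add.commute[of "\<eta> k" "\<eta> j"] by (simp add: algebra_simps)
    then show "0 \<le> ?g j k + ?g k j"
      using vm[OF q(1), of "\<xi> j + \<xi> k" "\<eta> j + \<eta> k"] vm[OF q(1), of "\<xi> j - \<xi> k" "\<eta> j - \<eta> k"] by simp
  qed
  moreover have "0 \<le> (\<Sum>j<n. (vq q0 (\<xi> j) - vq q0 (\<eta> j)) * ?d j + (vq q1 (\<xi> j) - vq q1 (\<eta> j)) * ?d j)"
    by (intro sum_nonneg add_nonneg_nonneg vm q)
  moreover have nn: "0 \<le> (\<Sum>j<n. 2 * real (m + 1) * (?d j)\<^sup>2)" by (intro sum_nonneg) auto
  ultimately have "(\<Sum>j<n. 2 * real (m + 1) * (?d j)\<^sup>2) = 0" using tot by linarith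
  then have "\<forall>j\<in>{..<n}. 2 * real (m + 1) * (?d j)\<^sup>2 = 0"
    by (subst (asm) sum_nonneg_eq_0_iff) auto
  then have "\<xi> j = \<eta> j" if "j < n" for j using that by auto
  then show ?thesis using ext by (intro extensionalityI[of _ "{..<n}"]) auto
qed

text \<open>The definite description in \<open>nodeb\<close> is resolved only for a vector already
  known to solve the equations; uniqueness is \<open>bethe_phase_inj\<close>.\<close>

lemma nodeb_unique:
  assumes ext: "\<xi> \<in> extensional {..<n}"
    and eq: "\<And>j. j < n \<Longrightarrow> bethe_phase j \<xi> = 2 * pi * (real (n - j) + real_of_int (la j))"
  shows "nodeb m n q q0 q1 la = \<xi>"
  unfolding nodeb_def bethe_phase_def[symmetric]
proof (rule the_equality)
  show "\<xi> \<in> {..<n} \<rightarrow>\<^sub>E UNIV \<and> (\<forall>j<n. bethe_phase j \<xi> = 2 * pi * (real (n - j) + real_of_int (la j)))"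
    using ext eq by (simp add: PiE_def)
  fix \<eta> assume \<eta>: "\<eta> \<in> {..<n} \<rightarrow>\<^sub>E UNIV \<and> (\<forall>j<n. bethe_phase j \<eta> = 2 * pi * (real (n - j) + real_of_int (la j)))"
  show "\<eta> = \<xi>"
    by (rule bethe_phase_inj) (use \<eta> ext eq in \<open>auto simp: PiE_def\<close>)
qed

lemma AbD:
  assumes "\<xi> \<in> Ab n"
  shows "\<xi> \<in> extensional {..<n}" "j < n \<Longrightarrow> 0 < \<xi> j" "j < n \<Longrightarrow> \<xi> j < pi" "j < k \<Longrightarrow> k < n \<Longrightarrow> \<xi> k < \<xi> j"
proof -
  show "\<xi> \<in> extensional {..<n}" "j < n \<Longrightarrow> 0 < \<xi> j" "j < n \<Longrightarrow> \<xi> j < pi"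
    using assms by (auto simp: Ab_def PiE_def)
  show "\<xi> k < \<xi> j" if "j < k" "k < n"
    using that
  proof (induction k)
    case (Suc k)
    have "\<xi> (Suc k) < \<xi> k" using assms Suc.prems by (simp add: Ab_def)
    then show ?case using Suc by (cases "j = k") auto
  qed simp
qed

text \<open>Every phase is an integer multiple of \<open>2 * pi\<close>. In the alcove, monotonicity
  of \<open>vq\<close> makes these integers strictly decreasing and confines them to the range from
  1 to \<open>m + n\<close>, which is exactly the condition that subtracting the staircase
  \<open>n - j\<close> leaves an element of \<open>Lambdab m n\<close>.\<close>

lemma alcove_bethe_solution_is_node:
  assumes \<xi>: "\<xi> \<in> Ab n" and b: "\<And>j. j < n \<Longrightarrow> bethe j (cis_vec n \<xi>) = 1"
  obtains la where "la \<in> Lambdab m n" "nodeb m n q q0 q1 la = \<xi>"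
proof -
  note A = AbD[OF \<xi>]
  have "\<exists>N::int. bethe_phase j \<xi> = 2 * pi * of_int N" if "j < n" for j
  proof -
    have "cis (bethe_phase j \<xi>) = 1" using cis_bethe_phase[OF that] b[OF that] by simp
    then have "cos (bethe_phase j \<xi>) = 1" by (simp add: complex_eq_iff)
    then show ?thesis unfolding cos_one_2pi_int by (auto simp: mult.commute)
  qed
  then obtain N :: "nat \<Rightarrow> int" where N: "\<And>j. j < n \<Longrightarrow> bethe_phase j \<xi> = 2 * pi * of_int (N j)" by metis
  have vl: "vq c a < vq c b" if "\<bar>c\<bar> < 1" "a < b" for c a b by (rule vq_strict_mono[OF that])
  have dec: "N k < N j" if jk: "j < k" "k < n" for j k
  proof -
    have jn: "j < n" using jk by simp
    let ?R = "{..<n} - {j, k}"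
    let ?g = "\<lambda>a. \<Sum>l\<in>?R. vq q (a + \<xi> l) + vq q (a - \<xi> l)"
    have sj: "{..<n} - {j} = insert k ?R" "{..<n} - {k} = insert j ?R" using jk by auto
    have Bj: "bethe_phase j \<xi> = 2 * real (m + 1) * \<xi> j + vq q0 (\<xi> j) + vq q1 (\<xi> j) + (vq q (\<xi> j + \<xi> k) + vq q (\<xi> j - \<xi> k)) + ?g (\<xi> j)"
      unfolding bethe_phase_def sj by (subst sum.insert) auto
    have Bk: "bethe_phase k \<xi> = 2 * real (m + 1) * \<xi> k + vq q0 (\<xi> k) + vq q1 (\<xi> k) + (vq q (\<xi> k + \<xi> j) + vq q (\<xi> k - \<xi> j)) + ?g (\<xi> k)"
      unfolding bethe_phase_def sj by (subst sum.insert) auto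
    have lt: "\<xi> k < \<xi> j" by (rule A(4)[OF jk])
    have "?g (\<xi> k) \<le> ?g (\<xi> j)"
      by (intro sum_mono add_mono less_imp_le vl q) (use lt in auto)
    moreover have "vq q (\<xi> k - \<xi> j) < vq q (\<xi> j - \<xi> k)" using lt by (intro vl q) auto
    moreover have "vq q0 (\<xi> k) < vq q0 (\<xi> j)" "vq q1 (\<xi> k) < vq q1 (\<xi> j)" using lt by (auto intro!: vl q)
    moreover have "2 * real (m + 1) * \<xi> k < 2 * real (m + 1) * \<xi> j" using lt by (intro mult_strict_left_mono) auto
    moreover have "vq q (\<xi> k + \<xi> j) = vq q (\<xi> j + \<xi> k)" by (simp add: add.commute)
    ultimately have "bethe_phase k \<xi> < bethe_phase j \<xi>" unfolding Bj Bk by linarith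
    then show ?thesis using N[OF jn] N[OF jk(2)] by simp
  qed
  have pos: "1 \<le> N j" if j: "j < n" for j
  proof -
    have "vq c (\<xi> j) > 0" if "\<bar>c\<bar> < 1" for c
      using vl[OF that A(2)[OF j]] by (simp add: vq_closed_form[OF that])
    moreover have "0 \<le> (\<Sum>k\<in>{..<n} - {j}. vq q (\<xi> j + \<xi> k) + vq q (\<xi> j - \<xi> k))"
    proof (rule sum_nonneg)
      fix k assume "k \<in> {..<n} - {j}"
      have "vq q (\<xi> k - \<xi> j) < vq q (\<xi> j + \<xi> k)" using A(2)[OF j] by (intro vl q) auto
      then show "0 \<le> vq q (\<xi> j + \<xi> k) + vq q (\<xi> j - \<xi> k)" using vq_odd[OF q(1), of "\<xi> k - \<xi> j"] by simp
    qed
    moreover have "0 < 2 * real (m + 1) * \<xi> j" using A(2)[OF j] by simp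
    ultimately have "0 < bethe_phase j \<xi>" unfolding bethe_phase_def using q(2,3) by (smt (verit))
    then have "0 < real_of_int (N j)" using N[OF j] by (simp add: zero_less_mult_iff)
    then show ?thesis by simp
  qed
  have upper: "N j < int (m + n + 1)" if j: "j < n" for j
  proof -
    have v: "vq c (\<xi> j) < pi" if "\<bar>c\<bar> < 1" for c
      using vl[OF that A(3)[OF j]] by (simp add: vq_closed_form[OF that])
    have "(\<Sum>k\<in>{..<n} - {j}. vq q (\<xi> j + \<xi> k) + vq q (\<xi> j - \<xi> k)) \<le> (\<Sum>k\<in>{..<n} - {j}. 2 * pi)"
    proof (rule sum_mono)
      fix k assume "k \<in> {..<n} - {j}"
      \<comment> \<open>The two arguments add up to \<open>2 * \<xi> j\<close>, less than a full
        period, and \<open>vq_reflect\<close> converts this into the bound \<open>2 * pi\<close> for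
        the two values together.\<close>
      have "vq q (\<xi> j + \<xi> k) < vq q (2 * pi - (\<xi> j - \<xi> k))" using A(3)[OF j] by (intro vl q) auto
      then show "vq q (\<xi> j + \<xi> k) + vq q (\<xi> j - \<xi> k) \<le> 2 * pi" unfolding vq_reflect[OF q(1)] by simp
    qed
    also have "\<dots> = 2 * pi * (real n - 1)"
    proof -
      have "real (card ({..<n} - {j})) = real n - 1" using j by (simp add: of_nat_diff)
      then show ?thesis by simp
    qed
    finally have s: "(\<Sum>k\<in>{..<n} - {j}. vq q (\<xi> j + \<xi> k) + vq q (\<xi> j - \<xi> k)) \<le> 2 * pi * (real n - 1)" .
    have "2 * real (m + 1) * \<xi> j < 2 * real (m + 1) * pi"
      by (rule mult_strict_left_mono[OF A(3)[OF j]]) simp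
    then have "bethe_phase j \<xi> < 2 * real (m + 1) * pi + pi + pi + 2 * pi * (real n - 1)"
      unfolding bethe_phase_def using v[OF q(2)] v[OF q(3)] s by linarith
    also have "\<dots> = 2 * pi * real (m + n + 1)" by (simp add: algebra_simps)
    finally have "real_of_int (N j) < real (m + n + 1)" using N[OF j] by simp
    then show ?thesis by linarith
  qed
  define la where "la j = (if j < n then N j - int (n - j) else 0)" for j
  have step: "la (Suc j) \<le> la j" if "Suc j < n" for j
    using dec[of j "Suc j"] that by (simp add: la_def of_nat_diff)
  have mono: "la k \<le> la j" if "j \<le> k" "k < n" for j k
    using that by (induction rule: dec_induct) (use step in \<open>force intro: order_trans\<close>)+
  have bounds: "0 \<le> la j" "la j \<le> int m" if j: "j < n" for j
  proof -
    have "0 \<le> la (n - 1)" using pos[of "n - 1"] j by (simp add: la_def)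
    moreover have "la (n - 1) \<le> la j" by (rule mono) (use j in auto)
    ultimately show "0 \<le> la j" by linarith
    have "la 0 \<le> int m" using upper[of 0] j by (simp add: la_def)
    moreover have "la j \<le> la 0" by (rule mono) (use j in auto)
    ultimately show "la j \<le> int m" by linarith
  qed
  have "la \<in> Lambdab m n" using mono bounds by (auto simp: Lambdab_def la_def)
  moreover have "nodeb m n q q0 q1 la = \<xi>"
    by (rule nodeb_unique[OF A(1)]) (simp add: N la_def)
  ultimately show thesis by (rule that)
qed

end

section \<open>Transfer to the alcove\<close>

text \<open>The image of \<open>Ab n\<close> under \<open>cis_vec\<close>. Cosine reverses the order
  of the angles, hence the increasing real parts.\<close>

definition alcove :: "nat \<Rightarrow> (nat \<Rightarrow> complex) set" where
  "alcove n = {z \<in> torus n. (\<forall>j\<in>{..<n}. 0 < Im (z j)) \<and> (\<forall>j\<in>{j. Suc j < n}. Re (z j) < Re (z (Suc j)))}"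

lemma circle_Re_eq:
  assumes "norm x = 1" "norm y = 1" "Re x = Re y" shows "x = y \<or> x * y = 1"
proof -
  have "(Im x)\<^sup>2 = (Im y)\<^sup>2" using assms cmod_power2[of x] cmod_power2[of y] by simp
  then have "Im x = Im y \<or> Im x = - Im y" by (simp add: power2_eq_iff)
  then have "x = y \<or> x = cnj y" using assms(3) by (auto simp: complex_eq_iff)
  moreover have "cnj y * y = 1" using complex_norm_square[of y] assms(2) by (simp add: mult.commute)
  ultimately show ?thesis by auto
qed

lemma circle_Im_zero: assumes "norm x = 1" shows "Im x = 0 \<longleftrightarrow> x\<^sup>2 = 1"
proof
  assume "Im x = 0"
  then have "(Re x)\<^sup>2 = 1" using assms cmod_power2[of x] by simp
  then show "x\<^sup>2 = 1" using \<open>Im x = 0\<close> by (simp add: complex_eq_iff power2_eq_square)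
next
  assume "x\<^sup>2 = 1"
  then have "x = 1 \<or> x = -1" by (simp add: power2_eq_1_iff)
  then show "Im x = 0" by auto
qed

lemma alcove_strict:
  assumes "z \<in> alcove n" "j < k" "k < n" shows "Re (z j) < Re (z k)"
  using assms(2,3)
proof (induction k)
  case (Suc k)
  have "Re (z k) < Re (z (Suc k))" using assms(1) Suc.prems by (simp add: alcove_def)
  then show ?case using Suc by (cases "j = k") auto
qed simp

lemma alcove_regular: assumes "z \<in> alcove n" shows "regular n z"
proof -
  have z: "z \<in> torus n" using assms by (simp add: alcove_def)
  have 1: "(z j)\<^sup>2 \<noteq> 1" if "j < n" for j
    using circle_Im_zero[OF torusD[OF z that]] assms that by (force simp: alcove_def)
  have 2: "z j \<noteq> z k \<and> z j * z k \<noteq> 1" if "j < n" "k < n" "j \<noteq> k" for j k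
  proof -
    have "Re (z j) \<noteq> Re (z k)"
      using alcove_strict[OF assms, of j k] alcove_strict[OF assms, of k j] that by (metis less_irrefl nat_neq_iff)
    moreover have "Im (z j) > 0" "Im (z k) > 0" using assms that by (auto simp: alcove_def)
    moreover have "Re (z j) = Re (z k)" if e: "z j * z k = 1"
    proof -
      have "z j = cnj (z k)"
        using e complex_norm_square[of "z k"] torusD[OF z \<open>k < n\<close>] torus_nz[OF z \<open>k < n\<close>]
        by (metis mult.commute mult_cancel_left of_real_1 power_one)
      then show ?thesis by simp
    qed
    ultimately show ?thesis by auto
  qed
  show ?thesis unfolding regular_def using 1 2 torus_nz[OF z] by blast
qed

lemma sort_unique:
  fixes x :: "nat \<Rightarrow> real"
  assumes inj: "inj_on x {..<n}"
  shows "\<exists>!\<sigma>. \<sigma> permutes {..<n} \<and> (\<forall>j. Suc j < n \<longrightarrow> x (\<sigma> j) < x (\<sigma> (Suc j)))"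
proof -
  obtain \<sigma> where s: "\<sigma> permutes {..<n}" "\<And>j k. j \<le> k \<Longrightarrow> k < n \<Longrightarrow> - x (\<sigma> k) \<le> - x (\<sigma> j)"
    using sort_permutation[of n "\<lambda>j. - x j"] by blast
  have "x (\<sigma> j) < x (\<sigma> (Suc j))" if "Suc j < n" for j
  proof -
    have "\<sigma> j \<noteq> \<sigma> (Suc j)" using permutes_eq_iff[OF s(1)] by simp
    then have "x (\<sigma> j) \<noteq> x (\<sigma> (Suc j))"
      using inj permutes_lessThan_less[OF s(1), of j] permutes_lessThan_less[OF s(1), of "Suc j"] that
      by (auto dest: inj_onD)
    then show ?thesis using s(2)[of j "Suc j"] that by simp
  qed
  moreover have "\<sigma> = \<tau>" if \<sigma>: "\<sigma> permutes {..<n}" "\<forall>j. Suc j < n \<longrightarrow> x (\<sigma> j) < x (\<sigma> (Suc j))"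
    and \<tau>: "\<tau> permutes {..<n}" "\<forall>j. Suc j < n \<longrightarrow> x (\<tau> j) < x (\<tau> (Suc j))" for \<sigma> \<tau>
  proof -
    let ?l = "\<lambda>\<sigma>. map (\<lambda>j. x (\<sigma> j)) [0..<n]"
    have str: "x (\<rho> j) < x (\<rho> k)" if "\<forall>j. Suc j < n \<longrightarrow> x (\<rho> j) < x (\<rho> (Suc j))" "j < k" "k < n" for \<rho> j k
      using that(2,3)
    proof (induction k)
      case (Suc k)
      have "x (\<rho> k) < x (\<rho> (Suc k))" using that(1) Suc.prems by simp
      then show ?case using Suc by (cases "j = k") auto
    qed simp
    have srt: "sorted_wrt (<) (?l \<rho>)" if "\<forall>j. Suc j < n \<longrightarrow> x (\<rho> j) < x (\<rho> (Suc j))" for \<rho>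
      using str[OF that] by (auto simp: sorted_wrt_iff_nth_less)
    have st: "set (?l \<rho>) = x ` {..<n}" if "\<rho> permutes {..<n}" for \<rho>
    proof -
      have "set (?l \<rho>) = x ` \<rho> ` {..<n}" by (auto simp: image_iff atLeast0LessThan)
      then show ?thesis by (simp add: permutes_image[OF that])
    qed
    have "?l \<sigma> = ?l \<tau>"
      by (rule strict_sorted_equal) (use srt \<sigma> \<tau> st in auto)
    then have "x (\<sigma> j) = x (\<tau> j)" if "j < n" for j using that by (auto dest: nth_map_upt simp: map_eq_conv)
    then have "\<sigma> j = \<tau> j" if "j < n" for j
      using inj permutes_lessThan_less[OF \<sigma>(1) that] permutes_lessThan_less[OF \<tau>(1) that] that
      by (auto dest: inj_onD)
    then show ?thesis using \<sigma>(1) \<tau>(1) by (metis ext lessThan_iff permutes_not_in)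
  qed
  ultimately show ?thesis using s(1) by blast
qed

text \<open>The alcove is a fundamental domain. Inversion on the circle keeps real parts and negates
  imaginary parts. At a regular point the real parts are distinct, which leaves one sorting
  permutation, and the imaginary parts are nonzero, which then leaves one choice of signs.\<close>

lemma alcove_tiling:
  assumes z: "z \<in> torus n" and reg: "regular n z"
  shows "wsum n (\<lambda>\<sigma> \<epsilon>. indicator (alcove n) (sact n \<sigma> \<epsilon> z)) = (1::complex)"
proof -
  define sg where "sg \<sigma> = (\<lambda>j\<in>{..<n}. if 0 < Im (z (\<sigma> j)) then 1 else -1 :: int)" for \<sigma> :: "nat \<Rightarrow> nat"
  define srt where "srt \<sigma> \<longleftrightarrow> (\<forall>j. Suc j < n \<longrightarrow> Re (z (\<sigma> j)) < Re (z (\<sigma> (Suc j))))" for \<sigma> :: "nat \<Rightarrow> nat"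
  have iff: "sact n \<sigma> \<epsilon> z \<in> alcove n \<longleftrightarrow> srt \<sigma> \<and> \<epsilon> = sg \<sigma>" if s: "\<sigma> permutes {..<n}" and e: "\<epsilon> \<in> signs n" for \<sigma> \<epsilon>
  proof -
    have n1: "norm (z (\<sigma> j)) = 1" if "j < n" for j by (rule torusD[OF z permutes_lessThan_less[OF s that]])
    have inv: "inverse (z (\<sigma> j)) = cnj (z (\<sigma> j))" if "j < n" for j
      using n1[OF that] complex_norm_square[of "z (\<sigma> j)"] by (intro inverse_unique) simp
    have re: "Re (sact n \<sigma> \<epsilon> z j) = Re (z (\<sigma> j))" and im: "Im (sact n \<sigma> \<epsilon> z j) = of_int (\<epsilon> j) * Im (z (\<sigma> j))" if "j < n" for j
      using signsD[OF e that] that inv[OF that] by (auto simp: sact_apply)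
    have im0: "Im (z (\<sigma> j)) \<noteq> 0" if "j < n" for j
      using circle_Im_zero[OF n1[OF that]] reg permutes_lessThan_less[OF s that] by (simp add: regular_def)
    have "(\<forall>j\<in>{..<n}. 0 < Im (sact n \<sigma> \<epsilon> z j)) \<longleftrightarrow> \<epsilon> = sg \<sigma>"
    proof
      assume a: "\<forall>j\<in>{..<n}. 0 < Im (sact n \<sigma> \<epsilon> z j)"
      show "\<epsilon> = sg \<sigma>"
      proof (rule extensionalityI[of _ "{..<n}"])
        show "\<epsilon> \<in> extensional {..<n}" using e by (simp add: signs_def PiE_def)
        show "sg \<sigma> \<in> extensional {..<n}" by (simp add: sg_def)
        fix j assume "j \<in> {..<n}"
        then have j: "j < n" by simp
        have "0 < of_int (\<epsilon> j) * Im (z (\<sigma> j))" unfolding im[OF j, symmetric] using a j by blast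
        then show "\<epsilon> j = sg \<sigma> j" using signsD[OF e j] j by (auto simp: sg_def)
      qed
    next
      assume a: "\<epsilon> = sg \<sigma>"
      show "\<forall>j\<in>{..<n}. 0 < Im (sact n \<sigma> \<epsilon> z j)"
      proof
        fix j assume "j \<in> {..<n}"
        then have j: "j < n" by simp
        show "0 < Im (sact n \<sigma> \<epsilon> z j)" unfolding im[OF j] using im0[OF j] j by (auto simp: a sg_def)
      qed
    qed
    moreover have "(\<forall>j\<in>{j. Suc j < n}. Re (sact n \<sigma> \<epsilon> z j) < Re (sact n \<sigma> \<epsilon> z (Suc j))) \<longleftrightarrow> srt \<sigma>"
      by (auto simp: srt_def re)
    ultimately show ?thesis using sact_torus[OF s z] by (auto simp: alcove_def)
  qed
  have sg: "sg \<sigma> \<in> signs n" for \<sigma> by (auto simp: sg_def signs_def)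
  have "inj_on (\<lambda>j. Re (z j)) {..<n}"
  proof (rule inj_onI, rule ccontr)
    fix j k assume "j \<in> {..<n}" "k \<in> {..<n}" "Re (z j) = Re (z k)" "j \<noteq> k"
    then show False using circle_Re_eq[OF torusD[OF z, of j] torusD[OF z, of k]] reg by (auto simp: regular_def)
  qed
  then have ex1: "\<exists>!\<sigma>. \<sigma> permutes {..<n} \<and> srt \<sigma>" unfolding srt_def by (rule sort_unique)
  then obtain \<sigma>0 where \<sigma>0: "\<sigma>0 permutes {..<n}" "srt \<sigma>0" by blast
  have un: "\<sigma> = \<sigma>0" if "\<sigma> permutes {..<n}" "srt \<sigma>" for \<sigma> using ex1 \<sigma>0 that by blast
  have "wsum n (\<lambda>\<sigma> \<epsilon>. indicator (alcove n) (sact n \<sigma> \<epsilon> z)) = (wsum n (\<lambda>\<sigma> \<epsilon>. if \<epsilon> = sg \<sigma> then if \<sigma> = \<sigma>0 then 1 else 0 else 0) :: complex)"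
  proof (rule wsum_cong)
    fix \<sigma> \<epsilon> assume s: "\<sigma> permutes {..<n}" and e: "\<epsilon> \<in> signs n"
    have "srt \<sigma> \<longleftrightarrow> \<sigma> = \<sigma>0" using un[OF s] \<sigma>0(2) by blast
    then show "indicator (alcove n) (sact n \<sigma> \<epsilon> z) = (if \<epsilon> = sg \<sigma> then if \<sigma> = \<sigma>0 then 1 else 0 else 0 :: complex)"
      using iff[OF s e] by (simp add: indicator_def)
  qed
  also have "\<dots> = 1"
    unfolding wsum_def using sg \<sigma>0 by (simp add: sum.delta)
  finally show ?thesis .
qed

lemma alcove_sets: "alcove n \<in> sets (torus_measure n)"
proof -
  have c: "(\<lambda>z. z j) \<in> borel_measurable (torus_measure n)" if "j < n" for j
    using tfun_coord[OF that] by (simp add: tfun_def)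
  have r: "(\<lambda>z. Re (z j)) \<in> borel_measurable (torus_measure n)" "(\<lambda>z. Im (z j)) \<in> borel_measurable (torus_measure n)" if "j < n" for j
    using c[OF that] by measurable
  have "{z \<in> space (torus_measure n). (\<forall>j\<in>{..<n}. 0 < Im (z j)) \<and> (\<forall>j\<in>{j. Suc j < n}. Re (z j) < Re (z (Suc j)))} \<in> sets (torus_measure n)"
  proof (intro sets.sets_Collect_conj sets.sets_Collect_finite_All)
    show "finite {j. Suc j < n}" by (rule finite_subset[of _ "{..<n}"]) auto
    show "{z \<in> space (torus_measure n). 0 < Im (z j)} \<in> sets (torus_measure n)" if "j \<in> {..<n}" for j
      by (intro borel_measurable_less borel_measurable_const r) (use that in auto)
    show "{z \<in> space (torus_measure n). Re (z j) < Re (z (Suc j))} \<in> sets (torus_measure n)" if "j \<in> {j. Suc j < n}" for j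
      by (intro borel_measurable_less r) (use that in auto)
  qed auto
  then show ?thesis by (simp add: alcove_def)
qed

text \<open>The translates of the alcove cover the regular points once. That \<open>F\<close>
  vanishes at the other points takes the place of an argument that the walls have measure
  zero.\<close>

lemma integral_alcove:
  assumes F: "tfun n F" "wsym n F" and z: "\<And>z. z \<in> torus n \<Longrightarrow> \<not> regular n z \<Longrightarrow> F z = 0"
  shows "wsum n (\<lambda>_ _. 1) * (\<integral>z. indicator (alcove n) z * F z \<partial>torus_measure n) = (\<integral>z. F z \<partial>torus_measure n)"
proof -
  let ?Q = "\<lambda>z. indicator (alcove n) z * F z"
  have mF: "F \<in> borel_measurable (torus_measure n)" using F by (simp add: tfun_def)
  have mQ: "?Q \<in> borel_measurable (torus_measure n)"
    by (intro borel_measurable_times mF borel_measurable_indicator alcove_sets)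
  interpret T: finite_measure "torus_measure n" by (rule finite_torus)
  obtain B where B: "\<And>z. z \<in> torus n \<Longrightarrow> norm (F z) \<le> B" using tfun_bounded[OF F(1)] by blast
  have int: "integrable (torus_measure n) (\<lambda>z. ?Q (sact n \<sigma> \<epsilon> z))" if s: "\<sigma> permutes {..<n}" and e: "\<epsilon> \<in> signs n" for \<sigma> \<epsilon>
  proof (rule T.integrable_const_bound[of _ B])
    show "(\<lambda>z. ?Q (sact n \<sigma> \<epsilon> z)) \<in> borel_measurable (torus_measure n)" by (rule integral_sact(1)[OF s e mQ])
    show "AE z in torus_measure n. norm (?Q (sact n \<sigma> \<epsilon> z)) \<le> B"
    proof (rule AE_I2)
      fix z assume "z \<in> space (torus_measure n)"
      then have "norm (F (sact n \<sigma> \<epsilon> z)) \<le> B" using B sact_torus[OF s] by simp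
      moreover from this have "0 \<le> B" using norm_ge_zero order_trans by blast
      ultimately show "norm (?Q (sact n \<sigma> \<epsilon> z)) \<le> B" by (auto simp: indicator_def)
    qed
  qed
  have "wsum n (\<lambda>_ _. 1) * (\<integral>z. ?Q z \<partial>torus_measure n) = wsum n (\<lambda>_ _. \<integral>z. ?Q z \<partial>torus_measure n)"
    by (rule wsum_const[symmetric])
  also have "\<dots> = wsum n (\<lambda>\<sigma> \<epsilon>. \<integral>z. ?Q (sact n \<sigma> \<epsilon> z) \<partial>torus_measure n)"
    by (rule wsum_cong) (rule integral_sact(2)[OF _ _ mQ, symmetric])
  also have "\<dots> = (\<integral>z. wsum n (\<lambda>\<sigma> \<epsilon>. ?Q (sact n \<sigma> \<epsilon> z)) \<partial>torus_measure n)"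
    unfolding wsum_def
    by (subst Bochner_Integration.integral_sum, intro Bochner_Integration.integrable_sum int, simp, simp,
        rule sum.cong[OF refl], rule Bochner_Integration.integral_sum[symmetric], rule int) auto
  also have "\<dots> = (\<integral>z. F z \<partial>torus_measure n)"
  proof (rule Bochner_Integration.integral_cong[OF refl])
    fix z assume "z \<in> space (torus_measure n)"
    then have zt: "z \<in> torus n" by simp
    have "wsum n (\<lambda>\<sigma> \<epsilon>. ?Q (sact n \<sigma> \<epsilon> z)) = wsum n (\<lambda>\<sigma> \<epsilon>. indicator (alcove n) (sact n \<sigma> \<epsilon> z)) * F z"
      unfolding wsum_mult_right[symmetric]
      by (rule wsum_cong) (use F(2) torus_nzvecs[OF zt] in \<open>simp add: wsym_def\<close>)
    then show "wsum n (\<lambda>\<sigma> \<epsilon>. ?Q (sact n \<sigma> \<epsilon> z)) = F z"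
      using alcove_tiling[OF zt] z[OF zt] by (cases "regular n z") simp_all
  qed
  finally show ?thesis .
qed

section \<open>From the torus to Lebesgue measure in the angles\<close>

lemma Ab_iff_alcove:
  assumes \<xi>: "\<xi> \<in> extensional {..<n}"
  shows "(\<forall>j<n. 0 \<le> \<xi> j \<and> \<xi> j \<le> 2 * pi) \<and> cis_vec n \<xi> \<in> alcove n \<longleftrightarrow> \<xi> \<in> Ab n"
proof
  assume a: "(\<forall>j<n. 0 \<le> \<xi> j \<and> \<xi> j \<le> 2 * pi) \<and> cis_vec n \<xi> \<in> alcove n"
  have b: "0 < \<xi> j \<and> \<xi> j < pi" if j: "j < n" for j
  proof -
    have s: "0 < sin (\<xi> j)" using a j by (auto simp: alcove_def cis_vec_def)
    have "\<xi> j \<noteq> 0" using s by auto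
    moreover have "\<xi> j < pi"
    proof (rule ccontr)
      assume "\<not> \<xi> j < pi"
      then have "sin (\<xi> j) \<le> 0" using a j
        by (cases "\<xi> j = 2 * pi") (auto intro!: sin_le_zero simp: less_le)
      then show False using s by simp
    qed
    ultimately show ?thesis using a j by (auto simp: less_le)
  qed
  have "\<xi> (Suc j) < \<xi> j" if "Suc j < n" for j
  proof -
    have "cos (\<xi> j) < cos (\<xi> (Suc j))" using a that by (auto simp: alcove_def cis_vec_def)
    then show ?thesis using b[of j] b[of "Suc j"] that by (simp add: cos_mono_less_eq)
  qed
  then show "\<xi> \<in> Ab n" using b \<xi> by (auto simp: Ab_def PiE_def)
next
  assume a: "\<xi> \<in> Ab n"
  then have b: "0 < \<xi> j" "\<xi> j < pi" if "j < n" for j using that by (auto simp: Ab_def)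
  have "cos (\<xi> j) < cos (\<xi> (Suc j))" if "Suc j < n" for j
  proof -
    have "\<xi> (Suc j) < \<xi> j" using a that by (simp add: Ab_def)
    then show ?thesis using b[of j] b[of "Suc j"] that by (simp add: cos_mono_less_eq)
  qed
  then show "(\<forall>j<n. 0 \<le> \<xi> j \<and> \<xi> j \<le> 2 * pi) \<and> cis_vec n \<xi> \<in> alcove n"
    using b cis_vec_torus[of n \<xi>]
    by (auto simp: alcove_def cis_vec_def sin_gt_zero intro!: less_imp_le intro: order.strict_trans2)
      (smt (verit) b pi_gt_zero)+
qed

interpretation lborel_prod: product_sigma_finite "\<lambda>_::nat. lborel :: real measure"
  by (simp add: product_sigma_finite_def sigma_finite_lborel)

lemma torus_measure_eq_distr:
  fixes n :: nat
  defines "w \<equiv> \<lambda>\<xi>. ennreal (\<Prod>j<n. indicator {0..2*pi} (\<xi> j) / (2*pi))"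
  shows "cis_vec n \<in> PiM {..<n} (\<lambda>_. lborel) \<rightarrow>\<^sub>M torus_measure n"
    and "torus_measure n = distr (density (PiM {..<n} (\<lambda>_. lborel)) w) (torus_measure n) (cis_vec n)"
proof -
  let ?L = "PiM {..<n} (\<lambda>_. lborel :: real measure)"
  have cc: "cis \<in> lborel \<rightarrow>\<^sub>M circle_measure"
    by (simp add: measurable_cong_sets[OF refl sets_circle])
  show m: "cis_vec n \<in> ?L \<rightarrow>\<^sub>M torus_measure n"
    unfolding cis_vec_def[abs_def] torus_measure_def
  proof (rule measurable_restrict)
    fix j assume j: "j \<in> {..<n}"
    show "(\<lambda>\<xi>. cis (\<xi> j)) \<in> ?L \<rightarrow>\<^sub>M circle_measure"
      by (rule measurable_compose[OF measurable_component_singleton[OF j] cc])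
  qed
  have wm: "w \<in> borel_measurable ?L"
    unfolding w_def by measurable
  have w_eq: "w \<xi> = (\<Prod>j<n. ennreal (indicator {0..2*pi} (\<xi> j) / (2*pi)))" for \<xi>
    unfolding w_def by (rule prod_ennreal[symmetric]) (auto simp: indicator_def)
  show "torus_measure n = distr (density ?L w) (torus_measure n) (cis_vec n)"
  proof (subst (1) torus_measure_def, rule circle_prod.PiM_eqI[symmetric])
    show "sets (distr (density ?L w) (torus_measure n) (cis_vec n)) = sets (PiM {..<n} (\<lambda>_. circle_measure))"
      by (simp add: torus_measure_def)
    fix A assume A: "\<And>i. i \<in> {..<n} \<Longrightarrow> A i \<in> sets circle_measure"
    have PA: "Pi\<^sub>E {..<n} A \<in> sets (torus_measure n)"
      unfolding torus_measure_def by (rule sets_PiM_I_finite) (use A in auto)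
    have m': "cis_vec n \<in> density ?L w \<rightarrow>\<^sub>M torus_measure n" using m by simp
    have pre: "cis_vec n -` Pi\<^sub>E {..<n} A \<inter> space ?L \<in> sets ?L" by (rule measurable_sets[OF m PA])
    have "emeasure (distr (density ?L w) (torus_measure n) (cis_vec n)) (Pi\<^sub>E {..<n} A)
       = emeasure (density ?L w) (cis_vec n -` Pi\<^sub>E {..<n} A \<inter> space ?L)"
      using emeasure_distr[OF m' PA] by simp
    also have "\<dots> = (\<integral>\<^sup>+ \<xi>. w \<xi> * indicator (cis_vec n -` Pi\<^sub>E {..<n} A \<inter> space ?L) \<xi> \<partial>?L)"
      by (rule emeasure_density[OF wm pre])
    also have "\<dots> = (\<integral>\<^sup>+ \<xi>. (\<Prod>j<n. ennreal (indicator {0..2*pi} (\<xi> j) / (2*pi)) * indicator (A j) (cis (\<xi> j))) \<partial>?L)"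
    proof (rule nn_integral_cong)
      fix \<xi> assume x: "\<xi> \<in> space ?L"
      have "indicator (cis_vec n -` Pi\<^sub>E {..<n} A \<inter> space ?L) \<xi> = (\<Prod>j<n. indicator (A j) (cis (\<xi> j)) :: ennreal)"
      proof (cases "\<forall>j<n. cis (\<xi> j) \<in> A j")
        case True
        then have "cis_vec n \<xi> \<in> Pi\<^sub>E {..<n} A" by (auto simp: cis_vec_def)
        then show ?thesis using True x by simp
      next
        case False
        then have "cis_vec n \<xi> \<notin> Pi\<^sub>E {..<n} A" by (auto simp: cis_vec_def PiE_def Pi_def)
        moreover have "(\<Prod>j<n. indicator (A j) (cis (\<xi> j)) :: ennreal) = 0"
        proof -
          obtain j where "j < n" "cis (\<xi> j) \<notin> A j" using False by blast
          then show ?thesis by (intro prod_zero bexI[of _ j]) auto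
        qed
        ultimately show ?thesis by simp
      qed
      then show "w \<xi> * indicator (cis_vec n -` Pi\<^sub>E {..<n} A \<inter> space ?L) \<xi>
        = (\<Prod>j<n. ennreal (indicator {0..2*pi} (\<xi> j) / (2*pi)) * indicator (A j) (cis (\<xi> j)))"
        by (simp add: w_eq prod.distrib)
    qed
    also have "\<dots> = (\<Prod>j<n. \<integral>\<^sup>+ x. ennreal (indicator {0..2*pi} x / (2*pi)) * indicator (A j) (cis x) \<partial>lborel)"
    proof (rule lborel_prod.product_nn_integral_prod)
      fix j assume j: "j \<in> {..<n}"
      have "(\<lambda>x. indicator (A j) (cis x) :: ennreal) \<in> borel_measurable borel"
        using A[OF j] sets_circle by (intro measurable_compose[OF cis_measurable]) (auto intro!: borel_measurable_indicator)
      then show "(\<lambda>x. ennreal (indicator {0..2*pi} x / (2*pi)) * indicator (A j) (cis x)) \<in> borel_measurable lborel"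
        by (intro borel_measurable_times_ennreal) auto
    qed simp
    also have "\<dots> = (\<Prod>j<n. emeasure circle_measure (A j))"
      by (rule prod.cong[OF refl], rule emeasure_circle[symmetric], rule A)
    finally show "emeasure (distr (density ?L w) (torus_measure n) (cis_vec n)) (Pi\<^sub>E {..<n} A)
       = (\<Prod>j<n. emeasure circle_measure (A j))" .
  qed simp
qed

lemma integral_Ab:
  assumes F: "tfun n F"
  shows "of_real (1 / (2*pi) ^ n) * set_lebesgue_integral (PiM {..<n} (\<lambda>_. lborel)) (Ab n) (\<lambda>\<xi>. F (cis_vec n \<xi>))
    = (\<integral>z. indicator (alcove n) z * F z \<partial>torus_measure n)"
proof -
  let ?L = "PiM {..<n} (\<lambda>_. lborel :: real measure)"
  let ?Q = "\<lambda>z. indicator (alcove n) z * F z"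
  let ?w = "\<lambda>\<xi>. \<Prod>j<n. indicator {0..2*pi} (\<xi> j) / (2*pi) :: real"
  note T = torus_measure_eq_distr[of n]
  have mQ: "?Q \<in> borel_measurable (torus_measure n)"
    using F by (intro borel_measurable_times borel_measurable_indicator alcove_sets) (simp add: tfun_def)
  have m': "cis_vec n \<in> density ?L (\<lambda>\<xi>. ennreal (?w \<xi>)) \<rightarrow>\<^sub>M torus_measure n" using T(1) by simp
  have "(\<integral>z. ?Q z \<partial>torus_measure n) = (\<integral>z. ?Q z \<partial>distr (density ?L (\<lambda>\<xi>. ennreal (?w \<xi>))) (torus_measure n) (cis_vec n))"
    using T(2) by simp
  also have "\<dots> = (\<integral>\<xi>. ?Q (cis_vec n \<xi>) \<partial>density ?L (\<lambda>\<xi>. ennreal (?w \<xi>)))"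
    by (rule integral_distr[OF m' mQ])
  also have "\<dots> = (\<integral>\<xi>. ?w \<xi> *\<^sub>R ?Q (cis_vec n \<xi>) \<partial>?L)"
  proof (rule integral_density)
    show "(\<lambda>\<xi>. ?Q (cis_vec n \<xi>)) \<in> borel_measurable ?L" by (rule measurable_compose[OF T(1) mQ])
    show "?w \<in> borel_measurable ?L" by measurable
    show "AE \<xi> in ?L. 0 \<le> ?w \<xi>" by (intro AE_I2 prod_nonneg) (auto simp: indicator_def)
  qed
  also have "\<dots> = (\<integral>\<xi>. of_real (1 / (2*pi) ^ n) * (indicator (Ab n) \<xi> *\<^sub>R F (cis_vec n \<xi>)) \<partial>?L)"
  proof (rule Bochner_Integration.integral_cong[OF refl])
    fix \<xi> assume "\<xi> \<in> space ?L"
    then have e: "\<xi> \<in> extensional {..<n}" by (simp add: space_PiM PiE_def)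
    have w: "?w \<xi> = (if \<forall>j<n. 0 \<le> \<xi> j \<and> \<xi> j \<le> 2 * pi then 1 / (2*pi) ^ n else 0)"
    proof (cases "\<forall>j<n. 0 \<le> \<xi> j \<and> \<xi> j \<le> 2 * pi")
      case True
      then have "?w \<xi> = (\<Prod>j<n. 1 / (2*pi))" by (intro prod.cong) auto
      then show ?thesis using True by (simp add: power_one_over)
    next
      case False
      then have "\<exists>j\<in>{..<n}. indicator {0..2*pi} (\<xi> j) / (2*pi) = (0::real)" by (auto simp: indicator_def)
      then have "?w \<xi> = 0" by (intro prod_zero) auto
      then show ?thesis by (simp only: if_not_P[OF False])
    qed
    have "?w \<xi> * indicator (alcove n) (cis_vec n \<xi>) = 1 / (2*pi) ^ n * indicator (Ab n) \<xi>"
      using Ab_iff_alcove[OF e] unfolding w by (auto simp: indicator_def)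
    then have "of_real (?w \<xi>) * of_real (indicator (alcove n) (cis_vec n \<xi>)) = (of_real (1 / (2*pi) ^ n) * of_real (indicator (Ab n) \<xi>) :: complex)"
      by (simp only: of_real_mult[symmetric])
    moreover have "(indicator (alcove n) (cis_vec n \<xi>) :: complex) = of_real (indicator (alcove n) (cis_vec n \<xi>))"
      by (simp add: indicator_def)
    ultimately show "?w \<xi> *\<^sub>R ?Q (cis_vec n \<xi>) = of_real (1 / (2*pi) ^ n) * (indicator (Ab n) \<xi> *\<^sub>R F (cis_vec n \<xi>))"
      unfolding scaleR_conv_of_real by (simp only: mult.assoc[symmetric])
  qed
  also have "\<dots> = of_real (1 / (2*pi) ^ n) * (\<integral>\<xi>. indicator (Ab n) \<xi> *\<^sub>R F (cis_vec n \<xi>) \<partial>?L)"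
    by (rule Bochner_Integration.integral_mult_right_zero)
  finally show ?thesis unfolding set_lebesgue_integral_def by simp
qed

section \<open>The given functions in exponential variables\<close>

lemma Cb_eq_hl_c:
  assumes "\<And>j. j < n \<Longrightarrow> z j = cis (x j)"
  shows "Cb n q q0 x = hl_c n q q0 z"
proof -
  have e1: "exp (- \<i> * complex_of_real y) = 1 / cis y" for y
    by (simp add: cis_conv_exp exp_minus inverse_eq_divide)
  have e2: "exp (- 2 * \<i> * complex_of_real y) = 1 / (cis y)\<^sup>2" for y
  proof -
    have "exp (- 2 * \<i> * complex_of_real y) = exp (- \<i> * complex_of_real y) * exp (- \<i> * complex_of_real y)"
      by (simp add: mult.assoc flip: exp_add)
    then show ?thesis unfolding e1 by (simp add: power2_eq_square)
  qed
  have "(\<Prod>j<n. (1 - complex_of_real q0 * exp (- \<i> * x j)) / (1 - exp (- 2 * \<i> * x j)))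
     = (\<Prod>j<n. (1 - of_real q0 / z j) / (1 - 1 / (z j)\<^sup>2))"
    by (rule prod.cong[OF refl]) (simp only: e1 e2 lessThan_iff assms times_divide_eq_right mult_1_right)
  moreover have "(\<Prod>j<n. \<Prod>k\<in>{j<..<n}.
        ((1 - complex_of_real q * exp (- \<i> * (x j - x k))) / (1 - exp (- \<i> * (x j - x k)))) *
        ((1 - complex_of_real q * exp (- \<i> * (x j + x k))) / (1 - exp (- \<i> * (x j + x k)))))
     = (\<Prod>(j,k)\<in>idx_pairs n. ((1 - of_real q * (z k / z j)) / (1 - z k / z j)) *
        ((1 - of_real q * (1 / (z j * z k))) / (1 - 1 / (z j * z k))))"
    unfolding prod_idx_pairs_nested
  proof (rule prod.cong[OF refl], clarify)
    fix j k assume "(j,k) \<in> idx_pairs n"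
    then have z: "z j = cis (x j)" "z k = cis (x k)" using assms by auto
    have "1 / cis (x j - x k) = z k / z j" "1 / cis (x j + x k) = 1 / (z j * z k)"
      unfolding z cis_divide[symmetric] cis_mult[symmetric] by simp_all
    then show "((1 - complex_of_real q * exp (- \<i> * (x j - x k))) / (1 - exp (- \<i> * (x j - x k)))) *
        ((1 - complex_of_real q * exp (- \<i> * (x j + x k))) / (1 - exp (- \<i> * (x j + x k))))
      = ((1 - of_real q * (z k / z j)) / (1 - z k / z j)) *
        ((1 - of_real q * (1 / (z j * z k))) / (1 - 1 / (z j * z k)))"
      unfolding e1 by simp
  qed
  ultimately show ?thesis unfolding Cb_def hl_c_def by simp
qed

lemma exp_sum_eq_lmono:
  assumes "\<And>j. j < n \<Longrightarrow> z j = cis (x j)"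
  shows "exp (\<i> * complex_of_real (\<Sum>j<n. x j * real_of_int (\<nu> j))) = lmono n \<nu> z"
proof -
  have "exp (\<i> * complex_of_real (\<Sum>j<n. x j * real_of_int (\<nu> j))) = cis (\<Sum>j<n. x j * real_of_int (\<nu> j))"
    by (simp add: cis_conv_exp)
  also have "\<dots> = (\<Prod>j<n. z j powi \<nu> j)"
    unfolding cis_sum by (rule prod.cong[OF refl]) (simp add: assms cis_power_int mult.commute)
  finally show ?thesis by (simp add: lmono_def)
qed

lemma Pb_eq_hl_sum: "Pb n \<mu> \<xi> q q0 = hl_sum n q q0 \<mu> (cis_vec n \<xi>)"
  unfolding Pb_def hl_sum_def wsum_def
proof (intro sum.cong refl)
  fix \<sigma> \<epsilon> assume s: "\<sigma> \<in> {\<sigma>. \<sigma> permutes {..<n}}" and e: "\<epsilon> \<in> signs n"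
  have y: "sact n \<sigma> \<epsilon> (cis_vec n \<xi>) j = cis (real_of_int (\<epsilon> j) * \<xi> (\<sigma> j))" if "j < n" for j
    using that s permutes_lessThan_less[of \<sigma> n j] by (simp add: sact_apply cis_vec_def cis_power_int)
  show "Cb n q q0 (\<lambda>j. real_of_int (\<epsilon> j) * \<xi> (\<sigma> j)) *
        exp (\<i> * complex_of_real (\<Sum>j<n. real_of_int (\<epsilon> j) * \<xi> (\<sigma> j) * real_of_int (\<mu> j)))
    = hl_c n q q0 (sact n \<sigma> \<epsilon> (cis_vec n \<xi>)) * lmono n \<mu> (sact n \<sigma> \<epsilon> (cis_vec n \<xi>))"
    by (simp only: Cb_eq_hl_c[of n "sact n \<sigma> \<epsilon> (cis_vec n \<xi>)", OF y]
        exp_sum_eq_lmono[of n "sact n \<sigma> \<epsilon> (cis_vec n \<xi>)", OF y])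
qed

lemma cnj_hl_c:
  fixes q q0 :: real
  assumes "\<And>j. j < n \<Longrightarrow> y j = cnj (z j)"
  shows "cnj (hl_c n q q0 z) = hl_c n q q0 y"
proof -
  have "(\<Prod>(j,k)\<in>idx_pairs n. cnj ((1 - q * (z k / z j)) / (1 - z k / z j) * ((1 - q * (1 / (z j * z k))) / (1 - 1 / (z j * z k)))))
    = (\<Prod>(j,k)\<in>idx_pairs n. (1 - q * (y k / y j)) / (1 - y k / y j) * ((1 - q * (1 / (y j * y k))) / (1 - 1 / (y j * y k))))"
    by (rule prod.cong[OF refl]) (auto simp: assms)
  moreover have "(\<Prod>j<n. cnj ((1 - q0 / z j) / (1 - 1 / (z j)\<^sup>2))) = (\<Prod>j<n. (1 - q0 / y j) / (1 - 1 / (y j)\<^sup>2))"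
    by (rule prod.cong[OF refl]) (auto simp: assms)
  ultimately show ?thesis unfolding hl_c_def complex_cnj_mult cnj_prod case_prod_unfold by simp
qed

text \<open>On the torus conjugation inverts all coordinates, which is an element of the symmetry
  group of \<open>p\<close>, and the coefficients of \<open>hl_c\<close> are real. Reality lets the
  squared moduli in the Christoffel weight be read as plain products of polynomial values.\<close>

lemma hl_polynomial_real:
  fixes q q0 :: real
  assumes p: "wsym n p" "\<And>z. regular n z \<Longrightarrow> p z = hl_sum n q q0 \<nu> z"
    and z: "z \<in> torus n" "regular n z"
  shows "cnj (p z) = p z"
proof -
  define \<epsilon>1 where "\<epsilon>1 = (\<lambda>j\<in>{..<n}. - 1 :: int)"
  have e1: "\<epsilon>1 \<in> signs n" by (auto simp: \<epsilon>1_def signs_def)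
  let ?y = "sact n id \<epsilon>1 z"
  have y: "?y j = cnj (z j)" if "j < n" for j
  proof -
    have "z j * cnj (z j) = 1" using complex_norm_square[of "z j"] torusD[OF z(1) that] by simp
    from inverse_unique[OF this] show ?thesis using that by (simp add: sact_apply \<epsilon>1_def)
  qed
  have pid: "id permutes {..<n}" by (rule permutes_id)
  have ry: "regular n ?y" using regular_sact[OF pid e1 torus_nzvecs[OF z(1)]] z(2) by simp
  have yt: "?y \<in> torus n" by (rule sact_torus[OF pid z(1)])
  have "cnj (p z) = wsum n (\<lambda>\<sigma> \<epsilon>. cnj (hl_c n q q0 (sact n \<sigma> \<epsilon> z)) * cnj (lmono n \<nu> (sact n \<sigma> \<epsilon> z)))"
    unfolding p(2)[OF z(2)] hl_sum_def wsum_def by (simp add: cnj_sum)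
  also have "\<dots> = wsum n (\<lambda>\<sigma> \<epsilon>. hl_c n q q0 (sact n \<sigma> \<epsilon> ?y) * lmono n \<nu> (sact n \<sigma> \<epsilon> ?y))"
  proof (rule wsum_cong)
    fix \<sigma> \<epsilon> assume s: "\<sigma> permutes {..<n}" and e: "\<epsilon> \<in> signs n"
    have cp: "cnj (x powi k) = cnj x powi k" for x k by (simp add: power_int_def)
    have yy: "sact n \<sigma> \<epsilon> ?y j = cnj (sact n \<sigma> \<epsilon> z j)" if "j < n" for j
      using y[OF permutes_lessThan_less[OF s that]] that by (simp only: sact_apply cp)
    have "cnj (lmono n \<nu> (sact n \<sigma> \<epsilon> z)) = lmono n \<nu> (sact n \<sigma> \<epsilon> ?y)"
      unfolding lmono_def cnj_prod by (rule prod.cong[OF refl]) (simp only: lessThan_iff cp yy)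
    then show "cnj (hl_c n q q0 (sact n \<sigma> \<epsilon> z)) * cnj (lmono n \<nu> (sact n \<sigma> \<epsilon> z))
      = hl_c n q q0 (sact n \<sigma> \<epsilon> ?y) * lmono n \<nu> (sact n \<sigma> \<epsilon> ?y)"
      using cnj_hl_c[of n "sact n \<sigma> \<epsilon> ?y" "sact n \<sigma> \<epsilon> z", OF yy] by simp
  qed
  also have "\<dots> = p ?y" unfolding p(2)[OF ry] hl_sum_def ..
  also have "\<dots> = p z" using p(1) pid e1 torus_nzvecs[OF z(1)] by (simp add: wsym_def)
  finally show ?thesis .
qed

lemma finite_Lambdab: "finite (Lambdab D n)"
proof (rule finite_subset)
  show "Lambdab D n \<subseteq> {\<mu>. \<forall>j. (j \<in> {..<n} \<longrightarrow> \<mu> j \<in> {0..int D}) \<and> (j \<notin> {..<n} \<longrightarrow> \<mu> j = 0)}"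
    by (auto simp: Lambdab_def)
  show "finite {\<mu>. \<forall>j::nat. (j \<in> {..<n} \<longrightarrow> \<mu> j \<in> {0..int D}) \<and> (j \<notin> {..<n} \<longrightarrow> \<mu> j = 0)}"
    by (rule finite_set_of_finite_funs) auto
qed

lemma finite_orbitb: "finite (orbitb n \<mu>)"
  by (simp add: orbitb_def)

lemma orbit_sum_wsym: "wsym n (\<lambda>z. \<Sum>\<nu>\<in>orbitb n \<mu>. lmono n \<nu> z)"
  unfolding wsym_def
proof (intro allI impI)
  fix \<pi> \<delta> z assume p: "\<pi> permutes {..<n}" and d: "\<delta> \<in> signs n" and z: "z \<in> nzvecs n"
  \<comment> \<open>The action on exponent vectors that is dual to
    \<open>sact n \<pi> \<delta>\<close>; like the vectors of the orbit, its values are 0 outside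
    \<open>{..<n}\<close>.\<close>
  define T where "T \<nu> j = (if j < n then \<delta> (inv \<pi> j) * \<nu> (inv \<pi> j) else 0)" for \<nu> :: "nat \<Rightarrow> int" and j
  have i: "inv \<pi> permutes {..<n}" by (rule permutes_inv[OF p])
  have lm: "lmono n \<nu> (sact n \<pi> \<delta> z) = lmono n (T \<nu>) z" for \<nu>
  proof -
    have "lmono n (T \<nu>) z = (\<Prod>j<n. z (\<pi> j) powi T \<nu> (\<pi> j))"
      using prod.permute[OF p, of "\<lambda>j. z j powi T \<nu> j"] by (simp add: lmono_def o_def)
    also have "\<dots> = lmono n \<nu> (sact n \<pi> \<delta> z)"
      unfolding lmono_sact by (rule prod.cong[OF refl]) (simp add: T_def permutes_lessThan_less[OF p] permutes_inverses[OF p])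
    finally show ?thesis by simp
  qed
  have sub: "T ` orbitb n \<mu> \<subseteq> orbitb n \<mu>"
  proof (rule image_subsetI)
    fix \<nu> assume "\<nu> \<in> orbitb n \<mu>"
    then obtain \<sigma> \<epsilon> where se: "\<sigma> permutes {..<n}" "\<epsilon> \<in> signs n" "\<nu> = (\<lambda>j. if j < n then \<epsilon> j * \<mu> (\<sigma> j) else 0)"
      by (auto simp: orbitb_def)
    define \<epsilon>' where "\<epsilon>' = (\<lambda>j\<in>{..<n}. \<delta> (inv \<pi> j) * \<epsilon> (inv \<pi> j))"
    have "\<epsilon>' \<in> signs n"
      unfolding signs_def \<epsilon>'_def
    proof (rule restrict_PiE_iff[THEN iffD2], rule ballI)
      fix j assume "j \<in> {..<n}"
      then have "inv \<pi> j < n" using permutes_lessThan_less[OF i] by simp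
      then show "\<delta> (inv \<pi> j) * \<epsilon> (inv \<pi> j) \<in> {-1, 1}"
        using signsD[OF d] signsD[OF se(2)] by (metis insertI1 insertI2 mult_1_right mult_minus1_right minus_minus)
    qed
    moreover have "\<sigma> \<circ> inv \<pi> permutes {..<n}" by (rule permutes_compose[OF i se(1)])
    moreover have "T \<nu> = (\<lambda>j. if j < n then \<epsilon>' j * \<mu> ((\<sigma> \<circ> inv \<pi>) j) else 0)"
      using permutes_lessThan_less[OF i] by (auto simp: T_def \<epsilon>'_def se(3) fun_eq_iff)
    ultimately show "T \<nu> \<in> orbitb n \<mu>" unfolding orbitb_def
      by (intro image_eqI[of _ _ "(\<sigma> \<circ> inv \<pi>, \<epsilon>')"]) auto
  qed
  have inj: "inj_on T (orbitb n \<mu>)"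
  proof (rule inj_onI)
    fix \<nu> \<nu>' assume o: "\<nu> \<in> orbitb n \<mu>" "\<nu>' \<in> orbitb n \<mu>" and e: "T \<nu> = T \<nu>'"
    show "\<nu> = \<nu>'"
    proof
      fix j
      show "\<nu> j = \<nu>' j"
      proof (cases "j < n")
        case True
        have "T \<nu> (\<pi> j) = T \<nu>' (\<pi> j)" using e by simp
        then have "\<delta> j * \<nu> j = \<delta> j * \<nu>' j"
          using permutes_lessThan_less[OF p True] by (simp add: T_def permutes_inverses[OF p])
        then show ?thesis using signsD[OF d True] by auto
      next
        case False
        then show ?thesis using o by (auto simp: orbitb_def)
      qed
    qed
  qed
  have bij: "bij_betw T (orbitb n \<mu>) (orbitb n \<mu>)"
    using endo_inj_surj[OF finite_orbitb sub inj] inj by (simp add: bij_betw_def)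
  show "(\<Sum>\<nu>\<in>orbitb n \<mu>. lmono n \<nu> (sact n \<pi> \<delta> z)) = (\<Sum>\<nu>\<in>orbitb n \<mu>. lmono n \<nu> z)"
    unfolding lm by (rule sum.reindex_bij_betw[OF bij])
qed

lemma Pspace_laurent:
  assumes "f \<in> Pspace D n"
  obtains F where "laurent n (\<lambda>_. D) F" "wsym n F" "\<And>\<xi>. f \<xi> = F (cis_vec n \<xi>)"
proof -
  obtain c where f: "f = (\<lambda>\<xi>. \<Sum>\<mu>\<in>Lambdab D n. c \<mu> * Mb n \<mu> \<xi>)" using assms by (auto simp: Pspace_def)
  let ?G = "\<lambda>\<mu> z. \<Sum>\<nu>\<in>orbitb n \<mu>. lmono n \<nu> z"
  have "laurent n (\<lambda>_. D) (?G \<mu>)" if "\<mu> \<in> Lambdab D n" for \<mu>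
  proof (rule laurent_sum)
    fix \<nu> assume "\<nu> \<in> orbitb n \<mu>"
    then obtain \<sigma> \<epsilon> where se: "\<sigma> permutes {..<n}" "\<epsilon> \<in> signs n" "\<nu> = (\<lambda>j. if j < n then \<epsilon> j * \<mu> (\<sigma> j) else 0)"
      by (auto simp: orbitb_def)
    have "\<bar>\<nu> j\<bar> \<le> int D" if j: "j < n" for j
    proof -
      have "0 \<le> \<mu> (\<sigma> j) \<and> \<mu> (\<sigma> j) \<le> int D"
        using \<open>\<mu> \<in> Lambdab D n\<close> permutes_lessThan_less[OF se(1) j] by (simp add: Lambdab_def)
      then show ?thesis using signsD[OF se(2) j] j by (auto simp: se(3))
    qed
    then show "laurent n (\<lambda>_. D) (lmono n \<nu>)" using laurent_lmono[of n \<nu> "\<lambda>_. D" 1] by simp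
  qed
  then have "laurent n (\<lambda>_. D) (\<lambda>z. \<Sum>\<mu>\<in>Lambdab D n. c \<mu> * ?G \<mu> z)"
    by (rule laurent_sum[OF laurent_cmult])
  moreover have "wsym n (\<lambda>z. \<Sum>\<mu>\<in>Lambdab D n. c \<mu> * ?G \<mu> z)"
    using orbit_sum_wsym[of n] unfolding wsym_def by (auto intro!: sum.cong)
  moreover have "Mb n \<mu> \<xi> = ?G \<mu> (cis_vec n \<xi>)" for \<mu> \<xi>
    unfolding Mb_def
    by (rule sum.cong[OF refl], subst exp_sum_eq_lmono[symmetric, of n _ \<xi>]) (simp_all add: cis_vec_def mult.commute)
  ultimately show thesis using that f by auto
qed

section \<open>The cubature rule\<close>

lemma stabilizer_sum_eq_deltab:
  fixes q :: real and \<nu> :: "nat \<Rightarrow> int"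
  assumes q: "\<bar>q\<bar> < 1" and mono: "\<And>j k. j \<le> k \<Longrightarrow> k < n \<Longrightarrow> \<nu> k \<le> \<nu> j"
  shows "(\<Sum>\<sigma>\<in>{\<sigma>. \<sigma> permutes {..<n} \<and> (\<forall>j<n. \<nu> (\<sigma> j) = \<nu> j)}. inv_weight n (complex_of_real q) \<sigma>)
     = complex_of_real (1 / deltab n \<nu> q)"
    and "deltab n \<nu> q \<noteq> 0"
proof -
  let ?S = "{(j,k). j < k \<and> k < n \<and> \<nu> j = \<nu> k}"
  have iw: "inv_weight n (complex_of_real q) \<sigma> = of_real (inv_weight n q \<sigma>)" for \<sigma>
    unfolding inv_weight_def of_real_prod by (rule prod.cong) auto
  have S: "?S = {x \<in> idx_pairs n. case x of (j,k) \<Rightarrow> \<nu> j = \<nu> k}" by auto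
  have fin: "finite ?S" unfolding S by simp
  have "(\<Prod>(j,k)\<in>idx_pairs n. if \<nu> j = \<nu> k then (1 - q ^ Suc (k - j)) / (1 - q ^ (k - j)) else 1)
     = (\<Prod>x\<in>idx_pairs n. if (case x of (j,k) \<Rightarrow> \<nu> j = \<nu> k) then (case x of (j,k) \<Rightarrow> (1 - q ^ Suc (k - j)) / (1 - q ^ (k - j))) else 1)"
    by (rule prod.cong) auto
  also have "\<dots> = (\<Prod>(j,k)\<in>?S. (1 - q ^ Suc (k - j)) / (1 - q ^ (k - j)))"
    unfolding S by (rule prod.inter_filter[symmetric]) simp
  \<comment> \<open>The exponent \<open>1 + k - j\<close> in \<open>deltab\<close> is a truncated
    difference of naturals; for \<open>j < k\<close> it is \<open>Suc (k - j)\<close>.\<close>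
  also have "\<dots> = (\<Prod>(j,k)\<in>?S. inverse ((1 - q ^ (k - j)) / (1 - q ^ (1 + k - j))))"
    by (rule prod.cong) (auto simp: Suc_diff_le)
  also have "\<dots> = 1 / deltab n \<nu> q"
    unfolding deltab_def inverse_eq_divide[symmetric]
    using prod_inversef[of "\<lambda>(j,k). (1 - q ^ (k - j)) * inverse (1 - q ^ (1 + k - j))" ?S]
    by (simp only: comp_def case_prod_unfold divide_inverse)
  finally have "(\<Sum>\<sigma>\<in>{\<sigma>. \<sigma> permutes {..<n} \<and> (\<forall>j<n. \<nu> (\<sigma> j) = \<nu> j)}. inv_weight n q \<sigma>) = 1 / deltab n \<nu> q"
    using stabilizer_inv_weight_sum[where \<nu> = \<nu>, OF q mono] by simp
  then show "(\<Sum>\<sigma>\<in>{\<sigma>. \<sigma> permutes {..<n} \<and> (\<forall>j<n. \<nu> (\<sigma> j) = \<nu> j)}. inv_weight n (complex_of_real q) \<sigma>)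
     = complex_of_real (1 / deltab n \<nu> q)"
    unfolding iw of_real_sum[symmetric] by simp
  have "(1 - q ^ (k - j)) / (1 - q ^ (1 + k - j)) \<noteq> 0" if "j < k" for j k
    using one_minus_power_nonzero[OF q, of "k - j"] one_minus_power_nonzero[OF q, of "1 + k - j"] that by simp
  then show "deltab n \<nu> q \<noteq> 0"
    unfolding deltab_def using fin by (auto simp: prod_zero_iff)
qed

lemma LambdabD:
  assumes "\<mu> \<in> Lambdab D n"
  shows "j \<le> k \<Longrightarrow> k < n \<Longrightarrow> \<mu> k \<le> \<mu> j" "j < n \<Longrightarrow> 0 \<le> \<mu> j" "j < n \<Longrightarrow> \<mu> j \<le> int D" "n \<le> j \<Longrightarrow> \<mu> j = 0"
  using assms by (auto simp: Lambdab_def)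

lemma circle_eq_cis_Arg2pi: "norm x = 1 \<Longrightarrow> x = cis (Arg2pi x)"
  using Arg2pi[of x] unfolding is_Arg_def cis_conv_exp by (simp add: mult.commute)

context bethe_system
begin

text \<open>The division by the group order makes this the normalized integral over one alcove, so
  that it is directly the left-hand side of the cubature rule.\<close>

definition haar :: "((nat \<Rightarrow> complex) \<Rightarrow> complex) \<Rightarrow> complex" where
  "haar F = (\<integral>z. F z * hl_delta n q q0 z \<partial>torus_measure n) / wsum n (\<lambda>_ _. 1)"

lemma tfun_weighted: "laurent n D F \<Longrightarrow> tfun n (\<lambda>z. F z * hl_delta n q q0 z)"
  by (intro tfun_mult tfun_laurent tfun_hl_delta) (use q in auto)

lemma haar_sum:
  assumes "\<And>i. i \<in> I \<Longrightarrow> laurent n D (F i)"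
  shows "haar (\<lambda>z. \<Sum>i\<in>I. c i * F i z) = (\<Sum>i\<in>I. c i * haar (F i))"
proof -
  have "(\<integral>z. (\<Sum>i\<in>I. c i * F i z) * hl_delta n q q0 z \<partial>torus_measure n)
    = (\<integral>z. (\<Sum>i\<in>I. c i * (F i z * hl_delta n q q0 z)) \<partial>torus_measure n)"
    by (simp add: sum_distrib_right mult.assoc)
  also have "\<dots> = (\<Sum>i\<in>I. \<integral>z. c i * (F i z * hl_delta n q q0 z) \<partial>torus_measure n)"
    by (rule Bochner_Integration.integral_sum)
       (intro tfun_integrable tfun_mult[OF tfun_const] tfun_weighted[OF assms])
  finally show ?thesis by (simp add: haar_def sum_divide_distrib)
qed

lemma haar_diff:
  assumes "laurent n D F" "laurent n D G"
  shows "haar (\<lambda>z. F z - G z) = haar F - haar G"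
proof -
  have "(\<integral>z. (F z - G z) * hl_delta n q q0 z \<partial>torus_measure n)
    = (\<integral>z. F z * hl_delta n q q0 z - G z * hl_delta n q q0 z \<partial>torus_measure n)"
    by (simp add: left_diff_distrib)
  also have "\<dots> = (\<integral>z. F z * hl_delta n q q0 z \<partial>torus_measure n) - (\<integral>z. G z * hl_delta n q q0 z \<partial>torus_measure n)"
    by (intro Bochner_Integration.integral_diff tfun_integrable tfun_weighted[OF assms(1)] tfun_weighted[OF assms(2)])
  finally show ?thesis by (simp add: haar_def diff_divide_distrib)
qed

lemma Ab_integral_eq_haar:
  assumes F: "laurent n D F" "wsym n F"
  shows "complex_of_real (1 / (2 * pi) ^ n) * set_lebesgue_integral (PiM {..<n} (\<lambda>_. lborel)) (Ab n)
             (\<lambda>\<xi>. F (cis_vec n \<xi>) * complex_of_real (1 / (cmod (Cb n q q0 \<xi>))\<^sup>2)) = haar F"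
proof -
  let ?F = "\<lambda>z. F z * hl_delta n q q0 z"
  have "set_lebesgue_integral (PiM {..<n} (\<lambda>_. lborel)) (Ab n)
             (\<lambda>\<xi>. F (cis_vec n \<xi>) * complex_of_real (1 / (cmod (Cb n q q0 \<xi>))\<^sup>2))
    = set_lebesgue_integral (PiM {..<n} (\<lambda>_. lborel)) (Ab n) (\<lambda>\<xi>. ?F (cis_vec n \<xi>))"
    unfolding set_lebesgue_integral_def
  proof (rule Bochner_Integration.integral_cong[OF refl])
    fix \<xi> :: "nat \<Rightarrow> real"
    show "indicator (Ab n) \<xi> *\<^sub>R (F (cis_vec n \<xi>) * complex_of_real (1 / (cmod (Cb n q q0 \<xi>))\<^sup>2))
      = indicator (Ab n) \<xi> *\<^sub>R ?F (cis_vec n \<xi>)"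
    proof (cases "\<xi> \<in> Ab n")
      case True
      then have "cis_vec n \<xi> \<in> alcove n" using Ab_iff_alcove[of \<xi> n] AbD(1)[OF True] by blast
      from hl_delta_norm[OF cis_vec_torus alcove_regular[OF this] q(1,2)]
      have "hl_delta n q q0 (cis_vec n \<xi>) = complex_of_real (1 / (cmod (Cb n q q0 \<xi>))\<^sup>2)"
        using Cb_eq_hl_c[of n "cis_vec n \<xi>" \<xi> q q0] by (simp add: cis_vec_def)
      then show ?thesis by simp
    qed simp
  qed
  moreover have "wsum n (\<lambda>_ _. 1) * (\<integral>z. indicator (alcove n) z * ?F z \<partial>torus_measure n) = (\<integral>z. ?F z \<partial>torus_measure n)"
  proof (rule integral_alcove[OF tfun_weighted[OF F(1)]])
    show "wsym n ?F" using F(2) hl_delta_wsym[of n "of_real q" "of_real q0"] by (simp add: wsym_def)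
    show "?F z = 0" if "z \<in> torus n" "\<not> regular n z" for z
      using hl_delta_nonregular[OF torus_nzvecs[OF that(1)] that(2)] by simp
  qed
  ultimately show ?thesis
    using integral_Ab[OF tfun_weighted[OF F(1)]] wsum_one_nonzero[of n] by (simp add: haar_def field_simps)
qed

definition node_vec :: "(nat \<Rightarrow> int) \<Rightarrow> nat \<Rightarrow> complex" where
  "node_vec la = cis_vec n (nodeb m n q q0 q1 la)"

text \<open>As \<open>nodeb\<close> is a definite description, nothing is known of it for a label
  whose equations have not been solved. Membership in the alcove is recorded instead; every regular
  solution leads to a realized label, and that all labels are realized comes out of the count in
  \<open>cubature\<close>.\<close>

definition realized :: "(nat \<Rightarrow> int) set" where
  "realized = {la \<in> Lambdab m n. nodeb m n q q0 q1 la \<in> Ab n}"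

text \<open>A regular solution is carried into the alcove by some signed permutation and is the node
  of a label there; the invariance of \<open>F\<close> brings the zero back to the original
  point.\<close>

lemma haar_zero_of_node_zeros:
  assumes F: "laurent n (\<lambda>_. 2 * m) F" "wsym n F" and v: "\<And>la. la \<in> realized \<Longrightarrow> F (node_vec la) = 0"
  shows "haar F = 0"
proof -
  have "(\<integral>z. F z * hl_delta n q q0 z \<partial>torus_measure n) = 0"
  proof (rule integral_delta_zero_of_bethe_zeros[OF F(1)])
    fix z assume z: "z \<in> torus n" "regular n z" and b: "\<And>j. j < n \<Longrightarrow> bethe j z = 1"
    have "\<exists>\<sigma> \<epsilon>. \<sigma> permutes {..<n} \<and> \<epsilon> \<in> signs n \<and> sact n \<sigma> \<epsilon> z \<in> alcove n"
    proof (rule ccontr)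
      assume "\<not> ?thesis"
      then have "wsum n (\<lambda>\<sigma> \<epsilon>. indicator (alcove n) (sact n \<sigma> \<epsilon> z)) = (wsum n (\<lambda>\<sigma> \<epsilon>. 0) :: complex)"
        by (intro wsum_cong) (auto simp: indicator_def)
      then show False using alcove_tiling[OF z] by (simp add: wsum_def)
    qed
    then obtain \<sigma> \<epsilon> where se: "\<sigma> permutes {..<n}" "\<epsilon> \<in> signs n" and al: "sact n \<sigma> \<epsilon> z \<in> alcove n" by blast
    let ?y = "sact n \<sigma> \<epsilon> z"
    have yt: "?y \<in> torus n" by (rule sact_torus[OF se(1) z(1)])
    define \<xi> where "\<xi> = (\<lambda>j\<in>{..<n}. Arg2pi (?y j))"
    have y: "?y = cis_vec n \<xi>"
    proof (rule extensionalityI[of _ "{..<n}"])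
      fix j assume "j \<in> {..<n}"
      then show "?y j = cis_vec n \<xi> j"
        using circle_eq_cis_Arg2pi[OF torusD[OF yt, of j]] by (simp add: cis_vec_def \<xi>_def)
    qed (simp_all add: sact_def cis_vec_def)
    have "\<xi> \<in> Ab n"
    proof (rule Ab_iff_alcove[THEN iffD1], safe)
      show "\<xi> \<in> extensional {..<n}" by (simp add: \<xi>_def)
      show "cis_vec n \<xi> \<in> alcove n" using al by (simp add: y)
      show "0 \<le> \<xi> j" "\<xi> j \<le> 2 * pi" if "j < n" for j
        using that Arg2pi[of "?y j"] by (auto simp: \<xi>_def)
    qed
    moreover have "bethe j (cis_vec n \<xi>) = 1" if "j < n" for j
      unfolding y[symmetric] bethe_sact[OF z(1) se that] using b[OF permutes_lessThan_less[OF se(1) that]] by simp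
    ultimately obtain la where "la \<in> Lambdab m n" "nodeb m n q q0 q1 la = \<xi>"
      using alcove_bethe_solution_is_node by blast
    then have "F ?y = 0" using v[of la] \<open>\<xi> \<in> Ab n\<close> by (simp add: realized_def node_vec_def y)
    then show "F z = 0" using F(2) se torus_nzvecs[OF z(1)] by (simp add: wsym_def)
  qed
  then show ?thesis by (simp add: haar_def)
qed

lemma realized_node: "la \<in> realized \<Longrightarrow> node_vec la \<in> torus n \<and> regular n (node_vec la)"
  unfolding realized_def node_vec_def
  using Ab_iff_alcove[of "nodeb m n q q0 q1 la" n] AbD(1) alcove_regular cis_vec_torus by blast

lemma cubature:
  assumes F: "laurent n (\<lambda>_. 2 * m) F" "wsym n F"
  shows "haar F = (\<Sum>la\<in>Lambdab m n. F (node_vec la) * complex_of_real (weightb m n q q0 q1 la))"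
proof -
  let ?\<Lambda> = "Lambdab m n"
  let ?\<delta> = "\<lambda>\<mu>. complex_of_real (deltab n \<mu> q)"
  define Q where "Q \<mu> p \<longleftrightarrow> laurent n (\<lambda>_. m) p \<and> wsym n p \<and> (\<forall>z. regular n z \<longrightarrow> p z = hl_sum n q q0 \<mu> z)" for \<mu> p
  define P where "P \<mu> = (SOME p. Q \<mu> p)" for \<mu>
  have QP: "Q \<mu> (P \<mu>)" if "\<mu> \<in> ?\<Lambda>" for \<mu>
  proof -
    have "\<exists>p. Q \<mu> p"
      by (rule hl_polynomial[of n \<mu> m q q0]) (use LambdabD[OF that] in \<open>auto simp: Q_def\<close>)
    then show ?thesis unfolding P_def by (rule someI_ex)
  qed
  note PL = QP[unfolded Q_def, THEN conjunct1] and PW = QP[unfolded Q_def, THEN conjunct2, THEN conjunct1]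
  have PH: "P \<mu> z = hl_sum n q q0 \<mu> z" if "\<mu> \<in> ?\<Lambda>" "regular n z" for \<mu> z using QP[OF that(1)] that(2) by (simp add: Q_def)
  have fin: "finite ?\<Lambda>" by (rule finite_Lambdab)
  have \<delta>0: "?\<delta> \<mu> \<noteq> 0" if "\<mu> \<in> ?\<Lambda>" for \<mu>
    using stabilizer_sum_eq_deltab(2)[OF q(1), of n \<mu>] LambdabD(1)[OF that] by simp
  have orth: "haar (\<lambda>z. P \<mu> z * P \<nu> z) = (if \<mu> = \<nu> then 1 / ?\<delta> \<nu> else 0)" if \<mu>: "\<mu> \<in> ?\<Lambda>" and \<nu>: "\<nu> \<in> ?\<Lambda>" for \<mu> \<nu>
  proof -
    have eq: "(\<forall>j<n. \<mu> j = \<nu> j) \<longleftrightarrow> \<mu> = \<nu>"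
    proof
      assume a: "\<forall>j<n. \<mu> j = \<nu> j"
      show "\<mu> = \<nu>"
      proof
        fix j show "\<mu> j = \<nu> j" using a LambdabD(4)[OF \<mu>, of j] LambdabD(4)[OF \<nu>, of j] by (cases "j < n") auto
      qed
    qed simp
    have "(\<integral>z. P \<mu> z * P \<nu> z * hl_delta n q q0 z \<partial>torus_measure n) = wsum n (\<lambda>_ _. 1) *
      (if \<forall>j<n. \<mu> j = \<nu> j then \<Sum>\<sigma>\<in>{\<sigma>. \<sigma> permutes {..<n} \<and> (\<forall>j<n. \<nu> (\<sigma> j) = \<nu> j)}. inv_weight n (complex_of_real q) \<sigma> else 0)"
      by (rule hl_orthogonality[OF _ _ PL[OF \<mu>] PW[OF \<mu>] PH[OF \<mu>] PL[OF \<nu>] PW[OF \<nu>] PH[OF \<nu>]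
            LambdabD(1)[OF \<mu>] LambdabD(2)[OF \<mu>] LambdabD(1)[OF \<nu>] LambdabD(2)[OF \<nu>]])
         (use q in simp_all)
    moreover have st: "(\<Sum>\<sigma>\<in>{\<sigma>. \<sigma> permutes {..<n} \<and> (\<forall>j<n. \<nu> (\<sigma> j) = \<nu> j)}. inv_weight n (complex_of_real q) \<sigma>)
       = 1 / ?\<delta> \<nu>"
      using stabilizer_sum_eq_deltab(1)[OF q(1), of n \<nu>] LambdabD(1)[OF \<nu>] by simp
    ultimately show ?thesis
      unfolding eq st using wsum_one_nonzero[of n] by (simp add: haar_def)
  qed
  have L2: "laurent n (\<lambda>_. 2 * m) (\<lambda>z. A z * B z)" if "laurent n (\<lambda>_. m) A" "laurent n (\<lambda>_. m) B" for A B
    using laurent_mult[OF that] by (simp add: mult_2)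
  have LW: "laurent n (\<lambda>_. 2 * m) A" if "laurent n (\<lambda>_. m) A" for A
    by (rule laurent_weaken[OF that]) simp
  have combL: "laurent n (\<lambda>_. m) (\<lambda>z. \<Sum>\<mu>\<in>?\<Lambda>. c \<mu> * P \<mu> z)" for c
    by (intro laurent_sum laurent_cmult PL)
  have combW: "wsym n (\<lambda>z. \<Sum>\<mu>\<in>?\<Lambda>. c \<mu> * P \<mu> z)" for c
    using PW unfolding wsym_def by (auto intro!: sum.cong)
  have pair: "haar (\<lambda>z. (\<Sum>\<mu>\<in>?\<Lambda>. c \<mu> * P \<mu> z) * P \<nu> z) = c \<nu> / ?\<delta> \<nu>" if \<nu>: "\<nu> \<in> ?\<Lambda>" for c \<nu>
  proof -
    have "haar (\<lambda>z. (\<Sum>\<mu>\<in>?\<Lambda>. c \<mu> * P \<mu> z) * P \<nu> z) = haar (\<lambda>z. \<Sum>\<mu>\<in>?\<Lambda>. c \<mu> * (P \<mu> z * P \<nu> z))"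
      by (simp add: sum_distrib_right mult.assoc)
    also have "\<dots> = (\<Sum>\<mu>\<in>?\<Lambda>. c \<mu> * haar (\<lambda>z. P \<mu> z * P \<nu> z))"
      by (rule haar_sum[OF L2[OF PL PL[OF \<nu>]]])
    also have "\<dots> = (\<Sum>\<mu>\<in>?\<Lambda>. if \<mu> = \<nu> then c \<nu> / ?\<delta> \<nu> else 0)"
      by (rule sum.cong) (auto simp: orth \<nu>)
    finally show ?thesis using fin \<nu> by simp
  qed
  \<comment> \<open>A combination vanishing at the nodes, multiplied by any \<open>P \<nu>\<close>,
    still has degree at most \<open>2 * m\<close> and so has mean zero. By orthogonality this mean
    is \<open>c \<nu> / ?\<delta> \<nu>\<close>.\<close>
  have inj: "\<forall>\<mu>\<in>?\<Lambda>. c \<mu> = 0" if "\<forall>la\<in>realized. (\<Sum>\<mu>\<in>?\<Lambda>. c \<mu> * P \<mu> (node_vec la)) = 0" for c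
  proof
    fix \<nu> assume \<nu>: "\<nu> \<in> ?\<Lambda>"
    have "haar (\<lambda>z. (\<Sum>\<mu>\<in>?\<Lambda>. c \<mu> * P \<mu> z) * P \<nu> z) = 0"
    proof (rule haar_zero_of_node_zeros)
      show "laurent n (\<lambda>_. 2 * m) (\<lambda>z. (\<Sum>\<mu>\<in>?\<Lambda>. c \<mu> * P \<mu> z) * P \<nu> z)" by (rule L2[OF combL PL[OF \<nu>]])
      show "wsym n (\<lambda>z. (\<Sum>\<mu>\<in>?\<Lambda>. c \<mu> * P \<mu> z) * P \<nu> z)"
        using combW[of c] PW[OF \<nu>] by (simp add: wsym_def)
    qed (use that in simp)
    then show "c \<nu> = 0" using pair[OF \<nu>] \<delta>0[OF \<nu>] by simp
  qed
  have finr: "finite realized" "realized \<subseteq> ?\<Lambda>" using fin by (auto simp: realized_def)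
  \<comment> \<open>With fewer nodes than polynomials there would be a nonzero combination vanishing
    at every node, contradicting \<open>inj\<close>.\<close>
  have "\<not> card realized < card ?\<Lambda>"
  proof
    assume "card realized < card ?\<Lambda>"
    from homogeneous_system_nontrivial[OF finr(1) fin this, of "\<lambda>\<mu> la. P \<mu> (node_vec la)"] inj
    show False by blast
  qed
  then have all: "realized = ?\<Lambda>"
    using card_mono[OF fin finr(2)] card_subset_eq[OF fin finr(2)] by simp
  have "\<exists>c. \<forall>\<kappa>\<in>?\<Lambda>. (\<Sum>\<mu>\<in>?\<Lambda>. c \<mu> * P \<mu> (node_vec \<kappa>)) = (if \<kappa> = la then 1 else 0)" for la
    by (rule injective_square_system_solvable[OF fin fin refl]) (rule inj[unfolded all])
  then obtain C where C: "\<And>la \<kappa>. \<kappa> \<in> ?\<Lambda> \<Longrightarrow> (\<Sum>\<mu>\<in>?\<Lambda>. C la \<mu> * P \<mu> (node_vec \<kappa>)) = (if \<kappa> = la then 1 else 0)"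
    by metis
  define l where "l la z = (\<Sum>\<mu>\<in>?\<Lambda>. C la \<mu> * P \<mu> z)" for la z
  have lL: "laurent n (\<lambda>_. m) (l la)" and lW: "wsym n (l la)" for la
    unfolding l_def[abs_def] by (rule combL, rule combW)
  have lv: "l la (node_vec \<kappa>) = (if \<kappa> = la then 1 else 0)" if "\<kappa> \<in> ?\<Lambda>" for la \<kappa>
    unfolding l_def by (rule C[OF that])
  have weight: "haar (l la) = complex_of_real (weightb m n q q0 q1 la)" if la: "la \<in> ?\<Lambda>" for la
  proof -
    let ?y = "node_vec la"
    have y: "?y \<in> torus n" "regular n ?y" using realized_node[of la] la all by auto
    \<comment> \<open>The reproducing kernel at \<open>?y\<close>: its pairing with a combination of
      the \<open>P \<mu>\<close> returns the value at \<open>?y\<close>, because the factors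
      \<open>?\<delta> \<nu>\<close> undo the squared norms. For \<open>l la\<close> that value is
      1.\<close>
    define K where "K z = (\<Sum>\<nu>\<in>?\<Lambda>. (?\<delta> \<nu> * P \<nu> ?y) * P \<nu> z)" for z
    have KL: "laurent n (\<lambda>_. m) K" and KW: "wsym n K" unfolding K_def[abs_def] by (rule combL, rule combW)
    have "haar (\<lambda>z. l la z * K z) = haar (\<lambda>z. \<Sum>\<nu>\<in>?\<Lambda>. (?\<delta> \<nu> * P \<nu> ?y) * (l la z * P \<nu> z))"
      by (simp add: K_def sum_distrib_left mult.left_commute)
    also have "\<dots> = (\<Sum>\<nu>\<in>?\<Lambda>. (?\<delta> \<nu> * P \<nu> ?y) * haar (\<lambda>z. l la z * P \<nu> z))"
      by (rule haar_sum[OF L2[OF lL PL]])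
    also have "\<dots> = (\<Sum>\<nu>\<in>?\<Lambda>. C la \<nu> * P \<nu> ?y)"
    proof (rule sum.cong[OF refl])
      fix \<nu> assume \<nu>: "\<nu> \<in> ?\<Lambda>"
      show "(?\<delta> \<nu> * P \<nu> ?y) * haar (\<lambda>z. l la z * P \<nu> z) = C la \<nu> * P \<nu> ?y"
        unfolding l_def pair[OF \<nu>] using \<delta>0[OF \<nu>] by simp
    qed
    also have "\<dots> = 1" using C[OF la, of la] by simp
    finally have one: "haar (\<lambda>z. l la z * K z) = 1" .
    have kl: "laurent n (\<lambda>_. 2 * m) (\<lambda>z. K ?y * l la z)" by (rule laurent_cmult[OF LW[OF lL]])
    \<comment> \<open>The two products agree at every node: at \<open>?y\<close> by evaluation, and
      at the others because \<open>l la\<close> vanishes there. Hence \<open>K ?y\<close> times the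
      mean of \<open>l la\<close> is 1, and \<open>K ?y\<close> is the sum inverted in
      \<open>weightb\<close>.\<close>
    have "haar (\<lambda>z. l la z * K z - K ?y * l la z) = 0"
    proof (rule haar_zero_of_node_zeros)
      show "laurent n (\<lambda>_. 2 * m) (\<lambda>z. l la z * K z - K ?y * l la z)"
        by (intro laurent_diff L2 lL KL kl)
      show "wsym n (\<lambda>z. l la z * K z - K ?y * l la z)" using lW[of la] KW by (simp add: wsym_def)
      show "l la (node_vec \<kappa>) * K (node_vec \<kappa>) - K ?y * l la (node_vec \<kappa>) = 0" if "\<kappa> \<in> realized" for \<kappa>
        using lv[of \<kappa> la] that all by simp
    qed
    then have "haar (\<lambda>z. K ?y * l la z) = 1"
      using haar_diff[OF L2[OF lL[of la] KL] kl] one by simp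
    moreover have "haar (\<lambda>z. K ?y * l la z) = K ?y * haar (l la)"
      using haar_sum[of "{()}" "\<lambda>_. m" "\<lambda>_. l la" "\<lambda>_. K ?y"] lL by simp
    ultimately have K1: "K ?y * haar (l la) = 1" by simp
    have "K ?y = (\<Sum>\<mu>\<in>?\<Lambda>. complex_of_real ((cmod (Pb n \<mu> (nodeb m n q q0 q1 la) q q0))\<^sup>2 * deltab n \<mu> q))"
      unfolding K_def
    proof (rule sum.cong[OF refl])
      fix \<mu> assume \<mu>: "\<mu> \<in> ?\<Lambda>"
      have e: "Pb n \<mu> (nodeb m n q q0 q1 la) q q0 = P \<mu> ?y"
        using PH[OF \<mu> y(2)] by (simp add: Pb_eq_hl_sum node_vec_def)
      have "cnj (P \<mu> ?y) = P \<mu> ?y"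
        by (rule hl_polynomial_real[OF PW[OF \<mu>] PH[OF \<mu>] y])
      then have "complex_of_real ((cmod (P \<mu> ?y))\<^sup>2) = P \<mu> ?y * P \<mu> ?y"
        using complex_norm_square[of "P \<mu> ?y"] by simp
      then show "(?\<delta> \<mu> * P \<mu> ?y) * P \<mu> ?y
        = complex_of_real ((cmod (Pb n \<mu> (nodeb m n q q0 q1 la) q q0))\<^sup>2 * deltab n \<mu> q)"
        unfolding e of_real_mult by simp
    qed
    then have "complex_of_real (weightb m n q q0 q1 la) = inverse (K ?y)"
      unfolding weightb_def by simp
    then show ?thesis using inverse_unique[OF K1] by simp
  qed
  let ?I = "\<lambda>z. \<Sum>la\<in>?\<Lambda>. F (node_vec la) * l la z"
  have IL: "laurent n (\<lambda>_. 2 * m) ?I" by (intro laurent_sum laurent_cmult LW lL)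
  have "haar (\<lambda>z. F z - ?I z) = 0"
  proof (rule haar_zero_of_node_zeros)
    show "laurent n (\<lambda>_. 2 * m) (\<lambda>z. F z - ?I z)" by (intro laurent_diff F IL)
    show "wsym n (\<lambda>z. F z - ?I z)" using F(2) lW unfolding wsym_def by (auto intro!: sum.cong)
    show "F (node_vec \<kappa>) - ?I (node_vec \<kappa>) = 0" if "\<kappa> \<in> realized" for \<kappa>
    proof -
      have \<kappa>: "\<kappa> \<in> ?\<Lambda>" using that all by simp
      have "?I (node_vec \<kappa>) = (\<Sum>la\<in>?\<Lambda>. if \<kappa> = la then F (node_vec la) else 0)"
        by (rule sum.cong) (auto simp: lv[OF \<kappa>])
      then show ?thesis using fin \<kappa> by simp
    qed
  qed
  then have "haar F = haar ?I" using haar_diff[OF F(1) IL] by simp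
  also have "\<dots> = (\<Sum>la\<in>?\<Lambda>. F (node_vec la) * haar (l la))" by (rule haar_sum[OF LW[OF lL]])
  also have "\<dots> = (\<Sum>la\<in>?\<Lambda>. F (node_vec la) * complex_of_real (weightb m n q q0 q1 la))"
    by (rule sum.cong) (auto simp: weight)
  finally show ?thesis .
qed

end

theorem mainTheorem3:
  fixes n m :: nat and q q0 q1 :: real and f :: "(nat \<Rightarrow> real) \<Rightarrow> complex"
  assumes "n \<ge> 1" and "m > 0"
    and "\<bar>q\<bar> < 1" and "\<bar>q0\<bar> < 1" and "\<bar>q1\<bar> < 1"
    and "f \<in> Pspace (2 * m) n"
  shows "complex_of_real (1 / (2 * pi) ^ n) *
           set_lebesgue_integral (PiM {..<n} (\<lambda>_. lborel)) (Ab n)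
             (\<lambda>\<xi>. f \<xi> * complex_of_real (1 / (cmod (Cb n q q0 \<xi>))\<^sup>2))
         = (\<Sum>la\<in>Lambdab m n. f (nodeb m n q q0 q1 la) * complex_of_real (weightb m n q q0 q1 la))"
proof -
  interpret bethe_system n m q q0 q1 by standard (use assms in auto)
  obtain F where F: "laurent n (\<lambda>_. 2 * m) F" "wsym n F" "\<And>\<xi>. f \<xi> = F (cis_vec n \<xi>)"
    using Pspace_laurent[OF assms(6)] by blast
  show ?thesis
    using Ab_integral_eq_haar[OF F(1,2)] cubature[OF F(1,2)] by (simp add: F(3) node_vec_def)
qed

end
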